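(* Let $\{X^i_t : i\in I_t,\ t\ge 0\}$ be the branching process described in the context, started from one particle at $x_0\in\mathcal X$, with underlying right-continuous strong Markov process $X$ ($X_0=x_0$), branching rate $\lambda$ and offspring number $N$, where $x\mapsto\lambda(x)$ and $x\mapsto\mathbb E(N\mid X_T=x)$ are bounded. Let $\mathcal Z$ be the set of bounded adapted processes, $\mathcal Z^\circ$ the set of bounded anticipative processes and $\mathcal M$ the set of non-negative martingales, all with respect to the filtration generated by $X$. Define $$h(x,z)=\max_{0\le\eta\le1}\{\eta z-\lambda(x)\,\mathbb E(\eta^N\mid X_T=x)\}\quad\text{for all }(x,z)\in\mathcal X\times\mathbb R .$$ Given a measurable function $f:\mathcal X\to[0,1]$ and $t\ge0$, let $$u=\mathbb E\Big[\prod_{i\in I_t}f(X^i_t)\Big],$$ $$M=\max_{Z\in\mathcal Z}\mathbb E\Big[e^{\int_0^tZ_s\,ds}f(X_t)-\int_0^te^{\int_0^sZ_r\,dr}\,h(X_s,Z_s+\lambda(X_s))\,ds\Big],$$ $$m=\min_{\zeta\in\mathcal M}\mathbb E\Big[\operatorname*{ess\,sup}_{z\in\mathcal Z^\circ}\Big\{e^{\int_0^tz_s\,ds}f(X_t)-\int_0^te^{\int_0^sz_r\,dr}\Big(z_s+\big[h(X_s,z_s+\lambda(X_s))-z_s\big]\frac{\zeta_t}{\zeta_s}\Big)ds\Big\}\Big],$$ where $\zeta_t/\zeta_s$ is set equal to $1$ on the event $\{\zeta_s=0\}$. Then the maximum and the minimum are attained and $$u=M=m .$$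
   Context: Branching process: $\mathcal X$ is a Polish space. Initially there is one particle at $x_0\in\mathcal X$, which moves according to the law of a given right-continuous strong Markov process $X$ with $X_0=x_0$. At a random time $T>0$ the particle is killed and replaced with a random number $N\in\{0,1,2,\dots\}$ of particles; each of these moves and branches as an independent copy of the initial particle, started from the final position $X_T$ of the initial particle. The law of $T$ given the process $X$ is $\mathbb P(T>t\mid X)=e^{-\int_0^t\lambda(X_s)\,ds}$ for all $t\ge0$, where $\lambda:\mathcal X\to[0,\infty)$ is a given measurable function. The conditional distribution of $N$ given $X$ and $T$ depends only on $X_T$. $I_t$ denotes the set of particles alive at time $t$, and $X^i_t$ the position of particle $i\in I_t$. $X_t$ denotes the position at time $t$ of the initial particle if it were allowed to continue living after the branching event. The functions $\lambda(x)$ and $\mathbb E(N\mid X_T=x)$ are assumed bounded in $x\in\mathcal X$ (so that $I_t$ is a.s. finite for every $t$). Conventions: an empty product equals $1$, and $0^0=1$. All real-valued processes have measurable sample paths, so pathwise integrals are well defined. "Bounded" means uniformly bounded in time and randomness; "anticipative" means that the process is not required to be adapted. The essential supremum is that of a family of random variables. *)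

theory Defs
  imports "HOL-Probability.Probability" "HOL-Probability.Stopping_Time" "HOL-Library.Sublist"
begin

section \<open>Right-continuous strong Markov processes\<close>

text \<open>The \<sigma>-algebra on \<open>\<Omega>\<close> generated by the maps \<open>\<xi> i\<close>, \<open>i \<in> J\<close>, with values in \<open>N\<close>.\<close>

definition sigma_generated ::
  "'w set \<Rightarrow> 'b measure \<Rightarrow> 'i set \<Rightarrow> ('i \<Rightarrow> 'w \<Rightarrow> 'b) \<Rightarrow> 'w measure" where
  "sigma_generated \<Omega> N J \<xi> = sigma \<Omega> {\<xi> i -` B \<inter> \<Omega> | i B. i \<in> J \<and> B \<in> sets N}"

text \<open>Time is \<open>[0,\<infinity>)\<close>, represented by the nonnegative reals.  A path is a function on \<open>real\<close> whose
  values at negative arguments are irrelevant: neither right-continuity nor any of the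
  \<sigma>-algebras below refers to them.\<close>

definition rc_paths :: "(real \<Rightarrow> 'a::topological_space) set" where
  "rc_paths = {w. \<forall>t\<ge>0. continuous (at_right t) w}"

text \<open>The natural filtration of the coordinate process, indexed by \<open>[0,\<infinity>]\<close>; at \<open>\<infinity>\<close> it is the
  \<sigma>-algebra generated by all coordinates.\<close>

definition path_filtration :: "ennreal \<Rightarrow> (real \<Rightarrow> 'a::topological_space) measure" where
  "path_filtration r = sigma_generated rc_paths borel {s. 0 \<le> s \<and> ennreal s \<le> r} (\<lambda>s w. w s)"

definition path_space :: "(real \<Rightarrow> 'a::topological_space) measure" where
  "path_space = path_filtration \<infinity>"

text \<open>\<open>P x\<close> is the law, on the space of right-continuous paths, of the process started at \<open>x\<close>.
  In the strong Markov property \<open>\<tau>\<close> ranges over all stopping times with values in \<open>[0,\<infinity>]\<close> of the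
  natural filtration.\<close>

locale rc_strong_markov =
  fixes P :: "'a::polish_space \<Rightarrow> (real \<Rightarrow> 'a) measure"
  assumes kernel: "P \<in> borel \<rightarrow>\<^sub>M prob_algebra path_space"
    and initial: "\<And>x. AE w in P x. w 0 = x"
    and strong_markov: "\<And>x \<tau> B. stopping_time path_filtration \<tau> \<Longrightarrow> B \<in> sets path_space \<Longrightarrow>
      AE w in P x. \<tau> w < \<infinity> \<longrightarrow>
        real_cond_exp (P x) (filtration.pre_sigma rc_paths path_filtration \<tau>)
          (indicator {w \<in> rc_paths. \<tau> w < \<infinity> \<and> (\<lambda>r. w (enn2real (\<tau> w) + r)) \<in> B}) w
        = measure (P (w (enn2real (\<tau> w)))) B"


section \<open>The branching process\<close>

text \<open>Particles carry Ulam--Harris labels, written with the youngest generation first: \<open>[]\<close> is the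
  initial particle and \<open>j # i\<close> is the child number \<open>j\<close> (counted from 0) of \<open>i\<close>.  Thus the
  descendants of \<open>i\<close>, including \<open>i\<close>, are the labels of which \<open>i\<close> is a suffix.

  \<open>Y i \<omega> s\<close> is the position of particle \<open>i\<close> at age \<open>s\<close>, continued beyond its branching event;
  \<open>L i \<omega>\<close> is the age at which it branches (\<open>\<infinity>\<close> if it never does), and \<open>K i \<omega>\<close> is the number of
  its children.  Labels that do not occur in the tree carry meaningless values.\<close>

type_synonym 'w lifetimes = "nat list \<Rightarrow> 'w \<Rightarrow> ennreal"
type_synonym 'w offspring = "nat list \<Rightarrow> 'w \<Rightarrow> nat"
type_synonym ('w, 'a) motions = "nat list \<Rightarrow> 'w \<Rightarrow> real \<Rightarrow> 'a"

primrec exists_particle :: "'w lifetimes \<Rightarrow> 'w offspring \<Rightarrow> nat list \<Rightarrow> 'w \<Rightarrow> bool" where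
  "exists_particle L K [] \<omega> \<longleftrightarrow> True"
| "exists_particle L K (j # i) \<omega> \<longleftrightarrow> exists_particle L K i \<omega> \<and> L i \<omega> < \<infinity> \<and> j < K i \<omega>"

primrec birth_time :: "'w lifetimes \<Rightarrow> nat list \<Rightarrow> 'w \<Rightarrow> ennreal" where
  "birth_time L [] \<omega> = 0"
| "birth_time L (j # i) \<omega> = birth_time L i \<omega> + L i \<omega>"

primrec birth_place ::
  "'a \<Rightarrow> ('w, 'a) motions \<Rightarrow> 'w lifetimes \<Rightarrow> nat list \<Rightarrow> 'w \<Rightarrow> 'a" where
  "birth_place x0 Y L [] \<omega> = x0"
| "birth_place x0 Y L (j # i) \<omega> = Y i \<omega> (enn2real (L i \<omega>))"

definition alive :: "'w lifetimes \<Rightarrow> 'w offspring \<Rightarrow> real \<Rightarrow> 'w \<Rightarrow> nat list set" where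
  "alive L K t \<omega> = {i. exists_particle L K i \<omega> \<and>
     birth_time L i \<omega> \<le> ennreal t \<and> ennreal t < birth_time L i \<omega> + L i \<omega>}"

definition position ::
  "('w, 'a) motions \<Rightarrow> 'w lifetimes \<Rightarrow> nat list \<Rightarrow> real \<Rightarrow> 'w \<Rightarrow> 'a" where
  "position Y L i t \<omega> = Y i \<omega> (t - enn2real (birth_time L i \<omega>))"

text \<open>The information carried by all particles other than \<open>i\<close> and its descendants; the same
  together with the motion of \<open>i\<close>; the same together with the motion and the lifetime of \<open>i\<close>.\<close>

definition info_outside :: "'w measure \<Rightarrow> ('w, 'a::topological_space) motions \<Rightarrow> 'w lifetimes \<Rightarrow>
    'w offspring \<Rightarrow> nat list \<Rightarrow> 'w measure" where
  "info_outside M Y L K i = sigma_generated (space M)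
     (path_space \<Otimes>\<^sub>M borel \<Otimes>\<^sub>M count_space UNIV) {k. \<not> suffix i k}
     (\<lambda>k \<omega>. (Y k \<omega>, L k \<omega>, K k \<omega>))"

definition info_motion :: "'w measure \<Rightarrow> ('w, 'a::topological_space) motions \<Rightarrow> 'w lifetimes \<Rightarrow>
    'w offspring \<Rightarrow> nat list \<Rightarrow> 'w measure" where
  "info_motion M Y L K i = sigma (space M)
     (sets (info_outside M Y L K i) \<union> sets (sigma_generated (space M) path_space {i} Y))"

definition info_lifetime :: "'w measure \<Rightarrow> ('w, 'a::topological_space) motions \<Rightarrow> 'w lifetimes \<Rightarrow>
    'w offspring \<Rightarrow> nat list \<Rightarrow> 'w measure" where
  "info_lifetime M Y L K i = sigma (space M)
     (sets (info_motion M Y L K i) \<union> sets (sigma_generated (space M) borel {i} L))"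

text \<open>\<open>p x\<close> is the conditional distribution of the number \<open>N\<close> of children given that the parent
  branches at \<open>x\<close>, so that expectations under \<open>p x\<close> are the conditional expectations given
  \<open>X\<^sub>T = x\<close>.

  The last three assumptions state that every particle \<open>i\<close> is an independent copy of the initial one,
  started at the final position of its parent: conditionally on all particles that are not
  descendants of \<open>i\<close>, it moves according to \<open>P\<close> started at its place of birth, it branches at rate
  \<open>lam\<close> along its path, and its number of children is governed by \<open>p\<close> at its final position.
  For \<open>i = []\<close> the conditioning is on the trivial \<sigma>-algebra.  (If \<open>lam\<close> is bounded, the integral
  in \<open>lifetime_law\<close> is always finite.)\<close>

locale branching_process = prob_space M + rc_strong_markov P
  for M :: "'w measure"
    and P :: "'a::polish_space \<Rightarrow> (real \<Rightarrow> 'a) measure"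
    and lam :: "'a \<Rightarrow> real"
    and p :: "'a \<Rightarrow> nat pmf"
    and x0 :: 'a
    and Y :: "('w, 'a) motions"
    and L :: "'w lifetimes"
    and K :: "'w offspring" +
  assumes lam_measurable: "lam \<in> borel_measurable borel"
    and lam_nonneg: "\<And>x. 0 \<le> lam x"
    and p_measurable: "\<And>n. (\<lambda>x. pmf (p x) n) \<in> borel_measurable borel"
    and Y_measurable: "\<And>i. Y i \<in> M \<rightarrow>\<^sub>M path_space"
    and L_measurable: "\<And>i. L i \<in> borel_measurable M"
    and L_pos: "\<And>i \<omega>. \<omega> \<in> space M \<Longrightarrow> 0 < L i \<omega>"
    and K_measurable: "\<And>i. K i \<in> M \<rightarrow>\<^sub>M count_space UNIV"
    and motion_law: "\<And>i B. B \<in> sets path_space \<Longrightarrow>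
      AE \<omega> in M. exists_particle L K i \<omega> \<longrightarrow>
        real_cond_exp M (info_outside M Y L K i) (indicator {\<omega> \<in> space M. Y i \<omega> \<in> B}) \<omega>
        = measure (P (birth_place x0 Y L i \<omega>)) B"
    and lifetime_law: "\<And>i t. 0 \<le> t \<Longrightarrow>
      AE \<omega> in M. exists_particle L K i \<omega> \<longrightarrow>
        real_cond_exp M (info_motion M Y L K i) (indicator {\<omega> \<in> space M. ennreal t < L i \<omega>}) \<omega>
        = exp (- (LINT s:{0..t}|lborel. lam (Y i \<omega> s)))"
    and offspring_law: "\<And>i n.
      AE \<omega> in M. exists_particle L K i \<omega> \<and> L i \<omega> < \<infinity> \<longrightarrow>
        real_cond_exp M (info_lifetime M Y L K i) (indicator {\<omega> \<in> space M. K i \<omega> = n}) \<omega>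
        = pmf (p (Y i \<omega> (enn2real (L i \<omega>)))) n"


section \<open>Classes of processes\<close>

text \<open>Real-valued processes are indexed by \<open>[0,\<infinity>)\<close> and jointly measurable in time and randomness.
  This makes all sample paths measurable, and pathwise time integrals random variables.\<close>

definition measurable_process :: "'w measure \<Rightarrow> (real \<Rightarrow> 'w \<Rightarrow> real) \<Rightarrow> bool" where
  "measurable_process M Z \<longleftrightarrow>
     (\<lambda>(s, \<omega>). Z s \<omega>) \<in> borel_measurable (restrict_space borel {0..} \<Otimes>\<^sub>M M)"

definition bounded_process :: "'w measure \<Rightarrow> (real \<Rightarrow> 'w \<Rightarrow> real) \<Rightarrow> bool" where
  "bounded_process M Z \<longleftrightarrow> (\<exists>C. \<forall>s\<ge>0. \<forall>\<omega>\<in>space M. \<bar>Z s \<omega>\<bar> \<le> C)"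

definition generated_filtration ::
  "'w measure \<Rightarrow> (real \<Rightarrow> 'w \<Rightarrow> 'a::topological_space) \<Rightarrow> real \<Rightarrow> 'w measure" where
  "generated_filtration M X s = sigma_generated (space M) borel {0..s} X"

definition adapted_process ::
  "(real \<Rightarrow> 'w measure) \<Rightarrow> (real \<Rightarrow> 'w \<Rightarrow> real) \<Rightarrow> bool" where
  "adapted_process F Z \<longleftrightarrow> (\<forall>s\<ge>0. Z s \<in> borel_measurable (F s))"

definition bounded_anticipative :: "'w measure \<Rightarrow> (real \<Rightarrow> 'w \<Rightarrow> real) set" where
  "bounded_anticipative M = {z. measurable_process M z \<and> bounded_process M z}"

definition bounded_adapted ::
  "'w measure \<Rightarrow> (real \<Rightarrow> 'w measure) \<Rightarrow> (real \<Rightarrow> 'w \<Rightarrow> real) set" where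
  "bounded_adapted M F = {Z. measurable_process M Z \<and> bounded_process M Z \<and> adapted_process F Z}"

definition nonneg_martingales ::
  "'w measure \<Rightarrow> (real \<Rightarrow> 'w measure) \<Rightarrow> (real \<Rightarrow> 'w \<Rightarrow> real) set" where
  "nonneg_martingales M F = {\<zeta>. measurable_process M \<zeta> \<and> adapted_process F \<zeta> \<and>
     (\<forall>s\<ge>0. \<forall>\<omega>\<in>space M. 0 \<le> \<zeta> s \<omega>) \<and>
     (\<forall>s\<ge>0. integrable M (\<zeta> s)) \<and>
     (\<forall>s r. 0 \<le> s \<and> s \<le> r \<longrightarrow> (AE \<omega> in M. real_cond_exp M (F s) (\<zeta> r) \<omega> = \<zeta> s \<omega>))}"


section \<open>Essential suprema and expectations in the extended reals\<close>

text \<open>The essential supremum of a family of random variables, as opposed to the library's essential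
  supremum \<open>esssup\<close> of a single function.  It exists for every family of random variables on a
  probability space and is unique up to null sets.\<close>

definition is_ess_sup :: "'w measure \<Rightarrow> 'i set \<Rightarrow> ('i \<Rightarrow> 'w \<Rightarrow> ereal) \<Rightarrow> ('w \<Rightarrow> ereal) \<Rightarrow> bool" where
  "is_ess_sup M I \<xi> S \<longleftrightarrow>
     S \<in> borel_measurable M \<and> (\<forall>i\<in>I. AE \<omega> in M. \<xi> i \<omega> \<le> S \<omega>) \<and>
     (\<forall>S'\<in>borel_measurable M. (\<forall>i\<in>I. AE \<omega> in M. \<xi> i \<omega> \<le> S' \<omega>) \<longrightarrow> (AE \<omega> in M. S \<omega> \<le> S' \<omega>))"

definition ess_sup :: "'w measure \<Rightarrow> 'i set \<Rightarrow> ('i \<Rightarrow> 'w \<Rightarrow> ereal) \<Rightarrow> 'w \<Rightarrow> ereal" where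
  "ess_sup M I \<xi> = (SOME S. is_ess_sup M I \<xi> S)"

text \<open>Used only when the negative part has finite integral.\<close>

definition ereal_expectation :: "'w measure \<Rightarrow> ('w \<Rightarrow> ereal) \<Rightarrow> ereal" where
  "ereal_expectation M S =
     enn2ereal (\<integral>\<^sup>+\<omega>. e2ennreal (S \<omega>) \<partial>M) - enn2ereal (\<integral>\<^sup>+\<omega>. e2ennreal (- S \<omega>) \<partial>M)"


section \<open>The two optimization problems\<close>

text \<open>The function of \<open>\<eta>\<close> is continuous on \<open>[0,1]\<close>, hence the supremum is a maximum.\<close>

definition branching_h :: "('a \<Rightarrow> real) \<Rightarrow> ('a \<Rightarrow> nat pmf) \<Rightarrow> 'a \<Rightarrow> real \<Rightarrow> real" where
  "branching_h lam p x z =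
     (SUP \<eta>\<in>{0..1}. \<eta> * z - lam x * measure_pmf.expectation (p x) (\<lambda>n. \<eta> ^ n))"

definition exp_int :: "(real \<Rightarrow> 'w \<Rightarrow> real) \<Rightarrow> real \<Rightarrow> 'w \<Rightarrow> real" where
  "exp_int Z t \<omega> = exp (LINT s:{0..t}|lborel. Z s \<omega>)"

definition primal_objective :: "'w measure \<Rightarrow> ('a \<Rightarrow> real) \<Rightarrow> ('a \<Rightarrow> nat pmf) \<Rightarrow>
    (real \<Rightarrow> 'w \<Rightarrow> 'a) \<Rightarrow> ('a \<Rightarrow> real) \<Rightarrow> real \<Rightarrow> (real \<Rightarrow> 'w \<Rightarrow> real) \<Rightarrow> real" where
  "primal_objective M lam p X f t Z =
     (\<integral>\<omega>. exp_int Z t \<omega> * f (X t \<omega>)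
        - (LINT s:{0..t}|lborel.
             exp_int Z s \<omega> * branching_h lam p (X s \<omega>) (Z s \<omega> + lam (X s \<omega>))) \<partial>M)"

definition ratio :: "(real \<Rightarrow> 'w \<Rightarrow> real) \<Rightarrow> real \<Rightarrow> real \<Rightarrow> 'w \<Rightarrow> real" where
  "ratio \<zeta> t s \<omega> = (if \<zeta> s \<omega> = 0 then 1 else \<zeta> t \<omega> / \<zeta> s \<omega>)"

definition dual_payoff :: "('a \<Rightarrow> real) \<Rightarrow> ('a \<Rightarrow> nat pmf) \<Rightarrow> (real \<Rightarrow> 'w \<Rightarrow> 'a) \<Rightarrow> ('a \<Rightarrow> real) \<Rightarrow>
    real \<Rightarrow> (real \<Rightarrow> 'w \<Rightarrow> real) \<Rightarrow> (real \<Rightarrow> 'w \<Rightarrow> real) \<Rightarrow> 'w \<Rightarrow> real" where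
  "dual_payoff lam p X f t \<zeta> z \<omega> =
     exp_int z t \<omega> * f (X t \<omega>)
     - (LINT s:{0..t}|lborel. exp_int z s \<omega> *
          (z s \<omega> + (branching_h lam p (X s \<omega>) (z s \<omega> + lam (X s \<omega>)) - z s \<omega>) * ratio \<zeta> t s \<omega>))"

definition dual_objective :: "'w measure \<Rightarrow> ('a \<Rightarrow> real) \<Rightarrow> ('a \<Rightarrow> nat pmf) \<Rightarrow>
    (real \<Rightarrow> 'w \<Rightarrow> 'a) \<Rightarrow> ('a \<Rightarrow> real) \<Rightarrow> real \<Rightarrow> (real \<Rightarrow> 'w \<Rightarrow> real) \<Rightarrow> ereal" where
  "dual_objective M lam p X f t \<zeta> = ereal_expectation M
     (ess_sup M (bounded_anticipative M) (\<lambda>z \<omega>. ereal (dual_payoff lam p X f t \<zeta> z \<omega>)))"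

end

theory Submission
  imports Defs
begin

text \<open>
Let \<open>G x \<eta>\<close> be the generating function of the offspring at \<open>x\<close>.  Decomposing the tree at its first
  branching event shows that the expected product \<open>u s x\<close> of a tree started at \<open>x\<close> and observed after
  time \<open>s\<close> solves an integral equation along the path of the initial particle: in formal terms
  \<open>dv = (\<lambda> v - \<lambda> G v) ds + martingale\<close> for the value \<open>v\<^sub>s = u (t - s) X\<^sub>s\<close>.  Everything else follows from
  this equation and from the convexity of \<open>G\<close>.

  The primal problem.  Integration by parts turns the equation into
  \<open>E(A\<^sub>t v\<^sub>t - \<integral> A\<^sub>s (v\<^sub>s (Z\<^sub>s + \<lambda>) - \<lambda> G v\<^sub>s) ds) = v\<^sub>0\<close> with \<open>A = exp \<integral> Z\<close> for every bounded adapted \<open>Z\<close>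
  (lemma \<open>feynman_kac\<close>).  By definition \<open>h\<close> dominates the integrand \<open>v (Z + \<lambda>) - \<lambda> G v\<close>, and
  since \<open>\<lambda> G\<close> is convex it is equal to it when \<open>Z + \<lambda>\<close> is the slope of \<open>\<lambda> G\<close> at \<open>v\<close>.  Hence the
  objective is at most \<open>v\<^sub>0\<close>, with equality for this feedback control (\<open>primal_value\<close>).

  The dual problem.  Against an adapted control the random factor \<open>\<zeta>\<^sub>t / \<zeta>\<^sub>s\<close> averages to 1, so the dual
  payoff of the optimal control has the primal value as its mean, and the dual objective dominates the
  primal one (\<open>dual_ge_primal\<close>).  Conversely \<open>\<zeta>\<^sub>s = (1 - v\<^sub>s) exp \<integral> c\<close> with \<open>c = \<lambda> (v - G v) / (1 - v)\<close> is
  a martingale for which the bound \<open>h \<ge> v (z + \<lambda>) - \<lambda> G v\<close> makes the payoff an exact differential: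
  whatever the anticipative control \<open>z\<close>, the payoff is at most \<open>1 - \<zeta>\<^sub>t\<close>, a random variable with mean
  \<open>v\<^sub>0\<close> (\<open>dual_payoff_opt_martingale_le\<close>).

  Two points need work beyond this calculation.  First, the integral equation is not available for a
  branching process that is given from the single starting point \<open>x0\<close>.  Its solution \<open>val\<close> is therefore
  constructed by Picard iteration from the law of the motion alone, and is then identified with the
  expected product by averaging over the particles of one generation after the other, one
  particle at a time (\<open>average_particle\<close>, \<open>frontier_step\<close>).  The \<open>n\<close>-th iterate is the expectation of
  the product on the event that generation \<open>n\<close> is not reached before time \<open>t\<close>; the complement is
  negligible because for \<open>f = 1\<close> the iterates converge to 1 (\<open>picard_one_tendsto\<close>).  Second, the paths of
  \<open>v\<close> have no regularity to speak of, and a measurable adapted control need not be progressive.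
  All stochastic calculus is therefore done pathwise for a process \<open>path_value\<close> that is absolutely
  continuous in time, anticipates the future, and has \<open>v\<close> as its conditional expectation.
\<close>

section \<open>Calculus with bounded densities\<close>

text \<open>Such a function has derivative zero at every point.\<close>

lemma const_of_quadratic_increments:
  fixes D :: "real \<Rightarrow> real"
  assumes D: "\<And>a b. 0 \<le> a \<Longrightarrow> a \<le> b \<Longrightarrow> b \<le> t \<Longrightarrow> \<bar>D b - D a\<bar> \<le> C * (b - a)\<^sup>2"
    and t: "0 \<le> t"
  shows "D t = D 0"
proof (cases "t = 0")
  case False
  with t have "t > 0" by simp
  have "(D has_field_derivative 0) (at x within {0..t})" if x: "x \<in> {0..t}" for x
  proof -
    have "((\<lambda>y. (D y - D x) / (y - x)) \<longlongrightarrow> 0) (at x within {0..t})"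
    proof (rule Lim_null_comparison)
      have "\<bar>(D y - D x) / (y - x)\<bar> \<le> C * \<bar>y - x\<bar>" if "y \<in> {0..t}" "y \<noteq> x" for y
      proof -
        have "\<bar>D y - D x\<bar> \<le> C * (y - x)\<^sup>2"
          using D[of x y] D[of y x] that x by (cases "x \<le> y") (auto simp: abs_minus_commute power2_commute)
        also have "(y - x)\<^sup>2 = \<bar>y - x\<bar> * \<bar>y - x\<bar>" by (simp add: power2_eq_square)
        finally show ?thesis using that by (simp add: divide_simps mult.assoc)
      qed
      then show "\<forall>\<^sub>F y in at x within {0..t}. norm ((D y - D x) / (y - x)) \<le> C * \<bar>y - x\<bar>"
        by (auto simp: eventually_at_filter intro!: always_eventually)
      have "((\<lambda>y. C * \<bar>y - x\<bar>) \<longlongrightarrow> C * \<bar>x - x\<bar>) (at x within {0..t})"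
        by (intro tendsto_intros)
      then show "((\<lambda>y. C * \<bar>y - x\<bar>) \<longlongrightarrow> 0) (at x within {0..t})" by simp
    qed
    then show ?thesis by (simp add: has_field_derivative_iff)
  qed
  then have "\<And>x. x \<in> {0..t} \<Longrightarrow> (D has_vector_derivative 0) (at x within {0..t})"
    by (simp add: has_real_derivative_iff_has_vector_derivative)
  then have "\<exists>c. \<forall>x\<in>{0..t}. D x = c"
    using has_vector_derivative_zero_constant[of "{0..t}" D] by (metis convex_real_interval(5))
  then show ?thesis using t by auto
qed simp

lemma abs_mult_le: "\<bar>a\<bar> \<le> A \<Longrightarrow> \<bar>b\<bar> \<le> B \<Longrightarrow> \<bar>a * b\<bar> \<le> A * (B::real)"
  unfolding abs_mult by (intro mult_mono) auto

lemma bounded_set_integrable: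
  fixes g :: "real \<Rightarrow> real"
  assumes [measurable]: "g \<in> borel_measurable borel" and bd: "\<And>s. s \<in> {a..b} \<Longrightarrow> \<bar>g s\<bar> \<le> C"
  shows "set_integrable lborel {a..b} g"
  unfolding set_integrable_def
proof (rule Bochner_Integration.integrable_bound)
  show "integrable lborel (\<lambda>s. indicator {a..b} s * C)"
    by (simp add: emeasure_lborel_Icc_eq)
  show "AE s in lborel. norm (indicat_real {a..b} s *\<^sub>R g s) \<le> norm (indicat_real {a..b} s * C)"
  proof -
    have "\<bar>g s\<bar> \<le> \<bar>C\<bar>" if "s \<in> {a..b}" for s using bd[OF that] by linarith
    then show ?thesis by (auto split: split_indicator)
  qed
qed simp

lemma bounded_set_integral_le:
  fixes g :: "real \<Rightarrow> real"
  assumes m: "g \<in> borel_measurable borel" and bd: "\<And>s. s \<in> {a..b} \<Longrightarrow> \<bar>g s\<bar> \<le> C" and ab: "a \<le> b"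
  shows "\<bar>LINT s:{a..b}|lborel. g s\<bar> \<le> C * (b - a)"
proof -
  have "\<bar>LINT s:{a..b}|lborel. g s\<bar> \<le> (LINT s:{a..b}|lborel. \<bar>g s\<bar>)"
    using set_integral_norm_bound[OF bounded_set_integrable[OF m bd]] by simp
  also have "\<dots> \<le> (LINT s:{a..b}|lborel. C)"
    using m bd ab order_trans[OF abs_ge_zero bd[of a]]
    by (intro set_integral_mono bounded_set_integrable[where C=C]) auto
  also have "\<dots> = C * (b - a)" using ab by (simp add: set_lebesgue_integral_def)
  finally show ?thesis .
qed

lemma set_integral_split:
  fixes g :: "real \<Rightarrow> real"
  assumes "set_integrable lborel {0..b} g" "0 \<le> a" "a \<le> b"
  shows "(LINT s:{0..b}|lborel. g s) = (LINT s:{0..a}|lborel. g s) + (LINT s:{a..b}|lborel. g s)"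
proof -
  have i: "set_integrable lborel {0..a} g" "set_integrable lborel {a..b} g"
    using assms by (auto intro: set_integrable_subset)
  have "(LINT s:{0..b}|lborel. g s) = (LINT s:{0..a} \<union> {a..b}|lborel. g s)"
    using assms by (simp add: ivl_disj_un)
  also have "\<dots> = (LINT s:{0..a}|lborel. g s) + (LINT s:{a..b}|lborel. g s)"
  proof (rule set_integral_Un_AE[OF _ _ _ i])
    have "AE s in lborel. s \<noteq> a" by (rule AE_lborel_singleton)
    then show "AE s in lborel. \<not> (s \<in> {0..a} \<and> s \<in> {a..b})" by eventually_elim auto
  qed auto
  finally show ?thesis .
qed

text \<open>A primitive of a bounded measurable density is Lipschitz, but need not be differentiable
  everywhere.  The product rule and the chain rule below hold all the same: the difference of their two
  sides has increments of second order and is therefore constant.\<close>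

locale bounded_primitive =
  fixes g G :: "real \<Rightarrow> real" and C t :: real
  assumes meas [measurable]: "g \<in> borel_measurable borel"
    and bound: "\<And>s. s \<in> {0..t} \<Longrightarrow> \<bar>g s\<bar> \<le> C"
    and prim: "\<And>s. s \<in> {0..t} \<Longrightarrow> G s = G 0 + (LINT r:{0..s}|lborel. g r)"
begin

lemma increment:
  assumes "0 \<le> a" "a \<le> b" "b \<le> t"
  shows "G b - G a = (LINT r:{a..b}|lborel. g r)"
proof -
  have "set_integrable lborel {0..b} g"
    using assms bound by (intro bounded_set_integrable[OF meas, where C=C]) auto
  from set_integral_split[OF this assms(1,2)] prim[of a] prim[of b] assms show ?thesis by simp
qed

lemma lipschitz:
  assumes "0 \<le> a" "a \<le> b" "b \<le> t"
  shows "\<bar>G b - G a\<bar> \<le> C * (b - a)"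
  unfolding increment[OF assms] using assms bound by (intro bounded_set_integral_le) auto

lemma continuous: "continuous_on {0..t} G"
proof (cases "0 \<le> t")
  case True
  have "0 \<le> C" using bound[of 0] True by auto
  then have "C-lipschitz_on {0..t} G"
  proof (intro lipschitz_onI)
    fix x y assume "x \<in> {0..t}" "y \<in> {0..t}"
    then show "dist (G x) (G y) \<le> C * dist x y"
      using lipschitz[of x y] lipschitz[of y x] by (cases "x \<le> y") (auto simp: dist_real_def abs_minus_commute)
  qed
  then show ?thesis by (rule lipschitz_on_continuous_on)
qed simp

lemma bounded: "s \<in> {0..t} \<Longrightarrow> \<bar>G s\<bar> \<le> \<bar>G 0\<bar> + C * t"
  using lipschitz[of 0 s] bound[of 0] mult_left_mono[of s t C] abs_ge_zero[of "g 0"]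
  by (auto simp: abs_if split: if_splits)

lemma measurable_ind: "(\<lambda>s. indicator {0..t} s * G s) \<in> borel_measurable borel"
  using borel_measurable_continuous_on_indicator[OF _ continuous] by simp

end

lemma bounded_primitive_uminus:
  assumes "bounded_primitive g G B t"
  shows "bounded_primitive (\<lambda>r. - g r) (\<lambda>r. - G r) B t"
proof -
  interpret bounded_primitive g G B t by fact
  show ?thesis
  proof
    show "\<bar>- g s\<bar> \<le> B" if "s \<in> {0..t}" for s using bound[OF that] by simp
    show "- G s = - G 0 + (LINT r:{0..s}|lborel. - g r)" if "s \<in> {0..t}" for s
      using prim[OF that] by (simp add: set_lebesgue_integral_def)
  qed measurable
qed

lemma bounded_primitive_mono:
  assumes "bounded_primitive g G C t" "b \<le> t"
  shows "bounded_primitive g G C b"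
proof -
  interpret bounded_primitive g G C t by fact
  show ?thesis
  proof
    show "\<bar>g s\<bar> \<le> C" if "s \<in> {0..b}" for s using that assms(2) by (intro bound) auto
    show "G s = G 0 + (LINT r:{0..s}|lborel. g r)" if "s \<in> {0..b}" for s using that assms(2) by (intro prim) auto
  qed (rule meas)
qed

lemma integration_by_parts_bounded:
  assumes P: "bounded_primitive p P B t" and Q: "bounded_primitive q Q C t" and t: "0 \<le> t"
  shows "P t * Q t - P 0 * Q 0 = (LINT s:{0..t}|lborel. p s * Q s + P s * q s)"
proof -
  interpret P: bounded_primitive p P B t by fact
  interpret Q: bounded_primitive q Q C t by fact
  note [measurable] = P.meas Q.meas P.measurable_ind Q.measurable_ind
  have BC: "0 \<le> B" "0 \<le> C" using P.bound[of 0] Q.bound[of 0] t by auto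
  define g where "g s = p s * (indicator {0..t} s * Q s) + (indicator {0..t} s * P s) * q s" for s
  have g_meas [measurable]: "g \<in> borel_measurable borel" unfolding g_def by measurable
  define K where "K = B * (\<bar>Q 0\<bar> + C * t) + (\<bar>P 0\<bar> + B * t) * C"
  have g_bd: "\<bar>g s\<bar> \<le> K" if "s \<in> {0..t}" for s
    unfolding g_def K_def using that P.bound[OF that] Q.bound[OF that] P.bounded[OF that] Q.bounded[OF that] BC
    by (intro order_trans[OF abs_triangle_ineq] add_mono abs_mult_le) auto
  have gi: "set_integrable lborel {0..b} g" if "b \<le> t" for b
    using that g_bd by (intro bounded_set_integrable[where C=K]) auto
  define D where "D s = P s * Q s - (LINT r:{0..s}|lborel. g r)" for s
  have "D t = D 0"
  proof (rule const_of_quadratic_increments[OF _ t, where C="3 * B * C"])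
    fix a b assume ab: "0 \<le> a" "a \<le> b" "b \<le> t"
    have sub: "{a..b} \<subseteq> {0..t}" using ab by auto
    have pi: "set_integrable lborel {a..b} p" "set_integrable lborel {a..b} q" "set_integrable lborel {a..b} g"
      using ab P.bound Q.bound g_bd
      by (auto intro!: bounded_set_integrable[where C=B and g=p] bounded_set_integrable[where C=C and g=q]
        bounded_set_integrable[where C=K and g=g])
    have eq: "(LINT s:{a..b}|lborel. g s) - (Q a * (P b - P a) + P a * (Q b - Q a))
        = (LINT s:{a..b}|lborel. g s - (Q a * p s + P a * q s))"
      unfolding P.increment[OF ab] Q.increment[OF ab] using pi
      by (simp add: set_integral_diff set_integral_add set_integrable_mult_right)
    \<comment> \<open>The densities are compared with those frozen at the left end point.\<close>
    have "\<bar>LINT s:{a..b}|lborel. g s - (Q a * p s + P a * q s)\<bar> \<le> (2 * B * C * (b - a)) * (b - a)"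
    proof (rule bounded_set_integral_le)
      fix s assume s: "s \<in> {a..b}"
      then have s': "s \<in> {0..t}" using sub by auto
      have "\<bar>Q s - Q a\<bar> \<le> C * (b - a)" "\<bar>P s - P a\<bar> \<le> B * (b - a)"
        using Q.lipschitz[of a s] P.lipschitz[of a s] s ab BC
          mult_left_mono[of "s - a" "b - a" C] mult_left_mono[of "s - a" "b - a" B] by auto
      then have "\<bar>p s * (Q s - Q a) + (P s - P a) * q s\<bar> \<le> B * (C * (b - a)) + (B * (b - a)) * C"
        using P.bound[OF s'] Q.bound[OF s'] BC ab

        by (intro order_trans[OF abs_triangle_ineq] add_mono abs_mult_le) auto
      moreover have "g s - (Q a * p s + P a * q s) = p s * (Q s - Q a) + (P s - P a) * q s"
        using s' by (simp add: g_def algebra_simps)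
      ultimately show "\<bar>g s - (Q a * p s + P a * q s)\<bar> \<le> 2 * B * C * (b - a)"
        by (simp add: algebra_simps)
    qed (use ab in auto)
    moreover have "\<bar>(P b - P a) * (Q b - Q a)\<bar> \<le> (B * (b - a)) * (C * (b - a))"
      unfolding abs_mult using P.lipschitz[OF ab] Q.lipschitz[OF ab] BC ab by (intro mult_mono) auto
    moreover have "D b - D a = (P b - P a) * (Q b - Q a)
       - ((LINT s:{a..b}|lborel. g s) - (Q a * (P b - P a) + P a * (Q b - Q a)))"
      unfolding D_def using set_integral_split[OF gi[OF ab(3)] ab(1,2)] by (simp add: algebra_simps)
    ultimately show "\<bar>D b - D a\<bar> \<le> 3 * B * C * (b - a)\<^sup>2"
      unfolding eq power2_eq_square by (simp add: algebra_simps abs_if split: if_splits)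
  qed
  then have "P t * Q t - P 0 * Q 0 = (LINT r:{0..t}|lborel. g r) - (LINT r:{0..0}|lborel. g r)"
    by (simp add: D_def)
  also have "(LINT r:{0..0}|lborel. g r) = 0"
    using bounded_set_integral_le[of g 0 0 K] g_bd t by simp
  also have "(LINT r:{0..t}|lborel. g r) = (LINT s:{0..t}|lborel. p s * Q s + P s * q s)"
    by (rule set_lebesgue_integral_cong) (auto simp: g_def)
  finally show ?thesis by simp
qed

lemma exp_primitive_bounded:
  assumes G: "bounded_primitive g G B t" and t: "0 \<le> t"
  shows "bounded_primitive (\<lambda>s. indicator {0..t} s * (g s * exp (G s))) (\<lambda>s. exp (G s)) (B * exp (\<bar>G 0\<bar> + B * t)) t"
proof -
  interpret G: bounded_primitive g G B t by fact
  note [measurable] = G.meas G.measurable_ind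
  have B: "0 \<le> B" using G.bound[of 0] t by auto
  define g' where "g' s = indicator {0..t} s * (g s * exp (indicator {0..t} s * G s))" for s :: real
  have g'_eq: "g' = (\<lambda>s. indicator {0..t} s * (g s * exp (G s)))"
    by (auto simp: g'_def fun_eq_iff split: split_indicator)
  have g'_meas [measurable]: "g' \<in> borel_measurable borel" unfolding g'_def by measurable
  define E where "E = exp (\<bar>G 0\<bar> + B * t)"
  have expE: "exp (G s) \<le> E" if "s \<in> {0..t}" for s
    using G.bounded[OF that] by (auto simp: E_def)
  have g'_bd: "\<bar>g' s\<bar> \<le> B * E" if "s \<in> {0..t}" for s
    unfolding g'_eq using that expE[OF that] G.bound[OF that] B by (auto intro!: abs_mult_le)
  have exp_diff: "\<bar>exp x - exp y - exp y * (x - y)\<bar> \<le> E * (x - y)\<^sup>2" "\<bar>exp x - exp y\<bar> \<le> E * \<bar>x - y\<bar>"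
    if "exp x \<le> E" "exp y \<le> E" for x y :: real
  proof -
    have 1: "exp u - exp v \<le> E * (u - v)" if "exp u \<le> E" "v \<le> u" for u v :: real
    proof -
      have "exp v \<ge> exp u * (1 + (v - u))"
        using exp_ge_add_one_self[of "v - u"] by (simp add: exp_diff field_simps)
      then have "exp u - exp v \<le> exp u * (u - v)" by (simp add: algebra_simps)
      also have "\<dots> \<le> E * (u - v)" using that by (intro mult_right_mono) auto
      finally show ?thesis .
    qed
    show 2: "\<bar>exp x - exp y\<bar> \<le> E * \<bar>x - y\<bar>"
      using 1[of x y] 1[of y x] that by (cases "x \<le> y") auto
    \<comment> \<open>Both bounds come from convexity of the exponential function.\<close>
    have lo: "exp x - exp y - exp y * (x - y) \<ge> 0"
      using exp_ge_add_one_self[of "x - y"] by (simp add: exp_diff field_simps)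
    have "exp y - exp x \<ge> exp x * (y - x)"
      using exp_ge_add_one_self[of "y - x"] by (simp add: exp_diff field_simps)
    then have "exp x - exp y - exp y * (x - y) \<le> (exp x - exp y) * (x - y)"
      by (simp add: algebra_simps)
    also have "\<dots> \<le> \<bar>exp x - exp y\<bar> * \<bar>x - y\<bar>" by (metis abs_ge_self abs_mult)
    also have "\<dots> \<le> E * \<bar>x - y\<bar> * \<bar>x - y\<bar>" using 2 by (intro mult_right_mono) auto
    finally show "\<bar>exp x - exp y - exp y * (x - y)\<bar> \<le> E * (x - y)\<^sup>2"
      using lo by (simp add: power2_eq_square abs_mult)
  qed
  have main: "exp (G s) - exp (G 0) = (LINT r:{0..s}|lborel. g' r)" if s: "s \<in> {0..t}" for s
  proof -
    have gi: "set_integrable lborel {0..b} g'" if "b \<le> s" for b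
      using that s g'_bd by (intro bounded_set_integrable[where C="B*E"]) auto
    define D where "D s = exp (G s) - (LINT r:{0..s}|lborel. g' r)" for s
    have "D s = D 0"
    proof (rule const_of_quadratic_increments[where C="2 * E * B * B"])
      fix a b assume ab': "0 \<le> a" "a \<le> b" "b \<le> s"
      then have ab: "0 \<le> a" "a \<le> b" "b \<le> t" using s by auto
      have sub: "{a..b} \<subseteq> {0..t}" using ab by auto
      have pi: "set_integrable lborel {a..b} g" "set_integrable lborel {a..b} g'"
        using ab G.bound g'_bd
      by (auto intro!: bounded_set_integrable[where C=B and g=g] bounded_set_integrable[where C="B * E" and g=g'])
      have eq: "(LINT r:{a..b}|lborel. g' r) - exp (G a) * (G b - G a)
          = (LINT r:{a..b}|lborel. g' r - exp (G a) * g r)"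
        unfolding G.increment[OF ab] using pi
        by (simp add: set_integral_diff set_integrable_mult_right)
      have "\<bar>LINT r:{a..b}|lborel. g' r - exp (G a) * g r\<bar> \<le> (B * (E * (B * (b - a)))) * (b - a)"
      proof (rule bounded_set_integral_le)
        fix r assume r: "r \<in> {a..b}"
        then have r': "r \<in> {0..t}" using sub by auto
        have a': "a \<in> {0..t}" using ab by auto
        have "\<bar>exp (G r) - exp (G a)\<bar> \<le> E * \<bar>G r - G a\<bar>" using exp_diff(2) expE r' a' by blast
        also have "\<dots> \<le> E * (B * (b - a))"
          using G.lipschitz[of a r] r ab B mult_left_mono[of "r - a" "b - a" B]
          by (intro mult_left_mono) (auto simp: E_def)
        finally have "\<bar>g r * (exp (G r) - exp (G a))\<bar> \<le> B * (E * (B * (b - a)))"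
          using G.bound[OF r'] B unfolding abs_mult by (intro mult_mono) auto
        then show "\<bar>g' r - exp (G a) * g r\<bar> \<le> B * (E * (B * (b - a)))"
          using r' by (simp add: g'_def algebra_simps)
      qed (use ab in auto)
      moreover have "\<bar>exp (G b) - exp (G a) - exp (G a) * (G b - G a)\<bar> \<le> E * (G b - G a)\<^sup>2"
        using exp_diff(1) expE ab by auto
      moreover have "E * (G b - G a)\<^sup>2 \<le> E * (B * (b - a))\<^sup>2"
        using G.lipschitz[OF ab] by (intro mult_left_mono) (auto simp: E_def abs_le_square_iff[symmetric])
      moreover have "D b - D a = (exp (G b) - exp (G a) - exp (G a) * (G b - G a))
         - ((LINT r:{a..b}|lborel. g' r) - exp (G a) * (G b - G a))"
        unfolding D_def using set_integral_split[OF gi[OF ab'(3)] ab(1,2)] by (simp add: algebra_simps)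
      ultimately show "\<bar>D b - D a\<bar> \<le> 2 * E * B * B * (b - a)\<^sup>2"
        unfolding eq power2_eq_square by (simp add: algebra_simps abs_if split: if_splits)
    qed (use s in auto)
    moreover have "(LINT r:{0..0}|lborel. g' r) = 0"
      using bounded_set_integral_le[of g' 0 0 "B*E"] g'_bd t by simp
    ultimately show ?thesis by (simp add: D_def)
  qed
  show ?thesis
    unfolding g'_eq[symmetric] E_def[symmetric]
    by unfold_locales (use g'_bd in \<open>auto simp: main[symmetric]\<close>)
qed

lemma set_integral_translate:
  fixes g :: "real \<Rightarrow> real"
  shows "(LINT a:{0..r}|lborel. g (s + a)) = (LINT b:{s..s + r}|lborel. g b)"
proof -
  have "(LINT b:{s..s + r}|lborel. g b) = (\<integral>a. indicator {s..s + r} (s + 1 * a) *\<^sub>R g (s + 1 * a) \<partial>lborel)"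
    unfolding set_lebesgue_integral_def
    using lborel_integral_real_affine[of 1 "\<lambda>b. indicator {s..s + r} b *\<^sub>R g b" s] by simp
  also have "\<dots> = (LINT a:{0..r}|lborel. g (s + a))"
    unfolding set_lebesgue_integral_def by (intro Bochner_Integration.integral_cong) (auto split: split_indicator)
  finally show ?thesis by simp
qed

lemma measurable_set_integral_upto [measurable (raw)]:
  fixes g :: "'b \<Rightarrow> real \<Rightarrow> real"
  assumes [measurable]: "(\<lambda>(y, r). g y r) \<in> borel_measurable (N \<Otimes>\<^sub>M borel)" "s \<in> borel_measurable N"
  shows "(\<lambda>y. LINT r:{0..s y}|lborel. g y r) \<in> borel_measurable N"
proof -
  have "(LINT r:{0..s y}|lborel. g y r) = (\<integral>r. indicator {r. 0 \<le> r \<and> r \<le> s y} r * g y r \<partial>lborel)" for y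
    unfolding set_lebesgue_integral_def by (intro Bochner_Integration.integral_cong) (auto split: split_indicator)
  moreover have "(\<lambda>y. \<integral>r. indicator {r. 0 \<le> r \<and> r \<le> s y} r * g y r \<partial>lborel) \<in> borel_measurable N"
    unfolding indicator_def mem_Collect_eq by measurable
  ultimately show ?thesis by simp
qed

section \<open>Essential suprema\<close>

text \<open>Exhaustion: some countable subfamily attains the supremum of the measures of countable unions.
  As the measure is finite, no further member can add mass to that union.\<close>

lemma (in finite_measure) countable_essential_cover:
  assumes A: "\<And>i. i \<in> I \<Longrightarrow> A i \<in> sets M"
  shows "\<exists>J\<subseteq>I. countable J \<and> (\<forall>i\<in>I. AE x in M. x \<in> A i \<longrightarrow> x \<in> (\<Union>j\<in>J. A j))"
proof -
  define c where "c = (SUP J\<in>{J. J \<subseteq> I \<and> countable J}. emeasure M (\<Union>j\<in>J. A j))"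
  have "{J. J \<subseteq> I \<and> countable J} \<noteq> {}" by auto
  from ennreal_SUP_countable_SUP[OF this, of "\<lambda>J. emeasure M (\<Union>j\<in>J. A j)"]
  obtain g :: "nat \<Rightarrow> ennreal" where g: "range g \<subseteq> (\<lambda>J. emeasure M (\<Union>j\<in>J. A j)) ` {J. J \<subseteq> I \<and> countable J}"
    "c = (SUP n. g n)" unfolding c_def by blast
  from g(1) have "\<forall>n. \<exists>J. J \<subseteq> I \<and> countable J \<and> g n = emeasure M (\<Union>j\<in>J. A j)" by blast
  then obtain J where J: "\<And>n. J n \<subseteq> I" "\<And>n. countable (J n)"
    and "\<And>n. g n = emeasure M (\<Union>j\<in>J n. A j)" by metis
  with g(2) have c: "c = (SUP n. emeasure M (\<Union>j\<in>J n. A j))" by simp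
  define K where "K = (\<Union>n. J n)"
  have K: "K \<subseteq> I" "countable K" using J by (auto simp: K_def)
  have UN_sets: "(\<Union>j\<in>J. A j) \<in> sets M" if "J \<subseteq> I" "countable J" for J
    using that A by (intro sets.countable_UN') auto
  have le_c: "emeasure M (\<Union>j\<in>J. A j) \<le> c" if "J \<subseteq> I" "countable J" for J
    unfolding c_def using that by (intro SUP_upper) auto
  have "c \<le> emeasure M (\<Union>j\<in>K. A j)"
    unfolding c by (intro SUP_least emeasure_mono UN_sets K) (auto simp: K_def)
  have "AE x in M. x \<in> A i \<longrightarrow> x \<in> (\<Union>j\<in>K. A j)" if i: "i \<in> I" for i
  proof -
    have "emeasure M (\<Union>j\<in>K. A j) + emeasure M (A i - (\<Union>j\<in>K. A j)) = emeasure M (\<Union>j\<in>insert i K. A j)"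
      using A[OF i] UN_sets[OF K] by (subst plus_emeasure) (auto intro!: arg_cong[where f="emeasure M"])
    also have "\<dots> \<le> c" using K i by (intro le_c) auto
    also have "\<dots> \<le> emeasure M (\<Union>j\<in>K. A j) + 0" using \<open>c \<le> _\<close> by simp
    finally have "emeasure M (A i - (\<Union>j\<in>K. A j)) = 0"
      by (simp add: ennreal_add_left_cancel_le del: add_0_right)
    then show ?thesis
      using A[OF i] UN_sets[OF K] by (intro AE_I[where N="A i - (\<Union>j\<in>K. A j)"]) auto
  qed
  then show ?thesis using K by blast
qed

lemma ereal_rational_between:
  fixes a b :: ereal
  assumes "a < b"
  shows "\<exists>r::rat. a < ereal (of_rat r) \<and> ereal (of_rat r) < b"
proof -
  obtain c where c: "a < ereal c" "ereal c < b" using ereal_dense2[OF assms] by blast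
  then obtain d where d: "ereal c < ereal d" "ereal d < b" using ereal_dense2 by blast
  then obtain r where "c < of_rat r" "of_rat r < d" using of_rat_dense[of c d] by auto
  then have "ereal c < ereal (of_rat r)" "ereal (of_rat r) < ereal d" by auto
  then show ?thesis using c d by (meson less_trans)
qed

text \<open>For each rational level, countably many members essentially cover the sets on which a member
  exceeds the level.  The pointwise supremum over all these countably many members dominates
  every member, because two distinct extended reals are separated by a rational.\<close>

lemma (in finite_measure) is_ess_sup_exists:
  assumes \<xi>: "\<And>i. i \<in> I \<Longrightarrow> \<xi> i \<in> borel_measurable M"
  shows "\<exists>S. is_ess_sup M I \<xi> S"
proof -
  have "\<exists>J\<subseteq>I. countable J \<and> (\<forall>i\<in>I. AE x in M. ereal (of_rat q) < \<xi> i x \<longrightarrow> (\<exists>j\<in>J. ereal (of_rat q) < \<xi> j x))" for q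
  proof -
    have "{x \<in> space M. ereal (of_rat q) < \<xi> i x} \<in> sets M" if "i \<in> I" for i
      using \<xi>[OF that] by measurable
    from countable_essential_cover[of I "\<lambda>i. {x \<in> space M. ereal (of_rat q) < \<xi> i x}", OF this]
    obtain J where J: "J \<subseteq> I" "countable J" "\<And>i. i \<in> I \<Longrightarrow> AE x in M. x \<in> {x \<in> space M. ereal (of_rat q) < \<xi> i x} \<longrightarrow>
        x \<in> (\<Union>j\<in>J. {x \<in> space M. ereal (of_rat q) < \<xi> j x})" by blast
    have "AE x in M. ereal (of_rat q) < \<xi> i x \<longrightarrow> (\<exists>j\<in>J. ereal (of_rat q) < \<xi> j x)" if "i \<in> I" for i
      using J(3)[OF that] AE_space by eventually_elim auto
    with J show ?thesis by blast
  qed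
  then have "\<forall>q. \<exists>J\<subseteq>I. countable J \<and> (\<forall>i\<in>I. AE x in M. ereal (of_rat q) < \<xi> i x \<longrightarrow> (\<exists>j\<in>J. ereal (of_rat q) < \<xi> j x))"
    by blast
  then obtain J where "\<forall>q. J q \<subseteq> I \<and> countable (J q) \<and>
    (\<forall>i\<in>I. AE x in M. ereal (of_rat q) < \<xi> i x \<longrightarrow> (\<exists>j\<in>J q. ereal (of_rat q) < \<xi> j x))"
    by (auto dest!: choice)
  then have J: "\<And>q. J q \<subseteq> I" "\<And>q. countable (J q)"
    "\<And>q i. i \<in> I \<Longrightarrow> AE x in M. ereal (of_rat q) < \<xi> i x \<longrightarrow> (\<exists>j\<in>J q. ereal (of_rat q) < \<xi> j x)"
    by auto
  define K where "K = (\<Union>q. J q)"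
  have K: "K \<subseteq> I" "countable K" using J by (auto simp: K_def)
  define S where "S x = (SUP j\<in>K. \<xi> j x)" for x
  have "S \<in> borel_measurable M"
    unfolding S_def using K \<xi> by (intro borel_measurable_SUP) auto
  moreover have "AE x in M. \<xi> i x \<le> S x" if i: "i \<in> I" for i
  proof -
    have "AE x in M. \<forall>q. ereal (of_rat q) < \<xi> i x \<longrightarrow> (\<exists>j\<in>J q. ereal (of_rat q) < \<xi> j x)"
      using J(3)[OF i] by (simp add: AE_all_countable)
    then show ?thesis
    proof eventually_elim
      case (elim x)
      show ?case
      proof (rule ccontr)
        assume "\<not> \<xi> i x \<le> S x"
        then obtain r where r: "S x < ereal (of_rat r)" "ereal (of_rat r) < \<xi> i x"
          using ereal_rational_between[of "S x" "\<xi> i x"] by (auto simp: not_le)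
        with elim obtain j where "j \<in> J r" "ereal (of_rat r) < \<xi> j x" by blast
        moreover from this have "\<xi> j x \<le> S x" unfolding S_def by (intro SUP_upper) (auto simp: K_def)
        ultimately show False using r by auto
      qed
    qed
  qed
  moreover have "AE x in M. S x \<le> S' x" if "\<forall>i\<in>I. AE x in M. \<xi> i x \<le> S' x" for S'
  proof -
    have "AE x in M. \<forall>j\<in>K. \<xi> j x \<le> S' x" using K that by (subst AE_ball_countable) auto
    then show ?thesis unfolding S_def by eventually_elim (auto intro: SUP_least)
  qed
  ultimately have "is_ess_sup M I \<xi> S" unfolding is_ess_sup_def by blast
  then show ?thesis by blast
qed

lemma ereal_expectation_ereal:
  assumes "integrable M g"
  shows "ereal_expectation M (\<lambda>x. ereal (g x)) = ereal (integral\<^sup>L M g)"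
proof -
  have "(\<integral>\<^sup>+x. ennreal (g x) \<partial>M) < top" "(\<integral>\<^sup>+x. ennreal (- g x) \<partial>M) < top"
    using assms by (auto elim!: integrableE simp: less_top)
  moreover have "enn2ereal a = ereal (enn2real a)" if "a < top" for a
    using that by (cases a rule: ennreal_cases) (auto simp: enn2ereal_ennreal)
  ultimately show ?thesis
    unfolding ereal_expectation_def real_lebesgue_integral_def[OF assms] by simp
qed

text \<open>Subtraction of extended reals is monotone also where both parts are infinite.\<close>

lemma ereal_expectation_mono:
  assumes "AE x in M. S x \<le> S' x"
  shows "ereal_expectation M S \<le> ereal_expectation M S'"
  unfolding ereal_expectation_def
  using assms
  by (intro ereal_minus_mono iffD1[OF less_eq_ennreal.rep_eq] nn_integral_mono_AE)
    (auto elim!: eventually_mono intro!: e2ennreal_mono)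

section \<open>Measurable processes\<close>

lemma (in prob_space) expectation_time_integral:
  fixes h :: "real \<Rightarrow> 'a \<Rightarrow> real"
  assumes meas: "(\<lambda>(r, \<omega>). h r \<omega>) \<in> borel_measurable (borel \<Otimes>\<^sub>M M)"
    and bound: "\<And>r. r \<in> {a..b} \<Longrightarrow> (\<integral>\<^sup>+\<omega>. ennreal \<bar>h r \<omega>\<bar> \<partial>M) \<le> ennreal C"
  shows "AE \<omega> in M. set_integrable lborel {a..b} (\<lambda>r. h r \<omega>)"
    and "integrable M (\<lambda>\<omega>. LINT r:{a..b}|lborel. h r \<omega>)"
    and "(\<integral>\<omega>. (LINT r:{a..b}|lborel. h r \<omega>) \<partial>M) = (LINT r:{a..b}|lborel. (\<integral>\<omega>. h r \<omega> \<partial>M))"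
proof -
  note fst = nn_integral_fst
  interpret pair_sigma_finite lborel M ..
  note [measurable] = meas
  let ?g = "\<lambda>r \<omega>. indicator {a..b} r *\<^sub>R h r \<omega>"
  have g_meas [measurable]: "case_prod ?g \<in> borel_measurable (lborel \<Otimes>\<^sub>M M)" by measurable
  have "(\<integral>\<^sup>+z. norm (case_prod ?g z) \<partial>(lborel \<Otimes>\<^sub>M M)) = (\<integral>\<^sup>+r. \<integral>\<^sup>+\<omega>. norm (?g r \<omega>) \<partial>M \<partial>lborel)"
    using fst[of "\<lambda>z. ennreal (norm (case_prod ?g z))" lborel]
    by simp
  also have "\<dots> \<le> (\<integral>\<^sup>+r. ennreal C * indicator {a..b} r \<partial>lborel)"
    using bound by (intro nn_integral_mono) (auto split: split_indicator)
  also have "\<dots> < \<infinity>"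
    by (subst nn_integral_cmult_indicator) (auto simp: emeasure_lborel_Icc_eq ennreal_mult_less_top)
  finally have int: "integrable (lborel \<Otimes>\<^sub>M M) (case_prod ?g)"
    using g_meas by (intro integrableI_bounded) auto
  show "AE \<omega> in M. set_integrable lborel {a..b} (\<lambda>r. h r \<omega>)"
    using AE_integrable_snd[OF int] unfolding set_integrable_def .
  show "integrable M (\<lambda>\<omega>. LINT r:{a..b}|lborel. h r \<omega>)"
    using integrable_snd[OF int] unfolding set_lebesgue_integral_def .
  show "(\<integral>\<omega>. (LINT r:{a..b}|lborel. h r \<omega>) \<partial>M) = (LINT r:{a..b}|lborel. (\<integral>\<omega>. h r \<omega> \<partial>M))"
    using Fubini_integral[OF int] unfolding set_lebesgue_integral_def by simp
qed

lemma (in prob_space) nn_integral_bounded_le: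
  fixes h :: "'a \<Rightarrow> real"
  assumes "\<And>\<omega>. \<omega> \<in> space M \<Longrightarrow> \<bar>h \<omega>\<bar> \<le> C"
  shows "(\<integral>\<^sup>+\<omega>. ennreal \<bar>h \<omega>\<bar> \<partial>M) \<le> ennreal C"
proof -
  have "(\<integral>\<^sup>+\<omega>. ennreal \<bar>h \<omega>\<bar> \<partial>M) \<le> (\<integral>\<^sup>+\<omega>. ennreal C \<partial>M)"
    using assms by (intro nn_integral_mono ennreal_leI) auto
  then show ?thesis by (simp add: emeasure_space_1)
qed

text \<open>Processes are indexed by \<open>[0,\<infinity>)\<close>.  Freezing them before time 0 turns them into jointly
  measurable functions on the whole line, to which the product measure \<open>lborel \<Otimes>\<^sub>M M\<close> applies.\<close>

lemma measurable_process_extend: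
  assumes "measurable_process M Z"
  shows "(\<lambda>(r, \<omega>). Z (max 0 r) \<omega>) \<in> borel_measurable (borel \<Otimes>\<^sub>M M)"
proof -
  have "(\<lambda>(r :: real, \<omega>). (max 0 r, \<omega>)) \<in> borel \<Otimes>\<^sub>M M \<rightarrow>\<^sub>M restrict_space borel {0..} \<Otimes>\<^sub>M M"
    unfolding case_prod_beta
  proof (intro measurable_Pair measurable_restrict_space2)
    show "(\<lambda>x. max 0 (fst x)) \<in> borel \<Otimes>\<^sub>M M \<rightarrow>\<^sub>M (borel :: real measure)" by measurable
  qed (auto simp: le_max_iff_disj)
  from measurable_compose[OF this assms[unfolded measurable_process_def]]
  show ?thesis by (simp add: case_prod_beta)
qed

lemma measurable_process_restrict:
  assumes "(\<lambda>(r, \<omega>). Z r \<omega>) \<in> borel_measurable (borel \<Otimes>\<^sub>M M)"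
  shows "measurable_process M Z"
proof -
  have "(\<lambda>(r, \<omega>). (r, \<omega>)) \<in> restrict_space borel {0..} \<Otimes>\<^sub>M M \<rightarrow>\<^sub>M borel \<Otimes>\<^sub>M M"
    unfolding case_prod_beta by (intro measurable_Pair measurable_compose[OF measurable_fst measurable_restrict_space1]) auto
  from measurable_compose[OF this assms] show ?thesis
    unfolding measurable_process_def by (simp add: case_prod_beta)
qed

lemma measurable_process_section:
  assumes "measurable_process M Z" "0 \<le> s"
  shows "Z s \<in> borel_measurable M"
  using measurable_compose[OF measurable_Pair1'[of s borel M] measurable_process_extend[OF assms(1)]] assms(2)
  by simp

lemma exp_int_extend: "exp_int Z s \<omega> = exp_int (\<lambda>r. Z (max 0 r)) s \<omega>"
  unfolding exp_int_def by (intro arg_cong[where f=exp] set_lebesgue_integral_cong) auto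

lemma exp_int_measurable:
  assumes [measurable]: "(\<lambda>(r, \<omega>). Z r \<omega>) \<in> borel_measurable (borel \<Otimes>\<^sub>M M)"
  shows "(\<lambda>(r, \<omega>). exp_int Z r \<omega>) \<in> borel_measurable (borel \<Otimes>\<^sub>M M)"
  unfolding exp_int_def case_prod_beta by measurable

lemma path_integral_primitive:
  assumes [measurable]: "(\<lambda>(r, \<omega>). Z r \<omega>) \<in> borel_measurable (borel \<Otimes>\<^sub>M M)"
    and \<omega>: "\<omega> \<in> space M" and bd: "\<And>r. \<bar>Z r \<omega>\<bar> \<le> C"
  shows "bounded_primitive (\<lambda>r. Z r \<omega>) (\<lambda>s. LINT r:{0..s}|lborel. Z r \<omega>) C t"
proof
  show m: "(\<lambda>r. Z r \<omega>) \<in> borel_measurable borel"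
    using measurable_compose[OF measurable_Pair2'[OF \<omega>] assms(1)] by simp
  have "(LINT r:{0..0}|lborel. Z r \<omega>) = 0"
    using bounded_set_integral_le[OF m, of 0 0 C] bd by simp
  then show "(LINT r:{0..s}|lborel. Z r \<omega>) = (LINT r:{0..0}|lborel. Z r \<omega>) + (LINT r:{0..s}|lborel. Z r \<omega>)" for s
    by simp
qed (rule bd)

lemma exp_int_0: "exp_int Z 0 \<omega> = 1"
proof -
  have "(LINT r:{0..0::real}|lborel. Z r \<omega>) = 0"
    unfolding set_lebesgue_integral_def using AE_lborel_singleton[of 0]
    by (intro integral_eq_zero_AE) auto
  then show ?thesis by (simp add: exp_int_def)
qed

lemma exp_int_primitive:
  assumes Z: "(\<lambda>(r, \<omega>). Z r \<omega>) \<in> borel_measurable (borel \<Otimes>\<^sub>M M)"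
    and \<omega>: "\<omega> \<in> space M" and bd: "\<And>r. \<bar>Z r \<omega>\<bar> \<le> C" and t: "0 \<le> t"
  shows "bounded_primitive (\<lambda>r. indicator {0..t} r * (Z r \<omega> * exp_int Z r \<omega>)) (\<lambda>r. exp_int Z r \<omega>) (C * exp (C * t)) t"
proof -
  have "(LINT r:{0..0::real}|lborel. Z r \<omega>) = 0" using exp_int_0[of Z \<omega>] by (simp add: exp_int_def)
  then show ?thesis
    using exp_primitive_bounded[OF path_integral_primitive[OF Z \<omega> bd] t]
    unfolding exp_int_def by simp
qed

lemma exp_int_bound:
  assumes Z: "(\<lambda>(r, \<omega>). Z r \<omega>) \<in> borel_measurable (borel \<Otimes>\<^sub>M M)"
    and \<omega>: "\<omega> \<in> space M" and bd: "\<And>r. \<bar>Z r \<omega>\<bar> \<le> C" and s: "s \<in> {0..t}"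
  shows "0 \<le> exp_int Z s \<omega> \<and> exp_int Z s \<omega> \<le> exp (C * t)"
proof -
  interpret bounded_primitive "\<lambda>r. Z r \<omega>" "\<lambda>s. LINT r:{0..s}|lborel. Z r \<omega>" C t
    by (rule path_integral_primitive[OF Z \<omega> bd])
  have "(LINT r:{0..0::real}|lborel. Z r \<omega>) = 0" using exp_int_0[of Z \<omega>] by (simp add: exp_int_def)
  then show ?thesis using bounded[OF s] by (auto simp: exp_int_def)
qed

section \<open>The space of right-continuous paths\<close>

lemma space_sigma_generated [simp]: "space (sigma_generated \<Omega> N J \<xi>) = \<Omega>"
  unfolding sigma_generated_def by (intro space_measure_of) auto

lemma sets_sigma_generated:
  "sets (sigma_generated \<Omega> N J \<xi>) = sigma_sets \<Omega> {\<xi> i -` B \<inter> \<Omega> | i B. i \<in> J \<and> B \<in> sets N}"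
  unfolding sigma_generated_def by (intro sets_measure_of) auto

lemma measurable_sigma_generated_coordinate:
  assumes "i \<in> J" "\<xi> i \<in> \<Omega> \<rightarrow> space N"
  shows "\<xi> i \<in> sigma_generated \<Omega> N J \<xi> \<rightarrow>\<^sub>M N"
  using assms by (intro measurableI) (auto intro!: sigma_sets.Basic exI[of _ i] simp: sets_sigma_generated)

lemma measurable_into_sigma_generated:
  assumes "g \<in> space M \<rightarrow> \<Omega>" "\<And>i. i \<in> J \<Longrightarrow> (\<lambda>x. \<xi> i (g x)) \<in> M \<rightarrow>\<^sub>M N"
  shows "g \<in> M \<rightarrow>\<^sub>M sigma_generated \<Omega> N J \<xi>"
  unfolding sigma_generated_def
proof (rule measurable_measure_of)
  fix A assume "A \<in> {\<xi> i -` B \<inter> \<Omega> | i B. i \<in> J \<and> B \<in> sets N}"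
  then obtain i B where A: "A = \<xi> i -` B \<inter> \<Omega>" "i \<in> J" "B \<in> sets N" by blast
  have "g -` A \<inter> space M = (\<lambda>x. \<xi> i (g x)) -` B \<inter> space M" using assms(1) A by auto
  also have "\<dots> \<in> sets M" using assms(2) A by auto
  finally show "g -` A \<inter> space M \<in> sets M" .
qed (use assms in auto)

lemma subalgebra_sigma_generated:
  assumes "\<And>i. i \<in> J \<Longrightarrow> \<xi> i \<in> M \<rightarrow>\<^sub>M N"
  shows "subalgebra M (sigma_generated (space M) N J \<xi>)"
proof -
  have "(\<lambda>x. x) \<in> M \<rightarrow>\<^sub>M sigma_generated (space M) N J \<xi>"
    using assms by (intro measurable_into_sigma_generated) auto
  from measurable_sets[OF this] sets.sets_into_space[of _ "sigma_generated (space M) N J \<xi>"]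
  show ?thesis unfolding subalgebra_def by (auto simp: Int_absorb2)
qed

lemma space_path_filtration [simp]: "space (path_filtration r) = rc_paths"
  and space_path_space [simp]: "space path_space = rc_paths"
  unfolding path_space_def path_filtration_def by simp_all

lemma measurable_coordinate:
  assumes "0 \<le> s" "ennreal s \<le> r"
  shows "(\<lambda>w. w s) \<in> path_filtration r \<rightarrow>\<^sub>M borel"
  unfolding path_filtration_def
  using assms
  by (intro measurable_sigma_generated_coordinate[of s "{s. 0 \<le> s \<and> ennreal s \<le> r}" "\<lambda>s w. w s"]) auto

lemma measurable_path_space_coordinate [measurable]: "0 \<le> s \<Longrightarrow> (\<lambda>w. w s) \<in> path_space \<rightarrow>\<^sub>M borel"
  unfolding path_space_def by (rule measurable_coordinate) auto

lemma measurable_into_path_filtration: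
  assumes "g \<in> space M \<rightarrow> rc_paths" "\<And>s. 0 \<le> s \<Longrightarrow> ennreal s \<le> r \<Longrightarrow> (\<lambda>x. g x s) \<in> M \<rightarrow>\<^sub>M borel"
  shows "g \<in> M \<rightarrow>\<^sub>M path_filtration r"
  unfolding path_filtration_def using assms by (intro measurable_into_sigma_generated) auto

lemma measurable_into_path_space:
  assumes "g \<in> space M \<rightarrow> rc_paths" "\<And>s. 0 \<le> s \<Longrightarrow> (\<lambda>x. g x s) \<in> M \<rightarrow>\<^sub>M borel"
  shows "g \<in> M \<rightarrow>\<^sub>M path_space"
  unfolding path_space_def using assms by (intro measurable_into_path_filtration) auto

lemma path_filtration_mono: "r \<le> r' \<Longrightarrow> (\<lambda>w. w) \<in> path_filtration r' \<rightarrow>\<^sub>M path_filtration r"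
  by (intro measurable_into_path_filtration measurable_coordinate) auto

lemma filtration_path_filtration: "filtration rc_paths path_filtration"
proof
  fix i j :: ennreal assume "i \<le> j"
  show "sets (path_filtration i :: (real \<Rightarrow> 'a) measure) \<subseteq> sets (path_filtration j)"
  proof
    fix A :: "(real \<Rightarrow> 'a) set" assume A: "A \<in> sets (path_filtration i)"
    from measurable_sets[OF path_filtration_mono[OF \<open>i \<le> j\<close>] A] sets.sets_into_space[OF A]
    show "A \<in> sets (path_filtration j)" by (simp add: Int_absorb2)
  qed
qed simp

text \<open>The past of a constant stopping time is the filtration at that time, so the strong Markov
  property contains the Markov property.\<close>

lemma pre_sigma_const:
  "filtration.pre_sigma rc_paths path_filtration (\<lambda>_. r) = (path_filtration r :: (real \<Rightarrow> 'a::topological_space) measure)"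
proof -
  interpret filtration rc_paths "path_filtration :: ennreal \<Rightarrow> (real \<Rightarrow> 'a) measure"
    by (rule filtration_path_filtration)
  show ?thesis
  proof (rule measure_eqI)
    have *: "(\<forall>t. {\<omega>\<in>A. r \<le> t} \<in> sets (path_filtration t)) \<longleftrightarrow> A \<in> sets (path_filtration r)" for A :: "(real \<Rightarrow> 'a) set"
    proof
      assume "\<forall>t. {\<omega>\<in>A. r \<le> t} \<in> sets (path_filtration t)"
      then have "{\<omega>\<in>A. r \<le> r} \<in> sets (path_filtration r)" by blast
      then show "A \<in> sets (path_filtration r)" by simp
    next
      assume A: "A \<in> sets (path_filtration r)"
      have "{\<omega>\<in>A. r \<le> t} \<in> sets (path_filtration t)" for t
        using A subsetD[OF sets_F_mono[of r t]] by (cases "r \<le> t") simp_all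
      then show "\<forall>t. {\<omega>\<in>A. r \<le> t} \<in> sets (path_filtration t)" by blast
    qed
    then show "sets (pre_sigma (\<lambda>_. r)) = sets (path_filtration r)"
      unfolding sets_pre_sigma[OF stopping_time_const] * by simp
  qed (simp add: path_filtration_def sigma_generated_def emeasure_sigma)
qed

text \<open>A right-continuous path at time \<open>r\<close> is the limit of its values at grid points just after \<open>r\<close>;
  stopping the grid points at \<open>s\<close> keeps the approximation inside the information up to \<open>s\<close>.\<close>

lemma measurable_evaluation_progressive:
  assumes s: "0 \<le> s"
  shows "(\<lambda>(r, w). w (max 0 (min r s))) \<in> borel \<Otimes>\<^sub>M path_filtration (ennreal s) \<rightarrow>\<^sub>M (borel :: 'a::metric_space measure)"
proof (rule borel_measurable_LIMSEQ_metric)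
  let ?\<tau> = "\<lambda>n k. max 0 (min s ((of_int k + 1) / real (Suc n)))"
  let ?k = "\<lambda>n (r::real). \<lfloor>max 0 (min r s) * real (Suc n)\<rfloor>"
  fix n
  show "(\<lambda>x. snd x (?\<tau> n (?k n (fst x)))) \<in> borel \<Otimes>\<^sub>M path_filtration (ennreal s) \<rightarrow>\<^sub>M (borel :: 'a measure)"
  proof (rule measurable_compose_countable[where f="\<lambda>k x. snd x (?\<tau> n k)" and g="\<lambda>x. ?k n (fst x)"])
    fix k :: int
    have "ennreal (?\<tau> n k) \<le> ennreal s" using s by (intro ennreal_leI) auto
    then have "(\<lambda>w. w (?\<tau> n k)) \<in> path_filtration (ennreal s) \<rightarrow>\<^sub>M (borel :: 'a measure)"
      by (intro measurable_coordinate) auto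
    then show "(\<lambda>x. snd x (?\<tau> n k)) \<in> borel \<Otimes>\<^sub>M path_filtration (ennreal s) \<rightarrow>\<^sub>M (borel :: 'a measure)"
      by (rule measurable_compose[OF measurable_snd])
  qed measurable
next
  let ?\<tau> = "\<lambda>n k. max 0 (min s ((of_int k + 1) / real (Suc n)))"
  let ?k = "\<lambda>n (r::real). \<lfloor>max 0 (min r s) * real (Suc n)\<rfloor>"
  fix x :: "real \<times> (real \<Rightarrow> 'a)" assume "x \<in> space (borel \<Otimes>\<^sub>M path_filtration (ennreal s))"
  then obtain r w where x: "x = (r, w)" and w: "w \<in> rc_paths" by (auto simp: space_pair_measure)
  define q where "q = max 0 (min r s)"
  have q: "0 \<le> q" "q \<le> s" using s by (auto simp: q_def)
  let ?d = "\<lambda>n. (of_int \<lfloor>q * real (Suc n)\<rfloor> + 1) / real (Suc n)"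
  have d1: "q < ?d n" for n
    using floor_correct[of "q * real (Suc n)"] by (simp add: field_simps)
  have d2: "?d n \<le> q + 1 / real (Suc n)" for n
  proof -
    have "?d n \<le> (q * real (Suc n) + 1) / real (Suc n)"
      using of_int_floor_le[of "q * real (Suc n)"] by (intro divide_right_mono) auto
    also have "\<dots> = q + 1 / real (Suc n)" by (simp add: add_divide_distrib del: of_nat_Suc)
    finally show ?thesis .
  qed
  have d: "?d \<longlonglongrightarrow> q"
  proof (rule tendsto_sandwich[of "\<lambda>_. q" _ _ "\<lambda>n. q + 1 / real (Suc n)"])
    show "(\<lambda>n. q + 1 / real (Suc n)) \<longlonglongrightarrow> q"
      using tendsto_add[OF tendsto_const[of q] LIMSEQ_inverse_real_of_nat] by (simp add: inverse_eq_divide)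
  qed (use d1 d2 less_imp_le in \<open>auto intro!: always_eventually\<close>)
  have "(\<lambda>n. w (max 0 (min s (?d n)))) \<longlonglongrightarrow> w q"
  proof (cases "q < s")
    case True
    have "(\<lambda>n. max 0 (min s (?d n))) \<longlonglongrightarrow> max 0 (min s q)"
      by (intro tendsto_max tendsto_min tendsto_const d)
    moreover have "max 0 (min s q) = q" using q by auto
    ultimately have 1: "(\<lambda>n. max 0 (min s (?d n))) \<longlonglongrightarrow> q" by simp
    have 2: "filterlim (\<lambda>n. max 0 (min s (?d n))) (at_right q) sequentially"
    proof (rule tendsto_imp_filterlim_at_right[OF 1])
      have "q < max 0 (min s (?d n))" for n using d1[of n] True by (simp add: less_max_iff_disj)
      then show "\<forall>\<^sub>F n in sequentially. q < max 0 (min s (?d n))" by (intro always_eventually allI)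
    qed
    have "(w \<longlongrightarrow> w q) (at_right q)" using w q by (auto simp: rc_paths_def continuous_within)
    from filterlim_compose[OF this 2] show ?thesis .
  next
    case False
    then have "q = s" using q by simp
    then have "max 0 (min s (?d n)) = q" for n using d1[of n] q by (simp add: min_def)
    then show ?thesis by simp
  qed
  then show "(\<lambda>n. snd x (?\<tau> n (?k n (fst x)))) \<longlonglongrightarrow> (case x of (r, w) \<Rightarrow> w (max 0 (min r s)))"
    by (simp add: x q_def)
qed

lemma measurable_evaluation:
  "(\<lambda>(r, w). w (max 0 r)) \<in> borel \<Otimes>\<^sub>M path_space \<rightarrow>\<^sub>M (borel :: 'a::metric_space measure)"
proof (rule borel_measurable_LIMSEQ_metric)
  fix n :: nat
  have "(\<lambda>x. (fst x, snd x)) \<in> borel \<Otimes>\<^sub>M path_space \<rightarrow>\<^sub>M borel \<Otimes>\<^sub>M (path_filtration (ennreal (real n)) :: (real \<Rightarrow> 'a) measure)"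
    unfolding path_space_def
    by (intro measurable_Pair measurable_fst measurable_compose[OF measurable_snd path_filtration_mono]) auto
  from measurable_compose[OF this measurable_evaluation_progressive[of "real n"]]
  show "(\<lambda>x. snd x (max 0 (min (fst x) (real n)))) \<in> borel \<Otimes>\<^sub>M path_space \<rightarrow>\<^sub>M (borel :: 'a measure)"
    by (simp add: case_prod_beta)
next
  fix x :: "real \<times> (real \<Rightarrow> 'a)"
  obtain N where "fst x \<le> real N" using real_arch_simple by blast
  then have "\<forall>\<^sub>F n in sequentially. snd x (max 0 (min (fst x) (real n))) = snd x (max 0 (fst x))"
    by (intro eventually_sequentiallyI[of N]) (auto simp: min_def)
  then show "(\<lambda>n. snd x (max 0 (min (fst x) (real n)))) \<longlonglongrightarrow> (case x of (r, w) \<Rightarrow> w (max 0 r))"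
    by (simp add: tendsto_eventually case_prod_beta)
qed

text \<open>Clamping the time at 0 makes evaluation jointly measurable on the whole line, although paths
  are arbitrary at negative times.\<close>

definition path_at :: "real \<Rightarrow> (real \<Rightarrow> 'a) \<Rightarrow> 'a" where
  "path_at r w = w (max 0 r)"

lemma path_at_nonneg [simp]: "0 \<le> r \<Longrightarrow> path_at r w = w r"
  by (simp add: path_at_def)

lemma measurable_path_at [measurable (raw)]:
  assumes "g \<in> borel_measurable N" "h \<in> N \<rightarrow>\<^sub>M path_space"
  shows "(\<lambda>x. path_at (g x) (h x)) \<in> N \<rightarrow>\<^sub>M (borel :: 'a::metric_space measure)"
  using measurable_compose[OF measurable_Pair[OF assms] measurable_evaluation] by (simp add: path_at_def)

definition shift :: "real \<Rightarrow> (real \<Rightarrow> 'a) \<Rightarrow> real \<Rightarrow> 'a" where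
  "shift s w = (\<lambda>r. w (s + r))"

lemma shift_rc_paths:
  assumes "w \<in> rc_paths" "0 \<le> s"
  shows "shift s w \<in> rc_paths"
  unfolding rc_paths_def
proof (intro CollectI allI impI)
  fix t :: real assume t: "0 \<le> t"
  have "filterlim (\<lambda>r. s + r) (at_right (s + t)) (at_right t)"
  proof (rule tendsto_imp_filterlim_at_right)
    show "((\<lambda>r. s + r) \<longlongrightarrow> s + t) (at_right t)" by (intro tendsto_intros)
    show "\<forall>\<^sub>F r in at_right t. s + t < s + r" by (auto simp: eventually_at_filter intro!: always_eventually)
  qed
  moreover have "(w \<longlongrightarrow> w (s + t)) (at_right (s + t))"
    using assms t by (auto simp: rc_paths_def continuous_within)
  ultimately have "((\<lambda>r. w (s + r)) \<longlongrightarrow> w (s + t)) (at_right t)"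
    by (rule filterlim_compose[rotated])
  then show "continuous (at_right t) (shift s w)" by (simp add: continuous_within shift_def)
qed

lemma measurable_shift:
  assumes "0 \<le> s"
  shows "shift s \<in> path_space \<rightarrow>\<^sub>M path_space"
proof (rule measurable_into_path_space)
  fix r :: real assume "0 \<le> r"
  then show "(\<lambda>w. shift s w r) \<in> path_space \<rightarrow>\<^sub>M borel" using assms by (simp add: shift_def)
qed (use assms shift_rc_paths in auto)

lemma (in rc_strong_markov) markov_property:
  assumes s: "0 \<le> s" and B: "B \<in> sets path_space"
  shows "AE w in P x. real_cond_exp (P x) (path_filtration (ennreal s)) (indicator {w \<in> rc_paths. shift s w \<in> B}) w
    = measure (P (w s)) B"
  using strong_markov[OF stopping_time_const[of _ "ennreal s"] B, of x]
  unfolding pre_sigma_const using s by (simp add: shift_def)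

section \<open>Disintegration along a conditional law\<close>

lemma integral_density_indicator:
  "integral\<^sup>L (density M (indicator E)) f = (\<integral>x. indicator E x * f x \<partial>M)"
  if "E \<in> sets M" "f \<in> borel_measurable M" for f :: "'a \<Rightarrow> real"
proof -
  have "density M (indicator E) = density M (\<lambda>x. ennreal (indicator E x))"
    by (simp add: ennreal_indicator)
  then show ?thesis using that by (simp add: integral_density)
qed

lemma integral_measurable_kernel:
  fixes H :: "'a \<times> 'b \<Rightarrow> real"
  assumes H [measurable]: "H \<in> borel_measurable (M \<Otimes>\<^sub>M N)" and \<kappa> [measurable]: "\<kappa> \<in> M \<rightarrow>\<^sub>M subprob_algebra N"
  shows "(\<lambda>x. \<integral>y. H (x, y) \<partial>\<kappa> x) \<in> borel_measurable M"
proof -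
  have "(\<lambda>x. distr (\<kappa> x) (M \<Otimes>\<^sub>M N) (\<lambda>y. (x, y))) \<in> M \<rightarrow>\<^sub>M subprob_algebra (M \<Otimes>\<^sub>M N)"
    by (rule measurable_distr2[OF _ \<kappa>]) (simp add: case_prod_beta)
  from measurable_compose[OF this integral_measurable_subprob_algebra[OF H]]
  have "(\<lambda>x. \<integral>z. H z \<partial>distr (\<kappa> x) (M \<Otimes>\<^sub>M N) (\<lambda>y. (x, y))) \<in> borel_measurable M" .
  moreover have "(\<integral>z. H z \<partial>distr (\<kappa> x) (M \<Otimes>\<^sub>M N) (\<lambda>y. (x, y))) = (\<integral>y. H (x, y) \<partial>\<kappa> x)" if "x \<in> space M" for x
  proof (rule integral_distr)
    have "sets (\<kappa> x) = sets N" using measurable_space[OF \<kappa> that] by (simp add: space_subprob_algebra)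
    then show "(\<lambda>y. (x, y)) \<in> \<kappa> x \<rightarrow>\<^sub>M M \<Otimes>\<^sub>M N" using that by (simp cong: measurable_cong_sets)
  qed fact
  ultimately show ?thesis by (subst (asm) measurable_cong) auto
qed

text \<open>If the conditional law of \<open>Y\<close> given \<open>F\<close> is prescribed on a generator, then functions of \<open>Y\<close> and of
  information in \<open>F\<close> are averaged by integrating over \<open>Y\<close> first: both sides define finite measures on
  \<open>F \<Otimes>\<^sub>M N\<close> that agree on the rectangles over the generator.

  The law is only prescribed on the event \<open>E\<close>, which is known at the time of conditioning.  The event
  \<open>E'\<close> need not be known then; it restricts \<open>Y\<close> to where it is meaningful, and \<open>\<kappa>\<close> may
  accordingly be substochastic.  Lifetimes require this, since they can be infinite.\<close>

lemma (in prob_space) disintegration: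
  fixes H :: "'a \<times> 'b \<Rightarrow> real"
  assumes F: "subalgebra M F" and E: "E \<in> sets F" and E': "E' \<in> sets M"
    and Y [measurable]: "Y \<in> M \<rightarrow>\<^sub>M N" and \<kappa>: "\<kappa> \<in> F \<rightarrow>\<^sub>M subprob_algebra N"
    and G: "G \<subseteq> Pow (space N)" "sets N = sigma_sets (space N) G" "Int_stable G"
    and A: "\<And>n::nat. A n \<in> G" "(\<Union>n. A n) = space N"
    and law: "\<And>B. B \<in> G \<Longrightarrow> AE \<omega> in M. \<omega> \<in> E \<longrightarrow>
       real_cond_exp M F (indicator {\<omega> \<in> E'. Y \<omega> \<in> B}) \<omega> = measure (\<kappa> \<omega>) B"
    and H: "H \<in> borel_measurable (F \<Otimes>\<^sub>M N)" and H_bd: "\<And>z. z \<in> space (F \<Otimes>\<^sub>M N) \<Longrightarrow> \<bar>H z\<bar> \<le> C"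
  shows "(\<integral>\<omega>. indicator E \<omega> * (indicator E' \<omega> * H (\<omega>, Y \<omega>)) \<partial>M)
    = (\<integral>\<omega>. indicator E \<omega> * (\<integral>y. H (\<omega>, y) \<partial>\<kappa> \<omega>) \<partial>M)"
proof -
  interpret F: finite_measure_subalgebra M F by unfold_locales (rule F)
  have spF: "space F = space M" and setsF: "\<And>a. a \<in> sets F \<Longrightarrow> a \<in> sets M"
    using F by (auto simp: subalgebra_def)
  have EM [measurable]: "E \<in> sets M" using E setsF by auto
  note [measurable] = E' \<kappa>
  have ne: "space M \<noteq> {}" by (rule not_empty)
  have id: "(\<lambda>\<omega>. \<omega>) \<in> M \<rightarrow>\<^sub>M F" using F by (auto intro!: measurableI simp: subalgebra_def Int_absorb2 sets.sets_into_space)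
  define \<mu> where "\<mu> = distr (density M (indicator (E \<inter> E'))) (F \<Otimes>\<^sub>M N) (\<lambda>\<omega>. (\<omega>, Y \<omega>))"
  define R where "R = restr_to_subalg M F"
  have sR [measurable_cong, simp]: "sets R = sets F" "space R = space M"
    using F by (simp_all add: R_def sets_restr_to_subalg space_restr_to_subalg)
  have E_R [measurable]: "E \<in> sets R" using E by simp
  define D where "D = density R (indicator E)"
  have sD [measurable_cong, simp]: "sets D = sets F" "space D = space M"
    by (simp_all add: D_def)
  define k where "k \<omega> = distr (\<kappa> \<omega>) (F \<Otimes>\<^sub>M N) (\<lambda>y. (\<omega>, y))" for \<omega>
  have k: "k \<in> D \<rightarrow>\<^sub>M subprob_algebra (F \<Otimes>\<^sub>M N)"
    unfolding k_def
  proof (rule measurable_distr2)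
    show "\<kappa> \<in> D \<rightarrow>\<^sub>M subprob_algebra N" using \<kappa> by (simp cong: measurable_cong_sets)
    show "(\<lambda>(\<omega>, y). (\<omega>, y)) \<in> D \<Otimes>\<^sub>M N \<rightarrow>\<^sub>M F \<Otimes>\<^sub>M N"
      by (simp cong: measurable_cong_sets sets_pair_measure_cong)
  qed
  define \<nu> where "\<nu> = D \<bind> k"
  have s\<mu>: "sets \<mu> = sets (F \<Otimes>\<^sub>M N)" by (simp add: \<mu>_def)
  have s\<nu>: "sets \<nu> = sets (F \<Otimes>\<^sub>M N)"
    unfolding \<nu>_def using ne by (intro sets_bind_measurable[OF k]) simp
  have pair_meas: "(\<lambda>\<omega>. (\<omega>, Y \<omega>)) \<in> M \<rightarrow>\<^sub>M F \<Otimes>\<^sub>M N" using id Y by (rule measurable_Pair)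
  have sub\<kappa>: "subprob_space (\<kappa> \<omega>)" "sets (\<kappa> \<omega>) = sets N" if "\<omega> \<in> space M" for \<omega>
    using measurable_space[OF \<kappa>, of \<omega>] that spF by (auto simp: space_subprob_algebra)
  have pairk: "(\<lambda>y. (\<omega>, y)) \<in> \<kappa> \<omega> \<rightarrow>\<^sub>M F \<Otimes>\<^sub>M N" if "\<omega> \<in> space M" for \<omega>
    using that spF sub\<kappa>(2)[OF that] by (simp cong: measurable_cong_sets)
  have \<mu>_rect: "emeasure \<mu> (a \<times> B) = \<nu> (a \<times> B)" if a: "a \<in> sets F" and B: "B \<in> G" for a B
  proof -
    have BN [measurable]: "B \<in> sets N" using B G by auto
    have aM [measurable]: "a \<in> sets M" using a setsF by auto
    have "emeasure \<mu> (a \<times> B) = (\<integral>\<^sup>+\<omega>. indicator (E \<inter> E') \<omega> * indicator {\<omega> \<in> space M. \<omega> \<in> a \<and> Y \<omega> \<in> B} \<omega> \<partial>M)"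
      unfolding \<mu>_def using a pair_meas
      by (subst emeasure_distr) (auto simp: emeasure_density vimage_def Int_def intro!: nn_integral_cong split: split_indicator cong: measurable_cong_sets)
    also have "\<dots> = (\<integral>\<^sup>+\<omega>. ennreal (indicator (a \<inter> E) \<omega> * indicator {\<omega> \<in> E'. Y \<omega> \<in> B} \<omega>) \<partial>M)"
      using sets.sets_into_space[OF E'] by (intro nn_integral_cong) (auto split: split_indicator)
    also have "\<dots> = ennreal (\<integral>\<omega>. indicator (a \<inter> E) \<omega> * indicator {\<omega> \<in> E'. Y \<omega> \<in> B} \<omega> \<partial>M)"
    proof (rule nn_integral_eq_integral)
      have "{\<omega> \<in> E'. Y \<omega> \<in> B} = {\<omega> \<in> space M. \<omega> \<in> E' \<and> Y \<omega> \<in> B}" using sets.sets_into_space[OF E'] by auto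
      also have "\<dots> \<in> sets M" by measurable
      finally have [measurable]: "{\<omega> \<in> E'. Y \<omega> \<in> B} \<in> sets M" .
      show "integrable M (\<lambda>\<omega>. indicator (a \<inter> E) \<omega> * indicator {\<omega> \<in> E'. Y \<omega> \<in> B} \<omega> :: real)"
        by (rule integrable_const_bound[where B=1]) (auto split: split_indicator)
    qed auto
    also have "(\<integral>\<omega>. indicator (a \<inter> E) \<omega> * indicator {\<omega> \<in> E'. Y \<omega> \<in> B} \<omega> \<partial>M)
        = (\<integral>\<omega>. indicator (a \<inter> E) \<omega> * real_cond_exp M F (indicator {\<omega> \<in> E'. Y \<omega> \<in> B}) \<omega> \<partial>M)"
    proof (rule F.real_cond_exp_intg(2)[symmetric])
      have "{\<omega> \<in> E'. Y \<omega> \<in> B} = {\<omega> \<in> space M. \<omega> \<in> E' \<and> Y \<omega> \<in> B}" using sets.sets_into_space[OF E'] by auto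
      also have "\<dots> \<in> sets M" by measurable
      finally have [measurable]: "{\<omega> \<in> E'. Y \<omega> \<in> B} \<in> sets M" .
      show "integrable M (\<lambda>\<omega>. indicator (a \<inter> E) \<omega> * indicator {\<omega> \<in> E'. Y \<omega> \<in> B} \<omega> :: real)"
        by (rule integrable_const_bound[where B=1]) (auto split: split_indicator)
      show "indicator {\<omega> \<in> E'. Y \<omega> \<in> B} \<in> borel_measurable M" by measurable
      show "indicator (a \<inter> E) \<in> borel_measurable F" using a E by measurable
    qed
    also have "\<dots> = (\<integral>\<omega>. indicator (a \<inter> E) \<omega> * measure (\<kappa> \<omega>) B \<partial>M)"
    proof (rule integral_cong_AE)
      have "(\<lambda>\<omega>. measure (\<kappa> \<omega>) B) \<in> borel_measurable F" by measurable
      from measurable_from_subalg[OF F this]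
      show "(\<lambda>\<omega>. indicator (a \<inter> E) \<omega> * measure (\<kappa> \<omega>) B) \<in> borel_measurable M" by measurable
      show "AE \<omega> in M. indicator (a \<inter> E) \<omega> * real_cond_exp M F (indicator {\<omega> \<in> E'. Y \<omega> \<in> B}) \<omega> = indicator (a \<inter> E) \<omega> * measure (\<kappa> \<omega>) B"
        using law[OF B] by eventually_elim (auto split: split_indicator)
    qed measurable
    also have "ennreal \<dots> = (\<integral>\<^sup>+\<omega>. ennreal (indicator (a \<inter> E) \<omega> * measure (\<kappa> \<omega>) B) \<partial>M)"
    proof (rule nn_integral_eq_integral[symmetric])
      have "(\<lambda>\<omega>. measure (\<kappa> \<omega>) B) \<in> borel_measurable F" by measurable
      from measurable_from_subalg[OF F this]
      show "integrable M (\<lambda>\<omega>. indicator (a \<inter> E) \<omega> * measure (\<kappa> \<omega>) B)"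
        by (intro integrable_const_bound[where B=1] AE_I2)
          (auto split: split_indicator intro: subprob_space.subprob_measure_le_1 sub\<kappa>)
    qed auto
    also have "\<dots> = (\<integral>\<^sup>+\<omega>. indicator (a \<inter> E) \<omega> * emeasure (\<kappa> \<omega>) B \<partial>M)"
      by (intro nn_integral_cong)
        (auto simp: finite_measure.emeasure_eq_measure[OF subprob_space.axioms(1)] sub\<kappa> split: split_indicator)
    also have "\<dots> = (\<integral>\<^sup>+\<omega>. indicator (a \<inter> E) \<omega> * emeasure (\<kappa> \<omega>) B \<partial>R)"
    proof -
      have "(\<lambda>\<omega>. indicator (a \<inter> E) \<omega> * emeasure (\<kappa> \<omega>) B) \<in> borel_measurable F" using a E by measurable
      from nn_integral_subalgebra2[OF F this] show ?thesis by (simp add: R_def)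
    qed
    also have "\<dots> = (\<integral>\<^sup>+\<omega>. indicator a \<omega> * emeasure (\<kappa> \<omega>) B \<partial>D)"
    proof -
      have [measurable]: "a \<in> sets R" "\<kappa> \<in> R \<rightarrow>\<^sub>M subprob_algebra N"
        using a \<kappa> by (simp_all cong: measurable_cong_sets)
      show ?thesis unfolding D_def
        by (subst nn_integral_density) (auto intro!: nn_integral_cong split: split_indicator)
    qed
    also have "\<dots> = (\<integral>\<^sup>+\<omega>. emeasure (k \<omega>) (a \<times> B) \<partial>D)"
    proof (rule nn_integral_cong)
      fix \<omega> assume w: "\<omega> \<in> space D"
      then have w': "\<omega> \<in> space M" by simp
      have "(\<lambda>y. (\<omega>, y)) -` (a \<times> B) \<inter> space (\<kappa> \<omega>) = (if \<omega> \<in> a then B else {})"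
        using sets.sets_into_space[OF BN] sets_eq_imp_space_eq[OF sub\<kappa>(2)[OF w']] by auto
      then show "indicator a \<omega> * emeasure (\<kappa> \<omega>) B = emeasure (k \<omega>) (a \<times> B)"
        unfolding k_def using a pairk[OF w'] by (subst emeasure_distr) (auto split: split_indicator)
    qed
    also have "\<dots> = \<nu> (a \<times> B)"
      unfolding \<nu>_def using ne a BN by (intro emeasure_bind[OF _ k, symmetric]) auto
    finally show ?thesis .
  qed
  have "\<mu> = \<nu>"
  proof (rule measure_eqI_generator_eq[where \<Omega>="space F \<times> space N" and E="{a \<times> B | a B. a \<in> sets F \<and> B \<in> G}" and A="\<lambda>n. space F \<times> A n"])
    show "Int_stable {a \<times> B |a B. a \<in> sets F \<and> B \<in> G}"
    proof (rule Int_stableI)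
      fix x y assume "x \<in> {a \<times> B |a B. a \<in> sets F \<and> B \<in> G}" "y \<in> {a \<times> B |a B. a \<in> sets F \<and> B \<in> G}"
      then obtain a B a' B' where xy: "x = a \<times> B" "y = a' \<times> B'" and G': "a \<in> sets F" "a' \<in> sets F" "B \<in> G" "B' \<in> G"
        by blast
      have "x \<inter> y = (a \<inter> a') \<times> (B \<inter> B')" using xy by auto
      moreover have "a \<inter> a' \<in> sets F" "B \<inter> B' \<in> G" using G' G(3) by (auto simp: Int_stable_def)
      ultimately show "x \<inter> y \<in> {a \<times> B |a B. a \<in> sets F \<and> B \<in> G}" by blast
    qed
    show "{a \<times> B |a B. a \<in> sets F \<and> B \<in> G} \<subseteq> Pow (space F \<times> space N)"
      using sets.sets_into_space[of _ F] G(1) by blast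
    have "sets (F \<Otimes>\<^sub>M N) = sets (sigma (space F) (sets F) \<Otimes>\<^sub>M sigma (space N) G)"
      using G by (intro sets_pair_measure_cong) (simp_all add: sets.sigma_sets_eq sets.space_closed)
    also have "\<dots> = sets (sigma (space F \<times> space N) {a \<times> B |a B. a \<in> sets F \<and> B \<in> G})"
    proof (rule arg_cong[where f=sets], rule sigma_prod)
      show "\<exists>E\<subseteq>sets F. countable E \<and> space F = \<Union> E" by (intro exI[of _ "{space F}"]) auto
      show "\<exists>E\<subseteq>G. countable E \<and> space N = \<Union> E" using A by (intro exI[of _ "range A"]) auto
    qed (use G(1) sets.space_closed[of F] in auto)
    finally have "sets (F \<Otimes>\<^sub>M N) = sigma_sets (space F \<times> space N) {a \<times> B |a B. a \<in> sets F \<and> B \<in> G}"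
      by (subst (asm) sets_measure_of) (use sets.sets_into_space[of _ F] G(1) in blast)+
    then show "sets \<mu> = sigma_sets (space F \<times> space N) {a \<times> B |a B. a \<in> sets F \<and> B \<in> G}"
      "sets \<nu> = sigma_sets (space F \<times> space N) {a \<times> B |a B. a \<in> sets F \<and> B \<in> G}"
      using s\<mu> s\<nu> by simp_all
    show "range (\<lambda>n. space F \<times> A n) \<subseteq> {a \<times> B |a B. a \<in> sets F \<and> B \<in> G}" using A by auto
    show "(\<Union>n. space F \<times> A n) = space F \<times> space N" using A(2) by auto
    fix n
    have "finite_measure \<mu>" unfolding \<mu>_def using pair_meas
      by (intro finite_measure.finite_measure_distr finite_measureI)
        (auto simp: emeasure_density cong: measurable_cong_sets)
    then show "emeasure \<mu> (space F \<times> A n) \<noteq> \<infinity>" by (simp add: finite_measure.emeasure_finite)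
  qed (use \<mu>_rect in auto)
  have int\<mu>: "(\<integral>z. H z \<partial>\<mu>) = (\<integral>\<omega>. indicator E \<omega> * (indicator E' \<omega> * H (\<omega>, Y \<omega>)) \<partial>M)"
  proof -
    have [measurable]: "(\<lambda>\<omega>. H (\<omega>, Y \<omega>)) \<in> borel_measurable M" by (rule measurable_compose[OF pair_meas H])
    have "(\<integral>z. H z \<partial>\<mu>) = (\<integral>\<omega>. H (\<omega>, Y \<omega>) \<partial>density M (indicator (E \<inter> E')))"
      unfolding \<mu>_def using pair_meas H by (intro integral_distr) (auto cong: measurable_cong_sets)
    also have "\<dots> = (\<integral>\<omega>. indicator (E \<inter> E') \<omega> * H (\<omega>, Y \<omega>) \<partial>M)"
      by (rule integral_density_indicator) auto
    finally show ?thesis by (simp add: indicator_inter_arith mult.assoc)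
  qed
  have int\<nu>: "(\<integral>z. H z \<partial>\<nu>) = (\<integral>\<omega>. indicator E \<omega> * (\<integral>y. H (\<omega>, y) \<partial>\<kappa> \<omega>) \<partial>M)"
  proof -
    have Hk: "(\<lambda>\<omega>. \<integral>y. H (\<omega>, y) \<partial>\<kappa> \<omega>) \<in> borel_measurable F"
      by (rule integral_measurable_kernel[OF H \<kappa>])
    have "(\<integral>z. H z \<partial>\<nu>) = (\<integral>\<omega>. (\<integral>z. H z \<partial>k \<omega>) \<partial>D)"
      unfolding \<nu>_def
    proof (rule integral_bind[OF H H_bd k, where B'=1])
      show "finite_measure D"
      proof (rule finite_measureI)
        have "emeasure D (space D) = (\<integral>\<^sup>+\<omega>. indicator E \<omega> * indicator (space R) \<omega> \<partial>R)"
          unfolding D_def space_density by (intro emeasure_density sets.top) measurable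
        also have "\<dots> = (\<integral>\<^sup>+\<omega>. indicator E \<omega> \<partial>R)" by (intro nn_integral_cong) auto
        also have "\<dots> = emeasure R E" by (rule nn_integral_indicator[OF E_R])
        also have "\<dots> = emeasure M E" unfolding R_def by (rule emeasure_restr_to_subalg[OF F E])
        finally show "emeasure D (space D) \<noteq> \<infinity>" by simp
      qed
      show "AE \<omega> in D. emeasure (k \<omega>) (space (k \<omega>)) \<le> ennreal 1"
        using subprob_space.emeasure_space_le_1 measurable_space[OF k] by (intro AE_I2) (auto simp: space_subprob_algebra)
    qed
    also have "\<dots> = (\<integral>\<omega>. (\<integral>y. H (\<omega>, y) \<partial>\<kappa> \<omega>) \<partial>D)"
    proof (rule Bochner_Integration.integral_cong[OF refl])
      fix \<omega> assume "\<omega> \<in> space D"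
      then show "(\<integral>z. H z \<partial>k \<omega>) = (\<integral>y. H (\<omega>, y) \<partial>\<kappa> \<omega>)"
        unfolding k_def using pairk H by (intro integral_distr) auto
    qed
    also have "\<dots> = (\<integral>\<omega>. indicator E \<omega> * (\<integral>y. H (\<omega>, y) \<partial>\<kappa> \<omega>) \<partial>R)"
      unfolding D_def using Hk E_R
      by (intro integral_density_indicator) (auto simp del: sR cong: measurable_cong_sets[OF sR(1) refl])
    also have "\<dots> = (\<integral>\<omega>. indicator E \<omega> * (\<integral>y. H (\<omega>, y) \<partial>\<kappa> \<omega>) \<partial>M)"
      unfolding R_def by (intro integral_subalgebra2[OF F] borel_measurable_times borel_measurable_indicator Hk E)
    finally show ?thesis .
  qed
  show ?thesis using int\<mu> int\<nu> \<open>\<mu> = \<nu>\<close> by simp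
qed

section \<open>The offspring generating function and its conjugate\<close>

text \<open>The numbers \<open>l\<close> and \<open>m\<close> bound the branching rate and the mean number of children.\<close>

locale branching_mechanism = rc_strong_markov P
  for P :: "'a::polish_space \<Rightarrow> (real \<Rightarrow> 'a) measure" +
  fixes lam :: "'a \<Rightarrow> real" and p :: "'a \<Rightarrow> nat pmf" and l m :: real
  assumes lam_measurable [measurable]: "lam \<in> borel_measurable borel"
    and lam_nonneg: "0 \<le> lam x" and lam_le: "lam x \<le> l"
    and p_measurable [measurable]: "(\<lambda>x. pmf (p x) n) \<in> borel_measurable borel"
    and mean_le: "(\<integral>\<^sup>+n. ennreal (real n) \<partial>measure_pmf (p x)) \<le> ennreal m"
    and m_nonneg: "0 \<le> m"
begin

lemma l_nonneg: "0 \<le> l"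
  using lam_nonneg lam_le order_trans by blast

lemma abs_lam_le: "\<bar>lam x\<bar> \<le> l"
  using lam_nonneg lam_le by simp

text \<open>Clipping makes the generating function total, bounded and measurable without side conditions
  on its argument.\<close>

definition clip :: "real \<Rightarrow> real" where
  "clip \<eta> = max 0 (min 1 \<eta>)"

lemma clip_range [simp]: "0 \<le> clip \<eta>" "clip \<eta> \<le> 1"
  and clip_id [simp]: "0 \<le> \<eta> \<Longrightarrow> \<eta> \<le> 1 \<Longrightarrow> clip \<eta> = \<eta>"
  by (auto simp: clip_def)

lemma clip_measurable [measurable]: "clip \<in> borel_measurable borel"
  unfolding clip_def by measurable

definition gen :: "'a \<Rightarrow> real \<Rightarrow> real" where
  "gen x \<eta> = measure_pmf.expectation (p x) (\<lambda>n. clip \<eta> ^ n)"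

text \<open>The termwise derivative of \<open>gen x\<close>.\<close>

definition gen_deriv :: "'a \<Rightarrow> real \<Rightarrow> real" where
  "gen_deriv x \<eta> = measure_pmf.expectation (p x) (\<lambda>n. real n * clip \<eta> ^ (n - 1))"

lemma integrable_offspring: "integrable (measure_pmf (p x)) real"
  using mean_le[of x] by (intro integrableI_nonneg) (auto simp: less_top[symmetric] top_unique)

lemma integrable_gen: "integrable (measure_pmf (p x)) (\<lambda>n. clip \<eta> ^ n)"
  by (intro measure_pmf.integrable_const_bound[where B=1] AE_I2) (auto intro: power_le_one)

lemma clip_power_le_1: "clip \<eta> ^ n \<le> 1"
  by (rule power_le_one) auto

lemma integrable_gen_deriv: "integrable (measure_pmf (p x)) (\<lambda>n. real n * clip \<eta> ^ (n - 1))"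
proof (rule Bochner_Integration.integrable_bound[OF integrable_offspring])
  show "AE n in measure_pmf (p x). norm (real n * clip \<eta> ^ (n - 1)) \<le> norm (real n)"
    using mult_left_mono[OF clip_power_le_1] by (auto simp: abs_mult)
qed auto

lemma gen_range [simp]: "0 \<le> gen x \<eta>" "gen x \<eta> \<le> 1"
proof -
  show "0 \<le> gen x \<eta>" unfolding gen_def by (intro Bochner_Integration.integral_nonneg) auto
  have "gen x \<eta> \<le> measure_pmf.expectation (p x) (\<lambda>n. 1)"
    unfolding gen_def using integrable_gen clip_power_le_1 by (intro integral_mono) auto
  then show "gen x \<eta> \<le> 1" by simp
qed

lemma gen_1 [simp]: "gen x 1 = 1"
  by (simp add: gen_def)

lemma gen_deriv_range [simp]: "0 \<le> gen_deriv x \<eta>" "gen_deriv x \<eta> \<le> m"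
proof -
  show "0 \<le> gen_deriv x \<eta>" unfolding gen_deriv_def by (intro Bochner_Integration.integral_nonneg) auto
  have "gen_deriv x \<eta> \<le> measure_pmf.expectation (p x) real"
    unfolding gen_deriv_def using integrable_gen_deriv integrable_offspring mult_left_mono[OF clip_power_le_1]
    by (intro integral_mono) auto
  also have "\<dots> \<le> m"
  proof -
    have "ennreal (measure_pmf.expectation (p x) real) = (\<integral>\<^sup>+n. ennreal (real n) \<partial>measure_pmf (p x))"
      using integrable_offspring by (intro nn_integral_eq_integral[symmetric]) auto
    then have "ennreal (measure_pmf.expectation (p x) real) \<le> ennreal m" using mean_le[of x] by simp
    then show ?thesis using m_nonneg by (subst (asm) ennreal_le_iff) auto
  qed
  finally show "gen_deriv x \<eta> \<le> m" .
qed

lemma power_above_tangent: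
  fixes a b :: real
  assumes "0 \<le> a" "0 \<le> b"
  shows "a ^ n + real n * a ^ (n - 1) * (b - a) \<le> b ^ n"
proof (induction n)
  case (Suc n)
  show ?case
  proof (cases n)
    case (Suc k)
    define c where "c = a ^ k"
    have "(a ^ n + real n * a ^ (n - 1) * (b - a)) * b \<le> b ^ n * b"
      using Suc.IH assms by (intro mult_right_mono) auto
    then have 1: "(a * c + real n * c * (b - a)) * b \<le> b ^ n * b"
      using Suc by (simp add: c_def)
    have 2: "0 \<le> real n * c * (b - a)\<^sup>2" using assms by (auto simp: c_def)
    have "a * (a * c) + real (Suc n) * (a * c) * (b - a)
        = (a * c + real n * c * (b - a)) * b - real n * c * (b - a)\<^sup>2"
      by (simp add: algebra_simps power2_eq_square)
    with 1 2 have "a * (a * c) + real (Suc n) * (a * c) * (b - a) \<le> b ^ n * b" by linarith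
    then show ?thesis using Suc by (simp add: c_def mult.commute)
  qed simp
qed simp

text \<open>The generating function is convex because powers are, and \<open>gen_deriv\<close> is the slope of a
  supporting line.\<close>

lemma gen_above_tangent:
  assumes "0 \<le> \<eta>" "\<eta> \<le> 1" "0 \<le> \<theta>" "\<theta> \<le> 1"
  shows "gen x \<eta> + gen_deriv x \<eta> * (\<theta> - \<eta>) \<le> gen x \<theta>"
proof -
  have "gen x \<eta> + gen_deriv x \<eta> * (\<theta> - \<eta>)
      = measure_pmf.expectation (p x) (\<lambda>n. clip \<eta> ^ n + real n * clip \<eta> ^ (n - 1) * (\<theta> - \<eta>))"
    unfolding gen_def gen_deriv_def
    using integrable_gen[of x \<eta>] integrable_gen_deriv[of x \<eta>]
    by (simp add: Bochner_Integration.integral_add)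
  also have "\<dots> \<le> gen x \<theta>"
    unfolding gen_def
  proof (rule integral_mono)
    fix n
    show "clip \<eta> ^ n + real n * clip \<eta> ^ (n - 1) * (\<theta> - \<eta>) \<le> clip \<theta> ^ n"
      using assms power_above_tangent[of \<eta> \<theta> n] by simp
  qed (use integrable_gen[of x] integrable_gen_deriv[of x] in auto)
  finally show ?thesis .
qed

lemma gen_mono:
  assumes "0 \<le> \<eta>" "\<eta> \<le> \<theta>" "\<theta> \<le> 1"
  shows "gen x \<eta> \<le> gen x \<theta>"
proof -
  have "0 \<le> gen_deriv x \<eta> * (\<theta> - \<eta>)" using assms by simp
  then show ?thesis using gen_above_tangent[of \<eta> \<theta> x] assms by linarith
qed

lemma gen_lipschitz:
  assumes "0 \<le> \<eta>" "\<eta> \<le> \<theta>" "\<theta> \<le> 1"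
  shows "gen x \<theta> - gen x \<eta> \<le> m * (\<theta> - \<eta>)"
proof -
  have "gen x \<theta> - gen x \<eta> \<le> gen_deriv x \<theta> * (\<theta> - \<eta>)"
    using gen_above_tangent[of \<theta> \<eta> x] assms by (simp add: algebra_simps)
  also have "\<dots> \<le> m * (\<theta> - \<eta>)" using assms by (intro mult_right_mono) auto
  finally show ?thesis .
qed

lemma gen_lipschitz_abs:
  assumes "0 \<le> \<eta>" "\<eta> \<le> 1" "0 \<le> \<theta>" "\<theta> \<le> 1"
  shows "\<bar>gen x \<theta> - gen x \<eta>\<bar> \<le> m * \<bar>\<theta> - \<eta>\<bar>"
  using gen_lipschitz[of \<eta> \<theta> x] gen_lipschitz[of \<theta> \<eta> x] gen_mono[of \<eta> \<theta> x] gen_mono[of \<theta> \<eta> x] assms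
  by (cases "\<eta> \<le> \<theta>") auto

lemma measurable_pmf_expectation:
  fixes a :: "nat \<Rightarrow> 'c \<Rightarrow> real"
  assumes [measurable]: "X \<in> N \<rightarrow>\<^sub>M borel" "\<And>n. a n \<in> borel_measurable N"
    and a: "\<And>n y. 0 \<le> a n y"
  shows "(\<lambda>y. measure_pmf.expectation (p (X y)) (\<lambda>n. a n y)) \<in> borel_measurable N"
proof -
  have "measure_pmf.expectation (p (X y)) (\<lambda>n. a n y) = enn2real (\<Sum>n. ennreal (pmf (p (X y)) n) * ennreal (a n y))" for y
  proof -
    have "measure_pmf.expectation (p (X y)) (\<lambda>n. a n y) = enn2real (\<integral>\<^sup>+n. ennreal (a n y) \<partial>measure_pmf (p (X y)))"
      using a by (intro integral_eq_nn_integral) auto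
    also have "(\<integral>\<^sup>+n. ennreal (a n y) \<partial>measure_pmf (p (X y))) = (\<Sum>n. ennreal (pmf (p (X y)) n) * ennreal (a n y))"
      by (simp add: nn_integral_measure_pmf nn_integral_count_space_nat)
    finally show ?thesis .
  qed
  moreover have "(\<lambda>y. pmf (p (X y)) n) \<in> borel_measurable N" for n
    using measurable_compose[OF assms(1) p_measurable] .
  ultimately show ?thesis by simp
qed

lemma gen_measurable [measurable (raw)]:
  assumes [measurable]: "X \<in> N \<rightarrow>\<^sub>M borel" "\<eta> \<in> borel_measurable N"
  shows "(\<lambda>y. gen (X y) (\<eta> y)) \<in> borel_measurable N"
  unfolding gen_def by (rule measurable_pmf_expectation) auto

lemma gen_deriv_measurable [measurable (raw)]:
  assumes [measurable]: "X \<in> N \<rightarrow>\<^sub>M borel" "\<eta> \<in> borel_measurable N"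
  shows "(\<lambda>y. gen_deriv (X y) (\<eta> y)) \<in> borel_measurable N"
  unfolding gen_deriv_def by (rule measurable_pmf_expectation) auto

lemma offspring_kernel_measurable:
  assumes [measurable]: "X \<in> N \<rightarrow>\<^sub>M borel"
  shows "(\<lambda>y. measure_pmf (p (X y))) \<in> N \<rightarrow>\<^sub>M subprob_algebra (count_space UNIV)"
proof (rule measurable_subprob_algebra)
  fix A :: "nat set"
  have "emeasure (measure_pmf (p (X y))) A = (\<Sum>n. ennreal (pmf (p (X y)) n) * indicator A n)" for y
  proof -
    have "emeasure (measure_pmf (p (X y))) A = (\<integral>\<^sup>+n. indicator A n \<partial>measure_pmf (p (X y)))" by simp
    also have "\<dots> = (\<Sum>n. ennreal (pmf (p (X y)) n) * indicator A n)"
      by (simp add: nn_integral_measure_pmf nn_integral_count_space_nat del: nn_integral_indicator)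
    finally show ?thesis .
  qed
  moreover have "(\<lambda>y. pmf (p (X y)) n) \<in> borel_measurable N" for n
    using measurable_compose[OF assms p_measurable] .
  ultimately show "(\<lambda>y. emeasure (measure_pmf (p (X y))) A) \<in> borel_measurable N" by simp
qed (auto intro: prob_space_imp_subprob_space measure_pmf.prob_space_axioms)

lemma branching_h_alt: "branching_h lam p x z = (SUP \<eta>\<in>{0..1}. \<eta> * z - lam x * gen x \<eta>)"
  unfolding branching_h_def gen_def by (intro SUP_cong) auto

lemma branching_h_term_le: "\<eta> \<in> {0..1} \<Longrightarrow> \<bar>\<eta> * z - lam x * gen x \<eta>\<bar> \<le> \<bar>z\<bar> + l"
proof -
  assume \<eta>: "\<eta> \<in> {0..1}"
  have "\<bar>\<eta> * z\<bar> \<le> 1 * \<bar>z\<bar>" using \<eta> unfolding abs_mult by (intro mult_right_mono) auto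
  moreover have "\<bar>lam x * gen x \<eta>\<bar> \<le> l * 1" using abs_lam_le by (intro abs_mult_le) auto
  ultimately show ?thesis by linarith
qed

lemma branching_h_bdd: "A \<subseteq> {0..1} \<Longrightarrow> bdd_above ((\<lambda>\<eta>. \<eta> * z - lam x * gen x \<eta>) ` A)"
  using branching_h_term_le[of _ z x] by (intro bdd_aboveI2[where M="\<bar>z\<bar> + l"]) (force simp: abs_le_iff)

lemma branching_h_ge:
  assumes "0 \<le> \<eta>" "\<eta> \<le> 1"
  shows "\<eta> * z - lam x * gen x \<eta> \<le> branching_h lam p x z"
  unfolding branching_h_alt using assms by (intro cSUP_upper branching_h_bdd) auto

lemma branching_h_abs_le: "\<bar>branching_h lam p x z\<bar> \<le> \<bar>z\<bar> + l"
proof -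
  have "branching_h lam p x z \<le> \<bar>z\<bar> + l"
    unfolding branching_h_alt using branching_h_term_le[of _ z x]
    by (intro cSUP_least) (auto simp: abs_le_iff)
  moreover have "- (\<bar>z\<bar> + l) \<le> branching_h lam p x z"
    using branching_h_ge[of 0 z x] branching_h_term_le[of 0 z x] by auto
  ultimately show ?thesis by auto
qed

text \<open>Conjugate duality: at the slope of a supporting line the supremum is attained where the line
  touches.\<close>

lemma branching_h_eq:
  assumes "0 \<le> \<eta>" "\<eta> \<le> 1"
  shows "branching_h lam p x (lam x * gen_deriv x \<eta>) = \<eta> * (lam x * gen_deriv x \<eta>) - lam x * gen x \<eta>"
proof (rule antisym)
  show "branching_h lam p x (lam x * gen_deriv x \<eta>) \<le> \<eta> * (lam x * gen_deriv x \<eta>) - lam x * gen x \<eta>"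
    unfolding branching_h_alt
  proof (rule cSUP_least)
    fix \<theta> :: real assume \<theta>: "\<theta> \<in> {0..1}"
    have "lam x * (gen x \<eta> + gen_deriv x \<eta> * (\<theta> - \<eta>)) \<le> lam x * gen x \<theta>"
      using gen_above_tangent[of \<eta> \<theta> x] assms \<theta> lam_nonneg by (intro mult_left_mono) auto
    then show "\<theta> * (lam x * gen_deriv x \<eta>) - lam x * gen x \<theta> \<le> \<eta> * (lam x * gen_deriv x \<eta>) - lam x * gen x \<eta>"
      by (simp add: algebra_simps)
  qed simp
qed (use branching_h_ge[OF assms] in simp)

text \<open>As \<open>gen x\<close> is Lipschitz continuous, rational \<open>\<eta>\<close> suffice; this makes \<open>branching_h\<close> measurable.\<close>

lemma branching_h_rational:
  "branching_h lam p x z = (SUP \<eta>\<in>\<rat> \<inter> {0..1}. \<eta> * z - lam x * gen x \<eta>)" (is "_ = Sup (?F ` ?Q)")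
proof (rule antisym)
  have Q: "0 \<in> ?Q" by simp
  show "branching_h lam p x z \<le> Sup (?F ` ?Q)"
    unfolding branching_h_alt
  proof (rule cSUP_least)
    fix \<eta> :: real assume \<eta>: "\<eta> \<in> {0..1}"
    define q where "q n = of_int \<lfloor>\<eta> * real (Suc n)\<rfloor> / real (Suc n)" for n
    have q1: "q n \<le> \<eta>" for n
      unfolding q_def by (simp add: divide_le_eq del: of_nat_Suc)
    have q2: "\<eta> - 1 / real (Suc n) \<le> q n" for n
    proof -
      have "(\<eta> * real (Suc n) - 1) / real (Suc n) \<le> q n"
        unfolding q_def using floor_correct[of "\<eta> * real (Suc n)"] by (intro divide_right_mono) linarith+
      moreover have "(\<eta> * real (Suc n) - 1) / real (Suc n) = \<eta> - 1 / real (Suc n)"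
        by (simp add: diff_divide_distrib del: of_nat_Suc)
      ultimately show ?thesis by simp
    qed
    have q0: "0 \<le> q n" for n unfolding q_def using \<eta> by simp
    have q01: "q n \<in> ?Q" for n
    proof -
      have "q n \<in> \<rat>" by (simp add: q_def)
      moreover have "q n \<le> 1" using q1[of n] \<eta> by simp
      ultimately show ?thesis using q0 by simp
    qed
    have q: "q \<longlonglongrightarrow> \<eta>"
    proof (rule tendsto_sandwich[of "\<lambda>n. \<eta> - 1 / real (Suc n)" _ _ "\<lambda>_. \<eta>"])
      show "(\<lambda>n. \<eta> - 1 / real (Suc n)) \<longlonglongrightarrow> \<eta>"
        using tendsto_diff[OF tendsto_const[of \<eta>] LIMSEQ_inverse_real_of_nat] by (simp add: inverse_eq_divide)
    qed (use q1 q2 in auto)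
    have "(\<lambda>n. gen x (q n)) \<longlonglongrightarrow> gen x \<eta>"
    proof (rule LIM_zero_cancel, rule Lim_null_comparison)
      show "\<forall>\<^sub>F n in sequentially. norm (gen x (q n) - gen x \<eta>) \<le> m * \<bar>q n - \<eta>\<bar>"
        using gen_lipschitz_abs[of \<eta> "q _" x] q01 \<eta> by (intro always_eventually allI) auto
      have "(\<lambda>n. m * \<bar>q n - \<eta>\<bar>) \<longlonglongrightarrow> m * \<bar>\<eta> - \<eta>\<bar>" by (intro tendsto_intros q)
      then show "(\<lambda>n. m * \<bar>q n - \<eta>\<bar>) \<longlonglongrightarrow> 0" by simp
    qed
    then have lim: "(\<lambda>n. ?F (q n)) \<longlonglongrightarrow> ?F \<eta>" by (intro tendsto_intros q)
    have le: "?F (q n) \<le> Sup (?F ` ?Q)" for n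
      using q01 by (intro cSUP_upper branching_h_bdd) auto
    show "?F \<eta> \<le> Sup (?F ` ?Q)" by (rule LIMSEQ_le_const2[OF lim]) (use le in blast)
  qed simp
  show "Sup (?F ` ?Q) \<le> branching_h lam p x z"
    unfolding branching_h_alt using Q by (intro cSUP_subset_mono branching_h_bdd) auto
qed

lemma branching_h_measurable [measurable (raw)]:
  assumes [measurable]: "X \<in> N \<rightarrow>\<^sub>M borel" "Z \<in> borel_measurable N"
  shows "(\<lambda>y. branching_h lam p (X y) (Z y)) \<in> borel_measurable N"
  unfolding branching_h_rational
  by (intro borel_measurable_cSUP branching_h_bdd) (auto intro: countable_rat countable_Int1)

section \<open>The integral equation at the first branching event\<close>

text \<open>The branching rate accumulated along a path: a particle that moves along \<open>w\<close> is still alive at age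
  \<open>s\<close> with probability \<open>exp (- clock s w)\<close>.\<close>

definition clock :: "real \<Rightarrow> (real \<Rightarrow> 'a) \<Rightarrow> real" where
  "clock s w = (LINT r:{0..s}|lborel. lam (path_at r w))"

lemma clock_measurable [measurable (raw)]:
  assumes [measurable]: "s \<in> borel_measurable N" "w \<in> N \<rightarrow>\<^sub>M path_space"
  shows "(\<lambda>y. clock (s y) (w y)) \<in> borel_measurable N"
  unfolding clock_def by measurable

lemma const_path_measurable [measurable]: "w \<in> rc_paths \<Longrightarrow> (\<lambda>_. w) \<in> N \<rightarrow>\<^sub>M path_space"
  by (rule measurable_const) simp

lemma clock_nonneg: "0 \<le> clock s w"
  unfolding clock_def set_lebesgue_integral_def
  by (intro Bochner_Integration.integral_nonneg) (auto simp: lam_nonneg)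

lemma clock_0 [simp]: "clock 0 w = 0"
proof -
  have "AE r in lborel. indicator {0..0::real} r *\<^sub>R lam (path_at r w) = 0"
    using AE_lborel_singleton[of 0] by eventually_elim auto
  then show ?thesis unfolding clock_def set_lebesgue_integral_def by (intro integral_eq_zero_AE)
qed

lemma exp_clock_le: "exp (- clock s w) \<le> 1"
  using clock_nonneg by simp

lemma clock_primitive:
  assumes w: "w \<in> rc_paths"
  shows "bounded_primitive (\<lambda>r. lam (path_at r w)) (\<lambda>r. clock r w) l t"
proof
  show "(\<lambda>r. lam (path_at r w)) \<in> borel_measurable borel" using w by measurable
  show "clock s w = clock 0 w + (LINT r:{0..s}|lborel. lam (path_at r w))" for s
    by (simp add: clock_def[of s])
qed (rule abs_lam_le)

lemma exp_clock_primitive: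
  assumes w: "w \<in> rc_paths" and s: "0 \<le> s"
  shows "exp (- clock s w) = 1 - (LINT r:{0..s}|lborel. exp (- clock r w) * lam (path_at r w))"
proof -
  interpret E: bounded_primitive "\<lambda>r. indicator {0..s} r * (- lam (path_at r w) * exp (- clock r w))"
    "\<lambda>r. exp (- clock r w)" "l * exp (\<bar>- clock 0 w\<bar> + l * s)" s
    by (rule exp_primitive_bounded[OF bounded_primitive_uminus[OF clock_primitive[OF w]] s])
  have "exp (- clock s w) = 1 + (LINT r:{0..s}|lborel. indicator {0..s} r * (- lam (path_at r w) * exp (- clock r w)))"
    using E.prim[of s] s by simp
  also have "(LINT r:{0..s}|lborel. indicator {0..s} r * (- lam (path_at r w) * exp (- clock r w)))
     = (LINT r:{0..s}|lborel. - (exp (- clock r w) * lam (path_at r w)))"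
    by (rule set_lebesgue_integral_cong) auto
  also have "\<dots> = - (LINT r:{0..s}|lborel. exp (- clock r w) * lam (path_at r w))"
    by (simp add: set_lebesgue_integral_def)
  finally show ?thesis by simp
qed

text \<open>The mean contribution after time \<open>s\<close> of a particle with path \<open>w\<close>, if a particle alive at \<open>y\<close>
  contributes \<open>f y\<close> and each child born at \<open>y\<close> with remaining time \<open>r\<close> contributes \<open>q r y\<close>.\<close>

definition first_branching :: "('a \<Rightarrow> real) \<Rightarrow> (real \<Rightarrow> 'a \<Rightarrow> real) \<Rightarrow> real \<Rightarrow> (real \<Rightarrow> 'a) \<Rightarrow> real" where
  "first_branching f q s w = exp (- clock s w) * f (path_at s w)
     + (LINT r:{0..s}|lborel. exp (- clock r w) * lam (path_at r w) * gen (path_at r w) (q (s - r) (path_at r w)))"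

text \<open>The expected product over the particles alive after time \<open>s\<close>, for a start at \<open>x\<close>, where the product is
  replaced by 0 when a particle of generation \<open>n\<close> is born by then.\<close>

primrec picard :: "('a \<Rightarrow> real) \<Rightarrow> nat \<Rightarrow> real \<Rightarrow> 'a \<Rightarrow> real" where
  "picard f 0 s x = 0"
| "picard f (Suc n) s x = (\<integral>w. first_branching f (picard f n) s w \<partial>P x)"

lemma first_branching_measurable [measurable (raw)]:
  assumes [measurable]: "f \<in> borel_measurable borel" "(\<lambda>(s, x). q s x) \<in> borel_measurable (borel \<Otimes>\<^sub>M borel)"
    "s \<in> borel_measurable N" "w \<in> N \<rightarrow>\<^sub>M path_space"
  shows "(\<lambda>y. first_branching f q (s y) (w y)) \<in> borel_measurable N"
  unfolding first_branching_def by measurable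

lemma integrand_measurable [measurable]:
  assumes [measurable]: "(\<lambda>(s, x). q s x) \<in> borel_measurable (borel \<Otimes>\<^sub>M borel)" and "w \<in> rc_paths"
  shows "(\<lambda>r. exp (- clock r w) * lam (path_at r w) * gen (path_at r w) (q (s - r) (path_at r w))) \<in> borel_measurable borel"
  using assms(2) by measurable

lemma integrand_bounds:
  "0 \<le> exp (- clock r w) * lam x * gen x \<eta>"
  "exp (- clock r w) * lam x * gen x \<eta> \<le> exp (- clock r w) * lam x"
  "\<bar>exp (- clock r w) * lam x * gen x \<eta>\<bar> \<le> l"
proof -
  show 1: "0 \<le> exp (- clock r w) * lam x * gen x \<eta>" using lam_nonneg by simp
  show 2: "exp (- clock r w) * lam x * gen x \<eta> \<le> exp (- clock r w) * lam x"
    using lam_nonneg by (intro mult_left_le) auto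
  have "exp (- clock r w) * lam x \<le> 1 * l"
    using exp_clock_le lam_nonneg lam_le by (intro mult_mono) auto
  then show "\<bar>exp (- clock r w) * lam x * gen x \<eta>\<bar> \<le> l" using 1 2 by linarith
qed

lemma integrand_integrable:
  assumes "(\<lambda>(s, x). q s x) \<in> borel_measurable (borel \<Otimes>\<^sub>M borel)" and "w \<in> rc_paths"
  shows "set_integrable lborel {a..b} (\<lambda>r. exp (- clock r w) * lam (path_at r w) * gen (path_at r w) (q (s - r) (path_at r w)))"
  using integrand_bounds(3) by (intro bounded_set_integrable[where C=l] integrand_measurable assms) auto

lemma branching_density_integrable:
  assumes [measurable]: "w \<in> rc_paths"
  shows "set_integrable lborel {a..b} (\<lambda>r. exp (- clock r w) * lam (path_at r w))"
proof (rule bounded_set_integrable[where C=l])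
  show "\<bar>exp (- clock s w) * lam (path_at s w)\<bar> \<le> l" for s
    using integrand_bounds(3)[of s w "path_at s w" 1] by simp
qed measurable

lemma first_branching_range:
  assumes f: "\<And>x. 0 \<le> f x \<and> f x \<le> 1" and q: "(\<lambda>(s, x). q s x) \<in> borel_measurable (borel \<Otimes>\<^sub>M borel)"
    and w: "w \<in> rc_paths" and s: "0 \<le> s"
  shows "0 \<le> first_branching f q s w" "first_branching f q s w \<le> 1"
proof -
  let ?I = "LINT r:{0..s}|lborel. exp (- clock r w) * lam (path_at r w) * gen (path_at r w) (q (s - r) (path_at r w))"
  have "0 \<le> ?I"
    unfolding set_lebesgue_integral_def using integrand_bounds(1)
    by (intro Bochner_Integration.integral_nonneg) (auto intro!: mult_nonneg_nonneg)
  then show "0 \<le> first_branching f q s w" unfolding first_branching_def using f by simp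
  have "?I \<le> (LINT r:{0..s}|lborel. exp (- clock r w) * lam (path_at r w))"
    using integrand_bounds(2) by (intro set_integral_mono integrand_integrable q w branching_density_integrable)
  moreover have "exp (- clock s w) * f (path_at s w) \<le> exp (- clock s w)"
    using f by (intro mult_left_le) auto
  ultimately show "first_branching f q s w \<le> 1"
    unfolding first_branching_def using exp_clock_primitive[OF w s] by linarith
qed

lemma first_branching_mono:
  assumes q: "(\<lambda>(s, x). q s x) \<in> borel_measurable (borel \<Otimes>\<^sub>M borel)" "(\<lambda>(s, x). q' s x) \<in> borel_measurable (borel \<Otimes>\<^sub>M borel)"
    and le: "\<And>s x. 0 \<le> s \<Longrightarrow> 0 \<le> q s x \<and> q s x \<le> q' s x \<and> q' s x \<le> 1"
    and w: "w \<in> rc_paths"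
  shows "first_branching f q s w \<le> first_branching f q' s w"
  unfolding first_branching_def using le lam_nonneg
  by (intro add_left_mono set_integral_mono integrand_integrable q w mult_left_mono gen_mono) auto

lemma sets_P [simp, measurable_cong]: "sets (P x) = sets path_space"
  using measurable_space[OF kernel, of x] by (auto simp: space_prob_algebra)

lemma space_P [simp]: "space (P x) = rc_paths"
  using sets_eq_imp_space_eq[OF sets_P[of x]] by simp

lemma prob_space_P: "prob_space (P x)"
  using measurable_space[OF kernel, of x] by (auto simp: space_prob_algebra)

lemma prob_P_space [simp]: "measure (P x) rc_paths = 1"
  using prob_space.prob_space[OF prob_space_P, of x] by simp

lemma kernel_subprob [measurable]: "P \<in> borel \<rightarrow>\<^sub>M subprob_algebra path_space"
  by (rule measurable_prob_algebraD[OF kernel])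

lemma P_integral_measurable:
  fixes H :: "real \<Rightarrow> (real \<Rightarrow> 'a) \<Rightarrow> real"
  assumes [measurable]: "(\<lambda>(s, w). H s w) \<in> borel_measurable (borel \<Otimes>\<^sub>M path_space)"
  shows "(\<lambda>(s, x). \<integral>w. H s w \<partial>P x) \<in> borel_measurable (borel \<Otimes>\<^sub>M borel)"
proof -
  have "(\<lambda>z. \<integral>w. (case (z, w) of ((s, x), w) \<Rightarrow> H s w) \<partial>P (snd z)) \<in> borel_measurable (borel \<Otimes>\<^sub>M borel)"
  proof (rule integral_measurable_kernel)
    show "(\<lambda>(z, w). case z of (s, x) \<Rightarrow> H s w) \<in> borel_measurable ((borel \<Otimes>\<^sub>M borel) \<Otimes>\<^sub>M path_space)"
      by measurable
  qed measurable
  then show ?thesis by (simp add: case_prod_beta)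
qed

lemma P_integral_range:
  assumes H: "\<And>w. w \<in> rc_paths \<Longrightarrow> 0 \<le> H w \<and> H w \<le> (1::real)"
  shows "0 \<le> (\<integral>w. H w \<partial>P x)" "(\<integral>w. H w \<partial>P x) \<le> 1"
proof -
  interpret prob_space "P x" by (rule prob_space_P)
  show "0 \<le> (\<integral>w. H w \<partial>P x)" using H by (intro Bochner_Integration.integral_nonneg) auto
  show "(\<integral>w. H w \<partial>P x) \<le> 1"
  proof (cases "integrable (P x) H")
    case True
    then have "(\<integral>w. H w \<partial>P x) \<le> (\<integral>w. 1 \<partial>P x)" using H by (intro integral_mono) auto
    then show ?thesis by (simp add: prob_space)
  qed (simp add: not_integrable_integral_eq)
qed

lemma P_integrable_unit:
  assumes [measurable]: "H \<in> borel_measurable path_space" and H: "\<And>w. w \<in> rc_paths \<Longrightarrow> 0 \<le> H w \<and> H w \<le> (1::real)"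
  shows "integrable (P x) H"
proof -
  interpret prob_space "P x" by (rule prob_space_P)
  show ?thesis using H by (intro integrable_const_bound[where B=1] AE_I2) auto
qed

end

locale branching_value = branching_mechanism +
  fixes f :: "'a \<Rightarrow> real"
  assumes f_measurable [measurable]: "f \<in> borel_measurable borel"
    and f_range: "0 \<le> f x \<and> f x \<le> 1"
begin

lemma picard_measurable [measurable]: "(\<lambda>(s, x). picard f n s x) \<in> borel_measurable (borel \<Otimes>\<^sub>M borel)"
proof (induction n)
  case (Suc n)
  note [measurable] = Suc
  have "(\<lambda>(s, x). \<integral>w. first_branching f (picard f n) s w \<partial>P x) \<in> borel_measurable (borel \<Otimes>\<^sub>M borel)"
    by (rule P_integral_measurable) measurable
  then show ?case by simp
qed simp

lemma picard_range: "0 \<le> s \<Longrightarrow> 0 \<le> picard f n s x \<and> picard f n s x \<le> 1"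
  by (cases n) (auto intro!: P_integral_range simp: first_branching_range[OF f_range picard_measurable])

lemma first_branching_path_measurable [measurable]:
  assumes "(\<lambda>(s, x). q s x) \<in> borel_measurable (borel \<Otimes>\<^sub>M borel)"
  shows "first_branching f q s \<in> borel_measurable path_space"
proof -
  have "(\<lambda>w. first_branching f q s w) \<in> borel_measurable path_space" using assms by measurable
  then show ?thesis by simp
qed

lemma picard_mono: "0 \<le> s \<Longrightarrow> picard f n s x \<le> picard f (Suc n) s x"
proof (induction n arbitrary: s x)
  case 0
  then show ?case using picard_range[of s "Suc 0" x] by simp
next
  case (Suc n)
  have "(\<integral>w. first_branching f (picard f n) s w \<partial>P x) \<le> (\<integral>w. first_branching f (picard f (Suc n)) s w \<partial>P x)"
  proof (rule integral_mono)
    show "first_branching f (picard f n) s w \<le> first_branching f (picard f (Suc n)) s w" if "w \<in> space (P x)" for w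
      by (intro first_branching_mono picard_measurable) (use that Suc.IH picard_range in \<open>auto simp del: picard.simps\<close>)
  qed (auto intro!: P_integrable_unit first_branching_path_measurable picard_measurable
         simp: first_branching_range[OF f_range picard_measurable] Suc.prems simp del: picard.simps)
  then show ?case by simp
qed

definition val :: "real \<Rightarrow> 'a \<Rightarrow> real" where
  "val s x = lim (\<lambda>n. picard f n s x)"

lemma picard_tendsto_val: "0 \<le> s \<Longrightarrow> (\<lambda>n. picard f n s x) \<longlonglongrightarrow> val s x"
proof -
  assume s: "0 \<le> s"
  have "incseq (\<lambda>n. picard f n s x)" using picard_mono[OF s] by (intro incseq_SucI)
  moreover have "\<And>n. picard f n s x \<le> 1" using picard_range[OF s] by blast
  ultimately have "convergent (\<lambda>n. picard f n s x)" using incseq_convergent convergentI by metis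
  then show ?thesis unfolding val_def by (simp add: convergent_LIMSEQ_iff)
qed

lemma val_measurable [measurable]: "(\<lambda>(s, x). val s x) \<in> borel_measurable (borel \<Otimes>\<^sub>M borel)"
proof -
  have "(\<lambda>z. lim (\<lambda>n. case z of (s, x) \<Rightarrow> picard f n s x)) \<in> borel_measurable (borel \<Otimes>\<^sub>M borel)"
    by (rule borel_measurable_lim_metric) measurable
  then show ?thesis by (simp add: val_def case_prod_beta)
qed

lemma val_range: "0 \<le> s \<Longrightarrow> 0 \<le> val s x \<and> val s x \<le> 1"
  using LIMSEQ_le_const[OF picard_tendsto_val, of s 0 x] LIMSEQ_le_const2[OF picard_tendsto_val, of s x 1] picard_range
  by blast

lemma first_branching_tendsto:
  assumes w: "w \<in> rc_paths"
  shows "(\<lambda>n. first_branching f (picard f n) s w) \<longlonglongrightarrow> first_branching f val s w"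
  unfolding first_branching_def set_lebesgue_integral_def
proof (intro tendsto_intros integral_dominated_convergence[where w="\<lambda>r. indicator {0..s} r * l"])
  let ?g = "\<lambda>q r. exp (- clock r w) * lam (path_at r w) * gen (path_at r w) (q (s - r) (path_at r w))"
  have meas: "?g (picard f n) \<in> borel_measurable borel" "?g val \<in> borel_measurable borel" for n
    using integrand_measurable[OF picard_measurable w] integrand_measurable[OF val_measurable w] by auto
  show "(\<lambda>r. indicat_real {0..s} r *\<^sub>R ?g (picard f n) r) \<in> borel_measurable lborel" for n
    using meas(1)[of n] by (auto intro!: borel_measurable_scaleR borel_measurable_indicator)
  show "(\<lambda>r. indicat_real {0..s} r *\<^sub>R ?g val r) \<in> borel_measurable lborel"
    using meas(2) by (auto intro!: borel_measurable_scaleR borel_measurable_indicator)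
  show "integrable lborel (\<lambda>r. indicator {0..s} r * l)"
    by (intro integrable_mult_left integrable_real_indicator) (auto simp: emeasure_lborel_Icc_eq)
  show "AE r in lborel. norm (indicat_real {0..s} r *\<^sub>R ?g (picard f n) r) \<le> indicator {0..s} r * l" for n
    using integrand_bounds(3) by (intro AE_I2) (auto split: split_indicator)
  show "AE r in lborel. (\<lambda>n. indicat_real {0..s} r *\<^sub>R ?g (picard f n) r) \<longlonglongrightarrow> indicat_real {0..s} r *\<^sub>R ?g val r"
  proof (intro AE_I2)
    fix r
    show "(\<lambda>n. indicat_real {0..s} r *\<^sub>R ?g (picard f n) r) \<longlonglongrightarrow> indicat_real {0..s} r *\<^sub>R ?g val r"
    proof (cases "r \<in> {0..s}")
      case True
      then have sr: "0 \<le> s - r" by simp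
      let ?x = "path_at r w"
      have "(\<lambda>n. gen ?x (picard f n (s - r) ?x)) \<longlonglongrightarrow> gen ?x (val (s - r) ?x)"
      proof (rule LIM_zero_cancel, rule Lim_null_comparison)
        show "\<forall>\<^sub>F n in sequentially. norm (gen ?x (picard f n (s - r) ?x) - gen ?x (val (s - r) ?x))
            \<le> m * \<bar>picard f n (s - r) ?x - val (s - r) ?x\<bar>"
          using gen_lipschitz_abs picard_range[OF sr] val_range[OF sr] by (intro always_eventually allI) auto
        have "(\<lambda>n. m * \<bar>picard f n (s - r) ?x - val (s - r) ?x\<bar>) \<longlonglongrightarrow> m * \<bar>val (s - r) ?x - val (s - r) ?x\<bar>"
          by (intro tendsto_intros picard_tendsto_val sr)
        then show "(\<lambda>n. m * \<bar>picard f n (s - r) ?x - val (s - r) ?x\<bar>) \<longlonglongrightarrow> 0" by simp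
      qed
      then show ?thesis by (intro tendsto_intros)
    qed simp
  qed
qed

text \<open>The integral equation, by dominated convergence from the recursion for the iterates.\<close>

lemma val_eq:
  assumes s: "0 \<le> s"
  shows "val s x = (\<integral>w. first_branching f val s w \<partial>P x)"
proof (rule LIMSEQ_unique)
  show "(\<lambda>n. picard f (Suc n) s x) \<longlonglongrightarrow> val s x"
    using picard_tendsto_val[OF s] by (rule LIMSEQ_Suc)
  interpret prob_space "P x" by (rule prob_space_P)
  have "(\<lambda>n. \<integral>w. first_branching f (picard f n) s w \<partial>P x) \<longlonglongrightarrow> (\<integral>w. first_branching f val s w \<partial>P x)"
    by (rule integral_dominated_convergence[where w="\<lambda>_. 1"])
      (auto intro!: first_branching_tendsto simp: first_branching_range[OF f_range picard_measurable _ s])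
  then show "(\<lambda>n. picard f (Suc n) s x) \<longlonglongrightarrow> (\<integral>w. first_branching f val s w \<partial>P x)" by simp
qed

lemma first_branching_0: "first_branching f q 0 w = f (w 0)"
proof -
  have "(LINT r:{0..0}|lborel. exp (- clock r w) * lam (path_at r w) * gen (path_at r w) (q (0 - r) (path_at r w))) = 0"
    unfolding set_lebesgue_integral_def using AE_lborel_singleton[of 0]
    by (intro integral_eq_zero_AE) auto
  then show ?thesis by (simp add: first_branching_def)
qed

lemma val_0: "val 0 x = f x"
proof -
  interpret prob_space "P x" by (rule prob_space_P)
  have "val 0 x = (\<integral>w. f (w 0) \<partial>P x)" using val_eq[of 0 x] by (simp add: first_branching_0)
  also have "\<dots> = (\<integral>w. f x \<partial>P x)"
    using initial[of x] by (intro integral_cong_AE) (auto elim!: eventually_mono)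
  finally show ?thesis by (simp add: prob_space)
qed

end

context branching_mechanism
begin

text \<open>For \<open>f = 1\<close> the iterates are the probabilities that generation \<open>n\<close> is not reached.  By the Lipschitz
  bound for \<open>gen\<close>, the defect of the \<open>n\<close>-th one is at most \<open>(l m s)\<^sup>n / n!\<close>, so the tree does not explode.\<close>

lemma picard_one_tendsto: "0 \<le> s \<Longrightarrow> (\<lambda>n. picard (\<lambda>_. 1) n s x) \<longlonglongrightarrow> 1"
proof -
  assume s: "0 \<le> s"
  interpret one: branching_value P lam p l m "\<lambda>_. 1" by unfold_locales auto
  have bound: "1 - picard (\<lambda>_. 1) n s x \<le> (l * m * s) ^ n / fact n" if "0 \<le> s" for n s x
    using that
  proof (induction n arbitrary: s x)
    case (Suc n)
    interpret prob_space "P x" by (rule prob_space_P)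
    let ?q = "picard (\<lambda>_. 1) n"
    let ?b = "\<lambda>s. (l * m * s) ^ n / fact n"
    define c where "c = (l * m * s) ^ Suc n / fact (Suc n)"
    have "1 - first_branching (\<lambda>_. 1) ?q s w \<le> c" if w: "w \<in> rc_paths" for w
    proof -
      have "1 - first_branching (\<lambda>_. 1) ?q s w
          = (LINT r:{0..s}|lborel. exp (- clock r w) * lam (path_at r w)) - (LINT r:{0..s}|lborel. exp (- clock r w) * lam (path_at r w) * gen (path_at r w) (?q (s - r) (path_at r w)))"
        unfolding first_branching_def using exp_clock_primitive[OF w Suc.prems] by simp
      also have "\<dots> = (LINT r:{0..s}|lborel. exp (- clock r w) * lam (path_at r w) - exp (- clock r w) * lam (path_at r w) * gen (path_at r w) (?q (s - r) (path_at r w)))"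
        using integrand_integrable[OF one.picard_measurable w] branching_density_integrable[OF w] by (intro set_integral_diff(2)[symmetric])
      also have "\<dots> \<le> (LINT r:{0..s}|lborel. l * m * ?b (s - r))"
      proof (intro set_integral_mono set_integral_diff(1) integrand_integrable[OF one.picard_measurable w] branching_density_integrable[OF w])
        show "set_integrable lborel {0..s} (\<lambda>r. l * m * ?b (s - r))"
          by (intro borel_integrable_atLeastAtMost' continuous_intros) auto
        fix r assume r: "r \<in> {0..s}"
        let ?x = "path_at r w"
        have q01: "0 \<le> ?q (s - r) ?x \<and> ?q (s - r) ?x \<le> 1" using r by (intro one.picard_range) auto
        have "exp (- clock r w) * lam ?x - exp (- clock r w) * lam ?x * gen ?x (?q (s - r) ?x)
            = (exp (- clock r w) * lam ?x) * (1 - gen ?x (?q (s - r) ?x))" by (simp add: algebra_simps)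
        also have "\<dots> \<le> (1 * l) * (m * ?b (s - r))"
        proof (rule mult_mono)
          show "exp (- clock r w) * lam ?x \<le> 1 * l"
            using exp_clock_le lam_nonneg lam_le by (intro mult_mono) auto
          have "1 - gen ?x (?q (s - r) ?x) \<le> m * (1 - ?q (s - r) ?x)"
            using gen_lipschitz[of "?q (s - r) ?x" 1 ?x] q01 by simp
          also have "\<dots> \<le> m * ?b (s - r)" using Suc.IH[of "s - r" ?x] r m_nonneg by (intro mult_left_mono) auto
          finally show "1 - gen ?x (?q (s - r) ?x) \<le> m * ?b (s - r)" .
        qed (use l_nonneg in auto)
        finally show "exp (- clock r w) * lam ?x - exp (- clock r w) * lam ?x * gen ?x (?q (s - r) ?x) \<le> l * m * ?b (s - r)"
          by simp
      qed
      also have "\<dots> = c"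
      proof -
        let ?F = "\<lambda>r. - ((l * m * (s - r)) ^ Suc n / fact (Suc n))"
        have "(?F has_real_derivative l * m * ?b (s - r)) (at r within {0..s})" for r
        proof -
          have "(?F has_real_derivative - (real (Suc n) * (l * m * (s - r)) ^ n * (l * m * (0 - 1)) / fact (Suc n))) (at r within {0..s})"
            by (auto intro!: derivative_eq_intros simp del: power_Suc of_nat_Suc fact_Suc)
          moreover have "- (real (Suc n) * (l * m * (s - r)) ^ n * (l * m * (0 - 1)) / fact (Suc n)) = l * m * ?b (s - r)"
            by (simp add: fact_Suc field_simps del: of_nat_Suc)
          ultimately show ?thesis by (rule DERIV_cong)
        qed
        then have "((\<lambda>r. l * m * ?b (s - r)) has_integral (?F s - ?F 0)) {0..s}"
          using Suc.prems by (intro fundamental_theorem_of_calculus) (auto simp: has_real_derivative_iff_has_vector_derivative)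
        then have "integral {0..s} (\<lambda>r. l * m * ?b (s - r)) = ?F s - ?F 0" by (rule integral_unique)
        also have "\<dots> = c" by (simp add: c_def)
        finally have "integral {0..s} (\<lambda>r. l * m * ?b (s - r)) = c" .
        moreover have "set_integrable lborel {0..s} (\<lambda>r. l * m * ?b (s - r))"
          by (intro borel_integrable_atLeastAtMost' continuous_intros) auto
        ultimately show ?thesis using set_borel_integral_eq_integral(2) by metis
      qed
      finally show ?thesis .
    qed
    then have "(\<integral>w. 1 - first_branching (\<lambda>_. 1) ?q s w \<partial>P x) \<le> (\<integral>w. c \<partial>P x)"
    proof (intro integral_mono)
      show "integrable (P x) (\<lambda>w. 1 - first_branching (\<lambda>_. 1) ?q s w)"
        by (intro Bochner_Integration.integrable_diff integrable_const P_integrable_unit)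
          (auto simp: first_branching_range[OF _ one.picard_measurable _ Suc.prems])
    qed auto
    also have "(\<integral>w. 1 - first_branching (\<lambda>_. 1) ?q s w \<partial>P x) = 1 - picard (\<lambda>_. 1) (Suc n) s x"
      by (subst Bochner_Integration.integral_diff)
        (auto simp: prob_space intro!: P_integrable_unit one.first_branching_path_measurable one.picard_measurable simp: first_branching_range[OF _ one.picard_measurable _ Suc.prems])
    finally show ?case by (simp add: prob_space c_def)
  qed simp
  show ?thesis
  proof (rule LIM_zero_cancel, rule Lim_null_comparison)
    show "\<forall>\<^sub>F n in sequentially. norm (picard (\<lambda>_. 1) n s x - 1) \<le> (l * m * s) ^ n / fact n"
    proof (intro always_eventually allI)
      fix n show "norm (picard (\<lambda>_. 1) n s x - 1) \<le> (l * m * s) ^ n / fact n"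
        using bound[OF s, of n x] one.picard_range[OF s, of n x] unfolding real_norm_def by linarith
    qed
    show "(\<lambda>n. (l * m * s) ^ n / fact n) \<longlonglongrightarrow> 0"
      using summable_LIMSEQ_zero[OF summable_exp[of "l * m * s"]] by (simp add: field_simps)
  qed
qed

end

section \<open>Averaging over a single particle\<close>

text \<open>The product is a limit of finite products along an enumeration of the indices, except where the
  index set is infinite; there it is 1 by convention.\<close>

lemma measurable_random_prod:
  fixes S :: "'b \<Rightarrow> 'i::countable set" and g :: "'i \<Rightarrow> 'b \<Rightarrow> real"
  assumes S: "\<And>\<omega>. \<omega> \<in> space N \<Longrightarrow> S \<omega> \<subseteq> I"
    and pred: "\<And>i. i \<in> I \<Longrightarrow> Measurable.pred N (\<lambda>\<omega>. i \<in> S \<omega>)"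
    and g: "\<And>i. i \<in> I \<Longrightarrow> g i \<in> borel_measurable N"
  shows "(\<lambda>\<omega>. \<Prod>i\<in>S \<omega>. g i \<omega>) \<in> borel_measurable N"
proof -
  have pred' [measurable]: "Measurable.pred N (\<lambda>\<omega>. i \<in> S \<omega>)" for i
  proof (cases "i \<in> I")
    case False
    then have "i \<in> S \<omega> \<longleftrightarrow> False" if "\<omega> \<in> space N" for \<omega> using S that by blast
    then have "Measurable.pred N (\<lambda>\<omega>. i \<in> S \<omega>) \<longleftrightarrow> Measurable.pred N (\<lambda>\<omega>. False)"
      by (rule measurable_cong)
    then show ?thesis by simp
  qed (rule pred)
  define J where "J n = {i. to_nat (i :: 'i) < n}" for n
  have J: "finite (J n)" for n
    using finite_vimageI[OF finite_lessThan inj_to_nat, of n] by (simp add: J_def vimage_def)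
  define a where "a i \<omega> = (if i \<in> S \<omega> then (if i \<in> I then g i \<omega> else 1) else 1)" for i \<omega>
  have [measurable]: "(\<lambda>\<omega>. if i \<in> I then g i \<omega> else 1) \<in> borel_measurable N" for i
    using g by (cases "i \<in> I") auto
  have [measurable]: "a i \<in> borel_measurable N" for i unfolding a_def by measurable
  have fin: "finite (S \<omega>) \<longleftrightarrow> (\<exists>n. \<forall>i. n \<le> to_nat i \<longrightarrow> i \<notin> S \<omega>)" for \<omega>
  proof
    assume "finite (S \<omega>)"
    then have "finite (to_nat ` S \<omega>)" by simp
    then obtain n where "\<forall>k\<in>to_nat ` S \<omega>. k < n" using finite_nat_set_iff_bounded by metis
    then show "\<exists>n. \<forall>i. n \<le> to_nat i \<longrightarrow> i \<notin> S \<omega>" by (intro exI[of _ n]) (auto simp: not_less[symmetric])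
  next
    assume "\<exists>n. \<forall>i. n \<le> to_nat i \<longrightarrow> i \<notin> S \<omega>"
    then obtain n where "S \<omega> \<subseteq> J n" unfolding J_def by (auto simp: not_less[symmetric])
    then show "finite (S \<omega>)" using J finite_subset by blast
  qed
  have "(\<Prod>i\<in>S \<omega>. g i \<omega>) = (if \<exists>n. \<forall>i. n \<le> to_nat i \<longrightarrow> i \<notin> S \<omega> then lim (\<lambda>n. \<Prod>i\<in>J n. a i \<omega>) else 1)"
    if w: "\<omega> \<in> space N" for \<omega>
  proof (cases "\<exists>n. \<forall>i. n \<le> to_nat i \<longrightarrow> i \<notin> S \<omega>")
    case True
    then obtain n where n: "\<forall>i. n \<le> to_nat i \<longrightarrow> i \<notin> S \<omega>" by blast
    have "(\<Prod>i\<in>J k. a i \<omega>) = (\<Prod>i\<in>S \<omega>. g i \<omega>)" if "n \<le> k" for k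
    proof -
      have "S \<omega> \<subseteq> J k"
      proof
        fix i assume "i \<in> S \<omega>"
        then have "\<not> n \<le> to_nat i" using n by blast
        then show "i \<in> J k" using that by (simp add: J_def)
      qed
      then have "(\<Prod>i\<in>J k. a i \<omega>) = (\<Prod>i\<in>S \<omega>. a i \<omega>)"
        using J by (intro prod.mono_neutral_right) (auto simp: a_def)
      also have "\<dots> = (\<Prod>i\<in>S \<omega>. g i \<omega>)" using S[OF w] by (intro prod.cong) (auto simp: a_def)
      finally show ?thesis .
    qed
    then have "(\<lambda>k. \<Prod>i\<in>J k. a i \<omega>) \<longlonglongrightarrow> (\<Prod>i\<in>S \<omega>. g i \<omega>)"
      by (intro tendsto_eventually eventually_sequentiallyI[of n])
    then show ?thesis using True limI by force
  next
    case False
    then have "infinite (S \<omega>)" using fin by blast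
    then show ?thesis unfolding if_not_P[OF False] by simp
  qed
  moreover have "(\<lambda>\<omega>. if \<exists>n. \<forall>i. n \<le> to_nat i \<longrightarrow> i \<notin> S \<omega> then lim (\<lambda>n. \<Prod>i\<in>J n. a i \<omega>) else 1) \<in> borel_measurable N"
    by measurable
  ultimately show ?thesis by (subst measurable_cong)
qed

lemma prod_unit_interval:
  fixes g :: "'i \<Rightarrow> real"
  assumes "\<And>i. i \<in> S \<Longrightarrow> 0 \<le> g i \<and> g i \<le> 1"
  shows "0 \<le> prod g S \<and> prod g S \<le> 1"
  using assms by (auto intro: prod_nonneg prod_le_1)

lemma ennreal_le_ennreal_iff_enn2real: "x \<le> ennreal a \<longleftrightarrow> x < \<infinity> \<and> enn2real x \<le> a" if "0 \<le> a"
  using that by (cases x rule: ennreal_cases) (auto simp: top_unique)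

lemma measurable_join1:
  assumes "g \<in> A \<rightarrow>\<^sub>M N" "space A = \<Omega>" "space B = \<Omega>"
  shows "g \<in> sigma \<Omega> (sets A \<union> sets B) \<rightarrow>\<^sub>M N"
  using assms sets.space_closed[of A] sets.space_closed[of B]
  by (auto simp: measurable_def space_measure_of_conv intro!: sigma_sets.Basic)

lemma measurable_join2:
  assumes "g \<in> B \<rightarrow>\<^sub>M N" "space A = \<Omega>" "space B = \<Omega>"
  shows "g \<in> sigma \<Omega> (sets A \<union> sets B) \<rightarrow>\<^sub>M N"
  using measurable_join1[OF assms(1,3,2)] by (simp add: Un_commute)

lemma subalgebra_join:
  assumes "subalgebra M A" "subalgebra M B"
  shows "subalgebra M (sigma (space M) (sets A \<union> sets B))"
  using assms sets.sigma_sets_subset[of "sets A \<union> sets B" M] sets.space_closed[of A] sets.space_closed[of B]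
  by (auto simp: subalgebra_def space_measure_of_conv)

text \<open>The process is observed at the fixed time \<open>t\<close>.\<close>

locale branching_tree = branching_process M P lam p x0 Y L K + branching_value P lam p l m f
  for M :: "'w measure" and P :: "'a::polish_space \<Rightarrow> (real \<Rightarrow> 'a) measure" and lam p x0 Y L K l m f +
  fixes t :: real
  assumes t_nonneg: "0 \<le> t"
begin

abbreviation "exists_p \<equiv> exists_particle L K"
abbreviation "birth \<equiv> birth_time L"
abbreviation "place \<equiv> birth_place x0 Y L"

definition born :: "nat list \<Rightarrow> 'w \<Rightarrow> bool" where
  "born i \<omega> \<longleftrightarrow> exists_p i \<omega> \<and> birth i \<omega> \<le> ennreal t"

text \<open>The age at time \<open>t\<close>.  It is clamped at 0 so that bounds for ages hold without reference to the
  event that the particle is born before \<open>t\<close>.\<close>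

definition age :: "nat list \<Rightarrow> 'w \<Rightarrow> real" where
  "age i \<omega> = max 0 (t - enn2real (birth i \<omega>))"

text \<open>The factor of a particle and its progeny when they are averaged given the birth of the particle.
  A particle that is not born by time \<open>t\<close> contributes the neutral factor 1.\<close>

definition start_value :: "nat \<Rightarrow> nat list \<Rightarrow> 'w \<Rightarrow> real" where
  "start_value n i \<omega> = (if born i \<omega> then picard f n (age i \<omega>) (place i \<omega>) else 1)"

text \<open>The same factor when the life of the particle itself is known, and only its children are averaged.\<close>

definition end_value :: "nat \<Rightarrow> nat list \<Rightarrow> 'w \<Rightarrow> real" where
  "end_value n i \<omega> = (if born i \<omega> then
     (if ennreal (age i \<omega>) < L i \<omega> then f (path_at (age i \<omega>) (Y i \<omega>))
      else picard f n (age i \<omega> - enn2real (L i \<omega>)) (path_at (enn2real (L i \<omega>)) (Y i \<omega>)) ^ K i \<omega>)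
     else 1)"

lemma age_nonneg [simp]: "0 \<le> age i \<omega>"
  by (simp add: age_def)

text \<open>The birth of a particle is determined by its strict ancestors.\<close>

lemma ancestors_measurable:
  assumes "\<And>k. strict_suffix k i \<Longrightarrow> Y k \<in> N \<rightarrow>\<^sub>M path_space"
    and "\<And>k. strict_suffix k i \<Longrightarrow> L k \<in> borel_measurable N"
    and "\<And>k. strict_suffix k i \<Longrightarrow> K k \<in> N \<rightarrow>\<^sub>M count_space UNIV"
  shows "Measurable.pred N (exists_p i) \<and> birth i \<in> borel_measurable N \<and> place i \<in> N \<rightarrow>\<^sub>M borel"
  using assms
proof (induction i)
  case Nil
  have "exists_p [] = (\<lambda>_. True)" "birth [] = (\<lambda>_. 0)" "place [] = (\<lambda>_. x0)"
    by (simp_all add: fun_eq_iff)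
  then show ?case by simp
next
  case (Cons j i)
  have i: "strict_suffix i (j # i)" and ss: "\<And>k. strict_suffix k i \<Longrightarrow> strict_suffix k (j # i)"
    by (auto simp: strict_suffix_def suffix_Cons dest: suffix_length_le)
  note [measurable] = Cons.prems(1)[OF i] Cons.prems(2)[OF i] Cons.prems(3)[OF i]
  have IH [measurable]: "Measurable.pred N (exists_p i)" "birth i \<in> borel_measurable N"
    using Cons.IH Cons.prems ss by auto
  have "Measurable.pred N (exists_p (j # i))" "birth (j # i) \<in> borel_measurable N"
    unfolding exists_particle.simps birth_time.simps by measurable
  moreover have "(\<lambda>\<omega>. path_at (enn2real (L i \<omega>)) (Y i \<omega>)) \<in> N \<rightarrow>\<^sub>M borel" by measurable
  moreover have "place (j # i) = (\<lambda>\<omega>. path_at (enn2real (L i \<omega>)) (Y i \<omega>))" by (simp add: fun_eq_iff)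
  ultimately show ?case by (metis (no_types))
qed

lemma info_triple_measurable:
  "(\<lambda>\<omega>. (Y k \<omega>, L k \<omega>, K k \<omega>)) \<in> M \<rightarrow>\<^sub>M path_space \<Otimes>\<^sub>M borel \<Otimes>\<^sub>M count_space UNIV"
  using Y_measurable[of k] L_measurable[of k] K_measurable[of k] by measurable

lemma space_info [simp]:
  "space (info_outside M Y L K i) = space M" "space (info_motion M Y L K i) = space M"
  "space (info_lifetime M Y L K i) = space M"
  by (simp_all add: info_outside_def info_motion_def info_lifetime_def space_measure_of_conv)

lemma subalgebra_info:
  "subalgebra M (info_outside M Y L K i)" "subalgebra M (info_motion M Y L K i)"
  "subalgebra M (info_lifetime M Y L K i)"
proof -
  show 1: "subalgebra M (info_outside M Y L K i)"
    unfolding info_outside_def by (intro subalgebra_sigma_generated info_triple_measurable)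
  show 2: "subalgebra M (info_motion M Y L K i)"
    unfolding info_motion_def using Y_measurable by (intro subalgebra_join 1 subalgebra_sigma_generated) auto
  show "subalgebra M (info_lifetime M Y L K i)"
    unfolding info_lifetime_def using L_measurable by (intro subalgebra_join 2 subalgebra_sigma_generated) auto
qed

lemma info_outside_coordinates:
  assumes "\<not> suffix i k"
  shows "Y k \<in> info_outside M Y L K i \<rightarrow>\<^sub>M path_space" "L k \<in> borel_measurable (info_outside M Y L K i)"
    "K k \<in> info_outside M Y L K i \<rightarrow>\<^sub>M count_space UNIV"
proof -
  have *: "(\<lambda>\<omega>. (Y k \<omega>, L k \<omega>, K k \<omega>)) \<in> info_outside M Y L K i \<rightarrow>\<^sub>M path_space \<Otimes>\<^sub>M borel \<Otimes>\<^sub>M count_space UNIV"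
    unfolding info_outside_def
    using assms measurable_space[OF info_triple_measurable]
    by (intro measurable_sigma_generated_coordinate[where \<xi>="\<lambda>k \<omega>. (Y k \<omega>, L k \<omega>, K k \<omega>)"]) auto
  show "Y k \<in> info_outside M Y L K i \<rightarrow>\<^sub>M path_space" "L k \<in> borel_measurable (info_outside M Y L K i)"
    "K k \<in> info_outside M Y L K i \<rightarrow>\<^sub>M count_space UNIV"
    using measurable_compose[OF * measurable_fst] measurable_compose[OF measurable_compose[OF * measurable_snd] measurable_fst]
      measurable_compose[OF measurable_compose[OF * measurable_snd] measurable_snd] by simp_all
qed

lemma outside_to_motion: "g \<in> info_outside M Y L K i \<rightarrow>\<^sub>M N \<Longrightarrow> g \<in> info_motion M Y L K i \<rightarrow>\<^sub>M N"
  unfolding info_motion_def by (rule measurable_join1) auto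

lemma motion_to_lifetime: "g \<in> info_motion M Y L K i \<rightarrow>\<^sub>M N \<Longrightarrow> g \<in> info_lifetime M Y L K i \<rightarrow>\<^sub>M N"
  unfolding info_lifetime_def by (rule measurable_join1) auto

lemma motion_measurable: "Y i \<in> info_motion M Y L K i \<rightarrow>\<^sub>M path_space"
  unfolding info_motion_def using measurable_space[OF Y_measurable[of i]]
  by (intro measurable_join2 measurable_sigma_generated_coordinate) auto

lemma lifetime_measurable: "L i \<in> borel_measurable (info_lifetime M Y L K i)"
  unfolding info_lifetime_def by (intro measurable_join2 measurable_sigma_generated_coordinate) auto

lemma exists_birth_place_outside:
  "Measurable.pred (info_outside M Y L K i) (exists_p i)" "birth i \<in> borel_measurable (info_outside M Y L K i)"
  "place i \<in> info_outside M Y L K i \<rightarrow>\<^sub>M borel"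
proof -
  have "\<not> suffix i k" if "strict_suffix k i" for k
    using that by (auto simp: strict_suffix_def dest: suffix_order.antisym)
  then have "Measurable.pred (info_outside M Y L K i) (exists_p i) \<and> birth i \<in> borel_measurable (info_outside M Y L K i)
    \<and> place i \<in> info_outside M Y L K i \<rightarrow>\<^sub>M borel"
    by (intro ancestors_measurable info_outside_coordinates)
  then show "Measurable.pred (info_outside M Y L K i) (exists_p i)" "birth i \<in> borel_measurable (info_outside M Y L K i)"
    "place i \<in> info_outside M Y L K i \<rightarrow>\<^sub>M borel" by auto
qed

lemma age_outside: "age i \<in> borel_measurable (info_outside M Y L K i)"
  using exists_birth_place_outside(2)[of i] unfolding age_def by measurable

lemma born_outside: "{\<omega> \<in> space M. born i \<omega>} \<in> sets (info_outside M Y L K i)"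
proof -
  note [measurable] = exists_birth_place_outside[of i]
  have "{\<omega> \<in> space (info_outside M Y L K i). born i \<omega>} \<in> sets (info_outside M Y L K i)"
    unfolding born_def by measurable
  then show ?thesis by simp
qed

text \<open>The law of a finite branching age given the path.  Its total mass is less than 1 if the particle
  may live forever.\<close>

definition lifetime_kernel :: "(real \<Rightarrow> 'a) \<Rightarrow> real measure" where
  "lifetime_kernel w = density lborel (\<lambda>r. ennreal (indicator {0..} r * (exp (- clock r w) * lam (path_at r w))))"

lemma emeasure_lifetime_kernel:
  assumes w: "w \<in> rc_paths"
  shows "emeasure (lifetime_kernel w) {..b} = ennreal (if 0 \<le> b then 1 - exp (- clock b w) else 0)"
proof -
  have [measurable]: "(\<lambda>_. w) \<in> borel \<rightarrow>\<^sub>M path_space" using w by (rule const_path_measurable)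
  have "emeasure (lifetime_kernel w) {..b}
      = (\<integral>\<^sup>+r. ennreal (indicator {0..} r * (exp (- clock r w) * lam (path_at r w))) * indicator {..b} r \<partial>lborel)"
    unfolding lifetime_kernel_def using w by (intro emeasure_density) (simp_all, measurable)
  also have "\<dots> = (\<integral>\<^sup>+r. ennreal (indicator {0..b} r *\<^sub>R (exp (- clock r w) * lam (path_at r w))) \<partial>lborel)"
    by (intro nn_integral_cong) (auto split: split_indicator)
  also have "\<dots> = ennreal (LINT r:{0..b}|lborel. exp (- clock r w) * lam (path_at r w))"
    unfolding set_lebesgue_integral_def
    using branching_density_integrable[OF w, of 0 b] lam_nonneg
    by (intro nn_integral_eq_integral) (auto simp: set_integrable_def)
  also have "(LINT r:{0..b}|lborel. exp (- clock r w) * lam (path_at r w)) = (if 0 \<le> b then 1 - exp (- clock b w) else 0)"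
    using exp_clock_primitive[OF w, of b] by (simp add: set_lebesgue_integral_def)
  finally show ?thesis .
qed

lemma lifetime_kernel_measurable:
  assumes [measurable]: "W \<in> N \<rightarrow>\<^sub>M path_space"
  shows "(\<lambda>y. lifetime_kernel (W y)) \<in> N \<rightarrow>\<^sub>M subprob_algebra borel"
proof (rule measurable_subprob_algebra)
  fix y assume y: "y \<in> space N"
  then have w: "W y \<in> rc_paths" using measurable_space[OF assms] by simp
  show "sets (lifetime_kernel (W y)) = sets borel" by (simp add: lifetime_kernel_def)
  show "subprob_space (lifetime_kernel (W y))"
  proof
    have "emeasure (lifetime_kernel (W y)) (\<Union>n::nat. {..real n}) = (SUP n::nat. emeasure (lifetime_kernel (W y)) {..real n})"
      by (intro SUP_emeasure_incseq[symmetric]) (auto simp: incseq_def lifetime_kernel_def)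
    also have "\<dots> \<le> 1"
      unfolding emeasure_lifetime_kernel[OF w] by (intro SUP_least) (auto simp: ennreal_le_1)
    also have "(\<Union>n::nat. {..real n}) = space (lifetime_kernel (W y))"
      using real_arch_simple by (auto simp: lifetime_kernel_def)
    finally show "emeasure (lifetime_kernel (W y)) (space (lifetime_kernel (W y))) \<le> 1" .
  qed (simp add: lifetime_kernel_def)
next
  fix A :: "real set" assume A [measurable]: "A \<in> sets borel"
  have "emeasure (lifetime_kernel (W y)) A
      = (\<integral>\<^sup>+r. ennreal (indicator {0..} r * (exp (- clock r (W y)) * lam (path_at r (W y)))) * indicator A r \<partial>lborel)"
    if "y \<in> space N" for y
  proof -
    have "W y \<in> rc_paths" using measurable_space[OF assms that] by simp
    then show ?thesis unfolding lifetime_kernel_def by (intro emeasure_density) (simp_all, measurable)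
  qed
  then show "(\<lambda>y. emeasure (lifetime_kernel (W y)) A) \<in> borel_measurable N"
    by (subst measurable_cong) measurable
qed

lemma lifetime_kernel_integral:
  fixes g :: "real \<Rightarrow> real"
  assumes w: "w \<in> rc_paths" and [measurable]: "g \<in> borel_measurable borel"
  shows "(\<integral>r. indicator {..a} r * g r \<partial>lifetime_kernel w) = (LINT r:{0..a}|lborel. exp (- clock r w) * lam (path_at r w) * g r)"
proof -
  have [measurable]: "(\<lambda>_. w) \<in> borel \<rightarrow>\<^sub>M path_space" using w by (rule const_path_measurable)
  have "(\<integral>r. indicator {..a} r * g r \<partial>lifetime_kernel w)
      = (\<integral>r. (indicator {0..} r * (exp (- clock r w) * lam (path_at r w))) * (indicator {..a} r * g r) \<partial>lborel)"
    unfolding lifetime_kernel_def using lam_nonneg by (subst integral_density) auto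
  also have "\<dots> = (LINT r:{0..a}|lborel. exp (- clock r w) * lam (path_at r w) * g r)"
    unfolding set_lebesgue_integral_def by (intro Bochner_Integration.integral_cong) (auto split: split_indicator)
  finally show ?thesis .
qed

text \<open>First, average over the number of children, given everything that precedes the branching event.\<close>

lemma average_offspring:
  fixes n :: nat and i :: "nat list"
  assumes R: "R \<in> borel_measurable (info_outside M Y L K i)" and R1: "\<And>\<omega>. \<omega> \<in> space M \<Longrightarrow> \<bar>R \<omega>\<bar> \<le> 1"
  defines "E \<equiv> {\<omega> \<in> space M. born i \<omega> \<and> L i \<omega> \<le> ennreal (age i \<omega>)}"
  defines "x \<equiv> \<lambda>\<omega>. path_at (enn2real (L i \<omega>)) (Y i \<omega>)"
  defines "q \<equiv> \<lambda>\<omega>. picard f n (age i \<omega> - enn2real (L i \<omega>)) (x \<omega>)"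
  shows "(\<integral>\<omega>. indicator E \<omega> * (R \<omega> * q \<omega> ^ K i \<omega>) \<partial>M) = (\<integral>\<omega>. indicator E \<omega> * (R \<omega> * gen (x \<omega>) (q \<omega>)) \<partial>M)"
proof -
  let ?F = "info_lifetime M Y L K i"
  note [measurable] = outside_to_motion[OF R, THEN motion_to_lifetime] lifetime_measurable[of i]
    motion_measurable[of i, THEN motion_to_lifetime] age_outside[of i, THEN outside_to_motion, THEN motion_to_lifetime]
    exists_birth_place_outside(1)[of i, THEN outside_to_motion, THEN motion_to_lifetime]
    exists_birth_place_outside(2)[of i, THEN outside_to_motion, THEN motion_to_lifetime]
  have E [measurable]: "E \<in> sets ?F"
  proof -
    have "{\<omega> \<in> space ?F. born i \<omega> \<and> L i \<omega> \<le> ennreal (age i \<omega>)} \<in> sets ?F"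
      unfolding born_def by measurable
    then show ?thesis by (simp add: E_def)
  qed
  have x [measurable]: "x \<in> ?F \<rightarrow>\<^sub>M borel" unfolding x_def by measurable
  have q [measurable]: "q \<in> borel_measurable ?F" unfolding q_def by measurable
  have "(\<integral>\<omega>. indicator E \<omega> * (indicator (space M) \<omega> * (case (\<omega>, K i \<omega>) of (\<omega>, k) \<Rightarrow> R \<omega> * clip (q \<omega>) ^ k)) \<partial>M)
    = (\<integral>\<omega>. indicator E \<omega> * (\<integral>k. (case (\<omega>, k) of (\<omega>, k) \<Rightarrow> R \<omega> * clip (q \<omega>) ^ k) \<partial>measure_pmf (p (x \<omega>))) \<partial>M)"
  proof (rule disintegration[OF subalgebra_info(3) E sets.top K_measurable offspring_kernel_measurable[OF x], where G="insert {} (range (\<lambda>k. {k}))" and A="\<lambda>k. {k}" and C=1 and H="\<lambda>(\<omega>, k). R \<omega> * clip (q \<omega>) ^ k"])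
    show "sets (count_space UNIV) = sigma_sets (space (count_space UNIV)) (insert {} (range (\<lambda>k::nat. {k})))"
    proof -
      have "A \<in> sigma_sets UNIV (insert {} (range (\<lambda>k::nat. {k})))" for A
      proof -
        have "(\<Union>k\<in>A. {k}) \<in> sigma_sets UNIV (insert {} (range (\<lambda>k::nat. {k})))"
          by (rule sigma_sets_UNION) (auto intro!: sigma_sets.Basic)
        then show ?thesis by simp
      qed
      then show ?thesis by auto
    qed
    show "Int_stable (insert {} (range (\<lambda>k::nat. {k})))" by (auto simp: Int_stable_def)
    fix B :: "nat set" assume B: "B \<in> insert {} (range (\<lambda>k. {k}))"
    interpret F: finite_measure_subalgebra M ?F by unfold_locales (rule subalgebra_info(3))
    show "AE \<omega> in M. \<omega> \<in> E \<longrightarrow> real_cond_exp M ?F (indicator {\<omega> \<in> space M. K i \<omega> \<in> B}) \<omega> = measure (measure_pmf (p (x \<omega>))) B"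
    proof (cases "B = {}")
      case True
      have "AE \<omega> in M. real_cond_exp M ?F (\<lambda>_. 0) \<omega> = 0" by (rule F.real_cond_exp_F_meas) auto
      moreover have eq: "indicator {\<omega> \<in> space M. K i \<omega> \<in> B} = (\<lambda>_. 0 :: real)" using True by (auto simp: fun_eq_iff)
      ultimately show ?thesis unfolding eq by eventually_elim (simp add: True)
    next
      case False
      then obtain k where k: "B = {k}" using B by auto
      have fin: "L i \<omega> < \<infinity>" if "\<omega> \<in> E" for \<omega>
        using that by (auto simp: E_def ennreal_le_ennreal_iff_enn2real)
      show ?thesis using offspring_law[of i k]
        by eventually_elim (use fin in \<open>auto simp: E_def k x_def born_def pmf.rep_eq\<close>)
    qed
  next
    have [measurable]: "(\<lambda>z. clip (q (fst z)) ^ snd z) \<in> borel_measurable (?F \<Otimes>\<^sub>M count_space UNIV)"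
    proof -
      have "(\<lambda>z. (\<lambda>k z. clip (q (fst z)) ^ k) (snd z) z) \<in> borel_measurable (?F \<Otimes>\<^sub>M count_space UNIV)"
        by (rule measurable_compose_countable[where g=snd]) measurable
      then show ?thesis by simp
    qed
    show "(\<lambda>(\<omega>, k). R \<omega> * clip (q \<omega>) ^ k) \<in> borel_measurable (?F \<Otimes>\<^sub>M count_space UNIV)"
      unfolding case_prod_beta by measurable
    show "\<bar>case z of (\<omega>, k) \<Rightarrow> R \<omega> * clip (q \<omega>) ^ k\<bar> \<le> 1" if "z \<in> space (?F \<Otimes>\<^sub>M count_space UNIV)" for z
      using that abs_mult_le[OF R1, of "fst z" "clip (q (fst z)) ^ snd z" 1] clip_power_le_1[of "q (fst z)" "snd z"]
      by (auto simp: space_pair_measure case_prod_beta)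
  qed auto
  also have "(\<integral>\<omega>. indicator E \<omega> * (\<integral>k. (case (\<omega>, k) of (\<omega>, k) \<Rightarrow> R \<omega> * clip (q \<omega>) ^ k) \<partial>measure_pmf (p (x \<omega>))) \<partial>M)
    = (\<integral>\<omega>. indicator E \<omega> * (R \<omega> * gen (x \<omega>) (q \<omega>)) \<partial>M)"
    by (intro Bochner_Integration.integral_cong) (auto simp: gen_def)
  also have "(\<integral>\<omega>. indicator E \<omega> * (indicator (space M) \<omega> * (case (\<omega>, K i \<omega>) of (\<omega>, k) \<Rightarrow> R \<omega> * clip (q \<omega>) ^ k)) \<partial>M)
    = (\<integral>\<omega>. indicator E \<omega> * (R \<omega> * q \<omega> ^ K i \<omega>) \<partial>M)"
  proof (intro Bochner_Integration.integral_cong refl)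
    fix \<omega> assume w: "\<omega> \<in> space M"
    have "clip (q \<omega>) = q \<omega>" if "\<omega> \<in> E"
      using that picard_range[of "age i \<omega> - enn2real (L i \<omega>)" n "x \<omega>"]
      by (auto simp: E_def q_def ennreal_le_ennreal_iff_enn2real)
    then show "indicator E \<omega> * (indicator (space M) \<omega> * (case (\<omega>, K i \<omega>) of (\<omega>, k) \<Rightarrow> R \<omega> * clip (q \<omega>) ^ k))
       = indicator E \<omega> * (R \<omega> * q \<omega> ^ K i \<omega>)"
      using w by (auto split: split_indicator)
  qed
  finally show ?thesis .
qed

text \<open>Next, average over the age at which the particle branches, given its motion.\<close>

lemma average_lifetime:
  assumes R: "R \<in> borel_measurable (info_outside M Y L K i)" and R1: "\<And>\<omega>. \<omega> \<in> space M \<Longrightarrow> \<bar>R \<omega>\<bar> \<le> 1"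
    and g: "(\<lambda>(\<omega>, r). g \<omega> r) \<in> borel_measurable (info_motion M Y L K i \<Otimes>\<^sub>M borel)" and g1: "\<And>\<omega> r. \<bar>g \<omega> r\<bar> \<le> 1"
  defines "E \<equiv> {\<omega> \<in> space M. born i \<omega>}"
  shows "(\<integral>\<omega>. indicator E \<omega> * (indicator {\<omega> \<in> space M. L i \<omega> < \<infinity>} \<omega> * (R \<omega> * (indicator {..age i \<omega>} (enn2real (L i \<omega>)) * g \<omega> (enn2real (L i \<omega>))))) \<partial>M)
    = (\<integral>\<omega>. indicator E \<omega> * (R \<omega> * (LINT r:{0..age i \<omega>}|lborel. exp (- clock r (Y i \<omega>)) * lam (path_at r (Y i \<omega>)) * g \<omega> r)) \<partial>M)"
proof -
  let ?F = "info_motion M Y L K i"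
  note [measurable] = outside_to_motion[OF R] motion_measurable[of i] age_outside[of i, THEN outside_to_motion] g
  have E [measurable]: "E \<in> sets ?F"
    using measurable_sets[OF outside_to_motion[OF measurable_ident] born_outside[of i]]
    by (simp add: E_def Int_absorb2)
  let ?E' = "{\<omega> \<in> space M. L i \<omega> < \<infinity>}"
  have E': "?E' \<in> sets M" using L_measurable[of i] by measurable
  have L': "(\<lambda>\<omega>. enn2real (L i \<omega>)) \<in> M \<rightarrow>\<^sub>M borel" using L_measurable[of i] by measurable
  let ?H = "\<lambda>z. R (fst z) * (indicator {..age i (fst z)} (snd z) * g (fst z) (snd z))"
  have "(\<integral>\<omega>. indicator E \<omega> * (indicator ?E' \<omega> * ?H (\<omega>, enn2real (L i \<omega>))) \<partial>M)
    = (\<integral>\<omega>. indicator E \<omega> * (\<integral>r. ?H (\<omega>, r) \<partial>lifetime_kernel (Y i \<omega>)) \<partial>M)"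
  proof (rule disintegration[OF subalgebra_info(2) E E' L' lifetime_kernel_measurable[OF motion_measurable], where G="range (\<lambda>b::real. {..b})" and A="\<lambda>n. {..real n}" and C=1 and H="?H"])
    show "sets borel = sigma_sets (space borel) (range (\<lambda>b::real. {..b}))"
      unfolding borel_eq_atMost by simp
    show "Int_stable (range (\<lambda>b::real. {..b}))"
      by (auto simp: Int_stable_def Int_atMost)
    show "(\<Union>n. {..real n}) = space borel" using real_arch_simple by auto
    fix B :: "real set" assume B: "B \<in> range (\<lambda>b. {..b})"
    then obtain b where b: "B = {..b}" by auto
    interpret F: finite_measure_subalgebra M ?F by unfold_locales (rule subalgebra_info(2))
    have w: "Y i \<omega> \<in> rc_paths" if "\<omega> \<in> space M" for \<omega> using measurable_space[OF Y_measurable that] by simp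
    have me: "measure (lifetime_kernel (Y i \<omega>)) {..b} = (if 0 \<le> b then 1 - exp (- clock b (Y i \<omega>)) else 0)" if "\<omega> \<in> space M" for \<omega>
      unfolding measure_def emeasure_lifetime_kernel[OF w[OF that]] using exp_clock_le by simp
    show "AE \<omega> in M. \<omega> \<in> E \<longrightarrow> real_cond_exp M ?F (indicator {\<omega> \<in> ?E'. enn2real (L i \<omega>) \<in> B}) \<omega> = measure (lifetime_kernel (Y i \<omega>)) B"
    proof (cases "0 \<le> b")
      case False
      then have "\<not> enn2real y \<le> b" for y using enn2real_nonneg[of y] by linarith
      then have "{\<omega> \<in> ?E'. enn2real (L i \<omega>) \<in> B} = {}" using b by auto
      then have eq: "indicator {\<omega> \<in> ?E'. enn2real (L i \<omega>) \<in> B} = (\<lambda>_. 0 :: real)" by (auto simp: fun_eq_iff)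
      have "AE \<omega> in M. real_cond_exp M ?F (\<lambda>_. 0) \<omega> = 0" by (rule F.real_cond_exp_F_meas) auto
      with AE_space show ?thesis unfolding eq
        by eventually_elim (use False me b in auto)
    next
      case True
      let ?J = "{\<omega> \<in> space M. ennreal b < L i \<omega>}"
      have J [measurable]: "?J \<in> sets M" using L_measurable[of i] by measurable
      have c: "AE \<omega> in M. real_cond_exp M ?F (indicator {\<omega> \<in> ?E'. enn2real (L i \<omega>) \<in> B}) \<omega> = real_cond_exp M ?F (\<lambda>\<omega>. 1 - indicator ?J \<omega>) \<omega>"
      proof (rule F.real_cond_exp_cong)
        show "AE \<omega> in M. indicator {\<omega> \<in> ?E'. enn2real (L i \<omega>) \<in> B} \<omega> = (1 - indicator ?J \<omega> :: real)"
        proof (rule AE_I2)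
          fix \<omega> assume "\<omega> \<in> space M"
          then show "indicator {\<omega> \<in> ?E'. enn2real (L i \<omega>) \<in> B} \<omega> = (1 - indicator ?J \<omega> :: real)"
            using ennreal_le_ennreal_iff_enn2real[OF True, of "L i \<omega>"] b
            by (auto simp: not_less[symmetric] split: split_indicator)
        qed
        have "{\<omega> \<in> ?E'. enn2real (L i \<omega>) \<in> B} = {\<omega> \<in> space M. L i \<omega> < \<infinity> \<and> enn2real (L i \<omega>) \<in> B}" by auto
        also have "\<dots> \<in> sets M" using L_measurable[of i] unfolding b by measurable
        finally show "indicator {\<omega> \<in> ?E'. enn2real (L i \<omega>) \<in> B} \<in> borel_measurable M" by simp
      qed measurable
      have d: "AE \<omega> in M. real_cond_exp M ?F (\<lambda>\<omega>. 1 - indicator ?J \<omega>) \<omega> = real_cond_exp M ?F (\<lambda>_. 1) \<omega> - real_cond_exp M ?F (indicator ?J) \<omega>"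
        by (rule F.real_cond_exp_diff) (auto simp: less_top[symmetric])
      have e: "AE \<omega> in M. real_cond_exp M ?F (\<lambda>_. 1) \<omega> = 1" by (rule F.real_cond_exp_F_meas) auto
      have clk: "(LINT s:{0..b}|lborel. lam (Y i \<omega> s)) = clock b (Y i \<omega>)" for \<omega>
        unfolding clock_def by (rule set_lebesgue_integral_cong) auto
      show ?thesis
        using c d e lifetime_law[OF True, of i] AE_space
        by eventually_elim (use True me b in \<open>auto simp: E_def born_def clk\<close>)
    qed
  next
    show "?H \<in> borel_measurable (?F \<Otimes>\<^sub>M borel)"
      using g unfolding indicator_def atMost_iff by (simp add: case_prod_beta)
    show "\<bar>?H z\<bar> \<le> 1" if "z \<in> space (?F \<Otimes>\<^sub>M borel)" for z
    proof -
      have "\<bar>indicator {..age i (fst z)} (snd z) * g (fst z) (snd z)\<bar> \<le> 1"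
        using g1 by (auto split: split_indicator)
      then show ?thesis using that abs_mult_le[OF R1, of "fst z" _ 1] by (auto simp: space_pair_measure)
    qed
  qed auto
  also have "(\<integral>\<omega>. indicator E \<omega> * (\<integral>r. ?H (\<omega>, r) \<partial>lifetime_kernel (Y i \<omega>)) \<partial>M)
    = (\<integral>\<omega>. indicator E \<omega> * (R \<omega> * (LINT r:{0..age i \<omega>}|lborel. exp (- clock r (Y i \<omega>)) * lam (path_at r (Y i \<omega>)) * g \<omega> r)) \<partial>M)"
  proof (intro Bochner_Integration.integral_cong refl)
    fix \<omega> assume w: "\<omega> \<in> space M"
    have gm: "g \<omega> \<in> borel_measurable borel"
      using measurable_compose[OF measurable_Pair1'[of \<omega> ?F borel] g] w by simp
    have "Y i \<omega> \<in> rc_paths" using measurable_space[OF Y_measurable w] by simp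
    from lifetime_kernel_integral[OF this gm, of "age i \<omega>"]
    show "indicator E \<omega> * (\<integral>r. ?H (\<omega>, r) \<partial>lifetime_kernel (Y i \<omega>))
      = indicator E \<omega> * (R \<omega> * (LINT r:{0..age i \<omega>}|lborel. exp (- clock r (Y i \<omega>)) * lam (path_at r (Y i \<omega>)) * g \<omega> r))"
      by simp
  qed
  finally show ?thesis by simp
qed

text \<open>Finally, average over the motion, given everything outside the progeny of the particle.\<close>

lemma average_motion:
  assumes R: "R \<in> borel_measurable (info_outside M Y L K i)" and R1: "\<And>\<omega>. \<omega> \<in> space M \<Longrightarrow> \<bar>R \<omega>\<bar> \<le> 1"
  defines "E \<equiv> {\<omega> \<in> space M. born i \<omega>}"
  shows "(\<integral>\<omega>. indicator E \<omega> * (R \<omega> * first_branching f (picard f n) (age i \<omega>) (Y i \<omega>)) \<partial>M)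
    = (\<integral>\<omega>. indicator E \<omega> * (R \<omega> * picard f (Suc n) (age i \<omega>) (place i \<omega>)) \<partial>M)"
proof -
  let ?F = "info_outside M Y L K i"
  note [measurable] = R age_outside[of i] exists_birth_place_outside(3)[of i]
  have E: "E \<in> sets ?F" unfolding E_def by (rule born_outside)
  let ?H = "\<lambda>z. R (fst z) * first_branching f (picard f n) (age i (fst z)) (snd z)"
  have "(\<integral>\<omega>. indicator E \<omega> * (indicator (space M) \<omega> * ?H (\<omega>, Y i \<omega>)) \<partial>M)
    = (\<integral>\<omega>. indicator E \<omega> * (\<integral>w. ?H (\<omega>, w) \<partial>P (place i \<omega>)) \<partial>M)"
  proof (rule disintegration[OF subalgebra_info(1) E sets.top Y_measurable, where G="sets path_space" and A="\<lambda>_. space path_space" and C=1 and H="?H"])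
    show "(\<lambda>\<omega>. P (place i \<omega>)) \<in> ?F \<rightarrow>\<^sub>M subprob_algebra path_space" by measurable
    show "sets path_space = sigma_sets (space path_space) (sets path_space)" by (simp only: sets.sigma_sets_eq)
    show "AE \<omega> in M. \<omega> \<in> E \<longrightarrow> real_cond_exp M ?F (indicator {\<omega> \<in> space M. Y i \<omega> \<in> B}) \<omega> = measure (P (place i \<omega>)) B"
      if "B \<in> sets path_space" for B
      using motion_law[OF that, of i] by eventually_elim (auto simp: E_def born_def)
    show "?H \<in> borel_measurable (?F \<Otimes>\<^sub>M path_space)" by measurable
    show "\<bar>?H z\<bar> \<le> 1" if "z \<in> space (?F \<Otimes>\<^sub>M path_space)" for z
      using that abs_mult_le[OF R1, of "fst z" "first_branching f (picard f n) (age i (fst z)) (snd z)" 1]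
        first_branching_range[OF f_range picard_measurable[of n], of "snd z" "age i (fst z)"]
      by (auto simp: space_pair_measure)
  qed (auto simp: sets.Int_stable sets.space_closed simp del: space_path_space)
  then show ?thesis by (simp cong: Bochner_Integration.integral_cong)
qed

text \<open>The decomposition at the first branching event for a single particle: average successively over the
  number of children, the lifetime and the motion.  The factor \<open>R\<close> collects all other particles.  The
  lifetime enters through branching before time \<open>t\<close> only, since an infinite lifetime is not covered
  by a density.  Hence \<open>end_value\<close> is written as the value of a survivor plus a correction on the event
  of branching.\<close>

lemma average_particle:
  assumes R: "R \<in> borel_measurable (info_outside M Y L K i)" and R1: "\<And>\<omega>. \<omega> \<in> space M \<Longrightarrow> \<bar>R \<omega>\<bar> \<le> 1"
  shows "(\<integral>\<omega>. R \<omega> * end_value n i \<omega> \<partial>M) = (\<integral>\<omega>. R \<omega> * start_value (Suc n) i \<omega> \<partial>M)"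
proof -
  define E where "E = {\<omega> \<in> space M. born i \<omega>}"
  define D where "D = {\<omega> \<in> space M. born i \<omega> \<and> L i \<omega> \<le> ennreal (age i \<omega>)}"
  define g where "g r \<omega> = gen (path_at r (Y i \<omega>)) (picard f n (age i \<omega> - r) (path_at r (Y i \<omega>)))" for r \<omega>
  define F where "F \<omega> = f (path_at (age i \<omega>) (Y i \<omega>))" for \<omega>
  define x where "x \<omega> = path_at (enn2real (L i \<omega>)) (Y i \<omega>)" for \<omega>
  define q where "q \<omega> = picard f n (age i \<omega> - enn2real (L i \<omega>)) (x \<omega>)" for \<omega>
  note toM = measurable_from_subalg[OF subalgebra_info(1)]
  have EM [measurable]: "E \<in> sets M" using born_outside subalgebra_info(1) by (auto simp: E_def subalgebra_def)
  note [measurable] = toM[OF R] Y_measurable[of i] L_measurable[of i] K_measurable[of i] toM[OF age_outside[of i]]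
    toM[OF exists_birth_place_outside(3)]
  have DE: "D = {\<omega> \<in> space M. \<omega> \<in> E \<and> L i \<omega> \<le> ennreal (age i \<omega>)}" by (auto simp: D_def E_def)
  have DM [measurable]: "D \<in> sets M" unfolding DE by measurable
  have F_M [measurable]: "F \<in> borel_measurable M" unfolding F_def by measurable
  have g_M [measurable]: "(\<lambda>\<omega>. g (enn2real (L i \<omega>)) \<omega>) \<in> borel_measurable M" unfolding g_def by measurable
  have q_M [measurable]: "(\<lambda>\<omega>. q \<omega> ^ K i \<omega>) \<in> borel_measurable M"
  proof -
    have [measurable]: "q \<in> borel_measurable M" unfolding q_def x_def by measurable
    have "(\<lambda>\<omega>. (\<lambda>k \<omega>. q \<omega> ^ k) (K i \<omega>) \<omega>) \<in> borel_measurable M"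
      by (rule measurable_compose_countable) measurable
    then show ?thesis by simp
  qed
  have F01: "0 \<le> F \<omega> \<and> F \<omega> \<le> 1" for \<omega> using f_range by (simp add: F_def)
  have g01: "0 \<le> g r \<omega> \<and> g r \<omega> \<le> 1" for r \<omega> by (simp add: g_def)
  have gF: "\<bar>g r \<omega> - F \<omega>\<bar> \<le> 1" for r \<omega> using g01[of r \<omega>] F01[of \<omega>] by (auto simp: abs_if)
  have q01: "0 \<le> q \<omega> ^ K i \<omega> \<and> q \<omega> ^ K i \<omega> \<le> 1" if "\<omega> \<in> D" for \<omega>
  proof -
    have "0 \<le> q \<omega> \<and> q \<omega> \<le> 1" unfolding q_def using that
      by (intro picard_range) (auto simp: D_def ennreal_le_ennreal_iff_enn2real)
    then show ?thesis by (auto intro: power_le_one)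
  qed
  have bint: "integrable M (\<lambda>\<omega>. R \<omega> * h \<omega>)" if [measurable]: "h \<in> borel_measurable M" and "\<And>\<omega>. \<omega> \<in> space M \<Longrightarrow> \<bar>h \<omega>\<bar> \<le> 1" for h
  proof (rule integrable_const_bound[where B=1])
    show "AE \<omega> in M. norm (R \<omega> * h \<omega>) \<le> 1"
      using abs_mult_le[OF R1 that(2)] by (intro AE_I2) auto
  qed measurable
  have R_int: "integrable M (\<lambda>\<omega>. R \<omega> * indicator (space M - E) \<omega>)"
    by (rule bint) (auto split: split_indicator)
  have RF_int: "integrable M (\<lambda>\<omega>. R \<omega> * (indicator E \<omega> * F \<omega>))"
    using F01 by (intro bint) (auto split: split_indicator)
  have RFD_int: "integrable M (\<lambda>\<omega>. R \<omega> * (indicator D \<omega> * F \<omega>))"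
    using F01 by (intro bint) (auto split: split_indicator)
  have Rq_int: "integrable M (\<lambda>\<omega>. R \<omega> * (indicator D \<omega> * q \<omega> ^ K i \<omega>))"
    using q01 by (intro bint) (auto split: split_indicator)
  have Rg_int: "integrable M (\<lambda>\<omega>. R \<omega> * (indicator D \<omega> * g (enn2real (L i \<omega>)) \<omega>))"
    using g01 by (intro bint) (auto split: split_indicator)
  have D_sub: "D \<subseteq> E" by (auto simp: D_def E_def)
  have "(\<integral>\<omega>. R \<omega> * end_value n i \<omega> \<partial>M)
      = (\<integral>\<omega>. R \<omega> * indicator (space M - E) \<omega> + R \<omega> * (indicator E \<omega> * F \<omega>) - R \<omega> * (indicator D \<omega> * F \<omega>)
            + R \<omega> * (indicator D \<omega> * q \<omega> ^ K i \<omega>) \<partial>M)"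
    by (intro Bochner_Integration.integral_cong refl)
      (auto simp: end_value_def E_def D_def F_def q_def x_def algebra_simps not_less split: split_indicator)
  also have "\<dots> = (\<integral>\<omega>. R \<omega> * indicator (space M - E) \<omega> \<partial>M) + (\<integral>\<omega>. R \<omega> * (indicator E \<omega> * F \<omega>) \<partial>M)
      - (\<integral>\<omega>. R \<omega> * (indicator D \<omega> * F \<omega>) \<partial>M) + (\<integral>\<omega>. R \<omega> * (indicator D \<omega> * q \<omega> ^ K i \<omega>) \<partial>M)"
    using R_int RF_int RFD_int Rq_int by simp
  also have "(\<integral>\<omega>. R \<omega> * (indicator D \<omega> * q \<omega> ^ K i \<omega>) \<partial>M) = (\<integral>\<omega>. R \<omega> * (indicator D \<omega> * g (enn2real (L i \<omega>)) \<omega>) \<partial>M)"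
    using average_offspring[OF R R1, of n]
    by (simp add: D_def q_def x_def g_def mult.left_commute)
  also have "(\<integral>\<omega>. R \<omega> * indicator (space M - E) \<omega> \<partial>M) + (\<integral>\<omega>. R \<omega> * (indicator E \<omega> * F \<omega>) \<partial>M)
      - (\<integral>\<omega>. R \<omega> * (indicator D \<omega> * F \<omega>) \<partial>M) + (\<integral>\<omega>. R \<omega> * (indicator D \<omega> * g (enn2real (L i \<omega>)) \<omega>) \<partial>M)
      = (\<integral>\<omega>. R \<omega> * indicator (space M - E) \<omega> \<partial>M) + (\<integral>\<omega>. R \<omega> * (indicator E \<omega> * F \<omega>) \<partial>M)
        + (\<integral>\<omega>. R \<omega> * (indicator D \<omega> * (g (enn2real (L i \<omega>)) \<omega> - F \<omega>)) \<partial>M)"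
    using RFD_int Rg_int by (simp add: right_diff_distrib)
  also have "(\<integral>\<omega>. R \<omega> * (indicator D \<omega> * (g (enn2real (L i \<omega>)) \<omega> - F \<omega>)) \<partial>M)
      = (\<integral>\<omega>. indicator E \<omega> * (indicator {\<omega> \<in> space M. L i \<omega> < \<infinity>} \<omega> * (R \<omega> * (indicator {..age i \<omega>} (enn2real (L i \<omega>)) * (g (enn2real (L i \<omega>)) \<omega> - F \<omega>)))) \<partial>M)"
    by (intro Bochner_Integration.integral_cong refl)
      (auto simp: E_def D_def ennreal_le_ennreal_iff_enn2real split: split_indicator)
  also have "\<dots> = (\<integral>\<omega>. indicator E \<omega> * (R \<omega> * (LINT r:{0..age i \<omega>}|lborel. exp (- clock r (Y i \<omega>)) * lam (path_at r (Y i \<omega>)) * (g r \<omega> - F \<omega>))) \<partial>M)"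
    unfolding E_def
  proof (rule average_lifetime[OF R R1, of "\<lambda>\<omega> r. g r \<omega> - F \<omega>"])
    note [measurable] = motion_measurable[of i] age_outside[of i, THEN outside_to_motion]
    show "(\<lambda>(\<omega>, r). g r \<omega> - F \<omega>) \<in> borel_measurable (info_motion M Y L K i \<Otimes>\<^sub>M borel)"
      unfolding g_def F_def case_prod_beta by measurable
  qed (use gF in auto)
  also have "(\<integral>\<omega>. R \<omega> * indicator (space M - E) \<omega> \<partial>M) + (\<integral>\<omega>. R \<omega> * (indicator E \<omega> * F \<omega>) \<partial>M) + \<dots>
      = (\<integral>\<omega>. R \<omega> * indicator (space M - E) \<omega> \<partial>M) + (\<integral>\<omega>. indicator E \<omega> * (R \<omega> * first_branching f (picard f n) (age i \<omega>) (Y i \<omega>)) \<partial>M)"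
  proof -
    let ?I = "\<lambda>\<omega>. LINT r:{0..age i \<omega>}|lborel. exp (- clock r (Y i \<omega>)) * lam (path_at r (Y i \<omega>)) * (g r \<omega> - F \<omega>)"
    have fb: "first_branching f (picard f n) (age i \<omega>) (Y i \<omega>) = F \<omega> + ?I \<omega>" if "\<omega> \<in> space M" for \<omega>
    proof -
      have w: "Y i \<omega> \<in> rc_paths" using measurable_space[OF Y_measurable that] by simp
      have "?I \<omega> = (LINT r:{0..age i \<omega>}|lborel. exp (- clock r (Y i \<omega>)) * lam (path_at r (Y i \<omega>)) * g r \<omega>
          - exp (- clock r (Y i \<omega>)) * lam (path_at r (Y i \<omega>)) * F \<omega>)"
        by (simp add: right_diff_distrib)
      also have "\<dots> = (LINT r:{0..age i \<omega>}|lborel. exp (- clock r (Y i \<omega>)) * lam (path_at r (Y i \<omega>)) * g r \<omega>)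
          - (LINT r:{0..age i \<omega>}|lborel. exp (- clock r (Y i \<omega>)) * lam (path_at r (Y i \<omega>)) * F \<omega>)"
        unfolding g_def using integrand_integrable[OF picard_measurable w] branching_density_integrable[OF w]
        by (intro set_integral_diff(2) set_integrable_mult_left)
      also have "(LINT r:{0..age i \<omega>}|lborel. exp (- clock r (Y i \<omega>)) * lam (path_at r (Y i \<omega>)) * F \<omega>) = (1 - exp (- clock (age i \<omega>) (Y i \<omega>))) * F \<omega>"
        using exp_clock_primitive[OF w age_nonneg] by simp
      finally show ?thesis by (simp add: first_branching_def F_def g_def algebra_simps)
    qed
    have fb_int: "integrable M (\<lambda>\<omega>. R \<omega> * (indicator E \<omega> * first_branching f (picard f n) (age i \<omega>) (Y i \<omega>)))"
    proof (rule bint)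
      fix \<omega> assume "\<omega> \<in> space M"
      then have "Y i \<omega> \<in> rc_paths" using measurable_space[OF Y_measurable] by force
      from first_branching_range[OF f_range picard_measurable this age_nonneg]
      show "\<bar>indicator E \<omega> * first_branching f (picard f n) (age i \<omega>) (Y i \<omega>)\<bar> \<le> 1" by (auto split: split_indicator)
    qed measurable
    have I_int: "integrable M (\<lambda>\<omega>. indicator E \<omega> * (R \<omega> * ?I \<omega>))"
    proof (subst Bochner_Integration.integrable_cong[OF refl])
      show "integrable M (\<lambda>\<omega>. R \<omega> * (indicator E \<omega> * first_branching f (picard f n) (age i \<omega>) (Y i \<omega>)) - R \<omega> * (indicator E \<omega> * F \<omega>))"
        using fb_int RF_int by (rule Bochner_Integration.integrable_diff)
    qed (simp add: fb algebra_simps)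
    have "(\<integral>\<omega>. indicator E \<omega> * (R \<omega> * first_branching f (picard f n) (age i \<omega>) (Y i \<omega>)) \<partial>M)
        = (\<integral>\<omega>. R \<omega> * (indicator E \<omega> * F \<omega>) + indicator E \<omega> * (R \<omega> * ?I \<omega>) \<partial>M)"
      by (intro Bochner_Integration.integral_cong refl) (simp add: fb algebra_simps)
    also have "\<dots> = (\<integral>\<omega>. R \<omega> * (indicator E \<omega> * F \<omega>) \<partial>M) + (\<integral>\<omega>. indicator E \<omega> * (R \<omega> * ?I \<omega>) \<partial>M)"
      using RF_int I_int by (rule Bochner_Integration.integral_add)
    finally show ?thesis by simp
  qed
  also have "(\<integral>\<omega>. indicator E \<omega> * (R \<omega> * first_branching f (picard f n) (age i \<omega>) (Y i \<omega>)) \<partial>M)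
      = (\<integral>\<omega>. indicator E \<omega> * (R \<omega> * picard f (Suc n) (age i \<omega>) (place i \<omega>)) \<partial>M)"
    unfolding E_def by (rule average_motion[OF R R1])
  also have "(\<integral>\<omega>. R \<omega> * indicator (space M - E) \<omega> \<partial>M) + \<dots> = (\<integral>\<omega>. R \<omega> * start_value (Suc n) i \<omega> \<partial>M)"
  proof -
    have "integrable M (\<lambda>\<omega>. R \<omega> * (indicator E \<omega> * picard f (Suc n) (age i \<omega>) (place i \<omega>)))"
    proof (rule bint)
      have "(\<lambda>\<omega>. case (age i \<omega>, place i \<omega>) of (s, x) \<Rightarrow> picard f (Suc n) s x) \<in> borel_measurable M"
        by (rule measurable_compose[OF _ picard_measurable]) measurable
      then have [measurable]: "(\<lambda>\<omega>. picard f (Suc n) (age i \<omega>) (place i \<omega>)) \<in> borel_measurable M" by simp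
      show "(\<lambda>\<omega>. indicator E \<omega> * picard f (Suc n) (age i \<omega>) (place i \<omega>)) \<in> borel_measurable M" by measurable
      show "\<bar>indicator E \<omega> * picard f (Suc n) (age i \<omega>) (place i \<omega>)\<bar> \<le> 1" for \<omega>
        using picard_range[of "age i \<omega>" "Suc n" "place i \<omega>"] by (auto split: split_indicator simp del: picard.simps)
    qed
    then have "integrable M (\<lambda>\<omega>. indicator E \<omega> * (R \<omega> * picard f (Suc n) (age i \<omega>) (place i \<omega>)))"
      by (simp add: mult.left_commute del: picard.simps)
    from Bochner_Integration.integral_add[OF R_int this, symmetric]
    show ?thesis
      by (simp only:) (intro Bochner_Integration.integral_cong refl; auto simp: start_value_def E_def split: split_indicator simp del: picard.simps)
  qed
  finally show ?thesis .
qed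

section \<open>Averaging over the generations\<close>

lemma birth_finite: "birth i \<omega> \<le> ennreal t \<Longrightarrow> birth i \<omega> = ennreal (t - age i \<omega>) \<and> age i \<omega> \<le> t"
  using t_nonneg by (cases "birth i \<omega>" rule: ennreal_cases) (auto simp: age_def top_unique)

lemma birth_add_le_iff:
  assumes "birth i \<omega> \<le> ennreal t"
  shows "birth i \<omega> + L i \<omega> \<le> ennreal t \<longleftrightarrow> L i \<omega> \<le> ennreal (age i \<omega>)"
proof -
  have b: "birth i \<omega> = ennreal (t - age i \<omega>)" "age i \<omega> \<le> t" using birth_finite[OF assms] by auto
  then have "ennreal t = birth i \<omega> + ennreal (age i \<omega>)" by (simp add: ennreal_plus[symmetric] del: ennreal_plus)
  then show ?thesis using b by (simp add: ennreal_add_left_cancel_le)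
qed

lemma alive_iff: "i \<in> alive L K t \<omega> \<longleftrightarrow> born i \<omega> \<and> ennreal (age i \<omega>) < L i \<omega>"
  using birth_add_le_iff[of i \<omega>] unfolding alive_def born_def by (auto simp: not_le[symmetric])

lemma position_alive:
  assumes "i \<in> alive L K t \<omega>"
  shows "position Y L i t \<omega> = path_at (age i \<omega>) (Y i \<omega>)"
proof -
  have "birth i \<omega> \<le> ennreal t" using assms by (simp add: alive_def)
  from birth_finite[OF this] show ?thesis by (simp add: position_def)
qed

definition survivor_value :: "nat list \<Rightarrow> 'w \<Rightarrow> real" where
  "survivor_value i \<omega> = f (path_at (age i \<omega>) (Y i \<omega>))"

definition generation :: "nat \<Rightarrow> 'w \<Rightarrow> nat list set" where
  "generation k \<omega> = {i. length i = k \<and> exists_p i \<omega>}"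

definition survivors_before :: "nat \<Rightarrow> 'w \<Rightarrow> nat list set" where
  "survivors_before k \<omega> = {i. length i < k \<and> i \<in> alive L K t \<omega>}"

lemma generation_0: "generation 0 \<omega> = {[]}"
  by (auto simp: generation_def)

lemma generation_Suc:
  "generation (Suc k) \<omega> = (\<lambda>(i, j). j # i) ` (SIGMA i:{i \<in> generation k \<omega>. L i \<omega> < \<infinity>}. {..<K i \<omega>})"
proof (intro set_eqI iffI)
  fix i assume "i \<in> generation (Suc k) \<omega>"
  then obtain j i' where "i = j # i'" "length i' = k" "exists_p (j # i') \<omega>"
    by (cases i) (auto simp: generation_def)
  then show "i \<in> (\<lambda>(i, j). j # i) ` (SIGMA i:{i \<in> generation k \<omega>. L i \<omega> < \<infinity>}. {..<K i \<omega>})"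
    by (intro image_eqI[of _ _ "(i', j)"]) (auto simp: generation_def)
qed (auto simp: generation_def)

lemma finite_generation: "finite (generation k \<omega>)"
proof (induction k)
  case (Suc k)
  then show ?case unfolding generation_Suc by (intro finite_imageI finite_SigmaI) auto
qed (simp add: generation_0)

lemma survivors_before_Suc:
  "survivors_before (Suc k) \<omega> = survivors_before k \<omega> \<union> {i \<in> generation k \<omega>. i \<in> alive L K t \<omega>}"
  by (auto simp: survivors_before_def generation_def alive_def less_Suc_eq)

lemma finite_survivors_before: "finite (survivors_before k \<omega>)"
  by (induction k) (auto simp: survivors_before_Suc finite_generation, simp add: survivors_before_def)

lemma start_value_range: "0 \<le> start_value n i \<omega> \<and> start_value n i \<omega> \<le> 1"
  using picard_range[OF age_nonneg] by (auto simp: start_value_def)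

lemma end_value_range: "0 \<le> end_value n i \<omega> \<and> end_value n i \<omega> \<le> 1"
proof -
  have "0 \<le> picard f n (age i \<omega> - enn2real (L i \<omega>)) x \<and> picard f n (age i \<omega> - enn2real (L i \<omega>)) x \<le> 1"
    if "\<not> ennreal (age i \<omega>) < L i \<omega>" for x
    using that by (intro picard_range) (auto simp: not_less ennreal_le_ennreal_iff_enn2real)
  then show ?thesis using f_range by (auto simp: end_value_def intro: power_le_one)
qed

lemma survivor_value_range: "0 \<le> survivor_value i \<omega> \<and> survivor_value i \<omega> \<le> 1"
  using f_range by (simp add: survivor_value_def)

lemma start_value_child:
  assumes "exists_p i \<omega>" "L i \<omega> < \<infinity>" "j < K i \<omega>"
  shows "start_value n (j # i) \<omega> = (if born i \<omega> \<and> L i \<omega> \<le> ennreal (age i \<omega>)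
    then picard f n (age i \<omega> - enn2real (L i \<omega>)) (path_at (enn2real (L i \<omega>)) (Y i \<omega>)) else 1)"
proof (cases "birth i \<omega> \<le> ennreal t")
  case True
  have b: "birth i \<omega> = ennreal (t - age i \<omega>)" "age i \<omega> \<le> t" using birth_finite[OF True] by auto
  have born: "born (j # i) \<omega> \<longleftrightarrow> L i \<omega> \<le> ennreal (age i \<omega>)"
    using birth_add_le_iff[OF True] assms by (simp add: born_def)
  show ?thesis
  proof (cases "L i \<omega> \<le> ennreal (age i \<omega>)")
    case le: True
    then have "enn2real (L i \<omega>) \<le> age i \<omega>" by (simp add: ennreal_le_ennreal_iff_enn2real)
    moreover have "enn2real (birth (j # i) \<omega>) = t - age i \<omega> + enn2real (L i \<omega>)"
      using b assms(2) by (cases "L i \<omega>" rule: ennreal_cases) (auto simp: ennreal_plus[symmetric] simp del: ennreal_plus)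
    ultimately have "age (j # i) \<omega> = age i \<omega> - enn2real (L i \<omega>)" unfolding age_def[of "j # i"] by simp
    then show ?thesis using le born True assms by (simp add: start_value_def born_def)
  qed (use born in \<open>auto simp: start_value_def\<close>)
next
  case False
  then have "\<not> born i \<omega>" "\<not> born (j # i) \<omega>"
    by (auto simp: born_def not_le intro: less_le_trans)
  then show ?thesis by (simp add: start_value_def)
qed

text \<open>A particle born by time \<open>t\<close> is either alive then, or has died and is replaced by its children.
  A lifetime that ends after \<open>t\<close> yields children with the neutral factor 1.\<close>

lemma end_value_split:
  assumes "exists_p i \<omega>"
  shows "end_value n i \<omega> = (if i \<in> alive L K t \<omega> then survivor_value i \<omega> else 1)
     * (if L i \<omega> < \<infinity> then \<Prod>j<K i \<omega>. start_value n (j # i) \<omega> else 1)"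
proof (cases "L i \<omega> < \<infinity>")
  case True
  then show ?thesis using assms
    by (auto simp: end_value_def alive_iff survivor_value_def start_value_child not_less)
next
  case False
  then have "L i \<omega> = \<infinity>" by (simp add: less_top[symmetric])
  then show ?thesis by (auto simp: end_value_def alive_iff survivor_value_def)
qed

lemma next_generation:
  "(\<Prod>i\<in>survivors_before k \<omega>. survivor_value i \<omega>) * (\<Prod>i\<in>generation k \<omega>. end_value n i \<omega>)
   = (\<Prod>i\<in>survivors_before (Suc k) \<omega>. survivor_value i \<omega>) * (\<Prod>i\<in>generation (Suc k) \<omega>. start_value n i \<omega>)"
proof -
  let ?G = "generation k \<omega>"
  have "(\<Prod>i\<in>?G. end_value n i \<omega>) = (\<Prod>i\<in>?G. if i \<in> alive L K t \<omega> then survivor_value i \<omega> else 1)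
      * (\<Prod>i\<in>?G. if L i \<omega> < \<infinity> then \<Prod>j<K i \<omega>. start_value n (j # i) \<omega> else 1)"
    unfolding prod.distrib[symmetric] by (intro prod.cong end_value_split) (auto simp: generation_def)
  also have "(\<Prod>i\<in>?G. if i \<in> alive L K t \<omega> then survivor_value i \<omega> else 1)
      = (\<Prod>i\<in>{i \<in> ?G. i \<in> alive L K t \<omega>}. survivor_value i \<omega>)"
    using finite_generation by (simp add: prod.inter_filter)
  also have "(\<Prod>i\<in>?G. if L i \<omega> < \<infinity> then \<Prod>j<K i \<omega>. start_value n (j # i) \<omega> else 1)
      = (\<Prod>i\<in>{i \<in> ?G. L i \<omega> < \<infinity>}. \<Prod>j<K i \<omega>. start_value n (j # i) \<omega>)"
    using finite_generation by (simp add: prod.inter_filter)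
  also have "\<dots> = (\<Prod>(i, j)\<in>(SIGMA i:{i \<in> ?G. L i \<omega> < \<infinity>}. {..<K i \<omega>}). start_value n (j # i) \<omega>)"
    using finite_generation by (intro prod.Sigma) auto
  also have "\<dots> = (\<Prod>i\<in>generation (Suc k) \<omega>. start_value n i \<omega>)"
    unfolding generation_Suc by (subst prod.reindex) (auto simp: inj_on_def case_prod_beta)
  finally have 1: "(\<Prod>i\<in>?G. end_value n i \<omega>) = (\<Prod>i\<in>{i \<in> ?G. i \<in> alive L K t \<omega>}. survivor_value i \<omega>)
      * (\<Prod>i\<in>generation (Suc k) \<omega>. start_value n i \<omega>)" .
  have 2: "(\<Prod>i\<in>survivors_before (Suc k) \<omega>. survivor_value i \<omega>)
      = (\<Prod>i\<in>survivors_before k \<omega>. survivor_value i \<omega>) * (\<Prod>i\<in>{i \<in> ?G. i \<in> alive L K t \<omega>}. survivor_value i \<omega>)"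
    unfolding survivors_before_Suc
  proof (rule prod.union_disjoint)
    show "survivors_before k \<omega> \<inter> {i \<in> ?G. i \<in> alive L K t \<omega>} = {}"
      by (auto simp: survivors_before_def generation_def)
  qed (simp_all add: finite_survivors_before finite_generation)
  show ?thesis unfolding 1 2 by (simp only: mult.assoc)
qed

lemma particle_measurable:
  assumes Y: "\<And>k. suffix k i \<Longrightarrow> Y k \<in> N \<rightarrow>\<^sub>M path_space"
    and L: "\<And>k. suffix k i \<Longrightarrow> L k \<in> borel_measurable N"
    and K: "\<And>k. suffix k i \<Longrightarrow> K k \<in> N \<rightarrow>\<^sub>M count_space UNIV"
  shows "Measurable.pred N (exists_p i)" "Measurable.pred N (\<lambda>\<omega>. i \<in> alive L K t \<omega>)"
    "start_value n i \<in> borel_measurable N" "end_value n i \<in> borel_measurable N"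
    "survivor_value i \<in> borel_measurable N"
proof -
  have "Measurable.pred N (exists_p i) \<and> birth i \<in> borel_measurable N \<and> place i \<in> N \<rightarrow>\<^sub>M borel"
    using assms by (intro ancestors_measurable) (auto simp: strict_suffix_def)
  then have ex [measurable]: "Measurable.pred N (exists_p i)"
    and [measurable]: "birth i \<in> borel_measurable N" "place i \<in> N \<rightarrow>\<^sub>M borel" by auto
  show "Measurable.pred N (exists_p i)" by (rule ex)
  note [measurable] = Y[OF suffix_order.refl] L[OF suffix_order.refl] K[OF suffix_order.refl]
  have age [measurable]: "age i \<in> borel_measurable N" unfolding age_def by measurable
  have born [measurable]: "Measurable.pred N (born i)" unfolding born_def by measurable
  show "Measurable.pred N (\<lambda>\<omega>. i \<in> alive L K t \<omega>)" unfolding alive_iff by measurable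
  have picard_meas: "(\<lambda>\<omega>. picard f n (s \<omega>) (x \<omega>)) \<in> borel_measurable N"
    if [measurable]: "s \<in> borel_measurable N" "x \<in> N \<rightarrow>\<^sub>M borel" for s x
  proof -
    have "(\<lambda>\<omega>. case (s \<omega>, x \<omega>) of (s, x) \<Rightarrow> picard f n s x) \<in> borel_measurable N"
      by (rule measurable_compose[OF _ picard_measurable]) measurable
    then show ?thesis by simp
  qed
  note [measurable] = picard_meas
  show "start_value n i \<in> borel_measurable N" unfolding start_value_def by measurable
  show "survivor_value i \<in> borel_measurable N" unfolding survivor_value_def by measurable
  let ?q = "\<lambda>\<omega>. picard f n (age i \<omega> - enn2real (L i \<omega>)) (path_at (enn2real (L i \<omega>)) (Y i \<omega>))"
  have [measurable]: "?q \<in> borel_measurable N" by measurable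
  have "(\<lambda>\<omega>. (\<lambda>k \<omega>. ?q \<omega> ^ k) (K i \<omega>) \<omega>) \<in> borel_measurable N"
    by (rule measurable_compose_countable) measurable
  then have [measurable]: "(\<lambda>\<omega>. ?q \<omega> ^ K i \<omega>) \<in> borel_measurable N" by simp
  show "end_value n i \<in> borel_measurable N" unfolding end_value_def by measurable
qed

lemma particle_measurable_M:
  "Measurable.pred M (exists_p i)" "Measurable.pred M (\<lambda>\<omega>. i \<in> alive L K t \<omega>)"
  "start_value n i \<in> borel_measurable M" "end_value n i \<in> borel_measurable M"
  "survivor_value i \<in> borel_measurable M"
  by (intro particle_measurable Y_measurable L_measurable K_measurable)+

lemma particle_measurable_outside:
  fixes i i' :: "nat list"
  assumes "length i \<le> length i'" "i \<noteq> i'"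
  defines "N \<equiv> info_outside M Y L K i'"
  shows "Measurable.pred N (exists_p i)" "Measurable.pred N (\<lambda>\<omega>. i \<in> alive L K t \<omega>)"
    "start_value n i \<in> borel_measurable N" "end_value n i \<in> borel_measurable N"
    "survivor_value i \<in> borel_measurable N"
proof -
  have s: "\<not> suffix i' k" if "suffix k i" for k
  proof
    assume "suffix i' k"
    then have "suffix i' i" using that by (rule suffix_order.trans)
    then have "i' = i" using assms(1) by (metis suffix_def append_eq_append_conv append_Nil le_antisym suffix_length_le)
    then show False using assms(2) by simp
  qed
  show "Measurable.pred N (exists_p i)" "Measurable.pred N (\<lambda>\<omega>. i \<in> alive L K t \<omega>)"
    "start_value n i \<in> borel_measurable N" "end_value n i \<in> borel_measurable N"
    "survivor_value i \<in> borel_measurable N"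
    unfolding N_def by (intro particle_measurable info_outside_coordinates s; assumption)+
qed

text \<open>Generation \<open>k\<close> is the current frontier.  Of its particles, those in \<open>T\<close> have already been exposed
  up to their end.\<close>

definition mixed :: "nat list set \<Rightarrow> nat \<Rightarrow> nat \<Rightarrow> 'w \<Rightarrow> real" where
  "mixed T k n \<omega> = (\<Prod>i\<in>survivors_before k \<omega>. survivor_value i \<omega>)
     * (\<Prod>i\<in>generation k \<omega>. if i \<in> T then end_value n i \<omega> else start_value (Suc n) i \<omega>)"

lemma mixed_range: "0 \<le> mixed T k n \<omega> \<and> mixed T k n \<omega> \<le> 1"
proof -
  have "0 \<le> (\<Prod>i\<in>survivors_before k \<omega>. survivor_value i \<omega>) \<and> (\<Prod>i\<in>survivors_before k \<omega>. survivor_value i \<omega>) \<le> 1"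
    by (intro prod_unit_interval survivor_value_range)
  moreover have "0 \<le> (\<Prod>i\<in>generation k \<omega>. if i \<in> T then end_value n i \<omega> else start_value (Suc n) i \<omega>) \<and>
    (\<Prod>i\<in>generation k \<omega>. if i \<in> T then end_value n i \<omega> else start_value (Suc n) i \<omega>) \<le> 1"
    using end_value_range start_value_range by (intro prod_unit_interval) (auto simp del: start_value_def)
  ultimately show ?thesis unfolding mixed_def by (auto intro: mult_le_one)
qed

lemma mixed_measurable: "mixed T k n \<in> borel_measurable M"
proof -
  note [measurable] = particle_measurable_M
  have "(\<lambda>\<omega>. \<Prod>i\<in>survivors_before k \<omega>. survivor_value i \<omega>) \<in> borel_measurable M"
    by (rule measurable_random_prod[where I=UNIV]) (auto simp: survivors_before_def)
  moreover have "(\<lambda>\<omega>. \<Prod>i\<in>generation k \<omega>. if i \<in> T then end_value n i \<omega> else start_value (Suc n) i \<omega>) \<in> borel_measurable M"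
  proof (rule measurable_random_prod[where I=UNIV])
    fix i show "(\<lambda>\<omega>. if i \<in> T then end_value n i \<omega> else start_value (Suc n) i \<omega>) \<in> borel_measurable M"
      by (cases "i \<in> T") auto
  qed (auto simp: generation_def)
  ultimately show ?thesis unfolding mixed_def by measurable
qed

text \<open>All other factors are determined by particles that do not descend from \<open>i\<close>, because their labels
  are different from \<open>i\<close> and not longer.\<close>

lemma mixed_insert:
  assumes i: "length i = k" "i \<notin> T"
  shows "(\<integral>\<omega>. mixed (insert i T) k n \<omega> \<partial>M) = (\<integral>\<omega>. mixed T k n \<omega> \<partial>M)"
proof -
  let ?v = "\<lambda>j \<omega>. if j \<in> T then end_value n j \<omega> else start_value (Suc n) j \<omega>"
  define R where "R \<omega> = (\<Prod>j\<in>survivors_before k \<omega>. survivor_value j \<omega>) * (\<Prod>j\<in>generation k \<omega> - {i}. ?v j \<omega>)" for \<omega>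
  have R: "R \<in> borel_measurable (info_outside M Y L K i)"
  proof -
    have "(\<lambda>\<omega>. \<Prod>j\<in>survivors_before k \<omega>. survivor_value j \<omega>) \<in> borel_measurable (info_outside M Y L K i)"
    proof (rule measurable_random_prod[where I="{j. length j < k}"])
      fix j :: "nat list" assume j: "j \<in> {j. length j < k}"
      then have j': "length j \<le> length i" "j \<noteq> i" using i by auto
      from particle_measurable_outside(2,5)[OF j'] j
      show "Measurable.pred (info_outside M Y L K i) (\<lambda>\<omega>. j \<in> survivors_before k \<omega>)"
        "survivor_value j \<in> borel_measurable (info_outside M Y L K i)"
        by (auto simp: survivors_before_def)
    qed (auto simp: survivors_before_def)
    moreover have "(\<lambda>\<omega>. \<Prod>j\<in>generation k \<omega> - {i}. ?v j \<omega>) \<in> borel_measurable (info_outside M Y L K i)"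
    proof (rule measurable_random_prod[where I="{j. length j = k \<and> j \<noteq> i}"])
      fix j :: "nat list" assume j: "j \<in> {j. length j = k \<and> j \<noteq> i}"
      then have j': "length j \<le> length i" "j \<noteq> i" using i by auto
      from particle_measurable_outside(1,3,4)[OF j'] j
      show "Measurable.pred (info_outside M Y L K i) (\<lambda>\<omega>. j \<in> generation k \<omega> - {i})"
        "?v j \<in> borel_measurable (info_outside M Y L K i)"
        by (auto simp: generation_def)
    qed (auto simp: generation_def)
    ultimately show ?thesis unfolding R_def by measurable
  qed
  have R01: "0 \<le> R \<omega> \<and> R \<omega> \<le> 1" for \<omega>
  proof -
    have "0 \<le> (\<Prod>i\<in>survivors_before k \<omega>. survivor_value i \<omega>) \<and> (\<Prod>i\<in>survivors_before k \<omega>. survivor_value i \<omega>) \<le> 1"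
      by (intro prod_unit_interval survivor_value_range)
    moreover have "0 \<le> (\<Prod>j\<in>generation k \<omega> - {i}. ?v j \<omega>) \<and> (\<Prod>j\<in>generation k \<omega> - {i}. ?v j \<omega>) \<le> 1"
      using end_value_range start_value_range by (intro prod_unit_interval) auto
    ultimately show ?thesis unfolding R_def by (auto intro: mult_le_one)
  qed
  \<comment> \<open>If \<open>i\<close> does not occur in the tree, its factor is 1 and may be split off all the same.\<close>
  have split: "(\<Prod>j\<in>generation k \<omega>. h j) = h i * (\<Prod>j\<in>generation k \<omega> - {i}. h j)" if "i \<notin> generation k \<omega> \<Longrightarrow> h i = 1" for h :: "nat list \<Rightarrow> real" and \<omega>
  proof (cases "i \<in> generation k \<omega>")
    case True
    then show ?thesis using finite_generation by (intro prod.remove) auto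
  qed (use that in auto)
  have out: "end_value n' i \<omega> = 1" "start_value n' i \<omega> = 1" if "i \<notin> generation k \<omega>" for \<omega> n'
    using that i by (auto simp: generation_def end_value_def start_value_def born_def)
  have "mixed (insert i T) k n \<omega> = R \<omega> * end_value n i \<omega>" for \<omega>
  proof -
    have "(\<Prod>j\<in>generation k \<omega>. if j \<in> insert i T then end_value n j \<omega> else start_value (Suc n) j \<omega>)
        = end_value n i \<omega> * (\<Prod>j\<in>generation k \<omega> - {i}. if j \<in> insert i T then end_value n j \<omega> else start_value (Suc n) j \<omega>)"
      by (subst split) (auto simp: out)
    also have "(\<Prod>j\<in>generation k \<omega> - {i}. if j \<in> insert i T then end_value n j \<omega> else start_value (Suc n) j \<omega>) = (\<Prod>j\<in>generation k \<omega> - {i}. ?v j \<omega>)"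
      by (intro prod.cong) auto
    finally show ?thesis by (simp add: mixed_def R_def)
  qed
  moreover have "mixed T k n \<omega> = R \<omega> * start_value (Suc n) i \<omega>" for \<omega>
    unfolding mixed_def R_def by (subst split) (auto simp: out i)
  ultimately show ?thesis using average_particle[OF R, of n] R01 by simp
qed

lemma mixed_finite:
  assumes "finite T" "\<And>i. i \<in> T \<Longrightarrow> length i = k"
  shows "(\<integral>\<omega>. mixed T k n \<omega> \<partial>M) = (\<integral>\<omega>. mixed {} k n \<omega> \<partial>M)"
  using assms by (induction T rule: finite_induct) (auto simp: mixed_insert)

text \<open>There are infinitely many labels of length \<open>k\<close>, but only finitely many of them occur in a given
  tree.  Exposing the labels in the order of an enumeration therefore becomes stationary pointwise.\<close>

lemma mixed_all: "(\<integral>\<omega>. mixed UNIV k n \<omega> \<partial>M) = (\<integral>\<omega>. mixed {} k n \<omega> \<partial>M)"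
proof (rule LIMSEQ_unique)
  define T where "T N = {i :: nat list. to_nat i < N \<and> length i = k}" for N
  have fT: "finite (T N)" for N
  proof (rule finite_subset)
    show "T N \<subseteq> to_nat -` {..<N}" by (auto simp: T_def)
    show "finite (to_nat -` {..<N} :: nat list set)" by (rule finite_vimageI[OF finite_lessThan inj_to_nat])
  qed
  show "(\<lambda>N. \<integral>\<omega>. mixed (T N) k n \<omega> \<partial>M) \<longlonglongrightarrow> (\<integral>\<omega>. mixed UNIV k n \<omega> \<partial>M)"
  proof (rule integral_dominated_convergence[where w="\<lambda>_. 1"])
    show "AE \<omega> in M. (\<lambda>N. mixed (T N) k n \<omega>) \<longlonglongrightarrow> mixed UNIV k n \<omega>"
    proof (intro AE_I2 tendsto_eventually)
      fix \<omega>
      have "finite (to_nat ` generation k \<omega>)" by (simp add: finite_generation)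
      then obtain N where N: "\<forall>j\<in>to_nat ` generation k \<omega>. j < N" using finite_nat_set_iff_bounded by metis
      have "mixed (T N') k n \<omega> = mixed UNIV k n \<omega>" if "N \<le> N'" for N'
        unfolding mixed_def using N that
        by (intro arg_cong[where f="\<lambda>x. _ * x"] prod.cong) (force simp: T_def generation_def)+
      then show "\<forall>\<^sub>F N in sequentially. mixed (T N) k n \<omega> = mixed UNIV k n \<omega>"
        by (intro eventually_sequentiallyI[of N])
    qed
    show "AE \<omega> in M. norm (mixed (T N) k n \<omega>) \<le> 1" for N
    proof (rule AE_I2)
      fix \<omega> show "norm (mixed (T N) k n \<omega>) \<le> 1"
        using mixed_range[of "T N" k n \<omega>] unfolding real_norm_def by linarith
    qed
  qed (auto simp: mixed_measurable)
  show "(\<lambda>N. \<integral>\<omega>. mixed (T N) k n \<omega> \<partial>M) \<longlonglongrightarrow> (\<integral>\<omega>. mixed {} k n \<omega> \<partial>M)"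
    using mixed_finite[OF fT] by (simp add: T_def)
qed

text \<open>The product with all progeny of generation \<open>k\<close> averaged out.  Its mean depends on \<open>k + n\<close> only:
  for \<open>k = 0\<close> it is the Picard iterate, and for \<open>n = 0\<close> it is the product itself, killed when
  generation \<open>k\<close> is reached.\<close>

definition frontier :: "nat \<Rightarrow> nat \<Rightarrow> 'w \<Rightarrow> real" where
  "frontier k n \<omega> = (\<Prod>i\<in>survivors_before k \<omega>. survivor_value i \<omega>) * (\<Prod>i\<in>generation k \<omega>. start_value n i \<omega>)"

lemma frontier_step: "(\<integral>\<omega>. frontier k (Suc n) \<omega> \<partial>M) = (\<integral>\<omega>. frontier (Suc k) n \<omega> \<partial>M)"
  using mixed_all[of k n] unfolding mixed_def frontier_def by (simp add: next_generation)

lemma frontier_all: "(\<integral>\<omega>. frontier k n \<omega> \<partial>M) = (\<integral>\<omega>. frontier (k + n) 0 \<omega> \<partial>M)"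
proof (induction n arbitrary: k)
  case (Suc n)
  show ?case using frontier_step[of k n] Suc[of "Suc k"] by simp
qed simp

lemma frontier_root: "(\<integral>\<omega>. frontier 0 n \<omega> \<partial>M) = picard f n t x0"
proof -
  have "frontier 0 n \<omega> = picard f n t x0" for \<omega>
    using t_nonneg by (simp add: frontier_def generation_0 survivors_before_def start_value_def born_def age_def)
  then show ?thesis by (simp add: prob_space)
qed

definition no_births :: "nat \<Rightarrow> 'w \<Rightarrow> real" where
  "no_births n \<omega> = (if \<exists>i\<in>generation n \<omega>. born i \<omega> then 0 else 1)"

lemma frontier_no_births: "frontier n 0 \<omega> = (\<Prod>i\<in>survivors_before n \<omega>. survivor_value i \<omega>) * no_births n \<omega>"
proof -
  have "(\<Prod>i\<in>generation n \<omega>. start_value 0 i \<omega>) = no_births n \<omega>"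
    using finite_generation by (auto simp: no_births_def start_value_def intro!: prod.neutral)
  then show ?thesis by (simp add: frontier_def)
qed

lemma born_ancestor:
  assumes "born i \<omega>" "n \<le> length i"
  shows "\<exists>i'\<in>generation n \<omega>. born i' \<omega>"
  using assms
proof (induction i)
  case (Cons j i)
  show ?case
  proof (cases "n = length (j # i)")
    case True
    then show ?thesis using Cons.prems by (intro bexI[of _ "j # i"]) (auto simp: generation_def born_def)
  next
    case False
    have "birth i \<omega> \<le> birth i \<omega> + L i \<omega>" by simp
    then have "born i \<omega>" using Cons.prems order_trans[of "birth i \<omega>" "birth i \<omega> + L i \<omega>" "ennreal t"]
      unfolding born_def by simp
    then show ?thesis using Cons False by auto
  qed
qed (auto simp: generation_def)

definition total_value :: "'w \<Rightarrow> real" where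
  "total_value \<omega> = (\<Prod>i\<in>alive L K t \<omega>. f (position Y L i t \<omega>))"

lemma total_value_eq: "total_value \<omega> = (\<Prod>i\<in>alive L K t \<omega>. survivor_value i \<omega>)"
  unfolding total_value_def by (intro prod.cong) (auto simp: position_alive survivor_value_def)

lemma total_value_range: "0 \<le> total_value \<omega> \<and> total_value \<omega> \<le> 1"
  unfolding total_value_eq by (intro prod_unit_interval survivor_value_range)

lemma total_value_measurable: "total_value \<in> borel_measurable M"
  unfolding total_value_eq using particle_measurable_M
  by (intro measurable_random_prod[where I=UNIV]) auto

lemma total_value_frontier: "\<bar>total_value \<omega> - frontier n 0 \<omega>\<bar> \<le> 1 - no_births n \<omega>"
proof (cases "\<exists>i\<in>generation n \<omega>. born i \<omega>")
  case True
  then show ?thesis using total_value_range[of \<omega>] by (simp add: frontier_no_births no_births_def)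
next
  case False
  then have "length i < n" if "i \<in> alive L K t \<omega>" for i
    using born_ancestor[of i \<omega> n] that by (auto simp: alive_iff not_le[symmetric])
  then have "alive L K t \<omega> = survivors_before n \<omega>" by (auto simp: survivors_before_def)
  then show ?thesis using False by (simp add: frontier_no_births no_births_def total_value_eq)
qed

text \<open>The product and its killed version differ only if generation \<open>n\<close> is reached.  The probability
  of this event is the defect of the Picard iterate for \<open>f = 1\<close>.\<close>

lemma expected_total_value: "(\<integral>\<omega>. total_value \<omega> \<partial>M) = val t x0"
proof -
  interpret one: branching_tree M P lam p x0 Y L K l m "\<lambda>_. 1" t
    by unfold_locales (auto simp: t_nonneg)
  have nb: "one.frontier n 0 \<omega> = no_births n \<omega>" for n \<omega>
    unfolding one.frontier_no_births by (simp add: one.survivor_value_def)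
  have frontier_meas: "frontier n 0 \<in> borel_measurable M" for n
  proof -
    have "(\<lambda>\<omega>. \<Prod>i\<in>survivors_before n \<omega>. survivor_value i \<omega>) \<in> borel_measurable M"
      using particle_measurable_M by (intro measurable_random_prod[where I=UNIV]) (auto simp: survivors_before_def)
    moreover have "(\<lambda>\<omega>. \<Prod>i\<in>generation n \<omega>. start_value 0 i \<omega>) \<in> borel_measurable M"
      using particle_measurable_M by (intro measurable_random_prod[where I=UNIV]) (auto simp: generation_def)
    ultimately show ?thesis unfolding frontier_def by measurable
  qed
  have nb_meas: "no_births n \<in> borel_measurable M" for n
  proof -
    have "(\<lambda>\<omega>. \<Prod>i\<in>generation n \<omega>. one.start_value 0 i \<omega>) \<in> borel_measurable M"
      using one.particle_measurable_M by (intro measurable_random_prod[where I=UNIV]) (auto simp: generation_def)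
    moreover have "(\<Prod>i\<in>generation n \<omega>. one.start_value 0 i \<omega>) = no_births n \<omega>" for \<omega>
      using nb[of n \<omega>] by (simp add: one.frontier_def one.survivor_value_def)
    ultimately show ?thesis by simp
  qed
  have f01: "0 \<le> frontier n 0 \<omega> \<and> frontier n 0 \<omega> \<le> 1" for n \<omega>
  proof -
    have "0 \<le> (\<Prod>i\<in>survivors_before n \<omega>. survivor_value i \<omega>) \<and> (\<Prod>i\<in>survivors_before n \<omega>. survivor_value i \<omega>) \<le> 1"
      by (intro prod_unit_interval survivor_value_range)
    then show ?thesis by (auto simp: frontier_no_births no_births_def)
  qed
  have int: "integrable M total_value" "integrable M (frontier n 0)" "integrable M (no_births n)" for n
  proof -
    have unit: "integrable M h" if "h \<in> borel_measurable M" "\<And>\<omega>. 0 \<le> h \<omega> \<and> h \<omega> \<le> 1" for h :: "'w \<Rightarrow> real"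
      using that by (intro integrable_const_bound[where B=1] AE_I2) auto
    show "integrable M total_value" using total_value_measurable total_value_range by (rule unit)
    show "integrable M (frontier n 0)" using frontier_meas f01 by (rule unit)
    show "integrable M (no_births n)" using nb_meas by (rule unit) (simp add: no_births_def)
  qed
  have bound: "\<bar>(\<integral>\<omega>. total_value \<omega> \<partial>M) - picard f n t x0\<bar> \<le> 1 - picard (\<lambda>_. 1) n t x0" for n
  proof -
    have "picard f n t x0 = (\<integral>\<omega>. frontier n 0 \<omega> \<partial>M)"
      using frontier_root[of n] frontier_all[of 0 n] by simp
    then have "\<bar>(\<integral>\<omega>. total_value \<omega> \<partial>M) - picard f n t x0\<bar> = \<bar>\<integral>\<omega>. total_value \<omega> - frontier n 0 \<omega> \<partial>M\<bar>"
      using int by simp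
    also have "\<dots> \<le> (\<integral>\<omega>. \<bar>total_value \<omega> - frontier n 0 \<omega>\<bar> \<partial>M)" by (rule integral_abs_bound)
    also have "\<dots> \<le> (\<integral>\<omega>. 1 - no_births n \<omega> \<partial>M)"
      using int total_value_frontier by (intro integral_mono) auto
    also have "\<dots> = 1 - (\<integral>\<omega>. no_births n \<omega> \<partial>M)"
      using int by (simp add: prob_space)
    also have "(\<integral>\<omega>. no_births n \<omega> \<partial>M) = picard (\<lambda>_. 1) n t x0"
      using one.frontier_root[of n] one.frontier_all[of 0 n] by (simp add: nb)
    finally show ?thesis .
  qed
  have "(\<lambda>n. (\<integral>\<omega>. total_value \<omega> \<partial>M) - picard f n t x0) \<longlonglongrightarrow> 0"
  proof (rule Lim_null_comparison)
    show "\<forall>\<^sub>F n in sequentially. norm ((\<integral>\<omega>. total_value \<omega> \<partial>M) - picard f n t x0) \<le> 1 - picard (\<lambda>_. 1) n t x0"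
      using bound by (intro always_eventually allI) simp
    show "(\<lambda>n. 1 - picard (\<lambda>_. 1) n t x0) \<longlonglongrightarrow> 0"
      using tendsto_diff[OF tendsto_const[of 1] picard_one_tendsto[OF t_nonneg, of x0]] by simp
  qed
  moreover have "(\<lambda>n. (\<integral>\<omega>. total_value \<omega> \<partial>M) - picard f n t x0) \<longlonglongrightarrow> (\<integral>\<omega>. total_value \<omega> \<partial>M) - val t x0"
    by (intro tendsto_intros picard_tendsto_val t_nonneg)
  ultimately have "(\<integral>\<omega>. total_value \<omega> \<partial>M) - val t x0 = 0" by (metis LIMSEQ_unique)
  then show ?thesis by simp
qed

section \<open>The value along the path of the initial particle\<close>

abbreviation "W \<equiv> Y []"
definition X :: "real \<Rightarrow> 'w \<Rightarrow> 'a" where "X s \<omega> = W \<omega> s"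
definition Fil :: "real \<Rightarrow> 'w measure" where "Fil = generated_filtration M X"
text \<open>The value process: the expected product for a tree that is restarted at time \<open>r\<close> from the
  position of the initial particle.\<close>

definition v :: "real \<Rightarrow> 'w \<Rightarrow> real" where "v r \<omega> = val (t - r) (path_at r (W \<omega>))"

lemma W_measurable [measurable]: "W \<in> M \<rightarrow>\<^sub>M path_space" by (rule Y_measurable)

lemma W_path: "\<omega> \<in> space M \<Longrightarrow> W \<omega> \<in> rc_paths"
  using measurable_space[OF W_measurable] by simp

lemma subalgebra_Fil: "subalgebra M (Fil s)"
  unfolding Fil_def generated_filtration_def
proof (rule subalgebra_sigma_generated)
  fix i :: real assume "i \<in> {0..s}"
  then have "(\<lambda>\<omega>. W \<omega> i) \<in> M \<rightarrow>\<^sub>M borel"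
    by (intro measurable_compose[OF W_measurable measurable_path_space_coordinate]) auto
  then show "X i \<in> M \<rightarrow>\<^sub>M borel" by (simp add: X_def[abs_def])
qed

lemma space_Fil [simp]: "space (Fil s) = space M"
  by (simp add: Fil_def generated_filtration_def)

lemma X_Fil: "0 \<le> r \<Longrightarrow> r \<le> s \<Longrightarrow> X r \<in> Fil s \<rightarrow>\<^sub>M borel"
  unfolding Fil_def generated_filtration_def by (intro measurable_sigma_generated_coordinate) auto

lemma W_Fil: "0 \<le> s \<Longrightarrow> W \<in> Fil s \<rightarrow>\<^sub>M path_filtration (ennreal s)"
proof (rule measurable_into_path_filtration)
  fix r :: real assume "0 \<le> s" "0 \<le> r" "ennreal r \<le> ennreal s"
  then show "(\<lambda>\<omega>. W \<omega> r) \<in> Fil s \<rightarrow>\<^sub>M borel"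
    using X_Fil[of r s] by (simp add: ennreal_le_iff X_def[abs_def])
qed (use W_path in auto)

lemma Fil_mono: "s \<le> s' \<Longrightarrow> g \<in> Fil s \<rightarrow>\<^sub>M N \<Longrightarrow> g \<in> Fil s' \<rightarrow>\<^sub>M N"
proof -
  assume s: "s \<le> s'" and g: "g \<in> Fil s \<rightarrow>\<^sub>M N"
  have "(\<lambda>\<omega>. \<omega>) \<in> Fil s' \<rightarrow>\<^sub>M Fil s"
    unfolding Fil_def generated_filtration_def[of M X s]
    by (rule measurable_into_sigma_generated) (use X_Fil s in \<open>auto simp: Fil_def generated_filtration_def\<close>)
  from measurable_compose[OF this g] show ?thesis .
qed

lemma path_at_progressive:
  assumes "0 \<le> s"
  shows "(\<lambda>(r, \<omega>). path_at (min r s) (W \<omega>)) \<in> borel \<Otimes>\<^sub>M Fil s \<rightarrow>\<^sub>M borel"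
proof -
  have "(\<lambda>z. (fst z, W (snd z))) \<in> borel \<Otimes>\<^sub>M Fil s \<rightarrow>\<^sub>M borel \<Otimes>\<^sub>M path_filtration (ennreal s)"
    using W_Fil[OF assms] by (intro measurable_Pair measurable_fst measurable_compose[OF measurable_snd])
  from measurable_compose[OF this measurable_evaluation_progressive[OF assms]]
  show ?thesis by (simp add: case_prod_beta path_at_def)
qed

lemma sets_Fil:
  assumes "0 \<le> s" "A \<in> sets (Fil s)"
  obtains A' where "A' \<in> sets (path_filtration (ennreal s))" "A = W -` A' \<inter> space M"
proof -
  let ?V = "vimage_algebra (space M) W (path_filtration (ennreal s))"
  have W: "W \<in> space M \<rightarrow> space (path_filtration (ennreal s))" using W_path by auto
  have "(\<lambda>\<omega>. \<omega>) \<in> ?V \<rightarrow>\<^sub>M Fil s"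
    unfolding Fil_def generated_filtration_def
  proof (rule measurable_into_sigma_generated)
    fix r :: real assume r: "r \<in> {0..s}"
    then have "ennreal r \<le> ennreal s" by (intro ennreal_leI) auto
    then have "(\<lambda>\<omega>. W \<omega> r) \<in> ?V \<rightarrow>\<^sub>M borel"
      using r by (intro measurable_compose[OF measurable_vimage_algebra1[OF W] measurable_coordinate]) auto
    then show "X r \<in> ?V \<rightarrow>\<^sub>M borel" by (simp add: X_def[abs_def])
  qed simp
  from measurable_sets[OF this assms(2)] sets.sets_into_space[OF assms(2)]
  have "A \<in> sets ?V" by (simp add: Int_absorb2)
  then show ?thesis using that unfolding sets_vimage_algebra2[OF W] by blast
qed

lemma law_W: "distr M path_space W = P x0"
proof (rule measure_eqI)
  fix B assume "B \<in> sets (distr M path_space W)"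
  then have B [measurable]: "B \<in> sets path_space" by simp
  interpret I: finite_measure_subalgebra M "info_outside M Y L K []"
    by unfold_locales (rule subalgebra_info(1))
  have [measurable]: "{\<omega> \<in> space M. W \<omega> \<in> B} \<in> sets M" by measurable
  have "measure M {\<omega> \<in> space M. W \<omega> \<in> B} = (\<integral>\<omega>. indicator {\<omega> \<in> space M. W \<omega> \<in> B} \<omega> \<partial>M)" by simp
  also have "\<dots> = (\<integral>\<omega>. real_cond_exp M (info_outside M Y L K []) (indicator {\<omega> \<in> space M. W \<omega> \<in> B}) \<omega> \<partial>M)"
    by (rule I.real_cond_exp_int(2)[symmetric]) (simp add: less_top[symmetric])
  also have "\<dots> = (\<integral>\<omega>. measure (P x0) B \<partial>M)"
    using motion_law[OF B, of "[]"] by (intro integral_cong_AE) (auto simp: borel_measurable_cond_exp2)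
  also have "\<dots> = measure (P x0) B" by (simp add: prob_space)
  finally have eq: "measure M {\<omega> \<in> space M. W \<omega> \<in> B} = measure (P x0) B" .
  interpret P: prob_space "P x0" by (rule prob_space_P)
  have "emeasure (distr M path_space W) B = emeasure M {\<omega> \<in> space M. W \<omega> \<in> B}"
    by (subst emeasure_distr) (auto simp: vimage_def Int_def conj_commute)
  then show "emeasure (distr M path_space W) B = emeasure (P x0) B"
    using eq by (simp add: emeasure_eq_measure P.emeasure_eq_measure)
qed simp

lemma X_0: "AE \<omega> in M. X 0 \<omega> = x0"
proof -
  have "AE w in distr M path_space W. w 0 = x0" unfolding law_W by (rule initial)
  moreover have "{w \<in> space path_space. w 0 = x0} \<in> sets path_space"
  proof -
    have "(\<lambda>w. w 0) -` {x0} \<inter> space path_space \<in> sets path_space"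
      by (rule measurable_sets[OF measurable_path_space_coordinate]) auto
    then show ?thesis by (simp add: vimage_def Int_def conj_commute)
  qed
  ultimately have "AE \<omega> in M. W \<omega> 0 = x0" by (subst (asm) AE_distr_iff) auto
  then show ?thesis by (simp add: X_def)
qed

lemma integral_W:
  fixes g :: "(real \<Rightarrow> 'a) \<Rightarrow> real"
  assumes "g \<in> borel_measurable path_space"
  shows "(\<integral>\<omega>. g (W \<omega>) \<partial>M) = (\<integral>w. g w \<partial>P x0)"
  unfolding law_W[symmetric] using assms by (subst integral_distr) auto

lemma markov_M:
  assumes s: "0 \<le> s" and B [measurable]: "B \<in> sets path_space"
  shows "AE \<omega> in M. real_cond_exp M (Fil s) (indicator {\<omega> \<in> space M. shift s (W \<omega>) \<in> B}) \<omega> = measure (P (X s \<omega>)) B"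
proof -
  interpret F: finite_measure_subalgebra M "Fil s" by unfold_locales (rule subalgebra_Fil)
  interpret P: prob_space "P x0" by (rule prob_space_P)
  have subP: "subalgebra (P x0) (path_filtration (ennreal s))"
  proof -
    have "(\<lambda>w. w) \<in> path_space \<rightarrow>\<^sub>M path_filtration (ennreal s)"
      unfolding path_space_def by (rule path_filtration_mono) simp
    note id = this
    have "A \<in> sets path_space" if "A \<in> sets (path_filtration (ennreal s))" for A :: "(real \<Rightarrow> 'a) set"
      using measurable_sets[OF id that] sets.sets_into_space[OF that] by (simp add: Int_absorb2)
    then show ?thesis unfolding subalgebra_def by auto
  qed
  interpret PF: finite_measure_subalgebra "P x0" "path_filtration (ennreal s)" by unfold_locales (rule subP)
  note [measurable] = measurable_shift[OF s] measurable_path_space_coordinate[OF s]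
  let ?S = "{w \<in> rc_paths. shift s w \<in> B}"
  have S [measurable]: "?S \<in> sets path_space"
  proof -
    have "{w \<in> space path_space. shift s w \<in> B} \<in> sets path_space" by measurable
    then show ?thesis by simp
  qed
  have ms: "(\<lambda>w. measure (P (w s)) B) \<in> borel_measurable path_space" by measurable
  have X_s: "X s \<in> Fil s \<rightarrow>\<^sub>M borel" using s by (intro X_Fil) auto
  have msX: "(\<lambda>\<omega>. measure (P (X s \<omega>)) B) \<in> borel_measurable (Fil s)" using X_s by measurable
  show ?thesis
  proof (rule F.real_cond_exp_charact)
    fix A assume A: "A \<in> sets (Fil s)"
    obtain A' where A': "A' \<in> sets (path_filtration (ennreal s))" "A = W -` A' \<inter> space M"
      using sets_Fil[OF s A] .
    have A'P [measurable]: "A' \<in> sets path_space" using A'(1) subP by (auto simp: subalgebra_def)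
    have "(\<integral>\<omega>\<in>A. indicator {\<omega> \<in> space M. shift s (W \<omega>) \<in> B} \<omega> \<partial>M) = ((\<integral>\<omega>. indicator A' (W \<omega>) * indicator ?S (W \<omega>) \<partial>M) :: real)"
      unfolding set_lebesgue_integral_def using W_path
      by (intro Bochner_Integration.integral_cong refl) (auto simp: A'(2) split: split_indicator)
    also have "\<dots> = ((\<integral>w. indicator A' w * indicator ?S w \<partial>P x0) :: real)"
      by (rule integral_W) measurable
    also have "\<dots> = (\<integral>w. indicator A' w * real_cond_exp (P x0) (path_filtration (ennreal s)) (indicator ?S) w \<partial>P x0)"
    proof (rule PF.real_cond_exp_intg(2)[symmetric])
      show "integrable (P x0) (\<lambda>w. indicator A' w * indicator ?S w :: real)"
        by (rule P.integrable_const_bound[where B=1]) (auto split: split_indicator)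
    qed (use A'(1) in auto)
    also have "\<dots> = (\<integral>w. indicator A' w * measure (P (w s)) B \<partial>P x0)"
      using markov_property[OF s B, of x0] by (intro integral_cong_AE) auto
    also have "\<dots> = (\<integral>\<omega>. indicator A' (W \<omega>) * measure (P (W \<omega> s)) B \<partial>M)"
      by (rule integral_W[symmetric]) measurable
    also have "\<dots> = (\<integral>\<omega>\<in>A. measure (P (X s \<omega>)) B \<partial>M)"
      unfolding set_lebesgue_integral_def
      by (intro Bochner_Integration.integral_cong refl) (auto simp: A'(2) X_def split: split_indicator)
    finally show "(\<integral>\<omega>\<in>A. indicator {\<omega> \<in> space M. shift s (W \<omega>) \<in> B} \<omega> \<partial>M) = (\<integral>\<omega>\<in>A. measure (P (X s \<omega>)) B \<partial>M)" .
  next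
    show "integrable M (\<lambda>\<omega>. indicator {\<omega> \<in> space M. shift s (W \<omega>) \<in> B} \<omega> :: real)"
      by (rule integrable_const_bound[where B=1]) (auto split: split_indicator)
    show "integrable M (\<lambda>\<omega>. measure (P (X s \<omega>)) B)"
      using measurable_from_subalg[OF subalgebra_Fil msX]
      by (intro integrable_const_bound[where B=1] AE_I2) (auto simp: prob_space.prob_le_1[OF prob_space_P])
  qed (rule msX)
qed

text \<open>By the integral equation and the Markov property, the value is the conditional expectation of its
  counterpart along the actual future path.\<close>

lemma val_cond_exp:
  assumes s: "0 \<le> s" "s \<le> t" and D: "D \<in> borel_measurable (Fil s)" and bd: "\<And>\<omega>. \<omega> \<in> space M \<Longrightarrow> \<bar>D \<omega>\<bar> \<le> C"
  shows "(\<integral>\<omega>. D \<omega> * first_branching f val (t - s) (shift s (W \<omega>)) \<partial>M) = (\<integral>\<omega>. D \<omega> * v s \<omega> \<partial>M)"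
proof -
  let ?H = "\<lambda>z. D (fst z) * first_branching f val (t - s) (snd z)"
  note [measurable] = D
  have X_s [measurable]: "X s \<in> Fil s \<rightarrow>\<^sub>M borel" using s by (intro X_Fil) auto
  have space_sets: "space M \<in> sets (Fil s)" using sets.top[of "Fil s"] by simp
  have "(\<integral>\<omega>. indicator (space M) \<omega> * (indicator (space M) \<omega> * ?H (\<omega>, shift s (W \<omega>))) \<partial>M)
    = (\<integral>\<omega>. indicator (space M) \<omega> * (\<integral>w. ?H (\<omega>, w) \<partial>P (X s \<omega>)) \<partial>M)"
  proof (rule disintegration[OF subalgebra_Fil space_sets sets.top, where N=path_space and G="sets path_space" and A="\<lambda>_. space path_space" and C=C and H="?H"])
    show "(\<lambda>\<omega>. shift s (W \<omega>)) \<in> M \<rightarrow>\<^sub>M path_space" using measurable_shift[OF s(1)] by measurable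
    show "(\<lambda>\<omega>. P (X s \<omega>)) \<in> Fil s \<rightarrow>\<^sub>M subprob_algebra path_space" by measurable
    show "sets path_space = sigma_sets (space path_space) (sets path_space)" by (simp only: sets.sigma_sets_eq)
    show "AE \<omega> in M. \<omega> \<in> space M \<longrightarrow> real_cond_exp M (Fil s) (indicator {\<omega> \<in> space M. shift s (W \<omega>) \<in> B}) \<omega> = measure (P (X s \<omega>)) B"
      if "B \<in> sets path_space" for B
      using markov_M[OF s(1) that] by eventually_elim auto
    show "?H \<in> borel_measurable (Fil s \<Otimes>\<^sub>M path_space)" by measurable
    show "\<bar>?H z\<bar> \<le> C" if "z \<in> space (Fil s \<Otimes>\<^sub>M path_space)" for z
      using that abs_mult_le[OF bd, of "fst z" "first_branching f val (t - s) (snd z)" 1]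
        first_branching_range[OF f_range val_measurable, of "snd z" "t - s"] s
      by (auto simp: space_pair_measure)
  qed (auto simp: sets.Int_stable sets.space_closed simp del: space_path_space)
  then show ?thesis using s by (simp add: v_def X_def val_eq cong: Bochner_Integration.integral_cong)
qed

lemma bounded_adaptedE:
  assumes "Z \<in> bounded_adapted M Fil"
  obtains C where "0 \<le> C" "\<And>r \<omega>. \<omega> \<in> space M \<Longrightarrow> \<bar>Z (max 0 r) \<omega>\<bar> \<le> C"
    "(\<lambda>(r, \<omega>). Z (max 0 r) \<omega>) \<in> borel_measurable (borel \<Otimes>\<^sub>M M)"
    "\<And>r. 0 \<le> r \<Longrightarrow> Z r \<in> borel_measurable (Fil r)"
proof -
  obtain C where C: "\<forall>s\<ge>0. \<forall>\<omega>\<in>space M. \<bar>Z s \<omega>\<bar> \<le> C"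
    using assms by (auto simp: bounded_adapted_def bounded_process_def)
  show ?thesis
  proof (rule that)
    show "0 \<le> max 0 C" by simp
    show "\<bar>Z (max 0 r) \<omega>\<bar> \<le> max 0 C" if "\<omega> \<in> space M" for r \<omega>
      using C that by (meson max.cobounded1 max.coboundedI2)
    show "(\<lambda>(r, \<omega>). Z (max 0 r) \<omega>) \<in> borel_measurable (borel \<Otimes>\<^sub>M M)"
      using assms by (intro measurable_process_extend) (auto simp: bounded_adapted_def)
    show "Z r \<in> borel_measurable (Fil r)" if "0 \<le> r" for r
      using assms that by (auto simp: bounded_adapted_def adapted_process_def)
  qed
qed

text \<open>A measurable adapted process need not be progressive, and its time integral up to \<open>s\<close> need not be
  measurable for the information at \<open>s\<close>.  It is so up to a null set: in the mean of the integral
  against a bounded \<open>U\<close>, one may replace \<open>U\<close> by its conditional expectation at each time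
  separately, so the integral has the same means as its own conditional expectation.\<close>

lemma time_integral_ae_adapted:
  assumes Z: "Z \<in> bounded_adapted M Fil" and s: "0 \<le> s"
  shows "\<exists>I\<in>borel_measurable (Fil s). AE \<omega> in M. (LINT r:{0..s}|lborel. Z r \<omega>) = I \<omega>"
proof -
  obtain C where C: "0 \<le> C" "\<And>r \<omega>. \<omega> \<in> space M \<Longrightarrow> \<bar>Z (max 0 r) \<omega>\<bar> \<le> C"
    and Zm: "(\<lambda>(r, \<omega>). Z (max 0 r) \<omega>) \<in> borel_measurable (borel \<Otimes>\<^sub>M M)"
    and ad: "\<And>r. 0 \<le> r \<Longrightarrow> Z r \<in> borel_measurable (Fil r)"
    using bounded_adaptedE[OF Z] by blast
  interpret F: finite_measure_subalgebra M "Fil s" by unfold_locales (rule subalgebra_Fil)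
  note toM = measurable_from_subalg[OF subalgebra_Fil]
  note [measurable] = Zm
  define \<phi> where "\<phi> \<omega> = (LINT r:{0..s}|lborel. Z (max 0 r) \<omega>)" for \<omega>
  have \<phi>_eq: "(LINT r:{0..s}|lborel. Z r \<omega>) = \<phi> \<omega>" for \<omega>
    unfolding \<phi>_def by (rule set_lebesgue_integral_cong) auto
  have \<phi>_m [measurable]: "\<phi> \<in> borel_measurable M" unfolding \<phi>_def[abs_def] by measurable
  have \<phi>_bd: "\<bar>\<phi> \<omega>\<bar> \<le> C * s" if "\<omega> \<in> space M" for \<omega>
  proof -
    have "(\<lambda>r. Z (max 0 r) \<omega>) \<in> borel_measurable borel"
      using measurable_compose[OF measurable_Pair2'[OF that] Zm] by simp
    from bounded_set_integral_le[OF this C(2)[OF that] s] show ?thesis by (simp add: \<phi>_def)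
  qed
  have \<phi>_int: "integrable M \<phi>" using \<phi>_bd by (intro integrable_const_bound[where B="C * s"]) auto
  let ?I = "real_cond_exp M (Fil s) \<phi>"
  have I_m [measurable]: "?I \<in> borel_measurable M" "?I \<in> borel_measurable (Fil s)" by auto
  have I_int: "integrable M ?I" by (rule F.real_cond_exp_int(1)[OF \<phi>_int])
  have swap: "(\<integral>\<omega>. U \<omega> * \<phi> \<omega> \<partial>M) = (LINT r:{0..s}|lborel. (\<integral>\<omega>. U \<omega> * Z (max 0 r) \<omega> \<partial>M))"
    if U: "integrable M U" for U
  proof -
    note [measurable] = borel_measurable_integrable[OF U]
    have "(\<integral>\<omega>. U \<omega> * \<phi> \<omega> \<partial>M) = (\<integral>\<omega>. (LINT r:{0..s}|lborel. U \<omega> * Z (max 0 r) \<omega>) \<partial>M)"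
      by (simp add: \<phi>_def)
    also have "\<dots> = (LINT r:{0..s}|lborel. (\<integral>\<omega>. U \<omega> * Z (max 0 r) \<omega> \<partial>M))"
    proof (rule expectation_time_integral(3))
      show "(\<lambda>(r, \<omega>). U \<omega> * Z (max 0 r) \<omega>) \<in> borel_measurable (borel \<Otimes>\<^sub>M M)" by measurable
      fix r :: real
      have "(\<integral>\<^sup>+\<omega>. ennreal \<bar>U \<omega> * Z (max 0 r) \<omega>\<bar> \<partial>M) \<le> (\<integral>\<^sup>+\<omega>. ennreal (\<bar>U \<omega>\<bar> * C) \<partial>M)"
        using C by (intro nn_integral_mono ennreal_leI) (auto simp: abs_mult intro: mult_left_mono)
      also have "\<dots> = ennreal (\<integral>\<omega>. \<bar>U \<omega>\<bar> * C \<partial>M)"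
        using U C by (intro nn_integral_eq_integral) auto
      finally show "(\<integral>\<^sup>+\<omega>. ennreal \<bar>U \<omega> * Z (max 0 r) \<omega>\<bar> \<partial>M) \<le> ennreal (\<integral>\<omega>. \<bar>U \<omega>\<bar> * C \<partial>M)" .
    qed
    finally show ?thesis .
  qed
  \<comment> \<open>Testing against the sign of the difference to the conditional expectation.\<close>
  define U where "U \<omega> = (if ?I \<omega> < \<phi> \<omega> then 1 else if \<phi> \<omega> < ?I \<omega> then -1 else 0 :: real)" for \<omega>
  have U_m [measurable]: "U \<in> borel_measurable M" unfolding U_def[abs_def] by measurable
  have U_int: "integrable M U" by (intro integrable_const_bound[where B=1]) (auto simp: U_def)
  have U_mult: "integrable M (\<lambda>\<omega>. g \<omega> * U \<omega>)" if "integrable M g" for g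
    by (rule Bochner_Integration.integrable_bound[OF that]) (use borel_measurable_integrable[OF that] in \<open>auto simp: U_def\<close>)
  let ?V = "real_cond_exp M (Fil s) U"
  have V_int: "integrable M ?V" by (rule F.real_cond_exp_int(1)[OF U_int])
  have "(\<integral>\<omega>. U \<omega> * \<phi> \<omega> \<partial>M) = (LINT r:{0..s}|lborel. (\<integral>\<omega>. U \<omega> * Z (max 0 r) \<omega> \<partial>M))"
    by (rule swap[OF U_int])
  also have "\<dots> = (LINT r:{0..s}|lborel. (\<integral>\<omega>. ?V \<omega> * Z (max 0 r) \<omega> \<partial>M))"
  proof (intro set_lebesgue_integral_cong allI impI)
    fix r :: real assume r: "r \<in> {0..s}"
    have Zr: "Z r \<in> borel_measurable (Fil s)" using r by (intro Fil_mono[OF _ ad]) auto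
    have "integrable M (Z r)"
      using C(2)[of _ r] r toM[OF Zr] by (intro integrable_const_bound[where B=C]) (auto simp: max_def)
    then have "(\<integral>\<omega>. Z r \<omega> * ?V \<omega> \<partial>M) = (\<integral>\<omega>. Z r \<omega> * U \<omega> \<partial>M)"
      by (intro F.real_cond_exp_intg(2) U_mult Zr) auto
    then show "(\<integral>\<omega>. U \<omega> * Z (max 0 r) \<omega> \<partial>M) = (\<integral>\<omega>. ?V \<omega> * Z (max 0 r) \<omega> \<partial>M)"
      using r by (simp add: max_def mult.commute)
  qed simp
  also have "\<dots> = (\<integral>\<omega>. ?V \<omega> * \<phi> \<omega> \<partial>M)" by (rule swap[OF V_int, symmetric])
  also have "\<dots> = (\<integral>\<omega>. ?V \<omega> * ?I \<omega> \<partial>M)"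
  proof (rule F.real_cond_exp_intg(2)[symmetric])
    show "integrable M (\<lambda>\<omega>. ?V \<omega> * \<phi> \<omega>)"
    proof (rule Bochner_Integration.integrable_bound[OF integrable_mult_left[OF V_int, of "C * s"]])
      show "AE \<omega> in M. norm (?V \<omega> * \<phi> \<omega>) \<le> norm (?V \<omega> * (C * s))"
        using \<phi>_bd C s by (intro AE_I2) (auto simp: abs_mult intro!: mult_left_mono)
    qed measurable
  qed auto
  also have "\<dots> = (\<integral>\<omega>. ?I \<omega> * ?V \<omega> \<partial>M)" by (simp add: mult.commute)
  also have "\<dots> = (\<integral>\<omega>. ?I \<omega> * U \<omega> \<partial>M)"
    by (intro F.real_cond_exp_intg(2) U_mult I_int) auto
  finally have "(\<integral>\<omega>. \<phi> \<omega> * U \<omega> - ?I \<omega> * U \<omega> \<partial>M) = 0"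
    using U_mult[OF \<phi>_int] U_mult[OF I_int] by (simp add: mult.commute)
  moreover have "\<phi> \<omega> * U \<omega> - ?I \<omega> * U \<omega> = \<bar>\<phi> \<omega> - ?I \<omega>\<bar>" for \<omega> by (auto simp: U_def)
  ultimately have "(\<integral>\<omega>. \<bar>\<phi> \<omega> - ?I \<omega>\<bar> \<partial>M) = 0" by simp
  then have "AE \<omega> in M. \<bar>\<phi> \<omega> - ?I \<omega>\<bar> = 0"
    using \<phi>_int I_int by (subst (asm) integral_nonneg_eq_0_iff_AE) auto
  then have "AE \<omega> in M. (LINT r:{0..s}|lborel. Z r \<omega>) = ?I \<omega>" unfolding \<phi>_eq by eventually_elim simp
  then show ?thesis using I_m(2) by blast
qed

text \<open>The value at time \<open>r\<close> computed along the actual future path.  It anticipates, but is absolutely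
  continuous in \<open>r\<close>.\<close>

definition path_value :: "real \<Rightarrow> 'w \<Rightarrow> real" where
  "path_value r \<omega> = first_branching f val (t - r) (shift (max 0 r) (W \<omega>))"

definition lamX :: "real \<Rightarrow> 'w \<Rightarrow> real" where
  "lamX r \<omega> = lam (path_at r (W \<omega>))"

definition genX :: "real \<Rightarrow> 'w \<Rightarrow> real" where
  "genX r \<omega> = gen (path_at r (W \<omega>)) (v r \<omega>)"

lemma shift_joint_measurable [measurable (raw)]:
  fixes w :: "'c \<Rightarrow> real \<Rightarrow> 'a"
  assumes [measurable]: "s \<in> borel_measurable N" "w \<in> N \<rightarrow>\<^sub>M path_space"
  shows "(\<lambda>y. shift (max 0 (s y)) (w y)) \<in> N \<rightarrow>\<^sub>M path_space"
proof (rule measurable_into_path_space)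
  show "(\<lambda>y. shift (max 0 (s y)) (w y)) \<in> space N \<rightarrow> rc_paths"
    using measurable_space[OF assms(2)] by (auto intro!: shift_rc_paths)
  fix r :: real assume r: "0 \<le> r"
  have "(\<lambda>y. path_at (max 0 (s y) + r) (w y)) \<in> N \<rightarrow>\<^sub>M borel"
    by (intro measurable_path_at) measurable
  then show "(\<lambda>y. shift (max 0 (s y)) (w y) r) \<in> N \<rightarrow>\<^sub>M borel"
    using r by (simp add: shift_def)
qed

lemma val_measurable' [measurable (raw)]:
  assumes "s \<in> borel_measurable N" "x \<in> N \<rightarrow>\<^sub>M borel"
  shows "(\<lambda>y. val (s y) (x y)) \<in> borel_measurable N"
  using measurable_compose[OF measurable_Pair[OF assms] val_measurable] by simp

lemma process_measurable [measurable]: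
  "(\<lambda>(r, \<omega>). v r \<omega>) \<in> borel_measurable (borel \<Otimes>\<^sub>M M)"
  "(\<lambda>(r, \<omega>). path_value r \<omega>) \<in> borel_measurable (borel \<Otimes>\<^sub>M M)"
  "(\<lambda>(r, \<omega>). lamX r \<omega>) \<in> borel_measurable (borel \<Otimes>\<^sub>M M)"
  "(\<lambda>(r, \<omega>). genX r \<omega>) \<in> borel_measurable (borel \<Otimes>\<^sub>M M)"
  unfolding v_def path_value_def lamX_def genX_def case_prod_beta by measurable

lemma section_measurable:
  assumes "(\<lambda>(r, \<omega>). h r \<omega>) \<in> borel_measurable (borel \<Otimes>\<^sub>M M)"
  shows "h r \<in> borel_measurable M" and "\<omega> \<in> space M \<Longrightarrow> (\<lambda>r. h r \<omega>) \<in> borel_measurable borel"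
  using measurable_compose[OF measurable_Pair1' assms] measurable_compose[OF measurable_Pair2' assms] by simp_all

lemma process_range:
  "0 \<le> lamX r \<omega>" "lamX r \<omega> \<le> l" "0 \<le> genX r \<omega>" "genX r \<omega> \<le> 1"
  "r \<le> t \<Longrightarrow> 0 \<le> v r \<omega> \<and> v r \<omega> \<le> 1"
  "r \<le> t \<Longrightarrow> \<omega> \<in> space M \<Longrightarrow> 0 \<le> path_value r \<omega> \<and> path_value r \<omega> \<le> 1"
proof -
  show "0 \<le> path_value r \<omega> \<and> path_value r \<omega> \<le> 1" if "r \<le> t" "\<omega> \<in> space M"
    unfolding path_value_def using first_branching_range[OF f_range val_measurable shift_rc_paths[OF W_path[OF that(2)]]] that by simp
qed (simp_all add: lamX_def genX_def v_def lam_nonneg lam_le val_range)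

lemma v_t: "v t \<omega> = f (X t \<omega>)"
  using t_nonneg by (simp add: v_def X_def val_0)

lemma path_value_t: "path_value t \<omega> = v t \<omega>"
  using t_nonneg by (simp add: path_value_def first_branching_0 v_t X_def shift_def)

lemma v_adapted: "0 \<le> r \<Longrightarrow> v r \<in> borel_measurable (Fil r)" (is "_ \<Longrightarrow> ?A")
  and lamX_adapted: "0 \<le> r \<Longrightarrow> lamX r \<in> borel_measurable (Fil r)" (is "_ \<Longrightarrow> ?B")
  and genX_adapted: "0 \<le> r \<Longrightarrow> genX r \<in> borel_measurable (Fil r)" (is "_ \<Longrightarrow> ?C")
proof -
  assume r: "0 \<le> r"
  have X_r [measurable]: "(\<lambda>\<omega>. path_at r (W \<omega>)) \<in> Fil r \<rightarrow>\<^sub>M borel"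
    using X_Fil[of r r] r by (simp add: X_def[abs_def])
  show v [measurable]: ?A unfolding v_def[abs_def] by measurable
  show ?B unfolding lamX_def[abs_def] by measurable
  show ?C unfolding genX_def[abs_def] by measurable
qed

lemma clock_shift:
  assumes w: "w \<in> rc_paths" and s: "0 \<le> s" and r: "0 \<le> r"
  shows "clock r (shift s w) = clock (s + r) w - clock s w"
proof -
  have "clock r (shift s w) = (LINT a:{0..r}|lborel. lam (path_at (s + a) w))"
    unfolding clock_def using s by (intro set_lebesgue_integral_cong) (auto simp: shift_def)
  also have "\<dots> = (LINT b:{s..s + r}|lborel. lam (path_at b w))"
    by (rule set_integral_translate)
  also have "\<dots> = clock (s + r) w - clock s w"
    using bounded_primitive.increment[OF clock_primitive[OF w], of s "s + r" "s + r"] s r by simp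
  finally show ?thesis .
qed

lemma first_branching_shift:
  assumes w: "w \<in> rc_paths" and s: "0 \<le> s" "s \<le> t"
  shows "first_branching f val (t - s) (shift s w) = exp (clock s w) * (exp (- clock t w) * f (path_at t w)
    + (LINT r:{s..t}|lborel. exp (- clock r w) * lam (path_at r w) * gen (path_at r w) (val (t - r) (path_at r w))))"
proof -
  let ?g = "\<lambda>r. exp (- clock r w) * lam (path_at r w) * gen (path_at r w) (val (t - r) (path_at r w))"
  have "(LINT r:{0..t - s}|lborel. exp (- clock r (shift s w)) * lam (path_at r (shift s w)) * gen (path_at r (shift s w)) (val (t - s - r) (path_at r (shift s w))))
      = (LINT r:{0..t - s}|lborel. exp (clock s w) * ?g (s + r))"
  proof (intro set_lebesgue_integral_cong allI impI)
    fix r assume "r \<in> {0..t - s}"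
    then have r: "0 \<le> r" by simp
    have "exp (- clock r (shift s w)) = exp (clock s w) * exp (- clock (s + r) w)"
      unfolding clock_shift[OF w s(1) r] by (simp add: exp_add[symmetric])
    then show "exp (- clock r (shift s w)) * lam (path_at r (shift s w)) * gen (path_at r (shift s w)) (val (t - s - r) (path_at r (shift s w))) = exp (clock s w) * ?g (s + r)"
      using r s by (simp add: shift_def diff_diff_eq mult.assoc)
  qed simp
  also have "\<dots> = exp (clock s w) * (LINT r:{s..s + (t - s)}|lborel. ?g r)"
    unfolding set_integral_translate[symmetric] by simp
  finally have 1: "(LINT r:{0..t - s}|lborel. exp (- clock r (shift s w)) * lam (path_at r (shift s w)) * gen (path_at r (shift s w)) (val (t - s - r) (path_at r (shift s w))))
      = exp (clock s w) * (LINT r:{s..t}|lborel. ?g r)" by simp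
  have "clock (t - s) (shift s w) = clock t w - clock s w" using clock_shift[OF w s(1), of "t - s"] s by simp
  then have 2: "exp (- clock (t - s) (shift s w)) = exp (clock s w) * exp (- clock t w)"
    by (simp add: exp_add[symmetric])
  have 3: "path_at (t - s) (shift s w) = path_at t w" using s by (simp add: shift_def)
  show ?thesis unfolding first_branching_def 1 2 3 by (simp add: distrib_left mult.assoc)
qed

text \<open>The linear equation \<open>path_value' = lamX path_value - lamX genX\<close>.  By \<open>first_branching_shift\<close>, the
  value is \<open>exp (clock s w)\<close> times a function whose derivative does not involve the value.\<close>

lemma path_value_primitive:
  assumes \<omega>: "\<omega> \<in> space M"
  shows "bounded_primitive (\<lambda>r. lamX r \<omega> * (indicator {0..t} r * path_value r \<omega> - genX r \<omega>)) (\<lambda>r. path_value r \<omega>) l t"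
proof
  note [measurable] = section_measurable(2)[OF process_measurable(1) \<omega>] section_measurable(2)[OF process_measurable(2) \<omega>]
    section_measurable(2)[OF process_measurable(3) \<omega>] section_measurable(2)[OF process_measurable(4) \<omega>]
  show "(\<lambda>r. lamX r \<omega> * (indicator {0..t} r * path_value r \<omega> - genX r \<omega>)) \<in> borel_measurable borel" by measurable
  show "\<bar>lamX r \<omega> * (indicator {0..t} r * path_value r \<omega> - genX r \<omega>)\<bar> \<le> l" if "r \<in> {0..t}" for r
  proof -
    have "\<bar>lamX r \<omega> * (indicator {0..t} r * path_value r \<omega> - genX r \<omega>)\<bar> \<le> l * 1"
      using process_range(1-4)[of r \<omega>] process_range(6)[of r \<omega>] that \<omega> by (intro abs_mult_le) (auto simp: abs_le_iff)
    then show ?thesis by simp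
  qed
  let ?w = "W \<omega>"
  have w: "?w \<in> rc_paths" using W_path[OF \<omega>] .
  have [measurable]: "(\<lambda>_. ?w) \<in> borel \<rightarrow>\<^sub>M path_space" using w by (rule const_path_measurable)
  let ?g = "\<lambda>r. exp (- clock r ?w) * lamX r \<omega> * genX r \<omega>"
  have g_eq: "?g = (\<lambda>r. exp (- clock r ?w) * lam (path_at r ?w) * gen (path_at r ?w) (val (t - r) (path_at r ?w)))"
    by (simp add: fun_eq_iff lamX_def genX_def v_def)
  have g_bd: "\<bar>?g r\<bar> \<le> l" for r unfolding lamX_def genX_def by (rule integrand_bounds(3))
  have g_m: "?g \<in> borel_measurable borel" by measurable
  define \<xi> where "\<xi> = exp (- clock t ?w) * f (path_at t ?w)"
  define Q where "Q s = \<xi> + (LINT r:{s..t}|lborel. ?g r)" for s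
  have path_value: "path_value s \<omega> = exp (clock s ?w) * Q s" if "s \<in> {0..t}" for s
    using first_branching_shift[OF w, of s] that unfolding path_value_def Q_def \<xi>_def g_eq by (simp add: max_def)
  fix s assume s: "s \<in> {0..t}"
  have Q: "bounded_primitive (\<lambda>r. - ?g r) Q l s"
  proof
    show "(\<lambda>r. - ?g r) \<in> borel_measurable borel" using g_m by measurable
    show "\<bar>- ?g r\<bar> \<le> l" for r using g_bd[of r] by (simp only: abs_minus_cancel)
    fix r assume r: "r \<in> {0..s}"
    have "set_integrable lborel {0..t} ?g" using g_bd by (intro bounded_set_integrable[OF g_m]) auto
    from set_integral_split[OF this, of r] r s
    show "Q r = Q 0 + (LINT r:{0..r}|lborel. - ?g r)" by (simp add: Q_def set_lebesgue_integral_def)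
  qed
  have s0: "0 \<le> s" using s by simp
  from integration_by_parts_bounded[OF exp_primitive_bounded[OF clock_primitive[OF w] s0] Q s0]
  have "path_value s \<omega> - path_value 0 \<omega> = (LINT r:{0..s}|lborel. indicator {0..s} r * (lam (path_at r ?w) * exp (clock r ?w)) * Q r + exp (clock r ?w) * - ?g r)"
    using path_value[of s] path_value[of 0] s t_nonneg by simp
  also have "\<dots> = (LINT r:{0..s}|lborel. lamX r \<omega> * (indicator {0..t} r * path_value r \<omega> - genX r \<omega>))"
  proof (intro set_lebesgue_integral_cong allI impI)
    fix r assume r: "r \<in> {0..s}"
    then have r': "r \<in> {0..t}" using s by auto
    have "exp (clock r ?w) * exp (- clock r ?w) = 1" by (simp add: exp_minus)
    then have "exp (clock r ?w) * - ?g r = - (lamX r \<omega> * genX r \<omega>)" by (simp add: exp_minus field_simps)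
    then show "indicator {0..s} r * (lam (path_at r ?w) * exp (clock r ?w)) * Q r + exp (clock r ?w) * - ?g r
      = lamX r \<omega> * (indicator {0..t} r * path_value r \<omega> - genX r \<omega>)"
      using r r' by (simp add: path_value[OF r'] lamX_def right_diff_distrib mult.assoc)
  qed simp
  finally show "path_value s \<omega> = path_value 0 \<omega> + (LINT r:{0..s}|lborel. lamX r \<omega> * (indicator {0..t} r * path_value r \<omega> - genX r \<omega>))" by simp
qed

text \<open>A test variable may differ from an adapted one on a null set, as exponentials of time
  integrals do.\<close>

lemma path_value_v_expectation:
  assumes r: "0 \<le> r" "r \<le> t" and D [measurable]: "D \<in> borel_measurable M" and bd: "\<And>\<omega>. \<omega> \<in> space M \<Longrightarrow> \<bar>D \<omega>\<bar> \<le> C"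
    and D': "D' \<in> borel_measurable (Fil r)" and ae: "AE \<omega> in M. D \<omega> = D' \<omega>"
  shows "(\<integral>\<omega>. D \<omega> * path_value r \<omega> \<partial>M) = (\<integral>\<omega>. D \<omega> * v r \<omega> \<partial>M)"
proof -
  \<comment> \<open>The adapted version inherits the bound only almost everywhere; truncation restores it.\<close>
  define E where "E \<omega> = max (- \<bar>C\<bar>) (min \<bar>C\<bar> (D' \<omega>))" for \<omega>
  have E: "E \<in> borel_measurable (Fil r)" unfolding E_def[abs_def] using D' by measurable
  have [measurable]: "E \<in> borel_measurable M" by (rule measurable_from_subalg[OF subalgebra_Fil E])
  note [measurable] = section_measurable(1)[OF process_measurable(1)] section_measurable(1)[OF process_measurable(2)]
  have ae': "AE \<omega> in M. D \<omega> = E \<omega>"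
    using ae AE_space
  proof eventually_elim
    case (elim \<omega>)
    then show ?case using bd[of \<omega>] by (auto simp: E_def abs_le_iff max_def min_def)
  qed
  have "(\<integral>\<omega>. D \<omega> * path_value r \<omega> \<partial>M) = (\<integral>\<omega>. E \<omega> * path_value r \<omega> \<partial>M)"
    using ae' by (intro integral_cong_AE) auto
  also have "\<dots> = (\<integral>\<omega>. E \<omega> * v r \<omega> \<partial>M)"
  proof -
    have "max 0 r = r" using r by simp
    moreover have "\<bar>E \<omega>\<bar> \<le> \<bar>C\<bar>" for \<omega> by (auto simp: E_def abs_le_iff)
    ultimately show ?thesis using val_cond_exp[OF r E, of "\<bar>C\<bar>"] by (simp only: path_value_def)
  qed
  also have "\<dots> = (\<integral>\<omega>. D \<omega> * v r \<omega> \<partial>M)"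
    using ae' by (intro integral_cong_AE) auto
  finally show ?thesis .
qed

lemma exp_int_ae_adapted:
  assumes Z: "Z \<in> bounded_adapted M Fil" and s: "0 \<le> s"
  shows "\<exists>E\<in>borel_measurable (Fil s). AE \<omega> in M. exp_int Z s \<omega> = E \<omega>"
proof -
  obtain I where "I \<in> borel_measurable (Fil s)" "AE \<omega> in M. (LINT r:{0..s}|lborel. Z r \<omega>) = I \<omega>"
    using time_integral_ae_adapted[OF assms] by blast
  then show ?thesis by (intro bexI[of _ "\<lambda>\<omega>. exp (I \<omega>)"]) (auto simp: exp_int_def elim!: eventually_mono)
qed

text \<open>Integration by parts for \<open>exp_int Z r * path_value r\<close> is a pathwise identity.  In its mean,
  \<open>path_value\<close> may be replaced by \<open>v\<close> at each time separately, since all factors next to it are adapted.\<close>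

lemma feynman_kac:
  assumes Z: "Z \<in> bounded_adapted M Fil" and s: "0 \<le> s" "s \<le> t" and A: "A \<in> sets (Fil s)"
  shows "(\<integral>\<omega>. indicator A \<omega> * (exp_int Z t \<omega> * v t \<omega> - exp_int Z s \<omega> * v s \<omega>) \<partial>M)
    = (\<integral>\<omega>. indicator A \<omega> * (LINT r:{s..t}|lborel. exp_int Z r \<omega> * (v r \<omega> * (Z r \<omega> + lamX r \<omega>) - lamX r \<omega> * genX r \<omega>)) \<partial>M)"
proof -
  obtain C where C: "0 \<le> C" "\<And>r \<omega>. \<omega> \<in> space M \<Longrightarrow> \<bar>Z (max 0 r) \<omega>\<bar> \<le> C"
    and Zm: "(\<lambda>(r, \<omega>). Z (max 0 r) \<omega>) \<in> borel_measurable (borel \<Otimes>\<^sub>M M)"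
    and ad: "\<And>r. 0 \<le> r \<Longrightarrow> Z r \<in> borel_measurable (Fil r)"
    using bounded_adaptedE[OF Z] by blast
  define Z' where "Z' r \<omega> = Z (max 0 r) \<omega>" for r \<omega>
  have Z'_eq: "Z' r \<omega> = Z r \<omega>" if "0 \<le> r" for r \<omega> using that by (simp add: Z'_def)
  have Z'm [measurable]: "(\<lambda>(r, \<omega>). Z' r \<omega>) \<in> borel_measurable (borel \<Otimes>\<^sub>M M)" using Zm by (simp add: Z'_def)
  have Z'_bd: "\<bar>Z' r \<omega>\<bar> \<le> C" if "\<omega> \<in> space M" for r \<omega> using C(2) that by (simp add: Z'_def)
  define E where "E r \<omega> = exp_int Z' r \<omega>" for r \<omega>
  have E_eq: "exp_int Z r \<omega> = E r \<omega>" for r \<omega> unfolding E_def exp_int_extend[of Z] Z'_def ..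
  have Em [measurable]: "(\<lambda>(r, \<omega>). E r \<omega>) \<in> borel_measurable (borel \<Otimes>\<^sub>M M)"
    unfolding E_def by (rule exp_int_measurable[OF Z'm])
  define K where "K = exp (C * t)"
  have K: "0 \<le> K" by (simp add: K_def)
  have E_bd: "\<bar>E r \<omega>\<bar> \<le> K" if "\<omega> \<in> space M" "r \<in> {0..t}" for r \<omega>
    using exp_int_bound[OF Z'm that(1) Z'_bd[OF that(1)] that(2)] by (simp add: E_def K_def)
  have AM [measurable]: "A \<in> sets M" using A subalgebra_Fil by (auto simp: subalgebra_def)
  have Ind: "\<bar>indicator A \<omega> :: real\<bar> \<le> 1" for \<omega> by (simp add: indicator_def)
  define h where "h y r \<omega> = indicator A \<omega> * (E r \<omega> * (y r \<omega> * (Z' r \<omega> + lamX r \<omega>) - lamX r \<omega> * genX r \<omega>))"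
    for y :: "real \<Rightarrow> 'w \<Rightarrow> real" and r \<omega>
  have h_m: "(\<lambda>(r, \<omega>). h y r \<omega>) \<in> borel_measurable (borel \<Otimes>\<^sub>M M)"
    if [measurable]: "(\<lambda>(r, \<omega>). y r \<omega>) \<in> borel_measurable (borel \<Otimes>\<^sub>M M)" for y
    unfolding h_def by measurable
  define B where "B = K * ((C + l) + l)"
  have kbd: "\<bar>Z' r \<omega> + lamX r \<omega>\<bar> \<le> C + l" if "\<omega> \<in> space M" for r \<omega>
    using Z'_bd[OF that, of r] process_range(1,2)[of r \<omega>] by linarith
  have lg: "\<bar>lamX r \<omega> * genX r \<omega>\<bar> \<le> l" for r \<omega>
    using abs_mult_le[of "lamX r \<omega>" l "genX r \<omega>" 1] process_range(1-4)[of r \<omega>] by simp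
  have h_bd: "\<bar>h y r \<omega>\<bar> \<le> B" if "\<omega> \<in> space M" "r \<in> {0..t}" "0 \<le> y r \<omega> \<and> y r \<omega> \<le> 1" for y r \<omega>
  proof -
    have "\<bar>y r \<omega> * (Z' r \<omega> + lamX r \<omega>)\<bar> \<le> 1 * (C + l)"
      using that by (intro abs_mult_le kbd) auto
    then have "\<bar>y r \<omega> * (Z' r \<omega> + lamX r \<omega>) - lamX r \<omega> * genX r \<omega>\<bar> \<le> (C + l) + l"
      by (intro order_trans[OF abs_triangle_ineq4] add_mono lg) simp
    then have "\<bar>E r \<omega> * (y r \<omega> * (Z' r \<omega> + lamX r \<omega>) - lamX r \<omega> * genX r \<omega>)\<bar> \<le> B"
      unfolding B_def using that by (intro abs_mult_le E_bd)
    then show ?thesis unfolding h_def using abs_mult_le[OF Ind] by fastforce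
  qed
  have swap: "(\<integral>\<omega>. (LINT r:{s..t}|lborel. h y r \<omega>) \<partial>M) = (LINT r:{s..t}|lborel. (\<integral>\<omega>. h y r \<omega> \<partial>M))"
    if "(\<lambda>(r, \<omega>). y r \<omega>) \<in> borel_measurable (borel \<Otimes>\<^sub>M M)"
      and y: "\<And>r \<omega>. \<omega> \<in> space M \<Longrightarrow> r \<in> {0..t} \<Longrightarrow> 0 \<le> y r \<omega> \<and> y r \<omega> \<le> 1" for y
    using s by (intro expectation_time_integral(3)[where C=B] h_m that nn_integral_bounded_le h_bd) auto
  have y_v: "0 \<le> v r \<omega> \<and> v r \<omega> \<le> 1" and y_fb: "0 \<le> path_value r \<omega> \<and> path_value r \<omega> \<le> 1"
    if "\<omega> \<in> space M" "r \<in> {0..t}" for r \<omega>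
    using process_range(5,6)[of r \<omega>] that by auto
  have pathwise: "indicator A \<omega> * (E t \<omega> * v t \<omega> - E s \<omega> * path_value s \<omega>) = (LINT r:{s..t}|lborel. h path_value r \<omega>)"
    if \<omega>: "\<omega> \<in> space M" for \<omega>
  proof -
    let ?p = "\<lambda>r. indicator {0..t} r * (Z' r \<omega> * E r \<omega>)"
    let ?q = "\<lambda>r. lamX r \<omega> * (indicator {0..t} r * path_value r \<omega> - genX r \<omega>)"
    let ?k = "\<lambda>r. E r \<omega> * (path_value r \<omega> * (Z' r \<omega> + lamX r \<omega>) - lamX r \<omega> * genX r \<omega>)"
    have prod: "E b \<omega> * path_value b \<omega> - E 0 \<omega> * path_value 0 \<omega> = (LINT r:{0..b}|lborel. ?k r)" if b: "b \<in> {0..t}" for b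
    proof -
      have 1: "bounded_primitive ?p (\<lambda>r. E r \<omega>) (C * exp (C * t)) b"
        unfolding E_def using b by (intro bounded_primitive_mono[OF exp_int_primitive[OF Z'm \<omega> Z'_bd[OF \<omega>] t_nonneg]]) simp
      have 2: "bounded_primitive ?q (\<lambda>r. path_value r \<omega>) l b"
        using b by (intro bounded_primitive_mono[OF path_value_primitive[OF \<omega>]]) simp
      have "E b \<omega> * path_value b \<omega> - E 0 \<omega> * path_value 0 \<omega> = (LINT r:{0..b}|lborel. ?p r * path_value r \<omega> + E r \<omega> * ?q r)"
        using b by (intro integration_by_parts_bounded[OF 1 2]) auto
      also have "\<dots> = (LINT r:{0..b}|lborel. ?k r)"
        using b by (intro set_lebesgue_integral_cong) (auto simp: algebra_simps)
      finally show ?thesis .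
    qed
    have "set_integrable lborel {0..t} (\<lambda>r. ?k r)"
    proof (rule bounded_set_integrable[where C=B])
      show "?k \<in> borel_measurable borel"
        using section_measurable(2)[OF Em \<omega>] section_measurable(2)[OF Z'm \<omega>] section_measurable(2)[OF process_measurable(2) \<omega>]
          section_measurable(2)[OF process_measurable(3) \<omega>] section_measurable(2)[OF process_measurable(4) \<omega>] by measurable
      fix r assume r: "r \<in> {0..t}"
      have "\<bar>path_value r \<omega> * (Z' r \<omega> + lamX r \<omega>)\<bar> \<le> 1 * (C + l)"
        using y_fb[OF \<omega> r] by (intro abs_mult_le kbd \<omega>) auto
      then have "\<bar>path_value r \<omega> * (Z' r \<omega> + lamX r \<omega>) - lamX r \<omega> * genX r \<omega>\<bar> \<le> (C + l) + l"
        by (intro order_trans[OF abs_triangle_ineq4] add_mono lg) simp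
      then show "\<bar>?k r\<bar> \<le> B" unfolding B_def by (intro abs_mult_le E_bd \<omega> r)
    qed
    from set_integral_split[OF this s] prod[of t] prod[of s] s
    have "E t \<omega> * path_value t \<omega> - E s \<omega> * path_value s \<omega> = (LINT r:{s..t}|lborel. ?k r)" by simp
    then show ?thesis by (simp add: path_value_t h_def)
  qed
  have same: "(\<integral>\<omega>. h path_value r \<omega> \<partial>M) = (\<integral>\<omega>. h v r \<omega> \<partial>M)" if r: "r \<in> {s..t}" for r
  proof -
    have r0: "0 \<le> r" "r \<le> t" using r s by auto
    note [measurable] = section_measurable(1)[OF Em] section_measurable(1)[OF Z'm] section_measurable(1)[OF process_measurable(1)]
      section_measurable(1)[OF process_measurable(2)] section_measurable(1)[OF process_measurable(3)] section_measurable(1)[OF process_measurable(4)]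
    let ?D = "\<lambda>\<omega>. indicator A \<omega> * (E r \<omega> * (Z' r \<omega> + lamX r \<omega>))"
    let ?R = "\<lambda>\<omega>. indicator A \<omega> * (E r \<omega> * (lamX r \<omega> * genX r \<omega>))"
    obtain E' where E': "E' \<in> borel_measurable (Fil r)" "AE \<omega> in M. exp_int Z r \<omega> = E' \<omega>"
      using exp_int_ae_adapted[OF Z r0(1)] by blast
    have "(\<lambda>\<omega>. \<omega>) \<in> Fil r \<rightarrow>\<^sub>M Fil s" using r by (intro Fil_mono[of s r]) auto
    then have Ar: "A \<in> sets (Fil r)" using measurable_sets[of "\<lambda>\<omega>. \<omega>" "Fil r" "Fil s" A] A sets.sets_into_space[OF A] by (simp add: Int_absorb2)
    have D_bd: "\<bar>?D \<omega>\<bar> \<le> 1 * (K * (C + l))" if "\<omega> \<in> space M" for \<omega>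
      using r0 that by (intro abs_mult_le Ind E_bd kbd) auto
    have eq: "(\<integral>\<omega>. ?D \<omega> * path_value r \<omega> \<partial>M) = (\<integral>\<omega>. ?D \<omega> * v r \<omega> \<partial>M)"
    proof (rule path_value_v_expectation[OF r0 _ D_bd])
      have "(\<lambda>\<omega>. indicator A \<omega> * (E' \<omega> * (Z r \<omega> + lamX r \<omega>))) \<in> borel_measurable (Fil r)"
        using Ar E'(1) ad[OF r0(1)] lamX_adapted[OF r0(1)] by measurable
      then show "(\<lambda>\<omega>. indicator A \<omega> * (E' \<omega> * (Z r \<omega> + lamX r \<omega>))) \<in> borel_measurable (Fil r)" .
      show "AE \<omega> in M. ?D \<omega> = indicator A \<omega> * (E' \<omega> * (Z r \<omega> + lamX r \<omega>))"
        using E'(2) by eventually_elim (simp add: E_eq Z'_eq[OF r0(1)])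
    qed measurable
    have D_int: "integrable M (\<lambda>\<omega>. ?D \<omega> * y \<omega>)" if "y \<in> borel_measurable M" "\<And>\<omega>. \<omega> \<in> space M \<Longrightarrow> 0 \<le> y \<omega> \<and> y \<omega> \<le> 1" for y
    proof (rule integrable_const_bound[where B="1 * (K * (C + l)) * 1"])
      show "AE \<omega> in M. norm (?D \<omega> * y \<omega>) \<le> 1 * (K * (C + l)) * 1"
        unfolding real_norm_def using that(2) by (intro AE_I2 abs_mult_le[OF D_bd]) auto
    qed (use that in measurable)
    have R_int: "integrable M ?R"
    proof (rule integrable_const_bound[where B="1 * (K * l)"])
      show "AE \<omega> in M. norm (?R \<omega>) \<le> 1 * (K * l)"
        unfolding real_norm_def using r0 by (intro AE_I2 abs_mult_le[OF Ind] abs_mult_le[OF E_bd] lg) auto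
    qed measurable
    have "(\<integral>\<omega>. h path_value r \<omega> \<partial>M) = (\<integral>\<omega>. ?D \<omega> * path_value r \<omega> - ?R \<omega> \<partial>M)"
      by (intro Bochner_Integration.integral_cong refl) (simp add: h_def algebra_simps)
    also have "\<dots> = (\<integral>\<omega>. ?D \<omega> * v r \<omega> - ?R \<omega> \<partial>M)"
      using D_int[of "path_value r"] D_int[of "v r"] y_v y_fb r0 R_int eq by simp
    also have "\<dots> = (\<integral>\<omega>. h v r \<omega> \<partial>M)"
      by (intro Bochner_Integration.integral_cong refl) (simp add: h_def algebra_simps)
    finally show ?thesis .
  qed
  note [measurable] = section_measurable(1)[OF Em] section_measurable(1)[OF process_measurable(1)] section_measurable(1)[OF process_measurable(2)]
  have E_int: "integrable M (\<lambda>\<omega>. indicator A \<omega> * E r \<omega> * y \<omega>)"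
    if "r \<in> {0..t}" "y \<in> borel_measurable M" "\<And>\<omega>. \<omega> \<in> space M \<Longrightarrow> 0 \<le> y \<omega> \<and> y \<omega> \<le> 1" for r y
  proof (rule integrable_const_bound[where B="1 * K * 1"])
    show "AE \<omega> in M. norm (indicator A \<omega> * E r \<omega> * y \<omega>) \<le> 1 * K * 1"
      unfolding real_norm_def using that by (intro AE_I2 abs_mult_le Ind E_bd) auto
  qed (use that in measurable)
  have at_s: "(\<integral>\<omega>. indicator A \<omega> * E s \<omega> * path_value s \<omega> \<partial>M) = (\<integral>\<omega>. indicator A \<omega> * E s \<omega> * v s \<omega> \<partial>M)"
  proof -
    obtain E' where E': "E' \<in> borel_measurable (Fil s)" "AE \<omega> in M. exp_int Z s \<omega> = E' \<omega>"
      using exp_int_ae_adapted[OF Z s(1)] by blast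
    show ?thesis
    proof (rule path_value_v_expectation[OF s])
      show "\<bar>indicator A \<omega> * E s \<omega>\<bar> \<le> 1 * K" if "\<omega> \<in> space M" for \<omega>
        using that s by (intro abs_mult_le Ind E_bd) auto
      show "(\<lambda>\<omega>. indicator A \<omega> * E' \<omega>) \<in> borel_measurable (Fil s)" using A E'(1) by measurable
      show "AE \<omega> in M. indicator A \<omega> * E s \<omega> = indicator A \<omega> * E' \<omega>"
        using E'(2) by eventually_elim (simp add: E_eq)
    qed measurable
  qed
  have "(\<integral>\<omega>. indicator A \<omega> * (E t \<omega> * v t \<omega> - E s \<omega> * v s \<omega>) \<partial>M)
      = (\<integral>\<omega>. indicator A \<omega> * E t \<omega> * v t \<omega> \<partial>M) - (\<integral>\<omega>. indicator A \<omega> * E s \<omega> * v s \<omega> \<partial>M)"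
    using E_int[of t "v t"] E_int[of s "v s"] y_v s t_nonneg by (simp add: right_diff_distrib mult.assoc)
  also have "\<dots> = (\<integral>\<omega>. indicator A \<omega> * (E t \<omega> * v t \<omega> - E s \<omega> * path_value s \<omega>) \<partial>M)"
    using E_int[of t "v t"] E_int[of s "path_value s"] y_v y_fb s t_nonneg at_s by (simp add: right_diff_distrib mult.assoc)
  also have "\<dots> = (\<integral>\<omega>. (LINT r:{s..t}|lborel. h path_value r \<omega>) \<partial>M)"
    using pathwise by (intro Bochner_Integration.integral_cong refl) simp
  also have "\<dots> = (LINT r:{s..t}|lborel. (\<integral>\<omega>. h path_value r \<omega> \<partial>M))" by (rule swap[OF process_measurable(2) y_fb])
  also have "\<dots> = (LINT r:{s..t}|lborel. (\<integral>\<omega>. h v r \<omega> \<partial>M))"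
    using same by (intro set_lebesgue_integral_cong) auto
  also have "\<dots> = (\<integral>\<omega>. (LINT r:{s..t}|lborel. h v r \<omega>) \<partial>M)" by (rule swap[OF process_measurable(1) y_v, symmetric])
  also have "\<dots> = (\<integral>\<omega>. indicator A \<omega> * (LINT r:{s..t}|lborel. exp_int Z r \<omega> * (v r \<omega> * (Z r \<omega> + lamX r \<omega>) - lamX r \<omega> * genX r \<omega>)) \<partial>M)"
  proof (intro Bochner_Integration.integral_cong refl)
    fix \<omega>
    have "(LINT r:{s..t}|lborel. h v r \<omega>) = (LINT r:{s..t}|lborel. indicator A \<omega> * (exp_int Z r \<omega> * (v r \<omega> * (Z r \<omega> + lamX r \<omega>) - lamX r \<omega> * genX r \<omega>)))"
      using s by (intro set_lebesgue_integral_cong) (auto simp: h_def E_eq Z'_eq)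
    then show "(LINT r:{s..t}|lborel. h v r \<omega>) = indicator A \<omega> * (LINT r:{s..t}|lborel. exp_int Z r \<omega> * (v r \<omega> * (Z r \<omega> + lamX r \<omega>) - lamX r \<omega> * genX r \<omega>))"
      by simp
  qed
  finally show ?thesis by (simp add: E_eq)
qed

section \<open>The primal problem\<close>

definition hX :: "real \<Rightarrow> real \<Rightarrow> 'w \<Rightarrow> real" where
  "hX r z \<omega> = branching_h lam p (path_at r (W \<omega>)) (z + lamX r \<omega>)"

lemma hX_measurable:
  assumes [measurable]: "(\<lambda>(r, \<omega>). Z r \<omega>) \<in> borel_measurable (borel \<Otimes>\<^sub>M M)"
  shows "(\<lambda>(r, \<omega>). hX r (Z r \<omega>) \<omega>) \<in> borel_measurable (borel \<Otimes>\<^sub>M M)"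
  unfolding hX_def case_prod_beta by measurable

lemma hX_abs_le: "\<bar>hX r z \<omega>\<bar> \<le> \<bar>z\<bar> + 2 * l"
  using branching_h_abs_le[of "path_at r (W \<omega>)" "z + lamX r \<omega>"] process_range(1,2)[of r \<omega>]
  by (auto simp: hX_def)

lemma hX_ge: "r \<le> t \<Longrightarrow> v r \<omega> * (z + lamX r \<omega>) - lamX r \<omega> * genX r \<omega> \<le> hX r z \<omega>"
  using branching_h_ge[of "v r \<omega>" "z + lamX r \<omega>" "path_at r (W \<omega>)"] process_range(5)[of r \<omega>]
  by (simp add: hX_def genX_def lamX_def)

text \<open>The control for which \<open>z + lamX\<close> is the slope of \<open>\<lambda> G\<close> at the current value.\<close>

definition opt_control :: "real \<Rightarrow> 'w \<Rightarrow> real" where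
  "opt_control r \<omega> = (if r \<le> t then lamX r \<omega> * (gen_deriv (path_at r (W \<omega>)) (v r \<omega>) - 1) else 0)"

lemma hX_opt_control: "r \<le> t \<Longrightarrow> hX r (opt_control r \<omega>) \<omega> = v r \<omega> * (opt_control r \<omega> + lamX r \<omega>) - lamX r \<omega> * genX r \<omega>"
proof -
  assume r: "r \<le> t"
  have "opt_control r \<omega> + lamX r \<omega> = lam (path_at r (W \<omega>)) * gen_deriv (path_at r (W \<omega>)) (v r \<omega>)"
    using r by (simp add: opt_control_def lamX_def algebra_simps)
  then show ?thesis
    using branching_h_eq[of "v r \<omega>" "path_at r (W \<omega>)"] process_range(5)[OF r, of \<omega>]
    by (simp add: hX_def genX_def lamX_def)
qed

lemma opt_control_bounded_adapted: "opt_control \<in> bounded_adapted M Fil"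
  unfolding bounded_adapted_def
proof (intro CollectI conjI)
  show "measurable_process M opt_control"
    unfolding opt_control_def[abs_def] by (rule measurable_process_restrict) (unfold case_prod_beta, measurable)
  show "bounded_process M opt_control"
    unfolding bounded_process_def
  proof (intro exI allI ballI impI)
    fix s \<omega>
    have "\<bar>lamX s \<omega> * (gen_deriv (path_at s (W \<omega>)) (v s \<omega>) - 1)\<bar> \<le> l * (m + 1)"
      using process_range(1,2)[of s \<omega>] gen_deriv_range[of "path_at s (W \<omega>)" "v s \<omega>"]
      by (intro abs_mult_le) (auto simp: abs_le_iff simp del: gen_deriv_range)
    moreover have "0 \<le> l * (m + 1)" using l_nonneg m_nonneg by simp
    ultimately show "\<bar>opt_control s \<omega>\<bar> \<le> l * (m + 1)" by (simp add: opt_control_def)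
  qed
  show "adapted_process Fil opt_control"
    unfolding adapted_process_def
  proof (intro allI impI)
    fix s :: real assume s: "0 \<le> s"
    note [measurable] = v_adapted[OF s] lamX_adapted[OF s]
    have [measurable]: "(\<lambda>\<omega>. path_at s (W \<omega>)) \<in> Fil s \<rightarrow>\<^sub>M borel"
      using X_Fil[of s s] s by (simp add: X_def[abs_def])
    show "opt_control s \<in> borel_measurable (Fil s)" unfolding opt_control_def[abs_def] by measurable
  qed
qed

lemma integral_v0: "(\<integral>\<omega>. v 0 \<omega> \<partial>M) = val t x0"
proof -
  have "(\<integral>\<omega>. v 0 \<omega> \<partial>M) = (\<integral>\<omega>. val t x0 \<partial>M)"
  proof (rule integral_cong_AE)
    show "v 0 \<in> borel_measurable M" by (rule section_measurable(1)[OF process_measurable(1)])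
    show "AE \<omega> in M. v 0 \<omega> = val t x0" using X_0 by eventually_elim (simp add: v_def X_def)
  qed simp
  then show ?thesis by (simp add: prob_space)
qed

lemma time_integral_bounded:
  fixes h :: "real \<Rightarrow> 'w \<Rightarrow> real"
  assumes m: "(\<lambda>(r, \<omega>). h r \<omega>) \<in> borel_measurable (borel \<Otimes>\<^sub>M M)"
    and bd: "\<And>r \<omega>. \<omega> \<in> space M \<Longrightarrow> r \<in> {a..b} \<Longrightarrow> \<bar>h r \<omega>\<bar> \<le> B"
  shows "\<And>\<omega>. \<omega> \<in> space M \<Longrightarrow> set_integrable lborel {a..b} (\<lambda>r. h r \<omega>)"
    and "integrable M (\<lambda>\<omega>. LINT r:{a..b}|lborel. h r \<omega>)"
proof -
  show "set_integrable lborel {a..b} (\<lambda>r. h r \<omega>)" if w: "\<omega> \<in> space M" for \<omega>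
    by (rule bounded_set_integrable[OF section_measurable(2)[OF m w]]) (rule bd[OF w])
  show "integrable M (\<lambda>\<omega>. LINT r:{a..b}|lborel. h r \<omega>)"
  proof (rule expectation_time_integral(2)[OF m])
    fix r assume r: "r \<in> {a..b}"
    show "(\<integral>\<^sup>+\<omega>. ennreal \<bar>h r \<omega>\<bar> \<partial>M) \<le> ennreal B"
      by (rule nn_integral_bounded_le) (rule bd[OF _ r])
  qed
qed

lemma primal_objective_alt:
  "primal_objective M lam p X f t Z = (\<integral>\<omega>. exp_int (\<lambda>r. Z (max 0 r)) t \<omega> * v t \<omega>
     - (LINT r:{0..t}|lborel. exp_int (\<lambda>r. Z (max 0 r)) r \<omega> * hX r (Z (max 0 r) \<omega>) \<omega>) \<partial>M)"
  unfolding primal_objective_def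
proof (intro Bochner_Integration.integral_cong refl)
  fix \<omega>
  have "(LINT s:{0..t}|lborel. exp_int Z s \<omega> * branching_h lam p (X s \<omega>) (Z s \<omega> + lam (X s \<omega>)))
      = (LINT r:{0..t}|lborel. exp_int (\<lambda>r. Z (max 0 r)) r \<omega> * hX r (Z (max 0 r) \<omega>) \<omega>)"
    by (intro set_lebesgue_integral_cong)
      (auto simp: exp_int_extend[of Z, symmetric] hX_def lamX_def X_def)
  then show "exp_int Z t \<omega> * f (X t \<omega>) - (LINT s:{0..t}|lborel. exp_int Z s \<omega> * branching_h lam p (X s \<omega>) (Z s \<omega> + lam (X s \<omega>)))
    = exp_int (\<lambda>r. Z (max 0 r)) t \<omega> * v t \<omega> - (LINT r:{0..t}|lborel. exp_int (\<lambda>r. Z (max 0 r)) r \<omega> * hX r (Z (max 0 r) \<omega>) \<omega>)"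
    by (simp add: v_t exp_int_extend[of Z, symmetric])
qed

text \<open>Compare the integrand of \<open>feynman_kac\<close> with \<open>hX\<close>.\<close>

lemma primal_value:
  assumes Z: "Z \<in> bounded_adapted M Fil"
  shows "primal_objective M lam p X f t Z \<le> val t x0"
    and "(\<And>r \<omega>. 0 \<le> r \<Longrightarrow> r \<le> t \<Longrightarrow> hX r (Z r \<omega>) \<omega> = v r \<omega> * (Z r \<omega> + lamX r \<omega>) - lamX r \<omega> * genX r \<omega>)
      \<Longrightarrow> primal_objective M lam p X f t Z = val t x0"
proof -
  obtain C where C: "0 \<le> C" "\<And>r \<omega>. \<omega> \<in> space M \<Longrightarrow> \<bar>Z (max 0 r) \<omega>\<bar> \<le> C"
    and Zm: "(\<lambda>(r, \<omega>). Z (max 0 r) \<omega>) \<in> borel_measurable (borel \<Otimes>\<^sub>M M)"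
    and ad: "\<And>r. 0 \<le> r \<Longrightarrow> Z r \<in> borel_measurable (Fil r)"
    using bounded_adaptedE[OF Z] by blast
  define Z' where "Z' r \<omega> = Z (max 0 r) \<omega>" for r \<omega>
  have Z'_eq: "Z' r \<omega> = Z r \<omega>" if "0 \<le> r" for r \<omega> using that by (simp add: Z'_def)
  have Z'm [measurable]: "(\<lambda>(r, \<omega>). Z' r \<omega>) \<in> borel_measurable (borel \<Otimes>\<^sub>M M)" using Zm by (simp add: Z'_def)
  have Z'_bd: "\<bar>Z' r \<omega>\<bar> \<le> C" if "\<omega> \<in> space M" for r \<omega> using C(2) that by (simp add: Z'_def)
  define E where "E r \<omega> = exp_int Z' r \<omega>" for r \<omega>
  have E_eq: "exp_int Z r \<omega> = E r \<omega>" for r \<omega> unfolding E_def exp_int_extend[of Z] Z'_def ..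
  have Em [measurable]: "(\<lambda>(r, \<omega>). E r \<omega>) \<in> borel_measurable (borel \<Otimes>\<^sub>M M)"
    unfolding E_def by (rule exp_int_measurable[OF Z'm])
  define K where "K = exp (C * t)"
  have E_bd: "0 \<le> E r \<omega>" "\<bar>E r \<omega>\<bar> \<le> K" if "\<omega> \<in> space M" "r \<in> {0..t}" for r \<omega>
    using exp_int_bound[OF Z'm that(1) Z'_bd[OF that(1)] that(2)] by (simp_all add: E_def K_def)
  let ?d = "\<lambda>r \<omega>. v r \<omega> * (Z' r \<omega> + lamX r \<omega>) - lamX r \<omega> * genX r \<omega>"
  let ?h = "\<lambda>r \<omega>. hX r (Z' r \<omega>) \<omega>"
  have h_m: "(\<lambda>(r, \<omega>). E r \<omega> * ?h r \<omega>) \<in> borel_measurable (borel \<Otimes>\<^sub>M M)"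
    using hX_measurable[OF Z'm] by measurable
  have d_m: "(\<lambda>(r, \<omega>). E r \<omega> * ?d r \<omega>) \<in> borel_measurable (borel \<Otimes>\<^sub>M M)"
    by measurable
  have h_bd: "\<bar>E r \<omega> * ?h r \<omega>\<bar> \<le> K * (C + 2 * l)" if "\<omega> \<in> space M" "r \<in> {0..t}" for r \<omega>
    using hX_abs_le[of r "Z' r \<omega>" \<omega>] Z'_bd[of \<omega> r] that by (intro abs_mult_le E_bd) auto
  have d_bd: "\<bar>E r \<omega> * ?d r \<omega>\<bar> \<le> K * ((C + l) + l)" if "\<omega> \<in> space M" "r \<in> {0..t}" for r \<omega>
  proof (intro abs_mult_le E_bd that order_trans[OF abs_triangle_ineq4] add_mono)
    have "\<bar>v r \<omega> * (Z' r \<omega> + lamX r \<omega>)\<bar> \<le> 1 * (C + l)"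
      using process_range(5)[of r \<omega>] process_range(1,2)[of r \<omega>] Z'_bd[OF that(1), of r] that by (intro abs_mult_le) auto
    then show "\<bar>v r \<omega> * (Z' r \<omega> + lamX r \<omega>)\<bar> \<le> C + l" by simp
    have "\<bar>lamX r \<omega> * genX r \<omega>\<bar> \<le> l * 1"
      using process_range(1-4)[of r \<omega>] by (intro abs_mult_le) auto
    then show "\<bar>lamX r \<omega> * genX r \<omega>\<bar> \<le> l" by simp
  qed
  have t0: "0 \<le> t" "t \<in> {0..t}" using t_nonneg by auto
  note h_int = time_integral_bounded[OF h_m h_bd] and d_int = time_integral_bounded[OF d_m d_bd]
  have v_m: "v r \<in> borel_measurable M" for r by (rule section_measurable(1)[OF process_measurable(1)])
  have Ev_int: "integrable M (\<lambda>\<omega>. E t \<omega> * v t \<omega>)"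
  proof (rule integrable_const_bound[where B="K * 1"])
    show "AE \<omega> in M. norm (E t \<omega> * v t \<omega>) \<le> K * 1"
      unfolding real_norm_def using process_range(5)[of t] t0 by (intro AE_I2 abs_mult_le E_bd) auto
  qed (use section_measurable(1)[OF Em, of t] v_m[of t] in measurable)
  have v0_int: "integrable M (v 0)"
    using v_m process_range(5)[of 0] t_nonneg by (intro integrable_const_bound[where B=1] AE_I2) auto
  have alt: "primal_objective M lam p X f t Z = (\<integral>\<omega>. E t \<omega> * v t \<omega> - (LINT r:{0..t}|lborel. E r \<omega> * ?h r \<omega>) \<partial>M)"
    unfolding primal_objective_alt E_def Z'_def by simp
  have sp: "space M \<in> sets (Fil 0)" using sets.top[of "Fil 0"] by simp
  have "(\<integral>\<omega>. E t \<omega> * v t \<omega> - v 0 \<omega> \<partial>M) = (\<integral>\<omega>. (LINT r:{0..t}|lborel. E r \<omega> * ?d r \<omega>) \<partial>M)"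
  proof -
    have "(\<integral>\<omega>. E t \<omega> * v t \<omega> - v 0 \<omega> \<partial>M) = (\<integral>\<omega>. indicator (space M) \<omega> * (exp_int Z t \<omega> * v t \<omega> - exp_int Z 0 \<omega> * v 0 \<omega>) \<partial>M)"
      by (intro Bochner_Integration.integral_cong refl) (simp add: exp_int_0 E_eq[symmetric])
    also have "\<dots> = (\<integral>\<omega>. indicator (space M) \<omega> * (LINT r:{0..t}|lborel. exp_int Z r \<omega> * (v r \<omega> * (Z r \<omega> + lamX r \<omega>) - lamX r \<omega> * genX r \<omega>)) \<partial>M)"
      by (rule feynman_kac[OF Z order_refl t_nonneg sp])
    also have "\<dots> = (\<integral>\<omega>. (LINT r:{0..t}|lborel. E r \<omega> * ?d r \<omega>) \<partial>M)"
    proof (intro Bochner_Integration.integral_cong refl)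
      fix \<omega> assume "\<omega> \<in> space M"
      moreover have "(LINT r:{0..t}|lborel. exp_int Z r \<omega> * (v r \<omega> * (Z r \<omega> + lamX r \<omega>) - lamX r \<omega> * genX r \<omega>)) = (LINT r:{0..t}|lborel. E r \<omega> * ?d r \<omega>)"
        by (intro set_lebesgue_integral_cong) (auto simp: E_eq Z'_eq)
      ultimately show "indicator (space M) \<omega> * (LINT r:{0..t}|lborel. exp_int Z r \<omega> * (v r \<omega> * (Z r \<omega> + lamX r \<omega>) - lamX r \<omega> * genX r \<omega>)) = (LINT r:{0..t}|lborel. E r \<omega> * ?d r \<omega>)"
        by simp
    qed
    finally show ?thesis .
  qed
  then have val_eq: "val t x0 = (\<integral>\<omega>. E t \<omega> * v t \<omega> - (LINT r:{0..t}|lborel. E r \<omega> * ?d r \<omega>) \<partial>M)"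
    using Ev_int v0_int d_int(2) by (simp add: integral_v0)
  show "primal_objective M lam p X f t Z \<le> val t x0"
    unfolding alt val_eq
  proof (intro integral_mono Bochner_Integration.integrable_diff Ev_int h_int(2) d_int(2) diff_left_mono)
    fix \<omega> assume w: "\<omega> \<in> space M"
    show "(LINT r:{0..t}|lborel. E r \<omega> * ?d r \<omega>) \<le> (LINT r:{0..t}|lborel. E r \<omega> * ?h r \<omega>)"
      using hX_ge E_bd(1)[OF w] by (intro set_integral_mono d_int(1) h_int(1) w mult_left_mono) auto
  qed
  show "primal_objective M lam p X f t Z = val t x0"
    if "\<And>r \<omega>. 0 \<le> r \<Longrightarrow> r \<le> t \<Longrightarrow> hX r (Z r \<omega>) \<omega> = v r \<omega> * (Z r \<omega> + lamX r \<omega>) - lamX r \<omega> * genX r \<omega>"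
  proof -
    have "(LINT r:{0..t}|lborel. E r \<omega> * ?d r \<omega>) = (LINT r:{0..t}|lborel. E r \<omega> * ?h r \<omega>)" for \<omega>
      using that by (intro set_lebesgue_integral_cong) (auto simp: Z'_eq)
    then show ?thesis unfolding alt val_eq by simp
  qed
qed

section \<open>The dual problem\<close>

lemma ratio_nonneg: "\<zeta> \<in> nonneg_martingales M Fil \<Longrightarrow> \<omega> \<in> space M \<Longrightarrow> 0 \<le> s \<Longrightarrow> 0 \<le> ratio \<zeta> t s \<omega>"
  using t_nonneg by (auto simp: ratio_def nonneg_martingales_def)

text \<open>The martingale property, divided by \<open>\<zeta> s\<close> where it is positive.  On the remaining event the
  convention for the ratio gives 1.\<close>

lemma ratio_expectation:
  assumes \<zeta>: "\<zeta> \<in> nonneg_martingales M Fil" and s: "0 \<le> s" "s \<le> t" and A: "A \<in> sets (Fil s)"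
  shows "(\<integral>\<^sup>+\<omega>. indicator A \<omega> * ennreal (ratio \<zeta> t s \<omega>) \<partial>M) = emeasure M A"
proof -
  interpret F: finite_measure_subalgebra M "Fil s" by unfold_locales (rule subalgebra_Fil)
  have zs [measurable]: "\<zeta> s \<in> borel_measurable (Fil s)" and zm: "measurable_process M \<zeta>"
    and nn: "\<And>r \<omega>. 0 \<le> r \<Longrightarrow> \<omega> \<in> space M \<Longrightarrow> 0 \<le> \<zeta> r \<omega>" and int: "\<And>r. 0 \<le> r \<Longrightarrow> integrable M (\<zeta> r)"
    and mart: "AE \<omega> in M. real_cond_exp M (Fil s) (\<zeta> t) \<omega> = \<zeta> s \<omega>"
    using \<zeta> s by (auto simp: nonneg_martingales_def adapted_process_def)
  have AM [measurable]: "A \<in> sets M" using A subalgebra_Fil by (auto simp: subalgebra_def)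
  note [measurable] = measurable_from_subalg[OF subalgebra_Fil zs] measurable_process_section[OF zm t_nonneg] A
  have ce: "AE \<omega> in M. ennreal (\<zeta> s \<omega>) = nn_cond_exp M (Fil s) (\<lambda>\<omega>. ennreal (\<zeta> t \<omega>)) \<omega>"
  proof (rule F.nn_cond_exp_charact)
    fix B assume B: "B \<in> sets (Fil s)"
    then have BM [measurable]: "B \<in> sets M" using subalgebra_Fil by (auto simp: subalgebra_def)
    have i: "integrable M (\<lambda>\<omega>. indicator B \<omega> * \<zeta> r \<omega>)" if "0 \<le> r" for r
      using integrable_mult_indicator[OF BM int[OF that]] by simp
    have e: "(\<integral>\<^sup>+\<omega>\<in>B. ennreal (\<zeta> r \<omega>) \<partial>M) = ennreal (\<integral>\<omega>\<in>B. \<zeta> r \<omega> \<partial>M)" if "0 \<le> r" for r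
    proof -
      have "(\<integral>\<^sup>+\<omega>\<in>B. ennreal (\<zeta> r \<omega>) \<partial>M) = (\<integral>\<^sup>+\<omega>. ennreal (indicator B \<omega> * \<zeta> r \<omega>) \<partial>M)"
        by (intro nn_integral_cong) (auto split: split_indicator)
      also have "\<dots> = ennreal (\<integral>\<omega>. indicator B \<omega> * \<zeta> r \<omega> \<partial>M)"
        using nn[OF that] by (intro nn_integral_eq_integral[OF i[OF that]] AE_I2) auto
      finally show ?thesis by (simp add: set_lebesgue_integral_def)
    qed
    have "(\<integral>\<omega>\<in>B. \<zeta> t \<omega> \<partial>M) = (\<integral>\<omega>\<in>B. real_cond_exp M (Fil s) (\<zeta> t) \<omega> \<partial>M)"
      by (rule F.real_cond_exp_intA[OF int[OF t_nonneg] B])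
    also have "\<dots> = (\<integral>\<omega>\<in>B. \<zeta> s \<omega> \<partial>M)"
      unfolding set_lebesgue_integral_def using mart by (intro integral_cong_AE) auto
    finally show "(\<integral>\<^sup>+\<omega>\<in>B. ennreal (\<zeta> t \<omega>) \<partial>M) = (\<integral>\<^sup>+\<omega>\<in>B. ennreal (\<zeta> s \<omega>) \<partial>M)"
      using e[OF t_nonneg] e[OF s(1)] by simp
  qed auto
  define \<psi> where "\<psi> \<omega> = indicator A \<omega> * ennreal (1 / \<zeta> s \<omega>)" for \<omega>
  have \<psi> [measurable]: "\<psi> \<in> borel_measurable (Fil s)" unfolding \<psi>_def[abs_def] by measurable
  note [measurable] = measurable_from_subalg[OF subalgebra_Fil \<psi>]
  define N where "N = {\<omega> \<in> space M. \<zeta> s \<omega> = 0}"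
  have [measurable]: "N \<in> sets M" unfolding N_def by measurable
  have "(\<integral>\<^sup>+\<omega>. indicator A \<omega> * ennreal (ratio \<zeta> t s \<omega>) \<partial>M) = (\<integral>\<^sup>+\<omega>. indicator (A \<inter> N) \<omega> + \<psi> \<omega> * ennreal (\<zeta> t \<omega>) \<partial>M)"
    using nn[OF s(1)] nn[OF t_nonneg]
    by (intro nn_integral_cong) (auto simp: ratio_def \<psi>_def N_def ennreal_mult[symmetric] split: split_indicator)
  also have "\<dots> = (\<integral>\<^sup>+\<omega>. indicator (A \<inter> N) \<omega> \<partial>M) + (\<integral>\<^sup>+\<omega>. \<psi> \<omega> * ennreal (\<zeta> t \<omega>) \<partial>M)"
    by (rule nn_integral_add) auto
  also have "(\<integral>\<^sup>+\<omega>. \<psi> \<omega> * ennreal (\<zeta> t \<omega>) \<partial>M) = (\<integral>\<^sup>+\<omega>. \<psi> \<omega> * nn_cond_exp M (Fil s) (\<lambda>\<omega>. ennreal (\<zeta> t \<omega>)) \<omega> \<partial>M)"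
    by (rule F.nn_cond_exp_intg[symmetric]) auto
  also have "\<dots> = (\<integral>\<^sup>+\<omega>. indicator (A - N) \<omega> \<partial>M)"
  proof (rule nn_integral_cong_AE)
    show "AE \<omega> in M. \<psi> \<omega> * nn_cond_exp M (Fil s) (\<lambda>\<omega>. ennreal (\<zeta> t \<omega>)) \<omega> = indicator (A - N) \<omega>"
      using ce AE_space
    proof eventually_elim
      case (elim \<omega>)
      have "ennreal (1 / \<zeta> s \<omega>) * ennreal (\<zeta> s \<omega>) = (if \<zeta> s \<omega> = 0 then 0 else 1)"
        using nn[OF s(1) elim(2)] by (simp flip: ennreal_mult)
      then show ?case using elim by (auto simp: \<psi>_def N_def mult.assoc split: split_indicator)
    qed
  qed
  also have "(\<integral>\<^sup>+\<omega>. indicator (A \<inter> N) \<omega> \<partial>M) + (\<integral>\<^sup>+\<omega>. indicator (A - N) \<omega> \<partial>M) = (\<integral>\<^sup>+\<omega>. indicator (A \<inter> N) \<omega> + indicator (A - N) \<omega> \<partial>M)"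
    by (rule nn_integral_add[symmetric]) auto
  also have "\<dots> = (\<integral>\<^sup>+\<omega>. indicator A \<omega> \<partial>M)"
    by (intro nn_integral_cong) (auto split: split_indicator)
  finally show ?thesis by simp
qed

lemma ratio_measurable:
  assumes "measurable_process M \<zeta>"
  shows "(\<lambda>(r, \<omega>). ratio (\<lambda>r. \<zeta> (max 0 r)) t r \<omega>) \<in> borel_measurable (borel \<Otimes>\<^sub>M M)"
proof -
  note [measurable] = measurable_process_extend[OF assms]
  have [measurable]: "\<zeta> (max 0 t) \<in> borel_measurable M"
    by (rule measurable_process_section[OF assms]) simp
  show ?thesis unfolding ratio_def case_prod_beta by measurable
qed

lemma ratio_extend: "0 \<le> r \<Longrightarrow> ratio (\<lambda>r. \<zeta> (max 0 r)) t r \<omega> = ratio \<zeta> t r \<omega>"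
  using t_nonneg by (simp add: ratio_def)

lemma ratio_integral:
  assumes \<zeta>: "\<zeta> \<in> nonneg_martingales M Fil" and s: "0 \<le> s" "s \<le> t"
  shows "integrable M (ratio \<zeta> t s)"
    and "D \<in> borel_measurable M \<Longrightarrow> (\<And>\<omega>. \<omega> \<in> space M \<Longrightarrow> \<bar>D \<omega>\<bar> \<le> C) \<Longrightarrow> D' \<in> borel_measurable (Fil s) \<Longrightarrow>
      AE \<omega> in M. D \<omega> = D' \<omega> \<Longrightarrow> (\<integral>\<omega>. D \<omega> * ratio \<zeta> t s \<omega> \<partial>M) = (\<integral>\<omega>. D \<omega> \<partial>M)"
proof -
  interpret F: finite_measure_subalgebra M "Fil s" by unfold_locales (rule subalgebra_Fil)
  have zm: "measurable_process M \<zeta>" using \<zeta> by (simp add: nonneg_martingales_def)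
  note nn = ratio_nonneg[OF \<zeta> _ s(1)]
  have sp: "space M \<in> sets (Fil s)" using sets.top[of "Fil s"] by simp
  have rm [measurable]: "ratio \<zeta> t s \<in> borel_measurable M"
  proof -
    have "ratio (\<lambda>r. \<zeta> (max 0 r)) t s = ratio \<zeta> t s" by (rule ext) (rule ratio_extend[OF s(1)])
    then show ?thesis using section_measurable(1)[OF ratio_measurable[OF zm], of s] by simp
  qed
  have "(\<integral>\<^sup>+\<omega>. ennreal (ratio \<zeta> t s \<omega>) \<partial>M) = (\<integral>\<^sup>+\<omega>. indicator (space M) \<omega> * ennreal (ratio \<zeta> t s \<omega>) \<partial>M)"
    by (intro nn_integral_cong) simp
  also have "\<dots> = 1" unfolding ratio_expectation[OF \<zeta> s sp] by (rule emeasure_space_1)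
  finally show int: "integrable M (ratio \<zeta> t s)"
    using nn by (intro integrableI_nonneg) auto
  assume D [measurable]: "D \<in> borel_measurable M" and bd: "\<And>\<omega>. \<omega> \<in> space M \<Longrightarrow> \<bar>D \<omega>\<bar> \<le> C"
    and D' [measurable]: "D' \<in> borel_measurable (Fil s)" and ae: "AE \<omega> in M. D \<omega> = D' \<omega>"
  note [measurable] = measurable_from_subalg[OF subalgebra_Fil D']
  have ce: "AE \<omega> in M. real_cond_exp M (Fil s) (ratio \<zeta> t s) \<omega> = 1"
  proof (rule F.real_cond_exp_charact[OF _ int])
    fix A assume A: "A \<in> sets (Fil s)"
    then have AM [measurable]: "A \<in> sets M" using subalgebra_Fil by (auto simp: subalgebra_def)
    have "ennreal (\<integral>\<omega>\<in>A. ratio \<zeta> t s \<omega> \<partial>M) = (\<integral>\<^sup>+\<omega>. ennreal (indicator A \<omega> * ratio \<zeta> t s \<omega>) \<partial>M)"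
      unfolding set_lebesgue_integral_def using nn integrable_mult_indicator[OF AM int]
      by (subst nn_integral_eq_integral) auto
    also have "\<dots> = (\<integral>\<^sup>+\<omega>. indicator A \<omega> * ennreal (ratio \<zeta> t s \<omega>) \<partial>M)"
      by (intro nn_integral_cong) (auto split: split_indicator)
    also have "\<dots> = ennreal (measure M A)" using ratio_expectation[OF \<zeta> s A] by (simp add: emeasure_eq_measure)
    finally have "(\<integral>\<omega>\<in>A. ratio \<zeta> t s \<omega> \<partial>M) = measure M A"
      using nn by (subst (asm) ennreal_inj) (auto simp: set_lebesgue_integral_def intro!: integral_nonneg_AE)
    then show "(\<integral>\<omega>\<in>A. ratio \<zeta> t s \<omega> \<partial>M) = (\<integral>\<omega>\<in>A. 1 \<partial>M)" by (simp add: set_lebesgue_integral_def)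
  qed auto
  have D'R: "integrable M (\<lambda>\<omega>. D' \<omega> * ratio \<zeta> t s \<omega>)"
  proof (rule Bochner_Integration.integrable_bound[OF integrable_mult_right[OF int, of C]])
    show "AE \<omega> in M. norm (D' \<omega> * ratio \<zeta> t s \<omega>) \<le> norm (C * ratio \<zeta> t s \<omega>)"
      using ae AE_space
    proof eventually_elim
      case (elim \<omega>)
      then have "\<bar>D' \<omega>\<bar> \<le> \<bar>C\<bar>" using bd[of \<omega>] by auto
      then show ?case by (simp add: abs_mult mult_right_mono)
    qed
  qed measurable
  have "(\<integral>\<omega>. D \<omega> * ratio \<zeta> t s \<omega> \<partial>M) = (\<integral>\<omega>. D' \<omega> * ratio \<zeta> t s \<omega> \<partial>M)"
    using ae by (intro integral_cong_AE) auto
  also have "\<dots> = (\<integral>\<omega>. D' \<omega> * real_cond_exp M (Fil s) (ratio \<zeta> t s) \<omega> \<partial>M)"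
    by (rule F.real_cond_exp_intg(2)[symmetric, OF D'R D' rm])
  also have "\<dots> = (\<integral>\<omega>. D \<omega> \<partial>M)" using ae ce by (intro integral_cong_AE) auto
  finally show "(\<integral>\<omega>. D \<omega> * ratio \<zeta> t s \<omega> \<partial>M) = (\<integral>\<omega>. D \<omega> \<partial>M)" .
qed

definition dual_integrand :: "(real \<Rightarrow> 'w \<Rightarrow> real) \<Rightarrow> (real \<Rightarrow> 'w \<Rightarrow> real) \<Rightarrow> real \<Rightarrow> 'w \<Rightarrow> real" where
  "dual_integrand \<zeta> z r \<omega> = exp_int (\<lambda>r. z (max 0 r)) r \<omega> * (z (max 0 r) \<omega>
      + (hX r (z (max 0 r) \<omega>) \<omega> - z (max 0 r) \<omega>) * ratio (\<lambda>r. \<zeta> (max 0 r)) t r \<omega>)"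

lemma dual_payoff_alt:
  "dual_payoff lam p X f t \<zeta> z \<omega> = exp_int (\<lambda>r. z (max 0 r)) t \<omega> * v t \<omega> - (LINT r:{0..t}|lborel. dual_integrand \<zeta> z r \<omega>)"
proof -
  have "(LINT s:{0..t}|lborel. exp_int z s \<omega> * (z s \<omega> + (branching_h lam p (X s \<omega>) (z s \<omega> + lam (X s \<omega>)) - z s \<omega>) * ratio \<zeta> t s \<omega>))
      = (LINT r:{0..t}|lborel. dual_integrand \<zeta> z r \<omega>)"
    by (intro set_lebesgue_integral_cong)
      (auto simp: exp_int_extend[of z, symmetric] hX_def lamX_def X_def ratio_extend dual_integrand_def)
  then show ?thesis unfolding dual_payoff_def by (simp add: v_t exp_int_extend[of z, symmetric])
qed

lemma dual_integrand_measurable: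
  assumes z: "measurable_process M z" and \<zeta>: "measurable_process M \<zeta>"
  shows "(\<lambda>(r, \<omega>). dual_integrand \<zeta> z r \<omega>) \<in> borel_measurable (borel \<Otimes>\<^sub>M M)"
proof -
  define Z where "Z r \<omega> = z (max 0 r) \<omega>" for r \<omega>
  define R where "R r \<omega> = ratio (\<lambda>r. \<zeta> (max 0 r)) t r \<omega>" for r \<omega>
  define H where "H r \<omega> = hX r (Z r \<omega>) \<omega>" for r \<omega>
  define E where "E r \<omega> = exp_int Z r \<omega>" for r \<omega>
  have Z: "(\<lambda>(r, \<omega>). Z r \<omega>) \<in> borel_measurable (borel \<Otimes>\<^sub>M M)"
    using measurable_process_extend[OF z] by (simp add: Z_def)
  have R: "(\<lambda>(r, \<omega>). R r \<omega>) \<in> borel_measurable (borel \<Otimes>\<^sub>M M)"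
    using ratio_measurable[OF \<zeta>] by (simp add: R_def)
  have H: "(\<lambda>(r, \<omega>). H r \<omega>) \<in> borel_measurable (borel \<Otimes>\<^sub>M M)"
    unfolding H_def by (rule hX_measurable[OF Z])
  have E: "(\<lambda>(r, \<omega>). E r \<omega>) \<in> borel_measurable (borel \<Otimes>\<^sub>M M)"
    unfolding E_def by (rule exp_int_measurable[OF Z])
  note [measurable] = Z R H E
  have "(\<lambda>(r, \<omega>). E r \<omega> * (Z r \<omega> + (H r \<omega> - Z r \<omega>) * R r \<omega>)) \<in> borel_measurable (borel \<Otimes>\<^sub>M M)"
    by measurable
  then show ?thesis unfolding dual_integrand_def E_def H_def Z_def R_def .
qed

lemma dual_payoff_measurable:
  assumes z: "measurable_process M z" and \<zeta>: "measurable_process M \<zeta>"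
  shows "dual_payoff lam p X f t \<zeta> z \<in> borel_measurable M"
proof -
  define g where "g r \<omega> = dual_integrand \<zeta> z r \<omega>" for r \<omega>
  have [measurable]: "(\<lambda>(r, \<omega>). g r \<omega>) \<in> borel_measurable (borel \<Otimes>\<^sub>M M)"
    unfolding g_def by (rule dual_integrand_measurable[OF assms])
  note [measurable] = section_measurable(1)[OF exp_int_measurable[OF measurable_process_extend[OF z]], of t]
    section_measurable(1)[OF process_measurable(1), of t]
  have "(\<lambda>\<omega>. exp_int (\<lambda>r. z (max 0 r)) t \<omega> * v t \<omega> - (LINT r:{0..t}|lborel. g r \<omega>)) \<in> borel_measurable M"
    by measurable
  then show ?thesis unfolding dual_payoff_alt[abs_def] g_def .
qed

lemma bounded_anticipativeE:
  assumes "z \<in> bounded_anticipative M"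
  obtains C where "0 \<le> C" "\<And>r \<omega>. \<omega> \<in> space M \<Longrightarrow> \<bar>z (max 0 r) \<omega>\<bar> \<le> C" "measurable_process M z"
proof -
  obtain C where C: "\<forall>s\<ge>0. \<forall>\<omega>\<in>space M. \<bar>z s \<omega>\<bar> \<le> C"
    using assms by (auto simp: bounded_anticipative_def bounded_process_def)
  show ?thesis
  proof (rule that)
    show "0 \<le> max 0 C" by simp
    show "\<bar>z (max 0 r) \<omega>\<bar> \<le> max 0 C" if "\<omega> \<in> space M" for r \<omega>
      using C that by (meson max.cobounded1 max.coboundedI2)
    show "measurable_process M z" using assms by (simp add: bounded_anticipative_def)
  qed
qed

text \<open>The ratio is unbounded, but its mean is 1.\<close>

lemma dual_integrand_bound:
  assumes \<zeta>: "\<zeta> \<in> nonneg_martingales M Fil" and z: "measurable_process M z"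
    and bd: "\<And>r \<omega>. \<omega> \<in> space M \<Longrightarrow> \<bar>z (max 0 r) \<omega>\<bar> \<le> C" and r: "r \<in> {0..t}"
  shows "(\<integral>\<^sup>+\<omega>. ennreal \<bar>dual_integrand \<zeta> z r \<omega>\<bar> \<partial>M) \<le> ennreal (exp (C * t) * C + exp (C * t) * (2 * C + 2 * l))"
proof -
  have r0: "0 \<le> r" "r \<le> t" using r by auto
  let ?K = "exp (C * t)"
  have "\<bar>dual_integrand \<zeta> z r \<omega>\<bar> \<le> ?K * C + ?K * (2 * C + 2 * l) * ratio \<zeta> t r \<omega>" if w: "\<omega> \<in> space M" for \<omega>
  proof -
    have E: "0 \<le> exp_int (\<lambda>r. z (max 0 r)) r \<omega>" "exp_int (\<lambda>r. z (max 0 r)) r \<omega> \<le> ?K"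
      using exp_int_bound[OF measurable_process_extend[OF z] w bd[OF w] r] by auto
    let ?z = "z (max 0 r) \<omega>"
    have "\<bar>hX r ?z \<omega> - ?z\<bar> \<le> 2 * C + 2 * l"
      using hX_abs_le[of r ?z \<omega>] bd[OF w, of r] by linarith
    then have "\<bar>(hX r ?z \<omega> - ?z) * ratio \<zeta> t r \<omega>\<bar> \<le> (2 * C + 2 * l) * ratio \<zeta> t r \<omega>"
      using ratio_nonneg[OF \<zeta> w r0(1)] by (intro abs_mult_le) auto
    then have "\<bar>?z + (hX r ?z \<omega> - ?z) * ratio \<zeta> t r \<omega>\<bar> \<le> C + (2 * C + 2 * l) * ratio \<zeta> t r \<omega>"
      by (intro order_trans[OF abs_triangle_ineq] add_mono bd w)
    then have "\<bar>dual_integrand \<zeta> z r \<omega>\<bar> \<le> ?K * (C + (2 * C + 2 * l) * ratio \<zeta> t r \<omega>)"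
      unfolding dual_integrand_def ratio_extend[OF r0(1)] using E by (intro abs_mult_le) auto
    then show ?thesis by (simp only: distrib_left[of ?K C] mult.assoc)
  qed
  then have "(\<integral>\<^sup>+\<omega>. ennreal \<bar>dual_integrand \<zeta> z r \<omega>\<bar> \<partial>M) \<le> (\<integral>\<^sup>+\<omega>. ennreal (?K * C + ?K * (2 * C + 2 * l) * ratio \<zeta> t r \<omega>) \<partial>M)"
    by (intro nn_integral_mono ennreal_leI)
  also have "\<dots> = ennreal (\<integral>\<omega>. ?K * C + ?K * (2 * C + 2 * l) * ratio \<zeta> t r \<omega> \<partial>M)"
  proof (rule nn_integral_eq_integral)
    show "integrable M (\<lambda>\<omega>. ?K * C + ?K * (2 * C + 2 * l) * ratio \<zeta> t r \<omega>)"
      using ratio_integral(1)[OF \<zeta> r0] by simp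
    obtain \<omega>0 where "\<omega>0 \<in> space M" using not_empty by blast
    then have "0 \<le> C" using bd[of \<omega>0 r] by linarith
    then show "AE \<omega> in M. 0 \<le> ?K * C + ?K * (2 * C + 2 * l) * ratio \<zeta> t r \<omega>"
      using ratio_nonneg[OF \<zeta> _ r0(1)] l_nonneg by (intro AE_I2) auto
  qed
  also have "(\<integral>\<omega>. ?K * C + ?K * (2 * C + 2 * l) * ratio \<zeta> t r \<omega> \<partial>M) = ?K * C + ?K * (2 * C + 2 * l)"
  proof -
    have "(\<integral>\<omega>. 1 * ratio \<zeta> t r \<omega> \<partial>M) = (\<integral>\<omega>. 1 \<partial>M)"
      by (rule ratio_integral(2)[OF \<zeta> r0, where C=1 and D'="\<lambda>_. 1"]) auto
    then show ?thesis using ratio_integral(1)[OF \<zeta> r0] by (simp add: prob_space)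
  qed
  finally show ?thesis .
qed

text \<open>Averaging the ratio against adapted factors removes it from the payoff.\<close>

lemma dual_payoff_adapted:
  assumes \<zeta>: "\<zeta> \<in> nonneg_martingales M Fil" and Z: "Z \<in> bounded_adapted M Fil"
  shows "integrable M (dual_payoff lam p X f t \<zeta> Z)"
    and "(\<integral>\<omega>. dual_payoff lam p X f t \<zeta> Z \<omega> \<partial>M) = primal_objective M lam p X f t Z"
proof -
  obtain C where C: "0 \<le> C" "\<And>r \<omega>. \<omega> \<in> space M \<Longrightarrow> \<bar>Z (max 0 r) \<omega>\<bar> \<le> C"
    and Zm: "(\<lambda>(r, \<omega>). Z (max 0 r) \<omega>) \<in> borel_measurable (borel \<Otimes>\<^sub>M M)"
    and ad: "\<And>r. 0 \<le> r \<Longrightarrow> Z r \<in> borel_measurable (Fil r)"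
    using bounded_adaptedE[OF Z] by blast
  have Zp: "measurable_process M Z" and \<zeta>p: "measurable_process M \<zeta>"
    using Z \<zeta> by (auto simp: bounded_adapted_def nonneg_martingales_def)
  define Z' where "Z' r \<omega> = Z (max 0 r) \<omega>" for r \<omega>
  have Z'_eq: "Z' r \<omega> = Z r \<omega>" if "0 \<le> r" for r \<omega> using that by (simp add: Z'_def)
  have Z'm [measurable]: "(\<lambda>(r, \<omega>). Z' r \<omega>) \<in> borel_measurable (borel \<Otimes>\<^sub>M M)" using Zm by (simp add: Z'_def)
  have Z'_bd: "\<bar>Z' r \<omega>\<bar> \<le> C" if "\<omega> \<in> space M" for r \<omega> using C(2) that by (simp add: Z'_def)
  define E where "E r \<omega> = exp_int Z' r \<omega>" for r \<omega>
  have E_eq: "exp_int Z r \<omega> = E r \<omega>" for r \<omega> unfolding E_def exp_int_extend[of Z] Z'_def ..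
  have Em [measurable]: "(\<lambda>(r, \<omega>). E r \<omega>) \<in> borel_measurable (borel \<Otimes>\<^sub>M M)"
    unfolding E_def by (rule exp_int_measurable[OF Z'm])
  define K where "K = exp (C * t)"
  have E_bd: "0 \<le> E r \<omega>" "\<bar>E r \<omega>\<bar> \<le> K" if "\<omega> \<in> space M" "r \<in> {0..t}" for r \<omega>
    using exp_int_bound[OF Z'm that(1) Z'_bd[OF that(1)] that(2)] by (simp_all add: E_def K_def)
  define H where "H r \<omega> = hX r (Z' r \<omega>) \<omega>" for r \<omega>
  have Hm [measurable]: "(\<lambda>(r, \<omega>). H r \<omega>) \<in> borel_measurable (borel \<Otimes>\<^sub>M M)"
    unfolding H_def by (rule hX_measurable[OF Z'm])
  have H_bd: "\<bar>H r \<omega>\<bar> \<le> C + 2 * l" if "\<omega> \<in> space M" for r \<omega>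
    using hX_abs_le[of r "Z' r \<omega>" \<omega>] Z'_bd[OF that, of r] by (simp add: H_def)
  have EH_m: "(\<lambda>(r, \<omega>). E r \<omega> * H r \<omega>) \<in> borel_measurable (borel \<Otimes>\<^sub>M M)" by measurable
  have EH_bd: "\<bar>E r \<omega> * H r \<omega>\<bar> \<le> K * (C + 2 * l)" if "\<omega> \<in> space M" "r \<in> {0..t}" for r \<omega>
    using that by (intro abs_mult_le E_bd H_bd)
  have EH_nn: "(\<integral>\<^sup>+\<omega>. ennreal \<bar>E r \<omega> * H r \<omega>\<bar> \<partial>M) \<le> ennreal (K * (C + 2 * l))" if "r \<in> {0..t}" for r
    by (rule nn_integral_bounded_le) (rule EH_bd[OF _ that])
  note G = expectation_time_integral[OF dual_integrand_measurable[OF Zp \<zeta>p] dual_integrand_bound[OF \<zeta> Zp C(2)]]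
  have t0: "t \<in> {0..t}" using t_nonneg by auto
  have Ev_int: "integrable M (\<lambda>\<omega>. E t \<omega> * v t \<omega>)"
  proof (rule integrable_const_bound[where B="K * 1"])
    show "AE \<omega> in M. norm (E t \<omega> * v t \<omega>) \<le> K * 1"
      unfolding real_norm_def using process_range(5)[of t] t0 by (intro AE_I2 abs_mult_le E_bd) auto
  qed (use section_measurable(1)[OF Em, of t] section_measurable(1)[OF process_measurable(1), of t] in measurable)
  have same: "(\<integral>\<omega>. dual_integrand \<zeta> Z r \<omega> \<partial>M) = (\<integral>\<omega>. E r \<omega> * H r \<omega> \<partial>M)" if r: "r \<in> {0..t}" for r
  proof -
    have r0: "0 \<le> r" "r \<le> t" using r by auto
    note [measurable] = section_measurable(1)[OF Em, of r] section_measurable(1)[OF Z'm, of r] section_measurable(1)[OF Hm, of r]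
    let ?D = "\<lambda>\<omega>. E r \<omega> * (H r \<omega> - Z' r \<omega>)"
    obtain E' where E': "E' \<in> borel_measurable (Fil r)" "AE \<omega> in M. exp_int Z r \<omega> = E' \<omega>"
      using exp_int_ae_adapted[OF Z r0(1)] by blast
    have D_bd: "\<bar>?D \<omega>\<bar> \<le> K * (2 * C + 2 * l)" if "\<omega> \<in> space M" for \<omega>
    proof (intro abs_mult_le E_bd that r)
      show "\<bar>H r \<omega> - Z' r \<omega>\<bar> \<le> 2 * C + 2 * l" using H_bd[OF that, of r] Z'_bd[OF that, of r] by linarith
    qed
    have DR: "(\<integral>\<omega>. ?D \<omega> * ratio \<zeta> t r \<omega> \<partial>M) = (\<integral>\<omega>. ?D \<omega> \<partial>M)"
    proof (rule ratio_integral(2)[OF \<zeta> r0 _ D_bd])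
      have [measurable]: "(\<lambda>\<omega>. path_at r (W \<omega>)) \<in> Fil r \<rightarrow>\<^sub>M borel"
        using X_Fil[of r r] r0 by (simp add: X_def[abs_def])
      show "(\<lambda>\<omega>. E' \<omega> * (branching_h lam p (path_at r (W \<omega>)) (Z r \<omega> + lamX r \<omega>) - Z r \<omega>)) \<in> borel_measurable (Fil r)"
        using E'(1) ad[OF r0(1)] lamX_adapted[OF r0(1)] by measurable
      show "AE \<omega> in M. ?D \<omega> = E' \<omega> * (branching_h lam p (path_at r (W \<omega>)) (Z r \<omega> + lamX r \<omega>) - Z r \<omega>)"
        using E'(2) by eventually_elim (simp add: E_eq Z'_eq[OF r0(1)] H_def hX_def)
    qed measurable
    have rm: "ratio \<zeta> t r \<in> borel_measurable M" using ratio_integral(1)[OF \<zeta> r0] by (rule borel_measurable_integrable)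
    have DR_int: "integrable M (\<lambda>\<omega>. ?D \<omega> * ratio \<zeta> t r \<omega>)"
    proof (rule Bochner_Integration.integrable_bound[OF integrable_mult_right[OF ratio_integral(1)[OF \<zeta> r0], of "K * (2 * C + 2 * l)"]])
      show "AE \<omega> in M. norm (?D \<omega> * ratio \<zeta> t r \<omega>) \<le> norm (K * (2 * C + 2 * l) * ratio \<zeta> t r \<omega>)"
      proof (rule AE_I2)
        fix \<omega> assume "\<omega> \<in> space M"
        from D_bd[OF this] have "\<bar>?D \<omega>\<bar> \<le> \<bar>K * (2 * C + 2 * l)\<bar>" by linarith
        then show "norm (?D \<omega> * ratio \<zeta> t r \<omega>) \<le> norm (K * (2 * C + 2 * l) * ratio \<zeta> t r \<omega>)"
          unfolding real_norm_def abs_mult[of "?D \<omega>"] abs_mult[of "K * (2 * C + 2 * l)"] by (intro mult_right_mono) auto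
      qed
    qed (use rm in measurable)
    have D_int: "integrable M ?D"
      using D_bd by (intro integrable_const_bound[where B="K * (2 * C + 2 * l)"] AE_I2) auto
    have EZ_int: "integrable M (\<lambda>\<omega>. E r \<omega> * Z' r \<omega>)"
    proof (rule integrable_const_bound[where B="K * C"])
      show "AE \<omega> in M. norm (E r \<omega> * Z' r \<omega>) \<le> K * C"
        unfolding real_norm_def using r by (intro AE_I2 abs_mult_le E_bd Z'_bd)
    qed measurable
    have "(\<integral>\<omega>. dual_integrand \<zeta> Z r \<omega> \<partial>M) = (\<integral>\<omega>. E r \<omega> * Z' r \<omega> + ?D \<omega> * ratio \<zeta> t r \<omega> \<partial>M)"
      unfolding dual_integrand_def ratio_extend[OF r0(1)] E_def H_def Z'_def
      by (intro Bochner_Integration.integral_cong refl) (simp add: algebra_simps)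
    also have "\<dots> = (\<integral>\<omega>. E r \<omega> * Z' r \<omega> \<partial>M) + (\<integral>\<omega>. ?D \<omega> * ratio \<zeta> t r \<omega> \<partial>M)"
      by (rule Bochner_Integration.integral_add[OF EZ_int DR_int])
    also have "\<dots> = (\<integral>\<omega>. E r \<omega> * Z' r \<omega> + ?D \<omega> \<partial>M)"
      unfolding DR by (rule Bochner_Integration.integral_add[OF EZ_int D_int, symmetric])
    also have "\<dots> = (\<integral>\<omega>. E r \<omega> * H r \<omega> \<partial>M)"
      by (intro Bochner_Integration.integral_cong refl) (simp add: algebra_simps)
    finally show ?thesis .
  qed
  have alt: "dual_payoff lam p X f t \<zeta> Z = (\<lambda>\<omega>. E t \<omega> * v t \<omega> - (LINT r:{0..t}|lborel. dual_integrand \<zeta> Z r \<omega>))"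
    unfolding dual_payoff_alt[abs_def] E_def Z'_def ..
  show "integrable M (dual_payoff lam p X f t \<zeta> Z)"
    unfolding alt by (intro Bochner_Integration.integrable_diff Ev_int G(2))
  have "(\<integral>\<omega>. dual_payoff lam p X f t \<zeta> Z \<omega> \<partial>M) = (\<integral>\<omega>. E t \<omega> * v t \<omega> \<partial>M) - (\<integral>\<omega>. (LINT r:{0..t}|lborel. dual_integrand \<zeta> Z r \<omega>) \<partial>M)"
    unfolding alt by (intro Bochner_Integration.integral_diff Ev_int G(2))
  also have "(\<integral>\<omega>. (LINT r:{0..t}|lborel. dual_integrand \<zeta> Z r \<omega>) \<partial>M) = (LINT r:{0..t}|lborel. (\<integral>\<omega>. dual_integrand \<zeta> Z r \<omega> \<partial>M))"
    by (rule G(3))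
  also have "\<dots> = (LINT r:{0..t}|lborel. (\<integral>\<omega>. E r \<omega> * H r \<omega> \<partial>M))"
    using same by (intro set_lebesgue_integral_cong) auto
  also have "\<dots> = (\<integral>\<omega>. (LINT r:{0..t}|lborel. E r \<omega> * H r \<omega>) \<partial>M)"
    by (rule expectation_time_integral(3)[OF EH_m EH_nn, symmetric])
  also have "(\<integral>\<omega>. E t \<omega> * v t \<omega> \<partial>M) - \<dots> = (\<integral>\<omega>. E t \<omega> * v t \<omega> - (LINT r:{0..t}|lborel. E r \<omega> * H r \<omega>) \<partial>M)"
    by (rule Bochner_Integration.integral_diff[OF Ev_int expectation_time_integral(2)[OF EH_m EH_nn], symmetric])
  also have "\<dots> = primal_objective M lam p X f t Z"
    unfolding primal_objective_alt E_def H_def Z'_def ..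
  finally show "(\<integral>\<omega>. dual_payoff lam p X f t \<zeta> Z \<omega> \<partial>M) = primal_objective M lam p X f t Z" .
qed

lemma dual_ess_sup:
  assumes \<zeta>: "\<zeta> \<in> nonneg_martingales M Fil"
  shows "is_ess_sup M (bounded_anticipative M) (\<lambda>z \<omega>. ereal (dual_payoff lam p X f t \<zeta> z \<omega>))
    (ess_sup M (bounded_anticipative M) (\<lambda>z \<omega>. ereal (dual_payoff lam p X f t \<zeta> z \<omega>)))"
proof -
  have "\<exists>S. is_ess_sup M (bounded_anticipative M) (\<lambda>z \<omega>. ereal (dual_payoff lam p X f t \<zeta> z \<omega>)) S"
  proof (rule is_ess_sup_exists)
    fix z assume "z \<in> bounded_anticipative M"
    then show "(\<lambda>\<omega>. ereal (dual_payoff lam p X f t \<zeta> z \<omega>)) \<in> borel_measurable M"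
      using \<zeta> by (intro borel_measurable_ereal dual_payoff_measurable)
        (auto simp: bounded_anticipative_def nonneg_martingales_def)
  qed
  then show ?thesis unfolding ess_sup_def by (rule someI_ex)
qed

text \<open>An adapted control is one of the competitors in the essential supremum.\<close>

lemma dual_ge_primal:
  assumes \<zeta>: "\<zeta> \<in> nonneg_martingales M Fil" and Z: "Z \<in> bounded_adapted M Fil"
  shows "ereal (primal_objective M lam p X f t Z) \<le> dual_objective M lam p X f t \<zeta>"
proof -
  have "Z \<in> bounded_anticipative M" using Z by (auto simp: bounded_adapted_def bounded_anticipative_def)
  then have "AE \<omega> in M. ereal (dual_payoff lam p X f t \<zeta> Z \<omega>)
      \<le> ess_sup M (bounded_anticipative M) (\<lambda>z \<omega>. ereal (dual_payoff lam p X f t \<zeta> z \<omega>)) \<omega>"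
    using dual_ess_sup[OF \<zeta>] by (auto simp: is_ess_sup_def)
  from ereal_expectation_mono[OF this]
  show ?thesis
    unfolding dual_objective_def ereal_expectation_ereal[OF dual_payoff_adapted(1)[OF \<zeta> Z]] dual_payoff_adapted(2)[OF \<zeta> Z] .
qed

section \<open>The optimal martingale\<close>

text \<open>The exponential rate that turns \<open>1 - v\<close> into a martingale.  Where \<open>v = 1\<close> the numerator vanishes
  as well and the quotient is 0.\<close>

definition compensator :: "real \<Rightarrow> 'w \<Rightarrow> real" where
  "compensator r \<omega> = (if r \<le> t then lamX r \<omega> * ((v r \<omega> - genX r \<omega>) / (1 - v r \<omega>)) else 0)"

text \<open>The process is stopped at time \<open>t\<close>.\<close>

definition opt_martingale :: "real \<Rightarrow> 'w \<Rightarrow> real" where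
  "opt_martingale s \<omega> = (1 - v (min s t) \<omega>) * exp_int compensator (min s t) \<omega>"

lemma compensator_measurable [measurable]: "(\<lambda>(r, \<omega>). compensator r \<omega>) \<in> borel_measurable (borel \<Otimes>\<^sub>M M)"
  unfolding compensator_def case_prod_beta by measurable

lemma compensator_bound: "\<bar>compensator r \<omega>\<bar> \<le> l * (m + 1)"
proof (cases "r \<le> t")
  case True
  have v: "0 \<le> v r \<omega>" "v r \<omega> \<le> 1" using process_range(5)[OF True, of \<omega>] by auto
  have "\<bar>(v r \<omega> - genX r \<omega>) / (1 - v r \<omega>)\<bar> \<le> m + 1"
  proof (cases "v r \<omega> = 1")
    case False
    with v have pos: "0 < 1 - v r \<omega>" by simp
    have "1 - genX r \<omega> \<le> m * (1 - v r \<omega>)"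
      using gen_lipschitz[of "v r \<omega>" 1 "path_at r (W \<omega>)"] v by (simp add: genX_def)
    moreover have "genX r \<omega> \<le> 1" by (rule process_range(4))
    ultimately have "v r \<omega> - genX r \<omega> \<le> (m + 1) * (1 - v r \<omega>)" "- (v r \<omega> - genX r \<omega>) \<le> (m + 1) * (1 - v r \<omega>)"
      using pos mult_nonneg_nonneg[OF m_nonneg, of "1 - v r \<omega>"] by (auto simp: distrib_right)
    then have "\<bar>v r \<omega> - genX r \<omega>\<bar> \<le> (m + 1) * (1 - v r \<omega>)" by (simp only: abs_le_iff)
    then show ?thesis using pos by (simp add: abs_divide pos_divide_le_eq)
  qed (use m_nonneg in simp)
  then show ?thesis using True process_range(1,2)[of r \<omega>] by (simp only: compensator_def if_True) (intro abs_mult_le; simp)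
qed (use l_nonneg m_nonneg in \<open>simp add: compensator_def\<close>)

lemma compensator_eq: "r \<le> t \<Longrightarrow> compensator r \<omega> * (1 - v r \<omega>) = lamX r \<omega> * (v r \<omega> - genX r \<omega>)"
proof (cases "v r \<omega> = 1")
  case True
  then show ?thesis by (simp add: compensator_def genX_def)
qed (simp add: compensator_def)

lemma compensator_bounded_adapted: "compensator \<in> bounded_adapted M Fil"
  unfolding bounded_adapted_def
proof (intro CollectI conjI)
  show "measurable_process M compensator" by (rule measurable_process_restrict) (rule compensator_measurable)
  show "bounded_process M compensator" unfolding bounded_process_def using compensator_bound by blast
  show "adapted_process Fil compensator"
    unfolding adapted_process_def
  proof (intro allI impI)
    fix s :: real assume s: "0 \<le> s"
    note [measurable] = v_adapted[OF s] lamX_adapted[OF s] genX_adapted[OF s]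
    show "compensator s \<in> borel_measurable (Fil s)" unfolding compensator_def[abs_def] by measurable
  qed
qed

lemma exp_int_compensator_adapted:
  assumes s: "0 \<le> s" "s \<le> t"
  shows "exp_int compensator s \<in> borel_measurable (Fil s)"
proof -
  have "(\<lambda>(\<omega>, r). (r, \<omega>)) \<in> Fil s \<Otimes>\<^sub>M borel \<rightarrow>\<^sub>M borel \<Otimes>\<^sub>M Fil s"
    by (simp add: case_prod_beta)
  from measurable_compose[OF this path_at_progressive[OF s(1)]]
  have pm: "(\<lambda>z. path_at (min (snd z) s) (W (fst z))) \<in> Fil s \<Otimes>\<^sub>M borel \<rightarrow>\<^sub>M borel" by (simp add: case_prod_beta)
  define y where "y \<omega> r = path_at (min r s) (W \<omega>)" for \<omega> r
  have [measurable]: "(\<lambda>(\<omega>, r). y \<omega> r) \<in> Fil s \<Otimes>\<^sub>M borel \<rightarrow>\<^sub>M borel" using pm by (simp add: y_def case_prod_beta)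
  define c where "c \<omega> r = lam (y \<omega> r) * ((val (t - r) (y \<omega> r) - gen (y \<omega> r) (val (t - r) (y \<omega> r))) / (1 - val (t - r) (y \<omega> r)))" for \<omega> r
  have [measurable]: "(\<lambda>(\<omega>, r). c \<omega> r) \<in> borel_measurable (Fil s \<Otimes>\<^sub>M borel)" unfolding c_def by measurable
  have "(\<lambda>\<omega>. exp (LINT r:{0..s}|lborel. c \<omega> r)) \<in> borel_measurable (Fil s)" by measurable
  moreover have "(LINT r:{0..s}|lborel. c \<omega> r) = (LINT r:{0..s}|lborel. compensator r \<omega>)" for \<omega>
    using s by (intro set_lebesgue_integral_cong) (auto simp: c_def y_def compensator_def lamX_def genX_def v_def min_def)
  ultimately show ?thesis unfolding exp_int_def[abs_def] by simp
qed

lemma opt_martingale_adapted: "0 \<le> s \<Longrightarrow> opt_martingale s \<in> borel_measurable (Fil s)"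
proof -
  assume s: "0 \<le> s"
  have m: "0 \<le> min s t" "min s t \<le> t" using s t_nonneg by auto
  have [measurable]: "v (min s t) \<in> borel_measurable (Fil s)" "exp_int compensator (min s t) \<in> borel_measurable (Fil s)"
    using Fil_mono[OF _ v_adapted[OF m(1)]] Fil_mono[OF _ exp_int_compensator_adapted[OF m]] by auto
  show ?thesis unfolding opt_martingale_def[abs_def] by measurable
qed

lemma exp_int_compensator_bound: "s \<in> {0..t} \<Longrightarrow> \<omega> \<in> space M \<Longrightarrow> 0 \<le> exp_int compensator s \<omega> \<and> exp_int compensator s \<omega> \<le> exp (l * (m + 1) * t)"
  using exp_int_bound[OF compensator_measurable _ compensator_bound] by blast

lemma opt_martingale_range: "0 \<le> s \<Longrightarrow> \<omega> \<in> space M \<Longrightarrow> 0 \<le> opt_martingale s \<omega> \<and> opt_martingale s \<omega> \<le> exp (l * (m + 1) * t)"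
proof -
  assume s: "0 \<le> s" and w: "\<omega> \<in> space M"
  have m: "min s t \<in> {0..t}" using s t_nonneg by auto
  have 1: "0 \<le> 1 - v (min s t) \<omega>" "1 - v (min s t) \<omega> \<le> 1" using process_range(5)[of "min s t" \<omega>] by auto
  note 2 = exp_int_compensator_bound[OF m w]
  have "opt_martingale s \<omega> \<le> 1 * exp (l * (m + 1) * t)" unfolding opt_martingale_def using 1 2 by (intro mult_mono) auto
  then show ?thesis using 1 2 by (simp add: opt_martingale_def)
qed

lemma opt_martingale_integrable: "0 \<le> s \<Longrightarrow> integrable M (opt_martingale s)"
  using opt_martingale_range[of s] measurable_from_subalg[OF subalgebra_Fil opt_martingale_adapted[of s]]
  by (intro integrable_const_bound[where B="exp (l * (m + 1) * t)"] AE_I2) auto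

text \<open>For the control \<open>compensator\<close>, the integrand in \<open>feynman_kac\<close> is the derivative of its own exponential.\<close>

lemma opt_martingale_expectation:
  assumes s: "0 \<le> s" "s \<le> t" and A: "A \<in> sets (Fil s)"
  shows "(\<integral>\<omega>. indicator A \<omega> * opt_martingale t \<omega> \<partial>M) = (\<integral>\<omega>. indicator A \<omega> * opt_martingale s \<omega> \<partial>M)"
proof -
  let ?E = "exp_int compensator"
  have AM [measurable]: "A \<in> sets M" using A subalgebra_Fil by (auto simp: subalgebra_def)
  have Em: "(\<lambda>(r, \<omega>). ?E r \<omega>) \<in> borel_measurable (borel \<Otimes>\<^sub>M M)" by (rule exp_int_measurable[OF compensator_measurable])
  note [measurable] = section_measurable(1)[OF Em] section_measurable(1)[OF process_measurable(1)]
  have t0: "t \<in> {0..t}" "s \<in> {0..t}" using t_nonneg s by auto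
  have int: "integrable M (\<lambda>\<omega>. indicator A \<omega> * (?E r \<omega> * y \<omega>))"
    if r: "r \<in> {0..t}" and y: "y \<in> borel_measurable M" "\<And>\<omega>. \<bar>y \<omega>\<bar> \<le> 1" for r y
  proof (rule integrable_const_bound[where B="1 * (exp (l * (m + 1) * t) * 1)"])
    show "AE \<omega> in M. norm (indicator A \<omega> * (?E r \<omega> * y \<omega>)) \<le> 1 * (exp (l * (m + 1) * t) * 1)"
      unfolding real_norm_def using exp_int_compensator_bound[OF r] y(2)
      by (intro AE_I2 abs_mult_le) (auto split: split_indicator)
  qed (use y in measurable)
  have v1: "\<bar>v r \<omega>\<bar> \<le> 1" if "r \<in> {0..t}" for r \<omega> using process_range(5)[of r \<omega>] that by auto
  have "(\<integral>\<omega>. indicator A \<omega> * (?E t \<omega> * v t \<omega> - ?E s \<omega> * v s \<omega>) \<partial>M)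
      = (\<integral>\<omega>. indicator A \<omega> * (LINT r:{s..t}|lborel. ?E r \<omega> * (v r \<omega> * (compensator r \<omega> + lamX r \<omega>) - lamX r \<omega> * genX r \<omega>)) \<partial>M)"
    by (rule feynman_kac[OF compensator_bounded_adapted s A])
  also have "\<dots> = (\<integral>\<omega>. indicator A \<omega> * (?E t \<omega> - ?E s \<omega>) \<partial>M)"
  proof (intro Bochner_Integration.integral_cong refl arg_cong[where f="\<lambda>x. _ * x"])
    fix \<omega> assume w: "\<omega> \<in> space M"
    have "(LINT r:{s..t}|lborel. ?E r \<omega> * (v r \<omega> * (compensator r \<omega> + lamX r \<omega>) - lamX r \<omega> * genX r \<omega>))
        = (LINT r:{s..t}|lborel. indicator {0..t} r * (compensator r \<omega> * ?E r \<omega>))"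
    proof (intro set_lebesgue_integral_cong allI impI)
      fix r assume r: "r \<in> {s..t}"
      then have "v r \<omega> * (compensator r \<omega> + lamX r \<omega>) - lamX r \<omega> * genX r \<omega> = compensator r \<omega>"
        using compensator_eq[of r \<omega>] by (simp add: algebra_simps)
      then show "?E r \<omega> * (v r \<omega> * (compensator r \<omega> + lamX r \<omega>) - lamX r \<omega> * genX r \<omega>) = indicator {0..t} r * (compensator r \<omega> * ?E r \<omega>)"
        using r s by simp
    qed simp
    also have "\<dots> = ?E t \<omega> - ?E s \<omega>"
      by (rule bounded_primitive.increment[OF exp_int_primitive[OF compensator_measurable w compensator_bound t_nonneg], symmetric])
        (use s in auto)
    finally show "(LINT r:{s..t}|lborel. ?E r \<omega> * (v r \<omega> * (compensator r \<omega> + lamX r \<omega>) - lamX r \<omega> * genX r \<omega>)) = ?E t \<omega> - ?E s \<omega>" .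
  qed
  finally have eq: "(\<integral>\<omega>. indicator A \<omega> * (?E t \<omega> * v t \<omega> - ?E s \<omega> * v s \<omega>) \<partial>M) = (\<integral>\<omega>. indicator A \<omega> * (?E t \<omega> - ?E s \<omega>) \<partial>M)" .
  note i = int[OF t0(1) section_measurable(1)[OF process_measurable(1)] v1[OF t0(1)]] int[OF t0(2) section_measurable(1)[OF process_measurable(1)] v1[OF t0(2)]]
    int[OF t0(1), of "\<lambda>_. 1", simplified] int[OF t0(2), of "\<lambda>_. 1", simplified]
  have "(\<integral>\<omega>. indicator A \<omega> * (?E t \<omega> * v t \<omega>) \<partial>M) - (\<integral>\<omega>. indicator A \<omega> * (?E s \<omega> * v s \<omega>) \<partial>M)
      = (\<integral>\<omega>. indicator A \<omega> * ?E t \<omega> \<partial>M) - (\<integral>\<omega>. indicator A \<omega> * ?E s \<omega> \<partial>M)"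
    using eq i by (simp add: right_diff_distrib)
  moreover have "(\<integral>\<omega>. indicator A \<omega> * opt_martingale r \<omega> \<partial>M) = (\<integral>\<omega>. indicator A \<omega> * ?E r \<omega> \<partial>M) - (\<integral>\<omega>. indicator A \<omega> * (?E r \<omega> * v r \<omega>) \<partial>M)"
    if r: "r \<in> {0..t}" for r
  proof -
    have "(\<integral>\<omega>. indicator A \<omega> * opt_martingale r \<omega> \<partial>M) = (\<integral>\<omega>. indicator A \<omega> * ?E r \<omega> - indicator A \<omega> * (?E r \<omega> * v r \<omega>) \<partial>M)"
      using r by (intro Bochner_Integration.integral_cong refl) (simp add: opt_martingale_def min_absorb1 algebra_simps)
    then show ?thesis
      using int[OF r section_measurable(1)[OF process_measurable(1)] v1[OF r]] int[OF r, of "\<lambda>_. 1", simplified] by simp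
  qed
  ultimately show ?thesis using t0 by simp
qed

lemma opt_martingale_in: "opt_martingale \<in> nonneg_martingales M Fil"
  unfolding nonneg_martingales_def
proof (intro CollectI conjI allI impI ballI)
  have Em: "(\<lambda>(r, \<omega>). exp_int compensator r \<omega>) \<in> borel_measurable (borel \<Otimes>\<^sub>M M)" by (rule exp_int_measurable[OF compensator_measurable])
  have mm: "(\<lambda>(s, \<omega>). (min s t, \<omega>)) \<in> borel \<Otimes>\<^sub>M M \<rightarrow>\<^sub>M borel \<Otimes>\<^sub>M M" unfolding case_prod_beta by measurable
  show "measurable_process M opt_martingale"
  proof (rule measurable_process_restrict)
    have [measurable]: "(\<lambda>(s, \<omega>). v (min s t) \<omega>) \<in> borel_measurable (borel \<Otimes>\<^sub>M M)"
      "(\<lambda>(s, \<omega>). exp_int compensator (min s t) \<omega>) \<in> borel_measurable (borel \<Otimes>\<^sub>M M)"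
      using measurable_compose[OF mm process_measurable(1)] measurable_compose[OF mm Em] by (simp_all add: case_prod_beta)
    show "(\<lambda>(s, \<omega>). opt_martingale s \<omega>) \<in> borel_measurable (borel \<Otimes>\<^sub>M M)" unfolding opt_martingale_def case_prod_beta by measurable
  qed
  show "adapted_process Fil opt_martingale" unfolding adapted_process_def using opt_martingale_adapted by blast
  fix s :: real
  show "0 \<le> opt_martingale s \<omega>" if "0 \<le> s" "\<omega> \<in> space M" for \<omega> using opt_martingale_range that by blast
  show "integrable M (opt_martingale s)" if "0 \<le> s" using opt_martingale_integrable that .
  fix r :: real assume sr: "0 \<le> s \<and> s \<le> r"
  interpret F: finite_measure_subalgebra M "Fil s" by unfold_locales (rule subalgebra_Fil)
  show "AE \<omega> in M. real_cond_exp M (Fil s) (opt_martingale r) \<omega> = opt_martingale s \<omega>"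
  proof (rule F.real_cond_exp_charact)
    fix A assume A: "A \<in> sets (Fil s)"
    have clip_t: "opt_martingale q = opt_martingale (min q t)" for q by (simp add: opt_martingale_def fun_eq_iff)
    have "(\<integral>\<omega>. indicator A \<omega> * opt_martingale t \<omega> \<partial>M) = (\<integral>\<omega>. indicator A \<omega> * opt_martingale q \<omega> \<partial>M)" if q: "s \<le> q" for q
    proof (cases "q \<le> t")
      case True
      have "(\<lambda>\<omega>. \<omega>) \<in> Fil q \<rightarrow>\<^sub>M Fil s" using q by (intro Fil_mono[of s q]) auto
      then have "A \<in> sets (Fil q)"
        using measurable_sets[of "\<lambda>\<omega>. \<omega>" "Fil q" "Fil s" A] A sets.sets_into_space[OF A] by (simp add: Int_absorb2)
      then show ?thesis using sr q True by (intro opt_martingale_expectation) auto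
    next
      case False
      then have "min q t = t" by simp
      then show ?thesis using clip_t[of q] by simp
    qed
    from this[of r] this[of s] sr
    show "(\<integral>\<omega>\<in>A. opt_martingale r \<omega> \<partial>M) = (\<integral>\<omega>\<in>A. opt_martingale s \<omega> \<partial>M)" by (simp add: set_lebesgue_integral_def)
  qed (use sr opt_martingale_integrable opt_martingale_adapted in auto)
qed

text \<open>A nonnegative martingale does not leave 0.\<close>

lemma opt_martingale_absorbed:
  assumes r: "0 \<le> r" "r \<le> t"
  shows "AE \<omega> in M. opt_martingale r \<omega> = 0 \<longrightarrow> opt_martingale t \<omega> = 0"
proof -
  let ?A = "{\<omega> \<in> space M. opt_martingale r \<omega> = 0}"
  have "{\<omega> \<in> space (Fil r). opt_martingale r \<omega> = 0} \<in> sets (Fil r)" using opt_martingale_adapted[OF r(1)] by measurable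
  then have A: "?A \<in> sets (Fil r)" by simp
  then have AM: "?A \<in> sets M" using subalgebra_Fil by (auto simp: subalgebra_def)
  have "(\<integral>\<omega>. indicator ?A \<omega> * opt_martingale t \<omega> \<partial>M) = (\<integral>\<omega>. indicator ?A \<omega> * opt_martingale r \<omega> \<partial>M)"
    by (rule opt_martingale_expectation[OF r A])
  also have "\<dots> = (\<integral>\<omega>. 0 \<partial>M)" by (intro Bochner_Integration.integral_cong) auto
  finally have "(\<integral>\<omega>. indicator ?A \<omega> * opt_martingale t \<omega> \<partial>M) = 0" by simp
  moreover have "integrable M (\<lambda>\<omega>. indicator ?A \<omega> * opt_martingale t \<omega>)"
    using integrable_mult_indicator[OF AM opt_martingale_integrable[OF t_nonneg]] by simp
  ultimately have "AE \<omega> in M. indicator ?A \<omega> * opt_martingale t \<omega> = 0"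
    using opt_martingale_range[OF t_nonneg] by (subst (asm) integral_nonneg_eq_0_iff_AE) auto
  then show ?thesis using AE_space by eventually_elim auto
qed

text \<open>The exceptional null set of \<open>opt_martingale_absorbed\<close> depends on the time; by Fubini, almost
  every path has an exceptional set of times of measure 0.\<close>

lemma opt_martingale_absorbed_pathwise: "AE \<omega> in M. AE r in lborel. r \<in> {0..t} \<longrightarrow> opt_martingale r \<omega> = 0 \<longrightarrow> opt_martingale t \<omega> = 0"
proof -
  note sf = sigma_finite_measure_axioms
  interpret pair_sigma_finite lborel M ..
  have Em: "(\<lambda>(r, \<omega>). exp_int compensator r \<omega>) \<in> borel_measurable (borel \<Otimes>\<^sub>M M)" by (rule exp_int_measurable[OF compensator_measurable])
  have z: "(\<lambda>(r, \<omega>). (1 - v r \<omega>) * exp_int compensator r \<omega>) \<in> borel_measurable (borel \<Otimes>\<^sub>M M)"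
    using Em by measurable
  define Q where "Q r \<omega> \<longleftrightarrow> (r \<in> {0..t} \<longrightarrow> (1 - v r \<omega>) * exp_int compensator r \<omega> = 0 \<longrightarrow> opt_martingale t \<omega> = 0)" for r \<omega>
  have Q_eq: "Q r \<omega> \<longleftrightarrow> (r \<in> {0..t} \<longrightarrow> opt_martingale r \<omega> = 0 \<longrightarrow> opt_martingale t \<omega> = 0)" for r \<omega>
    by (auto simp: Q_def opt_martingale_def min_absorb1)
  note [measurable] = z measurable_from_subalg[OF subalgebra_Fil opt_martingale_adapted[OF t_nonneg]]
  have "{x \<in> space (lborel \<Otimes>\<^sub>M M). Q (fst x) (snd x)} \<in> sets (lborel \<Otimes>\<^sub>M M)"
  proof -
    have "{x \<in> space (borel \<Otimes>\<^sub>M M). Q (fst x) (snd x)} \<in> sets (borel \<Otimes>\<^sub>M M)"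
      using z unfolding Q_def case_prod_beta atLeastAtMost_iff by measurable
    moreover have "space ((lborel :: real measure) \<Otimes>\<^sub>M M) = space (borel \<Otimes>\<^sub>M M)" by (simp add: space_pair_measure)
    moreover have "sets ((lborel :: real measure) \<Otimes>\<^sub>M M) = sets (borel \<Otimes>\<^sub>M M)" by (intro sets_pair_measure_cong) auto
    ultimately show ?thesis by (simp only:)
  qed
  from AE_commute[OF this]
  have "(AE r in lborel. AE \<omega> in M. Q r \<omega>) \<longleftrightarrow> (AE \<omega> in M. AE r in lborel. Q r \<omega>)" .
  moreover have "AE r in lborel. AE \<omega> in M. Q r \<omega>"
  proof (rule AE_I2)
    fix r show "AE \<omega> in M. Q r \<omega>"
      using opt_martingale_absorbed[of r] by (cases "r \<in> {0..t}") (auto simp: Q_eq)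
  qed
  ultimately show ?thesis unfolding Q_eq by blast
qed

text \<open>Write \<open>\<rho>\<close> for the ratio.  The bound for \<open>hX\<close> by the current value gives
  \<open>(hX - z) \<rho> \<ge> (1 - v) \<rho> (compensator - z)\<close>, and here \<open>(1 - v) \<rho> = \<zeta>\<^sub>t exp (- \<integral> compensator)\<close> is
  absolutely continuous in time although neither factor is.  Put \<open>\<phi> = 1 - (1 - v) \<rho>\<close>.  With \<open>E = exp \<integral> z\<close>,
  the lower bound for the integrand of the payoff is the derivative of \<open>E \<phi>\<close>, whose value at
  \<open>t\<close> is \<open>E v\<close> and cancels the first term of the payoff.\<close>

lemma dual_payoff_opt_martingale_le:
  assumes z: "z \<in> bounded_anticipative M"
  shows "AE \<omega> in M. dual_payoff lam p X f t opt_martingale z \<omega> \<le> 1 - opt_martingale t \<omega>"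
proof -
  obtain C where C: "0 \<le> C" "\<And>r \<omega>. \<omega> \<in> space M \<Longrightarrow> \<bar>z (max 0 r) \<omega>\<bar> \<le> C" and zm: "measurable_process M z"
    using bounded_anticipativeE[OF z] by blast
  define Z where "Z r \<omega> = z (max 0 r) \<omega>" for r \<omega>
  have Zm: "(\<lambda>(r, \<omega>). Z r \<omega>) \<in> borel_measurable (borel \<Otimes>\<^sub>M M)"
    using measurable_process_extend[OF zm] by (simp add: Z_def)
  have Z_bd: "\<bar>Z r \<omega>\<bar> \<le> C" if "\<omega> \<in> space M" for r \<omega> using C(2)[OF that] by (simp add: Z_def)
  define E where "E r \<omega> = exp_int Z r \<omega>" for r \<omega>
  have zp: "measurable_process M opt_martingale" using opt_martingale_in by (simp add: nonneg_martingales_def)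
  have int: "AE \<omega> in M. set_integrable lborel {0..t} (\<lambda>r. dual_integrand opt_martingale z r \<omega>)"
    by (rule expectation_time_integral(1)[OF dual_integrand_measurable[OF zm zp] dual_integrand_bound[OF opt_martingale_in zm C(2)]])
  from int opt_martingale_absorbed_pathwise AE_space show ?thesis
  proof eventually_elim
    case (elim \<omega>)
    have w: "\<omega> \<in> space M" by (rule elim(3))
    let ?c = "\<lambda>r. exp_int (\<lambda>r \<omega>. - compensator r \<omega>) r \<omega>"
    \<comment> \<open>Only the value of the martingale at time \<open>t\<close> enters, so \<open>\<phi>\<close> is a smooth function of a bounded primitive.\<close>
    define \<phi> where "\<phi> r = 1 - opt_martingale t \<omega> * ?c r" for r
    define d where "d r = indicator {0..t} r * (opt_martingale t \<omega> * (compensator r \<omega> * ?c r))" for r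
    let ?B = "l * (m + 1) * exp (l * (m + 1) * t)"
    have cm': "(\<lambda>(r, \<omega>). - compensator r \<omega>) \<in> borel_measurable (borel \<Otimes>\<^sub>M M)" by measurable
    have cb': "\<bar>- compensator r \<omega>\<bar> \<le> l * (m + 1)" for r using compensator_bound[of r \<omega>] by simp
    interpret c: bounded_primitive "\<lambda>r. indicator {0..t} r * (- compensator r \<omega> * ?c r)" ?c ?B t
      by (rule exp_int_primitive[OF cm' w cb' t_nonneg])
    have inv: "?c r * exp_int compensator r \<omega> = 1" for r
      by (simp add: exp_int_def exp_add[symmetric] set_lebesgue_integral_def)
    interpret phi: bounded_primitive d \<phi> "\<bar>opt_martingale t \<omega>\<bar> * ?B" t
    proof
      have d_alt: "d = (\<lambda>r. - opt_martingale t \<omega> * (indicator {0..t} r * (- compensator r \<omega> * ?c r)))"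
        by (simp add: d_def fun_eq_iff)
      show "d \<in> borel_measurable borel" unfolding d_alt by (rule borel_measurable_times[OF borel_measurable_const c.meas])
      show "\<bar>d r\<bar> \<le> \<bar>opt_martingale t \<omega>\<bar> * ?B" if "r \<in> {0..t}" for r
        unfolding d_alt by (rule abs_mult_le[OF _ c.bound[OF that]]) simp
      show "\<phi> s = \<phi> 0 + (LINT r:{0..s}|lborel. d r)" if s: "s \<in> {0..t}" for s
      proof -
        have "(LINT r:{0..s}|lborel. d r) = - opt_martingale t \<omega> * (LINT r:{0..s}|lborel. indicator {0..t} r * (- compensator r \<omega> * ?c r))"
          unfolding d_alt by (rule set_integral_mult_right)
        also have "(LINT r:{0..s}|lborel. indicator {0..t} r * (- compensator r \<omega> * ?c r)) = ?c s - ?c 0"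
          using c.prim[OF s] by simp
        finally show ?thesis by (simp add: \<phi>_def algebra_simps)
      qed
    qed
    have Ep: "bounded_primitive (\<lambda>r. indicator {0..t} r * (Z r \<omega> * E r \<omega>)) (\<lambda>r. E r \<omega>) (C * exp (C * t)) t"
      unfolding E_def by (rule exp_int_primitive[OF Zm w Z_bd[OF w] t_nonneg])
    interpret Ep: bounded_primitive "\<lambda>r. indicator {0..t} r * (Z r \<omega> * E r \<omega>)" "\<lambda>r. E r \<omega>" "C * exp (C * t)" t
      by (rule Ep)
    let ?low = "\<lambda>r. indicator {0..t} r * (Z r \<omega> * E r \<omega>) * \<phi> r + E r \<omega> * d r"
    have parts: "E t \<omega> * \<phi> t - E 0 \<omega> * \<phi> 0 = (LINT r:{0..t}|lborel. ?low r)"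
      by (rule integration_by_parts_bounded[OF Ep phi.bounded_primitive_axioms t_nonneg])
    have low_int: "set_integrable lborel {0..t} ?low"
    proof -
      let ?low' = "\<lambda>r. indicator {0..t} r * (Z r \<omega> * E r \<omega>) * (indicator {0..t} r * \<phi> r) + (indicator {0..t} r * E r \<omega>) * d r"
      have "set_integrable lborel {0..t} ?low'"
      proof (rule bounded_set_integrable)
        show "?low' \<in> borel_measurable borel"
          by (rule borel_measurable_add[OF borel_measurable_times[OF Ep.meas phi.measurable_ind]
              borel_measurable_times[OF Ep.measurable_ind phi.meas]])
        show "\<bar>?low' r\<bar> \<le> (C * exp (C * t)) * (\<bar>\<phi> 0\<bar> + \<bar>opt_martingale t \<omega>\<bar> * ?B * t) + (\<bar>E 0 \<omega>\<bar> + C * exp (C * t) * t) * (\<bar>opt_martingale t \<omega>\<bar> * ?B)"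
          if r: "r \<in> {0..t}" for r
        proof (intro order_trans[OF abs_triangle_ineq] add_mono)
          show "\<bar>indicator {0..t} r * (Z r \<omega> * E r \<omega>) * (indicator {0..t} r * \<phi> r)\<bar> \<le> (C * exp (C * t)) * (\<bar>\<phi> 0\<bar> + \<bar>opt_martingale t \<omega>\<bar> * ?B * t)"
            by (rule abs_mult_le[OF Ep.bound[OF r]]) (use phi.bounded[OF r] r in simp)
          show "\<bar>indicator {0..t} r * E r \<omega> * d r\<bar> \<le> (\<bar>E 0 \<omega>\<bar> + C * exp (C * t) * t) * (\<bar>opt_martingale t \<omega>\<bar> * ?B)"
            by (rule abs_mult_le[OF _ phi.bound[OF r]]) (use Ep.bounded[OF r] r in simp)
        qed
      qed
      then show ?thesis by (rule iffD1[OF set_integrable_cong, rotated -1]) auto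
    qed
    have le: "(LINT r:{0..t}|lborel. ?low r) \<le> (LINT r:{0..t}|lborel. dual_integrand opt_martingale z r \<omega>)"
    proof (rule set_integral_mono_AE[OF low_int elim(1)])
      show "AE r\<in>{0..t} in lborel. ?low r \<le> dual_integrand opt_martingale z r \<omega>"
        using elim(2)
      proof eventually_elim
        case (elim r)
        show ?case
        proof
          assume r: "r \<in> {0..t}"
          then have r0: "0 \<le> r" "r \<le> t" by auto
          let ?\<rho> = "ratio opt_martingale t r \<omega>"
          have zr: "opt_martingale r \<omega> = (1 - v r \<omega>) * exp_int compensator r \<omega>" using r0 by (simp add: opt_martingale_def min_absorb1)
          have E0: "0 \<le> E r \<omega>" using exp_int_bound[OF Zm w Z_bd[OF w] r] by (simp add: E_def)
          have \<rho>0: "0 \<le> ?\<rho>" by (rule ratio_nonneg[OF opt_martingale_in w r0(1)])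
          have key: "(1 - v r \<omega>) * ?\<rho> = opt_martingale t \<omega> * ?c r"
          proof (cases "opt_martingale r \<omega> = 0")
            case True
            then have "opt_martingale t \<omega> = 0" "v r \<omega> = 1" using elim r zr by (auto simp: exp_int_def)
            then show ?thesis by simp
          next
            case False
            then have ne: "1 - v r \<omega> \<noteq> 0" "exp_int compensator r \<omega> \<noteq> 0" using zr by auto
            have "?\<rho> = opt_martingale t \<omega> / ((1 - v r \<omega>) * exp_int compensator r \<omega>)" using False zr by (simp add: ratio_def)
            moreover have "?c r = 1 / exp_int compensator r \<omega>" using inv[of r] ne by (simp add: eq_divide_eq)
            ultimately show ?thesis using ne(1) by simp
          qed
          have "(1 - v r \<omega>) * (compensator r \<omega> - Z r \<omega>) \<le> hX r (Z r \<omega>) \<omega> - Z r \<omega>"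
            using hX_ge[OF r0(2), of \<omega> "Z r \<omega>"] compensator_eq[OF r0(2), of \<omega>] by (simp add: algebra_simps)
          then have "(1 - v r \<omega>) * (compensator r \<omega> - Z r \<omega>) * ?\<rho> \<le> (hX r (Z r \<omega>) \<omega> - Z r \<omega>) * ?\<rho>"
            using \<rho>0 by (rule mult_right_mono)
          moreover have "(1 - v r \<omega>) * (compensator r \<omega> - Z r \<omega>) * ?\<rho> = (compensator r \<omega> - Z r \<omega>) * (opt_martingale t \<omega> * ?c r)"
          proof -
            have "(1 - v r \<omega>) * (compensator r \<omega> - Z r \<omega>) * ?\<rho> = (compensator r \<omega> - Z r \<omega>) * ((1 - v r \<omega>) * ?\<rho>)"
              by (simp only: mult_ac)
            then show ?thesis by (simp only: key)
          qed
          ultimately have "Z r \<omega> + (compensator r \<omega> - Z r \<omega>) * (opt_martingale t \<omega> * ?c r) \<le> Z r \<omega> + (hX r (Z r \<omega>) \<omega> - Z r \<omega>) * ?\<rho>"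
            by simp
          then have "E r \<omega> * (Z r \<omega> + (compensator r \<omega> - Z r \<omega>) * (opt_martingale t \<omega> * ?c r)) \<le> E r \<omega> * (Z r \<omega> + (hX r (Z r \<omega>) \<omega> - Z r \<omega>) * ?\<rho>)"
            using E0 by (rule mult_left_mono)
          moreover have "E r \<omega> * (Z r \<omega> + (hX r (Z r \<omega>) \<omega> - Z r \<omega>) * ?\<rho>) = dual_integrand opt_martingale z r \<omega>"
            unfolding dual_integrand_def ratio_extend[OF r0(1)] E_def Z_def ..
          moreover have "?low r = E r \<omega> * (Z r \<omega> + (compensator r \<omega> - Z r \<omega>) * (opt_martingale t \<omega> * ?c r))"
            using r by (simp add: \<phi>_def d_def algebra_simps)
          ultimately show "?low r \<le> dual_integrand opt_martingale z r \<omega>" by simp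
        qed
      qed
    qed
    have phi0: "\<phi> 0 = 1 - opt_martingale t \<omega>" by (simp add: \<phi>_def exp_int_0)
    have phit: "\<phi> t = v t \<omega>"
      using inv[of t] by (simp add: \<phi>_def opt_martingale_def algebra_simps)
    have "dual_payoff lam p X f t opt_martingale z \<omega> = E t \<omega> * v t \<omega> - (LINT r:{0..t}|lborel. dual_integrand opt_martingale z r \<omega>)"
      unfolding dual_payoff_alt E_def Z_def ..
    also have "\<dots> \<le> E 0 \<omega> * \<phi> 0" using le parts phit by simp
    finally show ?case by (simp add: phi0 E_def exp_int_0)
  qed
qed

lemma dual_objective_opt_martingale_le: "dual_objective M lam p X f t opt_martingale \<le> ereal (val t x0)"
proof -
  let ?S = "ess_sup M (bounded_anticipative M) (\<lambda>z \<omega>. ereal (dual_payoff lam p X f t opt_martingale z \<omega>))"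
  have m: "(\<lambda>\<omega>. ereal (1 - opt_martingale t \<omega>)) \<in> borel_measurable M"
    using borel_measurable_integrable[OF opt_martingale_integrable[OF t_nonneg]] by measurable
  have upper: "\<forall>z\<in>bounded_anticipative M. AE \<omega> in M. ereal (dual_payoff lam p X f t opt_martingale z \<omega>) \<le> ereal (1 - opt_martingale t \<omega>)"
    using dual_payoff_opt_martingale_le by simp
  note least = dual_ess_sup[OF opt_martingale_in, unfolded is_ess_sup_def, THEN conjunct2, THEN conjunct2]
  have "AE \<omega> in M. ?S \<omega> \<le> ereal (1 - opt_martingale t \<omega>)"
    by (rule bspec[OF least m, THEN mp, OF upper])
  from ereal_expectation_mono[OF this]
  have "dual_objective M lam p X f t opt_martingale \<le> ereal (\<integral>\<omega>. 1 - opt_martingale t \<omega> \<partial>M)"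
    unfolding dual_objective_def using opt_martingale_integrable[OF t_nonneg] by (subst (asm) ereal_expectation_ereal) auto
  also have "(\<integral>\<omega>. 1 - opt_martingale t \<omega> \<partial>M) = 1 - (\<integral>\<omega>. opt_martingale 0 \<omega> \<partial>M)"
  proof -
    have sp: "space M \<in> sets (Fil 0)" using sets.top[of "Fil 0"] by simp
    have "(\<integral>\<omega>. opt_martingale t \<omega> \<partial>M) = (\<integral>\<omega>. opt_martingale 0 \<omega> \<partial>M)"
      using opt_martingale_expectation[OF order_refl t_nonneg sp] by (simp cong: Bochner_Integration.integral_cong)
    then show ?thesis using opt_martingale_integrable[OF t_nonneg] by (simp add: prob_space)
  qed
  also have "(\<integral>\<omega>. opt_martingale 0 \<omega> \<partial>M) = (\<integral>\<omega>. 1 - v 0 \<omega> \<partial>M)"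
    using t_nonneg by (simp add: opt_martingale_def min_absorb1 exp_int_0)
  also have "\<dots> = 1 - val t x0"
  proof -
    have "integrable M (v 0)"
      using process_range(5)[of 0] t_nonneg section_measurable(1)[OF process_measurable(1), of 0]
      by (intro integrable_const_bound[where B=1] AE_I2) auto
    then show ?thesis by (simp add: prob_space integral_v0)
  qed
  finally show ?thesis by simp
qed

lemma duality:
  "is_arg_max (primal_objective M lam p X f t) (\<lambda>Z. Z \<in> bounded_adapted M Fil) opt_control"
  "is_arg_min (dual_objective M lam p X f t) (\<lambda>\<zeta>. \<zeta> \<in> nonneg_martingales M Fil) opt_martingale"
  "primal_objective M lam p X f t opt_control = val t x0"
  "dual_objective M lam p X f t opt_martingale = ereal (val t x0)"
proof -
  show P: "primal_objective M lam p X f t opt_control = val t x0"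
    by (rule primal_value(2)[OF opt_control_bounded_adapted]) (rule hX_opt_control)
  have ge: "ereal (val t x0) \<le> dual_objective M lam p X f t \<zeta>" if "\<zeta> \<in> nonneg_martingales M Fil" for \<zeta>
    using dual_ge_primal[OF that opt_control_bounded_adapted] P by simp
  show D: "dual_objective M lam p X f t opt_martingale = ereal (val t x0)"
    using dual_objective_opt_martingale_le ge[OF opt_martingale_in] by (rule antisym)
  show "is_arg_max (primal_objective M lam p X f t) (\<lambda>Z. Z \<in> bounded_adapted M Fil) opt_control"
    using primal_value(1) opt_control_bounded_adapted P by (auto simp: is_arg_max_def not_less)
  show "is_arg_min (dual_objective M lam p X f t) (\<lambda>\<zeta>. \<zeta> \<in> nonneg_martingales M Fil) opt_martingale"
    using ge opt_martingale_in D by (auto simp: is_arg_min_def not_less)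
qed

end

section \<open>The duality theorem\<close>

theorem theorem1p1:
  fixes M :: "'w measure"
    and P :: "'a::polish_space \<Rightarrow> (real \<Rightarrow> 'a) measure"
    and lam :: "'a \<Rightarrow> real"
    and p :: "'a \<Rightarrow> nat pmf"
    and x0 :: 'a
    and Y :: "nat list \<Rightarrow> 'w \<Rightarrow> real \<Rightarrow> 'a"
    and L :: "nat list \<Rightarrow> 'w \<Rightarrow> ennreal"
    and K :: "nat list \<Rightarrow> 'w \<Rightarrow> nat"
    and f :: "'a \<Rightarrow> real"
    and t :: real
  assumes process: "branching_process M P lam p x0 Y L K"
    and lam_bounded: "\<exists>C. \<forall>x. lam x \<le> C"
    and mean_offspring_bounded:
      "\<exists>C::real. \<forall>x. (\<integral>\<^sup>+n. ennreal (real n) \<partial>measure_pmf (p x)) \<le> ennreal C"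
    and f_measurable: "f \<in> borel_measurable borel"
    and f_range: "\<And>x. 0 \<le> f x \<and> f x \<le> 1"
    and t_nonneg: "0 \<le> t"
  defines "X \<equiv> (\<lambda>s \<omega>. Y [] \<omega> s)"
  defines "F \<equiv> generated_filtration M X"
  defines "u \<equiv> (\<integral>\<omega>. (\<Prod>i\<in>alive L K t \<omega>. f (position Y L i t \<omega>)) \<partial>M)"
  shows "\<exists>Z \<zeta>.
      is_arg_max (primal_objective M lam p X f t) (\<lambda>Z. Z \<in> bounded_adapted M F) Z \<and>
      is_arg_min (dual_objective M lam p X f t) (\<lambda>\<zeta>. \<zeta> \<in> nonneg_martingales M F) \<zeta> \<and>
      u = primal_objective M lam p X f t Z \<and>
      ereal u = dual_objective M lam p X f t \<zeta>"
proof -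
  obtain l where l: "\<And>x. lam x \<le> l" using lam_bounded by blast
  obtain C where C: "\<And>x. (\<integral>\<^sup>+n. ennreal (real n) \<partial>measure_pmf (p x)) \<le> ennreal C"
    using mean_offspring_bounded by blast
  have m: "(\<integral>\<^sup>+n. ennreal (real n) \<partial>measure_pmf (p x)) \<le> ennreal (max 0 C)" for x
    by (rule order_trans[OF C]) (intro ennreal_leI, simp)
  interpret B: branching_process M P lam p x0 Y L K by (rule process)
  interpret T: branching_tree M P lam p x0 Y L K l "max 0 C" f t
    by unfold_locales
      (rule l m B.lam_measurable B.lam_nonneg B.p_measurable f_measurable f_range t_nonneg max.cobounded1)+
  have X: "X = T.X" by (simp add: X_def T.X_def fun_eq_iff)
  have F: "F = T.Fil" by (simp add: F_def T.Fil_def X)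
  have u: "u = T.val t x0" using T.expected_total_value by (simp add: u_def T.total_value_def)
  show ?thesis unfolding X F u using T.duality by metis
qed

end
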